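(* For any $n,m$ there exists a number $c_{n,m}\ge1$ such that the following holds. Let $\mathrm H=\mathrm h(\mathbf I,\mathbf J(\mathbf p,\mathbf q),y)+f(\mathbf I,\boldsymbol\varphi,\mathbf p,\mathbf q,y,x)$ be holomorphic on $\mathbb P_{\rho,s,\delta,r,\xi}$, with $f\in\mathcal O_{\rho,s,\delta,r,\xi}$, and let $\omega_y=\partial_y\mathrm h$, $\omega_{\mathbf I}=\partial_{\mathbf I}\mathrm h$, $\omega_{\mathbf J}=\partial_{\mathbf J}\mathrm h$, $\mathrm d:=\min\{\rho s,\ r\xi,\ \delta^2\}$, $\mathcal X:=\sup\{|x|:\ x\in\mathbb X_\xi\}$. For any $N\in\mathbb N$ such that $$4N\mathcal X\left\|\operatorname{Im}\frac{\omega_{\mathbf I}}{\omega_y}\right\|_{\rho,r}<s,\qquad 4N\mathcal X\left\|\frac{\omega_{\mathbf J}}{\omega_y}\right\|_{\rho,r}<1,\qquad c_{n,m}N\frac{\mathcal X}{\mathrm d}\,\|f\|_{\rho,s,\delta,r,\xi}\left\|\frac1{\omega_y}\right\|_{\rho,s,\delta,r,\xi}<1,$$ one can find an operator $$\Psi_*:\ \mathcal O_{\rho,s,\delta,r,\xi}\to\mathcal O_{\frac13(\rho,s,\delta,r,\xi)}$$ which carries $\mathrm H$ to $\mathrm H_*=\mathrm h+g_*+f_*$, where $g_*\in\mathcal N_{\frac13(\rho,s,\delta,r,\xi)}$, $f_*\in\mathcal O_{\frac13(\rho,s,\delta,r,\xi)}$ and $$\|g_*-\overline f\|_{\frac13(\rho,s,\delta,r,\xi)}\le162\,c_{n,m}\frac{\mathcal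 X}{\mathrm d}\left\|\frac{\widetilde f}{\omega_y}\right\|_{\rho,s,\delta,r,\xi}\|f\|_{\rho,s,\delta,r,\xi},\qquad \|f_*\|_{\frac13(\rho,s,\delta,r,\xi)}\le\frac1{2^{N+1}}\|f\|_{\rho,s,\delta,r,\xi}.$$ The transformation $\Psi_*$ can be obtained as a composition of time-one Hamiltonian flows and, if $(\mathbf I,\boldsymbol\varphi,\mathbf p,\mathbf q,y,x):=\Psi_*(\mathbf I_*,\boldsymbol\varphi_*,\mathbf p_*,\mathbf q_*,y_*,x_* )$, the following uniform bounds hold: $$\mathrm d\max\Big\{\tfrac{|\mathbf I-\mathbf I_*|}{\rho},\tfrac{|\boldsymbol\varphi-\boldsymbol\varphi_*|}{s},\tfrac{|\mathbf p-\mathbf p_*|}{\delta},\tfrac{|\mathbf q-\mathbf q_*|}{\delta},\tfrac{|y-y_*|}{r},\tfrac{|x-x_*|}{\xi}\Big\}$$ $$\le\max\big\{s|\mathbf I-\mathbf I_*|,\ \rho|\boldsymbol\varphi-\boldsymbol\varphi_*|,\ \delta|\mathbf p-\mathbf p_*|,\ \delta|\mathbf q-\mathbf q_*|,\ \xi|y-y_*|,\ r|x-x_*|\big\}\le19\,\mathcal X\left\|\frac f{\omega_y}\right\|_{\rho,s,\delta,r,\xi}.$$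
   Context: Let $\mathbb I\subset\mathbb R^n$, $\mathbb B\subset\mathbb R^{2m}$, $\mathbb Y\subset\mathbb R$, $\mathbb X\subset\mathbb R$ be open and connected, $\mathbb T=\mathbb R/2\pi\mathbb Z$. Variables are $\mathbf I\in\mathbb I$, $\boldsymbol\varphi\in\mathbb T^n$, $(\mathbf p,\mathbf q)\in\mathbb B$, $y\in\mathbb Y$, $x\in\mathbb X$, canonical for the symplectic form $\sum dI_i\wedge d\varphi_i+\sum dp_i\wedge dq_i+dy\wedge dx$. $\mathbf J(\mathbf p,\mathbf q)=(p_1q_1,\dots,p_mq_m)$. For positive $\rho,s,\delta,r,\xi$, $\mathbb P_{\rho,s,\delta,r,\xi}=\mathbb I_\rho\times\mathbb T^n_s\times\mathbb B_\delta\times\mathbb Y_r\times\mathbb X_\xi$, where $A_\rho$ denotes the complex neighbourhood of radius $\rho$ of $A$ and $\mathbb T_s$ the complex strip of half-width $s$ around $\mathbb T$. $\mathcal O_{\rho,s,\delta,r,\xi}$ is the set of complex functions holomorphic on $\mathbb P_{\hat\rho,\hat s,\hat\delta,\hat r,\hat\xi}$ for some $\hat\rho>\rho$, $\hat s>s$, $\hat\delta>\delta$, $\hat r>r$, $\hat\xi>\xi$, with norm $$\|\phi\|_{\rho,s,\delta,r,\xi}=\sum_{k,h,j}\|\phi_{khj}\|_{\rho,r,\xi}\,e^{s|k|}\delta^{|h|+|j|},\qquad \|\phi_{khj}\|_{\rho,r,\xi}=\sup_{\mathbb I_\rho\times\mathbb Y_r\times\mathbb X_\xi}|\phi_{khj}(\mathbf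 I,y,x)|,$$ where $\phi=\sum_{k\in\mathbb Z^n,\,h,j\in\mathbb N^m}\phi_{khj}(\mathbf I,y,x)e^{\mathrm i k\cdot\boldsymbol\varphi}\mathbf p^h\mathbf q^j$ is the Taylor–Fourier expansion. $\|\cdot\|_{\rho,r}$ is the sup norm for functions independent of $x$ (for $\omega_{\mathbf I}/\omega_y$, $\omega_{\mathbf J}/\omega_y$, sup over all their arguments and maximum over components). The off-average and average of $\phi$ are $\widetilde\phi=\sum_{(k,h-j)\ne(0,0)}\phi_{khj}e^{\mathrm i k\cdot\boldsymbol\varphi}\mathbf p^h\mathbf q^j$ and $\overline\phi=\phi-\widetilde\phi$. $\mathcal N_{\rho,s,\delta,r,\xi}=\{\phi\in\mathcal O_{\rho,s,\delta,r,\xi}:\ \phi=\overline\phi\}$. A time-one Hamiltonian flow is $e^{\mathcal L_\phi}=\sum_{k\ge0}\mathcal L_\phi^k/k!$ with $\mathcal L_\phi(f)=\{\phi,f\}$, $\{\phi,f\}=\sum_i(\partial_{I_i}\phi\,\partial_{\varphi_i}f-\partial_{I_i}f\,\partial_{\varphi_i}\phi)+\sum_i(\partial_{p_i}\phi\,\partial_{q_i}f-\partial_{p_i}f\,\partial_{q_i}\phi)+(\partial_y\phi\,\partial_xf-\partial_yf\,\partial_x\phi)$.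
   Formalization: Proved for n,m≥1, N≥1, ω_y≠0 and 0∈𝔹, with the (p,q)-domain 𝔹_δ cut down to the polydisc |p_i|,|q_i|<δ on which the Taylor norm controls functions; for larger 𝔹_δ (e.g. h=y, f=εp²) or for N=0 the statement as written fails. *)

theory Defs
  imports "HOL-Analysis.Analysis"
begin

text \<open>
  Conventions. A phase point is a tuple \<open>(I, \<theta>, p, q, y, x)\<close>, the angles being written \<open>\<theta>\<close>
  because \<open>\<phi>\<close> denotes functions. The torus is handled through its universal cover: \<open>\<theta>\<close> ranges
  over complex vectors, and functions on the torus are the functions that are \<open>2\<pi>\<close>-periodic in
  every \<open>\<theta>\<^sub>i\<close>. Complex vectors carry the maximum norm and multi-indices the 1-norm. All norms of
  functions take values in \<open>[0, \<infinity>]\<close>.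
\<close>

type_synonym ('n, 'm) phase =
  "(complex ^ 'n) \<times> (complex ^ 'n) \<times> (complex ^ 'm) \<times> (complex ^ 'm) \<times> complex \<times> complex"

type_synonym ('n, 'm) func = "('n, 'm) phase \<Rightarrow> complex"

text \<open>The real sets \<open>(\<I>, \<B>, \<Y>, \<X>)\<close>, and the radii \<open>(\<rho>, s, \<delta>, r, \<xi>)\<close>.\<close>

type_synonym ('n, 'm) base =
  "(real ^ 'n) set \<times> ((real ^ 'm) \<times> (real ^ 'm)) set \<times> real set \<times> real set"

type_synonym radii = "real \<times> real \<times> real \<times> real \<times> real"

fun radii_less :: "radii \<Rightarrow> radii \<Rightarrow> bool" where
  "radii_less (\<rho>, s, \<delta>, r, \<xi>) (\<rho>', s', \<delta>', r', \<xi>') \<longleftrightarrow>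
     \<rho> < \<rho>' \<and> s < s' \<and> \<delta> < \<delta>' \<and> r < r' \<and> \<xi> < \<xi>'"

subsection \<open>Domains\<close>

definition vmax :: "complex ^ 'n::finite \<Rightarrow> real" where
  "vmax v = Max (range (\<lambda>i. cmod (v $ i)))"

definition cvec :: "real ^ 'n::finite \<Rightarrow> complex ^ 'n" where
  "cvec a = (\<chi> i. complex_of_real (a $ i))"

definition nbhd_vec :: "(real ^ 'n::finite) set \<Rightarrow> real \<Rightarrow> (complex ^ 'n) set" where
  "nbhd_vec A \<rho> = {z. \<exists>a\<in>A. vmax (z - cvec a) < \<rho>}"

definition nbhd_line :: "real set \<Rightarrow> real \<Rightarrow> complex set" where
  "nbhd_line A r = {z. \<exists>a\<in>A. cmod (z - complex_of_real a) < r}"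

definition strip :: "real \<Rightarrow> (complex ^ 'n::finite) set" where
  "strip s = {\<theta>. \<forall>i. \<bar>Im (\<theta> $ i)\<bar> < s}"

text \<open>
  The norm below is built on the Taylor expansion at \<open>p = q = 0\<close> with weights
  \<open>\<delta>\<^bsup>|h|+|j|\<^esup>\<close>; it sees a function on the polydisc \<open>|p\<^sub>i|, |q\<^sub>i| < \<delta>\<close> only. The \<open>(p, q)\<close>-domain is
  therefore the part of the complex \<open>\<delta>\<close>-neighbourhood of \<open>\<B>\<close> that lies in this polydisc. When
  \<open>(0, 0) \<in> \<B>\<close> this is the whole polydisc.
\<close>

definition nbhd_pq ::
  "((real ^ 'm::finite) \<times> (real ^ 'm)) set \<Rightarrow> real \<Rightarrow> ((complex ^ 'm) \<times> (complex ^ 'm)) set" where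
  "nbhd_pq B \<delta> = {(p, q). (\<exists>(a, b)\<in>B. vmax (p - cvec a) < \<delta> \<and> vmax (q - cvec b) < \<delta>) \<and>
                          vmax p < \<delta> \<and> vmax q < \<delta>}"

fun PP :: "('n::finite, 'm::finite) base \<Rightarrow> radii \<Rightarrow> ('n, 'm) phase set" where
  "PP (II, BB, YY, XX) (\<rho>, s, \<delta>, r, \<xi>) =
     {(I, \<theta>, p, q, y, x). I \<in> nbhd_vec II \<rho> \<and> \<theta> \<in> strip s \<and> (p, q) \<in> nbhd_pq BB \<delta> \<and>
                          y \<in> nbhd_line YY r \<and> x \<in> nbhd_line XX \<xi>}"

subsection \<open>Holomorphic functions of several variables\<close>

definition cscale :: "complex \<Rightarrow> ('n::finite, 'm::finite) phase \<Rightarrow> ('n, 'm) phase" where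
  "cscale c = (\<lambda>(I, \<theta>, p, q, y, x). (c *s I, c *s \<theta>, c *s p, c *s q, c * y, c * x))"

text \<open>Complex Frechet differentiability at every point of \<open>S\<close> (used for open \<open>S\<close>).\<close>

definition holo_on :: "('n::finite, 'm::finite) func \<Rightarrow> ('n, 'm) phase set \<Rightarrow> bool" where
  "holo_on F S \<longleftrightarrow>
     (\<forall>z\<in>S. \<exists>L. (F has_derivative L) (at z) \<and> (\<forall>c v. L (cscale c v) = c * L v))"

definition periodic_on :: "('n::finite, 'm::finite) func \<Rightarrow> ('n, 'm) phase set \<Rightarrow> bool" where
  "periodic_on F S \<longleftrightarrow>
     (\<forall>(I, \<theta>, p, q, y, x)\<in>S. \<forall>i. F (I, \<theta> + axis i (2 * of_real pi), p, q, y, x)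
                                = F (I, \<theta>, p, q, y, x))"

subsection \<open>Taylor--Fourier expansions, norms and function spaces\<close>

type_synonym ('n, 'm) mindex = "(int ^ 'n) \<times> (nat ^ 'm) \<times> (nat ^ 'm)"

type_synonym ('n, 'm) coeffs =
  "('n, 'm) mindex \<Rightarrow> (complex ^ 'n) \<times> complex \<times> complex \<Rightarrow> complex"

fun tf_term :: "('n::finite, 'm::finite) coeffs \<Rightarrow> ('n, 'm) phase \<Rightarrow> ('n, 'm) mindex \<Rightarrow> complex" where
  "tf_term a (I, \<theta>, p, q, y, x) (k, h, j) =
     a (k, h, j) (I, y, x) * exp (\<i> * (\<Sum>i\<in>UNIV. of_int (k $ i) * \<theta> $ i))
       * (\<Prod>i\<in>UNIV. (p $ i) ^ (h $ i)) * (\<Prod>i\<in>UNIV. (q $ i) ^ (j $ i))"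

definition tf_expansion ::
  "('n::finite, 'm::finite) base \<Rightarrow> radii \<Rightarrow> ('n, 'm) func \<Rightarrow> ('n, 'm) coeffs \<Rightarrow> bool" where
  "tf_expansion D w \<phi> a \<longleftrightarrow> (\<forall>z\<in>PP D w. (tf_term a z has_sum \<phi> z) UNIV)"

text \<open>
  If \<open>(0, 0) \<in> \<B>\<close>, every holomorphic periodic \<open>\<phi>\<close> on \<open>PP D w\<close> has such an expansion, and its
  coefficients are unique as functions on the \<open>(I, y, x)\<close>-domain, so the choice is immaterial.
\<close>

definition tf_coeff ::
  "('n::finite, 'm::finite) base \<Rightarrow> radii \<Rightarrow> ('n, 'm) func \<Rightarrow> ('n, 'm) coeffs" where
  "tf_coeff D w \<phi> = (SOME a. tf_expansion D w \<phi> a)"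

fun tf_norm :: "('n::finite, 'm::finite) base \<Rightarrow> radii \<Rightarrow> ('n, 'm) func \<Rightarrow> ennreal" where
  "tf_norm (II, BB, YY, XX) (\<rho>, s, \<delta>, r, \<xi>) \<phi> =
     (\<Sum>\<^sub>\<infinity>(k, h, j)\<in>UNIV.
        (SUP u\<in>nbhd_vec II \<rho> \<times> nbhd_line YY r \<times> nbhd_line XX \<xi>.
           ennreal (cmod (tf_coeff (II, BB, YY, XX) (\<rho>, s, \<delta>, r, \<xi>) \<phi> (k, h, j) u)))
        * ennreal (exp (s * real_of_int (\<Sum>i\<in>UNIV. \<bar>k $ i\<bar>)) *
                   \<delta> ^ ((\<Sum>i\<in>UNIV. h $ i) + (\<Sum>i\<in>UNIV. j $ i))))"

text \<open>
  The spaces \<open>\<O>\<close> and \<open>\<N>\<close>. Finiteness of the norm, which for unbounded base sets does not follow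
  from holomorphy, is part of membership.
\<close>

definition Osp :: "('n::finite, 'm::finite) base \<Rightarrow> radii \<Rightarrow> ('n, 'm) func set" where
  "Osp D w = {\<phi>. (\<exists>w'. radii_less w w' \<and> holo_on \<phi> (PP D w') \<and> periodic_on \<phi> (PP D w')) \<and>
                tf_norm D w \<phi> < \<infinity>}"

definition off_average ::
  "('n::finite, 'm::finite) base \<Rightarrow> radii \<Rightarrow> ('n, 'm) func \<Rightarrow> ('n, 'm) func" where
  "off_average D w \<phi> z =
     (\<Sum>\<^sub>\<infinity>\<nu>\<in>{(k, h, j). \<not> (k = 0 \<and> h = j)}. tf_term (tf_coeff D w \<phi>) z \<nu>)"

definition average ::
  "('n::finite, 'm::finite) base \<Rightarrow> radii \<Rightarrow> ('n, 'm) func \<Rightarrow> ('n, 'm) func" where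
  "average D w \<phi> z = \<phi> z - off_average D w \<phi> z"

definition Nsp :: "('n::finite, 'm::finite) base \<Rightarrow> radii \<Rightarrow> ('n, 'm) func set" where
  "Nsp D w = {\<phi> \<in> Osp D w. \<forall>z\<in>PP D w. \<phi> z = average D w \<phi> z}"

definition sup_norm ::
  "('n::finite, 'm::finite) phase set \<Rightarrow> (('n, 'm) phase \<Rightarrow> 'l \<Rightarrow> 'a::real_normed_vector) \<Rightarrow> ennreal"
  where "sup_norm S u = (SUP z\<in>S. SUP i. ennreal (norm (u z i)))"

subsection \<open>Poisson brackets and time-one flows\<close>

definition pd :: "('n::finite, 'm::finite) phase \<Rightarrow> ('n, 'm) func \<Rightarrow> ('n, 'm) func" where
  "pd v F z = deriv (\<lambda>t. F (z + cscale t v)) 0"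

definition dI :: "'n \<Rightarrow> ('n::finite, 'm::finite) func \<Rightarrow> ('n, 'm) func" where
  "dI i = pd (axis i 1, 0, 0, 0, 0, 0)"

definition d\<theta> :: "'n \<Rightarrow> ('n::finite, 'm::finite) func \<Rightarrow> ('n, 'm) func" where
  "d\<theta> i = pd (0, axis i 1, 0, 0, 0, 0)"

definition dp :: "'m \<Rightarrow> ('n::finite, 'm::finite) func \<Rightarrow> ('n, 'm) func" where
  "dp i = pd (0, 0, axis i 1, 0, 0, 0)"

definition dq :: "'m \<Rightarrow> ('n::finite, 'm::finite) func \<Rightarrow> ('n, 'm) func" where
  "dq i = pd (0, 0, 0, axis i 1, 0, 0)"

definition dy :: "('n::finite, 'm::finite) func \<Rightarrow> ('n, 'm) func" where
  "dy = pd (0, 0, 0, 0, 1, 0)"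

definition dx :: "('n::finite, 'm::finite) func \<Rightarrow> ('n, 'm) func" where
  "dx = pd (0, 0, 0, 0, 0, 1)"

definition lie :: "('n::finite, 'm::finite) func \<Rightarrow> ('n, 'm) func \<Rightarrow> ('n, 'm) func" where
  "lie \<phi> f z =
     (\<Sum>i\<in>UNIV. dI i \<phi> z * d\<theta> i f z - dI i f z * d\<theta> i \<phi> z)
   + (\<Sum>i\<in>UNIV. dp i \<phi> z * dq i f z - dp i f z * dq i \<phi> z)
   + (dy \<phi> z * dx f z - dy f z * dx \<phi> z)"

definition lie_exp :: "('n::finite, 'm::finite) func \<Rightarrow> ('n, 'm) func \<Rightarrow> ('n, 'm) func" where
  "lie_exp \<phi> F z = (\<Sum>k. (lie \<phi> ^^ k) F z / fact k)"

text \<open>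
  \<open>lie_exp \<phi>\<close> acts from radii \<open>w\<close> to radii \<open>w'\<close>. Convergence is required for every \<open>F\<close> holomorphic
  on \<open>PP D w\<close>, periodic or not, so that coordinate functions (the angles included) and Hamiltonians
  that do not extend beyond \<open>PP D w\<close> are covered.
\<close>

definition time_one_flow ::
  "('n::finite, 'm::finite) base \<Rightarrow> radii \<Rightarrow> radii \<Rightarrow> ('n, 'm) func \<Rightarrow> bool" where
  "time_one_flow D w w' \<phi> \<longleftrightarrow>
     \<phi> \<in> Osp D w' \<and>
     (\<forall>F. holo_on F (PP D w) \<longrightarrow>
        (\<forall>z\<in>PP D w'. summable (\<lambda>k. (lie \<phi> ^^ k) F z / fact k)) \<and>
        holo_on (lie_exp \<phi> F) (PP D w')) \<and>
     (\<forall>F\<in>Osp D w. lie_exp \<phi> F \<in> Osp D w')"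

inductive flow_composition ::
  "('n::finite, 'm::finite) base \<Rightarrow> radii \<Rightarrow> radii \<Rightarrow> (('n, 'm) func \<Rightarrow> ('n, 'm) func) \<Rightarrow> bool"
  for D w where
  "flow_composition D w w id"
| "flow_composition D w w' \<Psi> \<Longrightarrow> radii_less (0, 0, 0, 0, 0) w'' \<Longrightarrow> radii_less w'' w' \<Longrightarrow>
     time_one_flow D w' w'' \<phi> \<Longrightarrow> flow_composition D w w'' (lie_exp \<phi> \<circ> \<Psi>)"

subsection \<open>The unperturbed Hamiltonian\<close>

definition JJ :: "complex ^ 'm::finite \<Rightarrow> complex ^ 'm \<Rightarrow> complex ^ 'm" where
  "JJ p q = (\<chi> i. p $ i * q $ i)"

text \<open>\<open>h\<close> and the components of its gradient, as functions on phase space (\<open>J = J(p, q)\<close>).\<close>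

fun ham0 :: "(complex ^ 'n::finite \<Rightarrow> complex ^ 'm::finite \<Rightarrow> complex \<Rightarrow> complex) \<Rightarrow> ('n, 'm) func" where
  "ham0 h (I, \<theta>, p, q, y, x) = h I (JJ p q) y"

fun omega_I :: "(complex ^ 'n::finite \<Rightarrow> complex ^ 'm::finite \<Rightarrow> complex \<Rightarrow> complex) \<Rightarrow>
    ('n, 'm) phase \<Rightarrow> 'n \<Rightarrow> complex" where
  "omega_I h (I, \<theta>, p, q, y, x) i = deriv (\<lambda>t. h (I + axis i t) (JJ p q) y) 0"

fun omega_J :: "(complex ^ 'n::finite \<Rightarrow> complex ^ 'm::finite \<Rightarrow> complex \<Rightarrow> complex) \<Rightarrow>
    ('n, 'm) phase \<Rightarrow> 'm \<Rightarrow> complex" where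
  "omega_J h (I, \<theta>, p, q, y, x) i = deriv (\<lambda>t. h I (JJ p q + axis i t) y) 0"

fun omega_y :: "(complex ^ 'n::finite \<Rightarrow> complex ^ 'm::finite \<Rightarrow> complex \<Rightarrow> complex) \<Rightarrow> ('n, 'm) func" where
  "omega_y h (I, \<theta>, p, q, y, x) = deriv (h I (JJ p q)) y"

end

theory Submission
  imports Defs "HOL-Complex_Analysis.Complex_Analysis"
begin

text \<open>
  Write \<open>f\<close> as the sum of its parts of degree \<open>a = (k, j - h)\<close> for the symplectic torus action. For
  \<open>0 < s |k| + |j - h| <= 3 N\<close> the equation \<open>{\<phi>\<^sub>a, h} = - f\<^sub>a\<close> is a linear equation in \<open>x\<close>, whose coefficient
  has a small real part by the hypotheses on the frequencies; it has a solution of size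
  \<open>4 e\<^bsup>3/4\<^esup> \<X> sup |f\<^sub>a / \<omega>\<^sub>y|\<close>. The flow of \<open>\<phi> = \<Sum> \<phi>\<^sub>a\<close> replaces these parts of \<open>f\<close> by brackets.

  All domains are scaled by a factor \<open>t\<close>. A first step from \<open>t = 1\<close> to \<open>t = 4/5\<close> leaves, besides the average
  and the tail of \<open>f\<close>, a remainder that is small compared with \<open>f / N\<close>. Then \<open>N\<close> steps of width \<open>2 / (5 N)\<close>
  halve this remainder each: the tail beyond the cut-off gains \<open>e\<^bsup>-6/5\<^esup>\<close>, and the brackets are small.
  The first tail is never touched again; on \<open>t = 1/3\<close> it has decreased by \<open>e\<^bsup>-2N\<^esup>\<close>.
\<close>

subsection \<open>Coordinates on the phase space\<close>

text \<open>The hypothesis makes N times a generator small, whereas a step of width 1/N with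
  generator \<kappa> needs N^2 * \<kappa> small, because a bracket costs two Cauchy estimates. Hence
  the wide first step: the hypothesis allows it, and the generators built from its remainder pass
  the N^2 test. The untouched part of f keeps its full size, but it is controlled on t = 1, at a
  fixed distance from all later domains, so its brackets cost only one factor N.

  The weighted norm is awkward for brackets. All estimates therefore use sup norms of components
  that are homogeneous under the torus action; the return to the weighted norm, from t = 2/5 to t =
  1/3, costs the factor \<open>Cm\<close> at 5/6, the only part of the constant that depends on the
  dimension.

  The full Hamiltonian may be unbounded and need not extend beyond t = 1. Lie series are therefore
  summed on polydiscs around single points, where the series is a multiplicative functional and
  hence the evaluation at a point. No differential equation is solved.\<close>

datatype ('n, 'm) ix = CI 'n | CT 'n | CP 'm | CQ 'm | CY | CX

lemma UNIV_ix:
  "(UNIV :: ('n, 'm) ix set) = range CI \<union> range CT \<union> range CP \<union> range CQ \<union> {CY, CX}"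
proof -
  have "x \<in> range CI \<union> range CT \<union> range CP \<union> range CQ \<union> {CY, CX}" for x :: "('n, 'm) ix"
    by (cases x) auto
  then show ?thesis by blast
qed

instance ix :: (finite, finite) finite
  by standard (simp add: UNIV_ix)

text \<open>A single index type for all coordinates lets radii, rotations and vector fields be
  functions of the index, so that one argument treats the six kinds of variables.\<close>

fun co :: "('n::finite, 'm::finite) ix => ('n, 'm) phase => complex" where
  "co (CI i) (I, \<theta>, p, q, y, x) = I $ i"
| "co (CT i) (I, \<theta>, p, q, y, x) = \<theta> $ i"
| "co (CP i) (I, \<theta>, p, q, y, x) = p $ i"
| "co (CQ i) (I, \<theta>, p, q, y, x) = q $ i"
| "co CY (I, \<theta>, p, q, y, x) = y"
| "co CX (I, \<theta>, p, q, y, x) = x"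

definition mk :: "(('n::finite, 'm::finite) ix => complex) => ('n, 'm) phase" where
  "mk f = (\<chi> i. f (CI i), \<chi> i. f (CT i), \<chi> i. f (CP i), \<chi> i. f (CQ i), f CY, f CX)"

definition eb :: "('n::finite, 'm::finite) ix => ('n, 'm) phase" where
  "eb i = mk (\<lambda>j. if j = i then 1 else 0)"

lemma co_mk [simp]: "co i (mk f) = f i"
  by (cases i) (auto simp: mk_def)

lemma phase_eqI: assumes "\<And>i. co i z = co i z'" shows "z = z'"
proof -
  obtain I \<theta> p q y x where z: "z = (I, \<theta>, p, q, y, x)" by (metis prod.exhaust)
  obtain I' \<theta>' p' q' y' x' where z': "z' = (I', \<theta>', p', q', y', x')" by (metis prod.exhaust)
  have "I $ i = I' $ i" "\<theta> $ i = \<theta>' $ i" for i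
    using assms[of "CI i"] assms[of "CT i"] by (simp_all add: z z')
  moreover have "p $ i = p' $ i" "q $ i = q' $ i" for i
    using assms[of "CP i"] assms[of "CQ i"] by (simp_all add: z z')
  moreover have "y = y'" "x = x'"
    using assms[of CY] assms[of CX] by (simp_all add: z z')
  ultimately show ?thesis by (simp add: z z' vec_eq_iff)
qed

lemma mk_co [simp]: "mk (\<lambda>i. co i z) = z"
  by (rule phase_eqI) simp

lemma co_add [simp]: "co i (z + z') = co i z + co i z'"
  by (cases i; cases z; cases z') auto
lemma co_diff [simp]: "co i (z - z') = co i z - co i z'"
  by (cases i; cases z; cases z') auto
lemma co_zero [simp]: "co i 0 = 0"
  by (cases i) (auto simp: zero_prod_def)
lemma co_uminus [simp]: "co i (- z) = - co i z"
  by (cases i; cases z) auto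
lemma co_scaleR [simp]: "co i (c *\<^sub>R z) = c *\<^sub>R co i z"
  by (cases i; cases z) auto
lemma co_cscale [simp]: "co i (cscale c z) = c * co i z"
  by (cases i; cases z) (auto simp: cscale_def)
lemma co_sum [simp]: "co i (sum f A) = (\<Sum>a\<in>A. co i (f a))"
  by (induction A rule: infinite_finite_induct) auto
lemma co_eb: "co i (eb j) = (if i = j then 1 else 0)"
  by (simp add: eb_def)

lemma bounded_linear_co: "bounded_linear (co i)"
  by (intro linear_conv_bounded_linear[THEN iffD1] linearI) auto

lemma cscale_0 [simp]: "cscale 0 v = 0" "cscale c 0 = 0"
  by (rule phase_eqI, simp)+
lemma cscale_1 [simp]: "cscale 1 v = v"
  by (rule phase_eqI) simp
lemma cscale_of_real: "cscale (of_real a) v = a *\<^sub>R v"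
  by (rule phase_eqI) (simp add: scaleR_conv_of_real)

lemma phase_expand: "(v :: ('n::finite, 'm::finite) phase) = (\<Sum>i\<in>UNIV. cscale (co i v) (eb i))"
proof (rule phase_eqI)
  fix i :: "('n, 'm) ix"
  show "co i v = co i (\<Sum>i\<in>UNIV. cscale (co i v) (eb i))"
    by (simp add: co_eb if_distrib sum.delta cong: if_cong)
qed

lemma bounded_linear_cscale_left: "bounded_linear (\<lambda>c. cscale c v)"
proof -
  have "linear (\<lambda>c. cscale c v)"
    by (rule linearI; rule phase_eqI; simp add: algebra_simps)
  then show ?thesis by (rule linear_conv_bounded_linear[THEN iffD1])
qed

lemma norm_vec_scalar: "norm (c *s (v :: complex ^ 'k::finite)) = cmod c * norm v"
  by (simp add: norm_vec_def L2_set_def norm_mult power_mult_distrib sum_distrib_left[symmetric]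
      real_sqrt_mult)

lemma norm_cscale: "norm (cscale c v) = cmod c * norm v"
proof -
  have *: "sqrt ((cmod c * a)\<^sup>2 + (cmod c * b)\<^sup>2) = cmod c * sqrt (a\<^sup>2 + b\<^sup>2)" for a b
    by (simp add: power_mult_distrib distrib_left[symmetric] real_sqrt_mult)
  show ?thesis
    by (cases v) (simp add: cscale_def norm_Pair norm_vec_scalar norm_mult * del: real_sqrt_eq_iff)
qed

lemma norm_le_co:
  "norm (v :: ('n::finite, 'm::finite) phase) <= (\<Sum>i\<in>UNIV. cmod (co i v) * norm (eb i :: ('n, 'm) phase))"
  by (subst phase_expand[of v], rule order_trans[OF norm_sum]) (simp add: norm_cscale)

lemma has_derivative_mk:
  fixes g :: "('n::finite, 'm::finite) ix => 'b::real_normed_vector => complex"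
  assumes "\<And>i. (g i has_derivative L i) F"
  shows "((\<lambda>z. mk (\<lambda>i. g i z)) has_derivative (\<lambda>v. mk (\<lambda>i. L i v))) F"
proof -
  have *: "mk f = (\<Sum>i\<in>UNIV. cscale (f i) (eb i))" for f :: "('n, 'm) ix => complex"
    using phase_expand[of "mk f"] by simp
  show ?thesis unfolding *
    by (intro has_derivative_sum bounded_linear.has_derivative[OF bounded_linear_cscale_left] assms)
qed

lemma continuous_on_mk:
  fixes g :: "('n::finite, 'm::finite) ix => 'b::topological_space => complex"
  assumes "\<And>i. continuous_on S (g i)"
  shows "continuous_on S (\<lambda>z. mk (\<lambda>i. g i z))"
proof -
  have *: "mk f = (\<Sum>i\<in>UNIV. cscale (f i) (eb i))" for f :: "('n, 'm) ix => complex"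
    using phase_expand[of "mk f"] by simp
  show ?thesis unfolding *
    by (intro continuous_on_sum bounded_linear.continuous_on[OF bounded_linear_cscale_left] assms)
qed

lemmas continuous_on_co = bounded_linear.continuous_on[OF bounded_linear_co]

subsection \<open>Complex differentiability\<close>

text \<open>On the complex line through z in direction v the chain rule gives the derivative L v. So
  the Frechet derivative is \<open>pd\<close>, which is defined for every function, and no
  derivative has to be carried along as an extra object.\<close>

lemma holo_at:
  assumes "holo_on F S" "z \<in> S"
  shows "(F has_derivative (\<lambda>v. pd v F z)) (at z)" "pd (cscale c v) F z = c * pd v F z"
proof -
  obtain L where L: "(F has_derivative L) (at z)" "\<And>c v. L (cscale c v) = c * L v"
    using assms unfolding holo_on_def by blast
  have "pd v F z = L v" for v
  proof -
    have "((\<lambda>t. F (z + cscale t v)) has_derivative (\<lambda>t. L (cscale t v))) (at 0)"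
      by (rule has_derivative_compose[where g = F and g' = L])
      (auto intro!: derivative_eq_intros bounded_linear.has_derivative[OF bounded_linear_cscale_left] L)
    moreover have "(\<lambda>t. L (cscale t v)) = (*) (L v)" using L(2) by (auto simp: mult.commute)
    ultimately show ?thesis
      unfolding pd_def by (intro DERIV_imp_deriv) (simp add: has_field_derivative_def)
  qed
  then have e: "(\<lambda>v. pd v F z) = L" by auto
  show "(F has_derivative (\<lambda>v. pd v F z)) (at z)" using L(1) e by simp
  show "pd (cscale c v) F z = c * pd v F z" using L(2) e by metis
qed

lemma holo_onI:
  assumes "\<And>z. z \<in> S ==> (F has_derivative L z) (at z)" "\<And>z c v. z \<in> S ==> L z (cscale c v) = c * L z v"
  shows "holo_on F S"
  unfolding holo_on_def using assms by blast

lemma holo_pdI: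
  assumes "(F has_derivative L) (at z)" "\<And>c v. L (cscale c v) = c * L v"
  shows "pd v F z = L v"
proof -
  have "holo_on F {z}" using assms by (auto simp: holo_on_def)
  from holo_at(1)[OF this, of z] assms(1) have "(\<lambda>v. pd v F z) = L"
    by (auto intro: has_derivative_unique)
  then show ?thesis by metis
qed

lemma holo_subset: "holo_on F S ==> T \<subseteq> S ==> holo_on F T"
  unfolding holo_on_def by blast

lemma holo_cong:
  assumes "open S" "\<And>z. z \<in> S ==> F z = G z" "holo_on F S"
  shows "holo_on G S"
proof (rule holo_onI)
  fix z assume z: "z \<in> S"
  show "(G has_derivative (\<lambda>v. pd v F z)) (at z)"
    using has_derivative_transform_within_open[OF holo_at(1)[OF assms(3) z] assms(1) z] assms(2) by auto
qed (use holo_at(2)[OF assms(3)] in auto)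

lemma pd_cong:
  assumes "open S" "\<And>z. z \<in> S ==> F z = G z" "z \<in> S"
  shows "pd v F z = pd v G z"
proof -
  have "open ((\<lambda>t. z + cscale t v) -` S)"
    by (intro open_vimage assms continuous_intros
      bounded_linear.continuous_on[OF bounded_linear_cscale_left])
  then have "\<forall>\<^sub>F t in nhds 0. t \<in> (\<lambda>t. z + cscale t v) -` S"
    using assms(3) by (intro eventually_nhds_in_open) auto
  then have "\<forall>\<^sub>F t in nhds 0. F (z + cscale t v) = G (z + cscale t v)"
    by eventually_elim (use assms(2) in auto)
  then show ?thesis unfolding pd_def by (rule deriv_cong_ev) simp
qed

lemma holo_linear:
  assumes "holo_on F S" "z \<in> S"
  shows "linear (\<lambda>v. pd v F z)"
  using holo_at(1)[OF assms] has_derivative_linear by blast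

lemma pd_add: "holo_on F S ==> z \<in> S ==> pd (u + v) F z = pd u F z + pd v F z"
  using holo_linear linear_add by blast

lemma pd_expand:
  assumes "holo_on F S" "z \<in> S"
  shows "pd v F z = (\<Sum>i\<in>UNIV. co i v * pd (eb i) F z)"
proof -
  have "pd v F z = pd (\<Sum>i\<in>UNIV. cscale (co i v) (eb i)) F z" using phase_expand[of v] by simp
  also have "... = (\<Sum>i\<in>UNIV. pd (cscale (co i v) (eb i)) F z)"
    using linear_sum[OF holo_linear[OF assms]] .
  finally show ?thesis using holo_at(2)[OF assms] by simp
qed

lemma holo_line:
  assumes "holo_on F S" "z + cscale c v \<in> S"
  shows "((\<lambda>t. F (z + cscale t v)) has_field_derivative pd v F (z + cscale c v)) (at c)"
proof -
  have "((\<lambda>t. F (z + cscale t v)) has_derivative (\<lambda>t. pd (cscale t v) F (z + cscale c v))) (at c)"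
    by (rule has_derivative_compose[where g = F and g' = "\<lambda>u. pd u F (z + cscale c v)"])
      (auto intro!: derivative_eq_intros bounded_linear.has_derivative[OF bounded_linear_cscale_left]
      holo_at(1)[OF assms])
  moreover have "(\<lambda>t. pd (cscale t v) F (z + cscale c v)) = (*) (pd v F (z + cscale c v))"
    using holo_at(2)[OF assms] by (auto simp: mult.commute)
  ultimately show ?thesis by (simp add: has_field_derivative_def)
qed

lemma holo_continuous: "holo_on F S ==> continuous_on S F"
  by (meson continuous_at_imp_continuous_on has_derivative_continuous holo_at(1))

lemma
  assumes "holo_on F S" "holo_on G S" "z \<in> S"
  shows pd_plus: "pd v (\<lambda>z. F z + G z) z = pd v F z + pd v G z"
    and pd_minus: "pd v (\<lambda>z. F z - G z) z = pd v F z - pd v G z"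
    and pd_mult: "pd v (\<lambda>z. F z * G z) z = pd v F z * G z + F z * pd v G z"
proof -
  note h = holo_at[OF assms(1,3)] holo_at[OF assms(2,3)]
  show "pd v (\<lambda>z. F z + G z) z = pd v F z + pd v G z"
    by (rule holo_pdI[OF has_derivative_add[OF h(1,3)]]) (simp add: h algebra_simps)
  show "pd v (\<lambda>z. F z - G z) z = pd v F z - pd v G z"
    by (rule holo_pdI[OF has_derivative_diff[OF h(1,3)]]) (simp add: h algebra_simps)
  show "pd v (\<lambda>z. F z * G z) z = pd v F z * G z + F z * pd v G z"
    by (rule trans[OF holo_pdI[OF has_derivative_mult[OF h(1,3)]]]) (simp_all add: h algebra_simps)
qed

lemma holo_const [simp]: "holo_on (\<lambda>_. c) S"
  by (auto simp: holo_on_def intro!: exI[of _ "\<lambda>_. 0"])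
lemma pd_const [simp]: "pd v (\<lambda>_. c) z = 0"
  by (simp add: pd_def)
lemma holo_co [simp]: "holo_on (co i) S"
  by (auto simp: holo_on_def intro!: exI[of _ "co i"] bounded_linear_imp_has_derivative bounded_linear_co)
lemma pd_co [simp]: "pd v (co i) z = co i v"
  by (rule holo_pdI) (auto intro!: bounded_linear_imp_has_derivative bounded_linear_co)

lemma holo_add:
  assumes "holo_on F S" "holo_on G S"
  shows "holo_on (\<lambda>z. F z + G z) S"
proof (rule holo_onI)
  fix z assume z: "z \<in> S"
  show "((\<lambda>z. F z + G z) has_derivative (\<lambda>v. pd v F z + pd v G z)) (at z)"
    by (rule has_derivative_add[OF holo_at(1)[OF assms(1) z] holo_at(1)[OF assms(2) z]])
  show "pd (cscale c v) F z + pd (cscale c v) G z = c * (pd v F z + pd v G z)" for c v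
    by (simp add: holo_at(2)[OF assms(1) z] holo_at(2)[OF assms(2) z] algebra_simps)
qed
lemma holo_diff:
  assumes "holo_on F S" "holo_on G S"
  shows "holo_on (\<lambda>z. F z - G z) S"
proof (rule holo_onI)
  fix z assume z: "z \<in> S"
  show "((\<lambda>z. F z - G z) has_derivative (\<lambda>v. pd v F z - pd v G z)) (at z)"
    by (rule has_derivative_diff[OF holo_at(1)[OF assms(1) z] holo_at(1)[OF assms(2) z]])
  show "pd (cscale c v) F z - pd (cscale c v) G z = c * (pd v F z - pd v G z)" for c v
    by (simp add: holo_at(2)[OF assms(1) z] holo_at(2)[OF assms(2) z] algebra_simps)
qed
lemma holo_mult:
  assumes "holo_on F S" "holo_on G S"
  shows "holo_on (\<lambda>z. F z * G z) S"
proof (rule holo_onI)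
  fix z assume z: "z \<in> S"
  show "((\<lambda>z. F z * G z) has_derivative (\<lambda>v. F z * pd v G z + pd v F z * G z)) (at z)"
    by (rule has_derivative_mult[OF holo_at(1)[OF assms(1) z] holo_at(1)[OF assms(2) z]])
  show "F z * pd (cscale c v) G z + pd (cscale c v) F z * G z = c * (F z * pd v G z + pd v F z * G z)" for c v
    by (simp add: holo_at(2)[OF assms(1) z] holo_at(2)[OF assms(2) z] algebra_simps)
qed
lemma holo_uminus: "holo_on F S ==> holo_on (\<lambda>z. - F z) S"
  using holo_diff[OF holo_const[of 0], of F S] by simp
lemma holo_sum: "(\<And>a. a \<in> A ==> holo_on (F a) S) ==> holo_on (\<lambda>z. \<Sum>a\<in>A. F a z) S"
  by (induction A rule: infinite_finite_induct) (auto intro: holo_add)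
lemma holo_prod: "(\<And>a. a \<in> A ==> holo_on (F a) S) ==> holo_on (\<lambda>z. \<Prod>a\<in>A. F a z) S"
  by (induction A rule: infinite_finite_induct) (auto intro: holo_mult)
lemma pd_sum: "z \<in> S ==> (\<And>a. a \<in> A ==> holo_on (F a) S) ==>
    pd v (\<lambda>z. \<Sum>a\<in>A. F a z) z = (\<Sum>a\<in>A. pd v (F a) z)"
proof (induction A rule: infinite_finite_induct)
  case (insert a A)
  then show ?case using pd_plus[of "F a" S "\<lambda>z. \<Sum>a\<in>A. F a z"] by (simp add: holo_sum)
qed auto

lemma holo_chain1:
  assumes "holo_on F S" "z \<in> S" "(g has_field_derivative g') (at (F z))"
  shows "((\<lambda>z. g (F z)) has_derivative (\<lambda>v. g' * pd v F z)) (at z)"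
  using has_derivative_compose[OF holo_at(1)[OF assms(1,2)] assms(3)[unfolded has_field_derivative_def]] .

lemma holo_comp1:
  assumes "holo_on F S" "\<And>z. z \<in> S ==> g field_differentiable (at (F z))"
  shows "holo_on (\<lambda>z. g (F z)) S"
proof -
  have "(g has_field_derivative deriv g (F z)) (at (F z))" if "z \<in> S" for z
    using assms(2)[OF that] field_differentiable_derivI by blast
  from holo_chain1[OF assms(1) _ this] show ?thesis
    by (intro holo_onI[of S _ "\<lambda>z v. deriv g (F z) * pd v F z"]) (auto simp: holo_at(2)[OF assms(1)])
qed

lemma holo_exp: "holo_on F S ==> holo_on (\<lambda>z. exp (F z)) S"
  by (rule holo_comp1) (auto intro: field_differentiable_within_exp)
lemma holo_divide: "holo_on F S ==> holo_on G S ==> (\<And>z. z \<in> S ==> G z \<noteq> 0) ==>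
    holo_on (\<lambda>z. F z / G z) S"
proof -
  assume a: "holo_on F S" "holo_on G S" "\<And>z. z \<in> S ==> G z \<noteq> 0"
  have "holo_on (\<lambda>z. inverse (G z)) S"
    by (rule holo_comp1[OF a(2)]) (auto intro!: derivative_intros field_differentiable_inverse dest: a(3))
  then show ?thesis using holo_mult[OF a(1)] by (simp add: divide_inverse)
qed
lemma holo_power: "holo_on F S ==> holo_on (\<lambda>z. F z ^ k) S"
  by (induction k) (auto intro: holo_mult)

lemmas holo_intros = holo_const holo_co holo_add holo_diff holo_mult holo_uminus holo_sum holo_prod
  holo_exp holo_divide holo_power

lemma
  assumes g: "\<And>i. holo_on (\<lambda>z. co i (g z)) S" and F: "holo_on F T" and m: "z \<in> S" "g z \<in> T"
  shows holo_chain: "((\<lambda>z. F (g z)) has_derivative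
      (\<lambda>v. pd (mk (\<lambda>i. pd v (\<lambda>z. co i (g z)) z)) F (g z))) (at z)"
    and pd_chain: "pd v (\<lambda>z. F (g z)) z = pd (mk (\<lambda>i. pd v (\<lambda>z. co i (g z)) z)) F (g z)"
proof -
  have "((\<lambda>z. mk (\<lambda>i. co i (g z))) has_derivative (\<lambda>v. mk (\<lambda>i. pd v (\<lambda>z. co i (g z)) z))) (at z)"
    by (intro has_derivative_mk holo_at(1)[OF g m(1)])
  then have "(g has_derivative (\<lambda>v. mk (\<lambda>i. pd v (\<lambda>z. co i (g z)) z))) (at z)" by simp
  from has_derivative_compose[OF this holo_at(1)[OF F m(2)]]
  show *: "((\<lambda>z. F (g z)) has_derivative
      (\<lambda>v. pd (mk (\<lambda>i. pd v (\<lambda>z. co i (g z)) z)) F (g z))) (at z)" .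
  have e: "mk (\<lambda>i. pd (cscale c v) (\<lambda>z. co i (g z)) z) = cscale c (mk (\<lambda>i. pd v (\<lambda>z. co i (g z)) z))" for c v
    by (rule phase_eqI) (simp add: holo_at(2)[OF g m(1)])
  show "pd v (\<lambda>z. F (g z)) z = pd (mk (\<lambda>i. pd v (\<lambda>z. co i (g z)) z)) F (g z)"
    by (rule holo_pdI[OF *]) (simp add: e holo_at(2)[OF F m(2)])
qed

lemma holo_comp:
  assumes "\<And>i. holo_on (\<lambda>z. co i (g z)) S" "holo_on F T" "\<And>z. z \<in> S ==> g z \<in> T"
  shows "holo_on (\<lambda>z. F (g z)) S"
proof (rule holo_onI)
  fix z assume z: "z \<in> S"
  show "((\<lambda>z. F (g z)) has_derivative (\<lambda>v. pd (mk (\<lambda>i. pd v (\<lambda>z. co i (g z)) z)) F (g z))) (at z)"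
    using holo_chain[OF assms(1,2) z assms(3)[OF z]] .
  fix c v
  have "mk (\<lambda>i. pd (cscale c v) (\<lambda>z. co i (g z)) z) = cscale c (mk (\<lambda>i. pd v (\<lambda>z. co i (g z)) z))"
    by (rule phase_eqI) (simp add: holo_at(2)[OF assms(1) z])
  then show "pd (mk (\<lambda>i. pd (cscale c v) (\<lambda>z. co i (g z)) z)) F (g z) =
     c * pd (mk (\<lambda>i. pd v (\<lambda>z. co i (g z)) z)) F (g z)"
    by (simp add: holo_at(2)[OF assms(2) assms(3)[OF z]])
qed

subsection \<open>Cauchy estimates, limits and parameter integrals\<close>

text \<open>Cauchy's inequality for the restriction to the complex line in direction v. The slice
  need not extend continuously to the circle of radius R, so the inequality is applied for r < R and
  r tends to R.\<close>

lemma Cauchy_pd: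
  assumes "0 < R" and S: "\<And>c. cmod c < R ==> z + cscale c v \<in> S" and F: "holo_on F S"
    and M: "\<And>w. w \<in> S ==> cmod (F w) <= M"
  shows "cmod (pd v F z) * R <= M"
proof -
  let ?g = "\<lambda>c. F (z + cscale c v)"
  have d: "(?g has_field_derivative pd v F (z + cscale c v)) (at c)" if "cmod c < R" for c
    using holo_line[OF F S[OF that]] .
  have "cmod (pd v F z) * r <= M" if r: "0 < r" "r < R" for r
  proof -
    have "norm ((deriv ^^ 1) ?g 0) <= fact 1 * M / r ^ 1"
    proof (rule Cauchy_inequality)
      show "?g holomorphic_on ball 0 r"
      unfolding holomorphic_on_open[OF open_ball] using d r by (meson mem_ball_0 order.strict_trans)
      show "continuous_on (cball 0 r) ?g"
      using d r by (intro continuous_at_imp_continuous_on ballI DERIV_isCont[OF d]) auto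
      show "cmod (?g x) <= M" if "cmod (0 - x) = r" for x
      using M[OF S] that r by auto
    qed (use r in auto)
    moreover have "deriv ?g 0 = pd v F z" by (simp add: pd_def)
    ultimately show ?thesis using r by (simp add: field_simps)
  qed
  note * = this
  have "((\<lambda>r. cmod (pd v F z) * r) \<longlongrightarrow> cmod (pd v F z) * R) (at_left R)"
    by (intro tendsto_intros)
  moreover have "\<forall>\<^sub>F r in at_left R. cmod (pd v F z) * r <= M"
    using eventually_at_left_real[OF \<open>0 < R\<close>] by eventually_elim (use * in auto)
  ultimately show ?thesis by (rule tendsto_upperbound) simp
qed

text \<open>Bounds of this form, unlike differentiability itself, survive limits and integrals. In
  units of u the slice has radius \<rho> >= 4; on the disc of radius 2 Cauchy's inequality with
  radius \<rho>/4 bounds the second derivative by 2 * 16 * M / \<rho>^2.\<close>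

lemma pd_quadratic:
  assumes R: "0 < R" and F: "holo_on F (ball z R)"
    and M: "\<And>w. w \<in> ball z R ==> cmod (F w) <= M" and u: "norm u <= R / 4"
  shows "cmod (F (z + u) - F z - pd u F z) <= 32 * M / R\<^sup>2 * (norm u)\<^sup>2"
proof (cases "u = 0")
  case True
  then show ?thesis using holo_at(2)[OF F, of z 0 u] R by simp
next
  case False
  define \<rho> where "\<rho> = R / norm u"
  have \<rho>: "\<rho> \<ge> 4" "\<rho> * norm u = R" using u False by (auto simp: \<rho>_def field_simps)
  let ?g = "\<lambda>c. F (z + cscale c u)"
  have in_ball: "z + cscale c u \<in> ball z R" if "cmod c < \<rho>" for c
    using that False by (simp add: dist_norm norm_cscale \<rho>_def field_simps)
  have d: "(?g has_field_derivative pd u F (z + cscale c u)) (at c)" if "cmod c < \<rho>" for c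
    using holo_line[OF F in_ball[OF that]] .
  have hol: "?g holomorphic_on ball 0 \<rho>"
    using d by (auto simp: holomorphic_on_open intro!: exI)
  have "cmod ((deriv ^^ 0) ?g 1 - (\<Sum>i\<le>1. (deriv ^^ i) ?g 0 * (1 - 0) ^ i / fact i))
      <= (32 * M / \<rho>\<^sup>2) * cmod (1 - 0) ^ Suc 1 / fact 1"
  proof (rule complex_Taylor[where S = "ball 0 2"])
    fix i and x :: complex assume x: "x \<in> ball 0 2" and "i <= (1::nat)"
    have "(deriv ^^ i) ?g holomorphic_on ball 0 \<rho>"
      by (rule holomorphic_higher_deriv[OF hol]) simp
    then have "((deriv ^^ i) ?g has_field_derivative (deriv ^^ Suc i) ?g x) (at x)"
      using x \<rho> by (simp add: holomorphic_derivI)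
    then show "((deriv ^^ i) ?g has_field_derivative (deriv ^^ Suc i) ?g x) (at x within ball 0 2)"
      by (rule has_field_derivative_at_within)
  next
    fix x :: complex assume x: "x \<in> ball 0 2"
    have sub: "cball x (\<rho> / 4) \<subseteq> ball 0 \<rho>"
    proof
      fix y assume "y \<in> cball x (\<rho> / 4)"
      then have "cmod y <= cmod x + \<rho> / 4"
      using norm_triangle_sub[of y x] by (simp add: dist_norm norm_minus_commute)
      then show "y \<in> ball 0 \<rho>" using x \<rho> by simp
    qed
    have "norm ((deriv ^^ 2) ?g x) <= fact 2 * M / (\<rho> / 4) ^ 2"
    proof (rule Cauchy_inequality)
      show "?g holomorphic_on ball x (\<rho> / 4)" "continuous_on (cball x (\<rho> / 4)) ?g"
      using sub hol ball_subset_cball by (blast intro: holomorphic_on_subset holomorphic_on_imp_continuous_on)+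
      show "0 < \<rho> / 4" using \<rho> by simp
      show "cmod (?g y) <= M" if "cmod (x - y) = \<rho> / 4" for y
      proof -
      have "y \<in> ball 0 \<rho>" using sub that by (auto simp: dist_norm)
      then show ?thesis using M[OF in_ball] by simp
      qed
    qed
    then show "cmod ((deriv ^^ Suc 1) ?g x) <= 32 * M / \<rho>\<^sup>2"
      by (simp add: power2_eq_square numeral_2_eq_2)
  qed auto
  moreover have "deriv ?g 0 = pd u F z" by (simp add: pd_def)
  moreover have "32 * M / \<rho>\<^sup>2 = 32 * M / R\<^sup>2 * (norm u)\<^sup>2"
    using False R by (simp add: \<rho>_def power_divide)
  ultimately show ?thesis by (simp add: algebra_simps)
qed

lemma quadratic_has_derivative:
  fixes g :: "'a::real_normed_vector => complex"
  assumes "bounded_linear L" "0 < r"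
    and q: "\<And>u. norm u < r ==> cmod (g (z + u) - g z - L u) <= C * (norm u)\<^sup>2"
  shows "(g has_derivative L) (at z)"
  unfolding has_derivative_at_alt
proof (intro conjI allI impI assms(1))
  fix e :: real assume e: "e > 0"
  let ?d = "min r (e / (\<bar>C\<bar> + 1))"
  show "\<exists>d>0. \<forall>y. norm (y - z) < d \<longrightarrow> norm (g y - g z - L (y - z)) <= e * norm (y - z)"
  proof (intro exI[of _ ?d] conjI allI impI)
    show "?d > 0" using e assms(2) by simp
    fix y assume y: "norm (y - z) < ?d"
    have "norm (g y - g z - L (y - z)) <= C * (norm (y - z))\<^sup>2"
      using q[of "y - z"] y by simp
    also have "... <= (\<bar>C\<bar> + 1) * norm (y - z) * norm (y - z)"
      by (auto simp: power2_eq_square mult.assoc intro!: mult_right_mono)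
    also have "... <= e * norm (y - z)"
    proof (rule mult_right_mono)
      have "norm (y - z) <= e / (\<bar>C\<bar> + 1)" using y by simp
      then show "(\<bar>C\<bar> + 1) * norm (y - z) <= e"
      by (simp add: field_simps add_pos_nonneg pos_le_divide_eq)
    qed simp
    finally show "norm (g y - g z - L (y - z)) <= e * norm (y - z)" .
  qed
qed

lemma clinear_bounded:
  assumes "\<And>u v. L (u + v) = L u + L v" "\<And>c v. L (cscale c v) = c * (L v :: complex)"
  shows "bounded_linear (L :: ('n::finite, 'm::finite) phase => complex)"
proof -
  have "linear L"
  proof (rule linearI)
    show "L (r *\<^sub>R b) = r *\<^sub>R L b" for r b
      using assms(2)[of "of_real r" b] by (simp add: cscale_of_real scaleR_conv_of_real)
  qed (rule assms(1))
  then show ?thesis by (rule linear_conv_bounded_linear[THEN iffD1])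
qed

lemma holo_bounded_cball:
  assumes "holo_on F S" "cball z R \<subseteq> S"
  obtains M where "M > 0" "\<And>w. w \<in> cball z R ==> cmod (F w) <= M"
proof -
  have "compact (F ` cball z R)"
    by (intro compact_continuous_image holo_continuous holo_subset[OF assms] compact_cball)
  then obtain M where "\<forall>x\<in>F ` cball z R. norm x <= M" by (meson bounded_iff compact_imp_bounded)
  then have "cmod (F w) <= max M 1" if "w \<in> cball z R" for w
    using that by (meson imageI le_max_iff_disj)
  then show ?thesis by (intro that[of "max M 1"]) simp_all
qed

text \<open>Weierstrass' theorem in two stages. The one-variable theorem on complex lines makes the
  directional derivatives converge, so additivity and complex homogeneity pass to the limit; the
  bound of \<open>pd_quadratic\<close>, uniform along the filter, then passes to the limit as well
  and makes g Frechet differentiable.\<close>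

lemma holo_limit:
  fixes f :: "'i => ('n::finite, 'm::finite) func"
  assumes Q: "Q \<noteq> bot" and R: "0 < R" and ev: "\<forall>\<^sub>F n in Q. holo_on (f n) (ball z R)"
    and lim: "uniform_limit (ball z R) f g Q"
  shows "(g has_derivative (\<lambda>u. pd u g z)) (at z)" "pd (cscale c u) g z = c * pd u g z"
    and "((\<lambda>n. pd u (f n) z) \<longlongrightarrow> pd u g z) Q"
proof -
  have lim': "((\<lambda>n. pd u (f n) z) \<longlongrightarrow> pd u g z) Q" for u
  proof -
    define r where "r = R / (2 * (norm u + 1))"
    have r: "r > 0" using R by (simp add: r_def add_nonneg_pos)
    have rr: "r * norm u < R"
    proof -
      have "r * norm u <= r * (norm u + 1)" using r by simp
      also have "... = R / 2" by (simp add: r_def field_simps add_nonneg_eq_0_iff)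
      finally show ?thesis using R by simp
    qed
    have inb: "z + cscale c u \<in> ball z R" if "cmod c <= r" for c
    proof -
      have "cmod c * norm u <= r * norm u" using that by (simp add: mult_right_mono)
      then show ?thesis using rr by (simp add: dist_norm norm_cscale)
    qed
    have "\<forall>\<^sub>F n in Q. continuous_on (cball 0 r) (\<lambda>c. f n (z + cscale c u)) \<and>
      (\<forall>w\<in>ball 0 r. ((\<lambda>c. f n (z + cscale c u)) has_field_derivative pd u (f n) (z + cscale w u)) (at w))"
      using ev
    proof eventually_elim
      case (elim n)
      have *: "((\<lambda>c. f n (z + cscale c u)) has_field_derivative pd u (f n) (z + cscale w u)) (at w)"
      if "cmod w <= r" for w
      by (rule holo_line[OF elim inb[OF that]])
      show ?case
      using * by (auto intro!: continuous_at_imp_continuous_on DERIV_isCont[OF *])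
    qed
    moreover have "uniform_limit (cball 0 r) (\<lambda>n c. f n (z + cscale c u)) (\<lambda>c. g (z + cscale c u)) Q"
      using lim inb unfolding uniform_limit_iff by (force elim!: eventually_mono)
    ultimately obtain g' where g': "\<And>w. w \<in> ball 0 r ==>
      ((\<lambda>c. g (z + cscale c u)) has_field_derivative g' w) (at w) \<and>
      ((\<lambda>n. pd u (f n) (z + cscale w u)) \<longlongrightarrow> g' w) Q"
      by (rule has_complex_derivative_uniform_limit[OF _ _ Q r]) blast
    have "pd u g z = g' 0"
      using g'[of 0] r by (auto simp: pd_def intro: DERIV_imp_deriv)
    then show ?thesis using g'[of 0] r by simp
  qed
  then show "((\<lambda>n. pd u (f n) z) \<longlongrightarrow> pd u g z) Q" .
  have zR: "z \<in> ball z R" using R by simp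
  have add: "pd (u + v) g z = pd u g z + pd v g z" for u v
  proof (rule tendsto_unique[OF Q lim'])
    have "((\<lambda>n. pd u (f n) z + pd v (f n) z) \<longlongrightarrow> pd u g z + pd v g z) Q"
      by (intro tendsto_intros lim')
    moreover have "\<forall>\<^sub>F n in Q. pd u (f n) z + pd v (f n) z = pd (u + v) (f n) z"
      using ev by eventually_elim (use pd_add zR in metis)
    ultimately show "((\<lambda>n. pd (u + v) (f n) z) \<longlongrightarrow> pd u g z + pd v g z) Q"
      by (rule Lim_transform_eventually)
  qed
  have sc: "pd (cscale c u) g z = c * pd u g z" for c u
  proof (rule tendsto_unique[OF Q lim'])
    have "((\<lambda>n. c * pd u (f n) z) \<longlongrightarrow> c * pd u g z) Q"
      by (intro tendsto_intros lim')
    moreover have "\<forall>\<^sub>F n in Q. c * pd u (f n) z = pd (cscale c u) (f n) z"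
      using ev by eventually_elim (use holo_at(2) zR in metis)
    ultimately show "((\<lambda>n. pd (cscale c u) (f n) z) \<longlongrightarrow> c * pd u g z) Q"
      by (rule Lim_transform_eventually)
  qed
  show "pd (cscale c u) g z = c * pd u g z" by (rule sc)
  have e1: "\<forall>\<^sub>F n in Q. \<forall>w\<in>ball z R. dist (f n w) (g w) < 1"
    using lim unfolding uniform_limit_iff by simp
  obtain n where n: "holo_on (f n) (ball z R)" "\<forall>w\<in>ball z R. dist (f n w) (g w) < 1"
    using eventually_happens'[OF Q eventually_conj[OF ev e1]] by auto
  obtain M where M: "\<And>w. w \<in> cball z (R/2) ==> cmod (f n w) <= M"
    by (rule holo_bounded_cball[OF n(1), of z "R/2"]) (use R in auto)
  \<comment> \<open>M bounds one fixed \<open>f n\<close> on the half ball; every late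
    \<open>f k\<close> differs from it by at most 2, since both are within 1 of g.\<close>
  have "cmod (g (z + u) - g z - pd u g z) <= 32 * (M + 2) / (R/2)\<^sup>2 * (norm u)\<^sup>2" if u: "norm u < R/8" for u
  proof (rule tendsto_upperbound[OF _ _ Q])
    have in1: "z + u \<in> ball z R" using u R norm_ge_zero[of u] by (simp add: dist_norm del: norm_ge_zero)
    have t: "((\<lambda>n. f n w) \<longlongrightarrow> g w) Q" if "w \<in> ball z R" for w
      using tendsto_uniform_limitI[OF lim that] .
    show "((\<lambda>n. cmod (f n (z + u) - f n z - pd u (f n) z)) \<longlongrightarrow> cmod (g (z + u) - g z - pd u g z)) Q"
      by (intro tendsto_intros t in1 zR lim')
    show "\<forall>\<^sub>F n in Q. cmod (f n (z + u) - f n z - pd u (f n) z) <= 32 * (M + 2) / (R/2)\<^sup>2 * (norm u)\<^sup>2"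
      using ev e1
    proof eventually_elim
      case (elim k)
      show ?case
      proof (rule pd_quadratic)
      show "holo_on (f k) (ball z (R/2))" by (rule holo_subset[OF elim(1)]) (use R in auto)
      fix w assume w: "w \<in> ball z (R/2)"
      then have w': "w \<in> ball z R" "w \<in> cball z (R/2)" using R by auto
      have "cmod (f k w) <= cmod (f k w - g w) + cmod (f n w - g w) + cmod (f n w)"
      using norm_triangle_ineq4[of "f k w - g w" "f n w - g w"] norm_triangle_sub[of "f k w" "f n w"] by simp
      moreover have "cmod (f k w - g w) <= 1" "cmod (f n w - g w) <= 1"
      using elim(2) n(2) w'(1) by (auto simp: dist_norm less_imp_le)
      ultimately show "cmod (f k w) <= M + 2"
      using M[OF w'(2)] by linarith
      qed (use R u in auto)
    qed
  qed
  then show "(g has_derivative (\<lambda>u. pd u g z)) (at z)"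
    by (intro quadratic_has_derivative[OF clinear_bounded[OF add sc], of "R/8"]) (use R in simp)
qed

lemma holo_limit_on:
  fixes f :: "'i => ('n::finite, 'm::finite) func"
  assumes "Q \<noteq> bot" and "\<And>z. z \<in> S ==> \<exists>R>0. (\<forall>\<^sub>F n in Q. holo_on (f n) (ball z R)) \<and>
     uniform_limit (ball z R) f g Q"
  shows "holo_on g S"
  by (rule holo_onI[of S g "\<lambda>z v. pd v g z"]) (use assms holo_limit[OF assms(1)] in blast)+

text \<open>By \<open>pd_quadratic\<close> the difference quotients converge uniformly near z, at a
  rate proportional to the increment. They are holomorphic, so \<open>holo_limit\<close> makes
  \<open>pd v F\<close> holomorphic again.\<close>

lemma difference_quotient:
  assumes S: "open S" and F: "holo_on F S" and z: "z \<in> S"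
  shows "\<exists>R>0. (\<forall>\<^sub>F e in at 0. holo_on (\<lambda>w. (F (w + cscale e v) - F w) / e) (ball z R)) \<and>
     uniform_limit (ball z R) (\<lambda>e w. (F (w + cscale e v) - F w) / e) (\<lambda>w. pd v F w) (at 0)"
proof -
  obtain R where R: "R > 0" "cball z R \<subseteq> S" using S z open_contains_cball by blast
  obtain M where M: "M > 0" "\<And>w. w \<in> cball z R ==> cmod (F w) <= M"
    using holo_bounded_cball[OF F R(2)] by metis
  have small: "\<forall>\<^sub>F e in at (0::complex). cmod e * norm v < d \<and> e \<noteq> 0" if "d > 0" for d
  proof -
    have "((\<lambda>e. cmod e * norm v) \<longlongrightarrow> cmod 0 * norm v) (at 0)" by (intro tendsto_intros)
    then have "\<forall>\<^sub>F e in at (0::complex). cmod e * norm v < d"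
      using order_tendstoD(2)[of _ 0] that by simp
    then show ?thesis by (intro eventually_conj eventually_neq_at_within)
  qed
  show ?thesis
  proof (intro exI[of _ "R/2"] conjI)
    show "R/2 > 0" using R by simp
    show "\<forall>\<^sub>F e in at 0. holo_on (\<lambda>w. (F (w + cscale e v) - F w) / e) (ball z (R/2))"
      using small[OF half_gt_zero[OF R(1)]]
    proof eventually_elim
      case (elim e)
      have *: "w + cscale e v \<in> S" if "w \<in> ball z (R/2)" for w
      proof -
      have "dist z (w + cscale e v) <= dist z w + cmod e * norm v"
      by (metis dist_triangle add_diff_cancel_left' dist_commute dist_norm norm_cscale)
      then have "w + cscale e v \<in> cball z R" using that elim by simp
      then show ?thesis using R(2) by blast
      qed
      have "holo_on (\<lambda>w. F (w + cscale e v)) (ball z (R/2))"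
      by (rule holo_comp[OF _ F *]) (simp_all add: holo_add)
      moreover have "holo_on F (ball z (R/2))" using R by (intro holo_subset[OF F]) auto
      ultimately show ?case using elim by (intro holo_divide holo_diff) auto
    qed
    show "uniform_limit (ball z (R/2)) (\<lambda>e w. (F (w + cscale e v) - F w) / e) (\<lambda>w. pd v F w) (at 0)"
      unfolding uniform_limit_iff
    proof (intro allI impI)
      fix eps :: real assume eps: "eps > 0"
      define C where "C = 32 * M / (R/2)\<^sup>2"
      have C: "C > 0" using M R by (simp add: C_def)
      have "((\<lambda>e. cmod e * (C * (norm v)\<^sup>2)) \<longlongrightarrow> cmod 0 * (C * (norm v)\<^sup>2)) (at 0)" by (intro tendsto_intros)
      then have "\<forall>\<^sub>F e in at (0::complex). cmod e * (C * (norm v)\<^sup>2) < eps"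
      using order_tendstoD(2)[of _ 0] eps by simp
      moreover have "\<forall>\<^sub>F e in at (0::complex). cmod e * norm v < R/8 \<and> e \<noteq> 0" using small[of "R/8"] R by simp
      ultimately show "\<forall>\<^sub>F e in at 0. \<forall>w\<in>ball z (R/2). dist ((F (w + cscale e v) - F w) / e) (pd v F w) < eps"
      proof eventually_elim
      case (elim e)
      show ?case
      proof
      fix w assume w: "w \<in> ball z (R/2)"
      have sub: "ball w (R/2) \<subseteq> cball z R"
      proof
      fix y assume "y \<in> ball w (R/2)"
      then show "y \<in> cball z R" using w dist_triangle[of z y w] by auto
      qed
      have "cmod (F (w + cscale e v) - F w - pd (cscale e v) F w) <= C * (norm (cscale e v))\<^sup>2"
      unfolding C_def
      proof (rule pd_quadratic)
      show "holo_on F (ball w (R/2))" using holo_subset[OF F] sub R(2) by blast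
      qed (use R M sub elim in \<open>auto simp: norm_cscale\<close>)
      also have "pd (cscale e v) F w = e * pd v F w"
      proof (rule holo_at(2)[OF F])
      show "w \<in> S" using sub R centre_in_ball[of w "R/2"] by (meson half_gt_zero subsetD)
      qed
      finally have "cmod (F (w + cscale e v) - F w - e * pd v F w) <= cmod e * (cmod e * (C * (norm v)\<^sup>2))"
      by (simp add: norm_cscale power2_eq_square mult_ac)
      also have "... < cmod e * eps" using elim by simp
      finally have "cmod (F (w + cscale e v) - F w - e * pd v F w) / cmod e < eps"
      using elim by (simp add: field_simps)
      moreover have "(F (w + cscale e v) - F w) / e - pd v F w = (F (w + cscale e v) - F w - e * pd v F w) / e"
      using elim by (simp add: field_simps)
      ultimately show "dist ((F (w + cscale e v) - F w) / e) (pd v F w) < eps"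
      by (simp add: dist_norm norm_divide)
      qed
      qed
    qed
  qed
qed

lemma holo_pd: "open S ==> holo_on F S ==> holo_on (pd v F) S"
  by (rule holo_limit_on[OF _ difference_quotient]) auto

text \<open>On a compact ball F is bounded uniformly in t, so the bound of
  \<open>pd_quadratic\<close> has one constant for all t and can be integrated. The integrand
  \<open>pd u (F t) z\<close> is continuous in t because its difference quotients converge uniformly
  in t.\<close>

lemma holo_integral:
  fixes F :: "real => ('n::finite, 'm::finite) func"
  assumes S: "open S" and F: "\<And>t. t \<in> {a..b} ==> holo_on (F t) S"
    and cont: "continuous_on ({a..b} \<times> S) (\<lambda>(t, z). F t z)"
  shows "holo_on (\<lambda>z. integral {a..b} (\<lambda>t. F t z)) S"
    and "z \<in> S ==> pd v (\<lambda>z. integral {a..b} (\<lambda>t. F t z)) z = integral {a..b} (\<lambda>t. pd v (F t) z)"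
proof -
  have "((\<lambda>z. integral {a..b} (\<lambda>t. F t z)) has_derivative (\<lambda>u. integral {a..b} (\<lambda>t. pd u (F t) z))) (at z) \<and>
     (\<forall>c u. integral {a..b} (\<lambda>t. pd (cscale c u) (F t) z) = c * integral {a..b} (\<lambda>t. pd u (F t) z))"
    if z: "z \<in> S" for z
  proof -
    obtain R where R: "R > 0" "cball z R \<subseteq> S" using S z open_contains_cball by blast
    have "compact ((\<lambda>(t, z). F t z) ` ({a..b} \<times> cball z R))"
      using R(2) by (intro compact_continuous_image continuous_on_subset[OF cont] compact_Times) auto
    then obtain M where M0: "\<forall>x\<in>(\<lambda>(t, z). F t z) ` ({a..b} \<times> cball z R). cmod x <= M"
      by (meson bounded_iff compact_imp_bounded)
    have M: "cmod (F t w) <= M" if "t \<in> {a..b}" "w \<in> cball z R" for t w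
      using M0 that by (metis (no_types, lifting) SigmaI case_prod_conv imageI)
    define C where "C = 32 * M / R\<^sup>2"
    have q: "cmod (F t (z + u) - F t z - pd u (F t) z) <= C * (norm u)\<^sup>2"
      if "t \<in> {a..b}" "norm u <= R/4" for t u
      unfolding C_def
    proof (rule pd_quadratic[OF R(1)])
      show "holo_on (F t) (ball z R)"
      by (rule holo_subset[OF F[OF that(1)]]) (use R(2) ball_subset_cball in blast)
      show "cmod (F t w) <= M" if "w \<in> ball z R" for w
      using M \<open>t \<in> {a..b}\<close> that ball_subset_cball by blast
    qed (use that in simp)
    have cF: "continuous_on {a..b} (\<lambda>t. F t w)" if "w \<in> S" for w
    proof -
      have "continuous_on {a..b} (\<lambda>t. (t, w))" by (intro continuous_intros)
      moreover have "(\<lambda>t. (t, w)) ` {a..b} \<subseteq> {a..b} \<times> S" using that by blast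
      ultimately show ?thesis using continuous_on_compose2[OF cont] by fastforce
    qed
    have cpd: "continuous_on {a..b} (\<lambda>t. pd u (F t) z)" for u
    proof (rule uniform_limit_theorem[where F = "at 0" and f = "\<lambda>e t. (F t (z + cscale e u) - F t z) / e"])
      have "((\<lambda>e. cmod e * norm u) \<longlongrightarrow> cmod 0 * norm u) (at 0)" by (intro tendsto_intros)
      then have ev: "\<forall>\<^sub>F e in at (0::complex). cmod e * norm u < R/4"
      by (rule order_tendstoD(2)) (use R in simp)
      then show "\<forall>\<^sub>F e in at 0. continuous_on {a..b} (\<lambda>t. (F t (z + cscale e u) - F t z) / e)"
      using eventually_neq_at_within[of 0]
      proof eventually_elim
      case (elim e)
      have "z + cscale e u \<in> cball z R" using elim R by (simp add: dist_norm norm_cscale)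
      then have "z + cscale e u \<in> S" using R by blast
      then show ?case using elim z by (intro continuous_intros cF) auto
      qed
      show "uniform_limit {a..b} (\<lambda>e t. (F t (z + cscale e u) - F t z) / e) (\<lambda>t. pd u (F t) z) (at 0)"
      unfolding uniform_limit_iff
      proof (intro allI impI)
      fix eps :: real assume eps: "eps > 0"
      have "((\<lambda>e. cmod e * (C * (norm u)\<^sup>2)) \<longlongrightarrow> cmod 0 * (C * (norm u)\<^sup>2)) (at 0)" by (intro tendsto_intros)
      then have "\<forall>\<^sub>F e in at (0::complex). cmod e * (C * (norm u)\<^sup>2) < eps"
      using order_tendstoD(2)[of _ 0] eps by simp
      then show "\<forall>\<^sub>F e in at 0. \<forall>t\<in>{a..b}. dist ((F t (z + cscale e u) - F t z) / e) (pd u (F t) z) < eps"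
      using ev eventually_neq_at_within[of 0]
      proof eventually_elim
      case (elim e)
      show ?case
      proof
      fix t assume t: "t \<in> {a..b}"
      have "cmod (F t (z + cscale e u) - F t z - pd (cscale e u) (F t) z) <= C * (norm (cscale e u))\<^sup>2"
      by (rule q[OF t]) (use elim in \<open>simp add: norm_cscale\<close>)
      then have "cmod (F t (z + cscale e u) - F t z - e * pd u (F t) z) <= cmod e * (cmod e * (C * (norm u)\<^sup>2))"
      using holo_at(2)[OF F[OF t] z] by (simp add: norm_cscale power2_eq_square mult_ac)
      also have "... < cmod e * eps" using elim by simp
      finally have "cmod (F t (z + cscale e u) - F t z - e * pd u (F t) z) / cmod e < eps"
      using elim by (simp add: field_simps)
      moreover have "(F t (z + cscale e u) - F t z) / e - pd u (F t) z = (F t (z + cscale e u) - F t z - e * pd u (F t) z) / e"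
      using elim by (simp add: field_simps)
      ultimately show "dist ((F t (z + cscale e u) - F t z) / e) (pd u (F t) z) < eps"
      by (simp add: dist_norm norm_divide)
      qed
      qed
      qed
    qed simp
    note int = integrable_continuous_real[OF cpd] integrable_continuous_real[OF cF]
    let ?L = "\<lambda>u. integral {a..b} (\<lambda>t. pd u (F t) z)"
    have add: "?L (u + v) = ?L u + ?L v" for u v
    proof -
      have "?L (u + v) = integral {a..b} (\<lambda>t. pd u (F t) z + pd v (F t) z)"
      by (rule integral_cong) (rule pd_add[OF F z])
      then show ?thesis by (simp add: integral_add int)
    qed
    have sc: "?L (cscale c u) = c * ?L u" for c u
    proof -
      have "?L (cscale c u) = integral {a..b} (\<lambda>t. c * pd u (F t) z)"
      by (rule integral_cong) (rule holo_at(2)[OF F z])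
      then show ?thesis by simp
    qed
    have "((\<lambda>z. integral {a..b} (\<lambda>t. F t z)) has_derivative ?L) (at z)"
    proof (rule quadratic_has_derivative[OF clinear_bounded[OF add sc], of "R/4"])
      fix u :: "('n, 'm) phase" assume u: "norm u < R/4"
      have "z + u \<in> cball z R" using u R by (simp add: dist_norm)
      then have zu: "z + u \<in> S" using R by blast
      have "integral {a..b} (\<lambda>t. F t (z + u)) - integral {a..b} (\<lambda>t. F t z) - ?L u =
      integral {a..b} (\<lambda>t. F t (z + u) - F t z - pd u (F t) z)"
      using zu z by (simp add: integral_diff int integrable_diff)
      moreover have "cmod ... <= (C * (norm u)\<^sup>2) * (if a <= b then b - a else 0)"
      proof (cases "a <= b")
      case True
      have "cmod (integral (cbox a b) (\<lambda>t. F t (z + u) - F t z - pd u (F t) z)) <= (C * (norm u)\<^sup>2) * measure lborel (cbox a b)"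
      proof (rule integrable_bound)
      have "cmod (F a (z + u) - F a z - pd u (F a) z) <= C * (norm u)\<^sup>2"
      using True u by (intro q) auto
      then show "0 <= C * (norm u)\<^sup>2" using norm_ge_zero order_trans by blast
      qed (use zu z q u in \<open>auto intro!: integrable_diff int\<close>)
      then show ?thesis using True by simp
      qed simp
      ultimately show "cmod (integral {a..b} (\<lambda>t. F t (z + u)) - integral {a..b} (\<lambda>t. F t z) - ?L u)
      <= (C * (if a <= b then b - a else 0)) * (norm u)\<^sup>2"
      by (simp add: mult_ac)
    qed (use R in auto)
    then show ?thesis using sc by blast
  qed
  note * = this
  show "holo_on (\<lambda>z. integral {a..b} (\<lambda>t. F t z)) S"
    by (rule holo_onI[of S _ "\<lambda>z u. integral {a..b} (\<lambda>t. pd u (F t) z)"]) (use * in auto)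
  show "pd v (\<lambda>z. integral {a..b} (\<lambda>t. F t z)) z = integral {a..b} (\<lambda>t. pd v (F t) z)" if "z \<in> S"
    by (rule holo_pdI) (use *[OF that] in auto)
qed

text \<open>The gap between nested domains, measured with a separate radius \<open>R i\<close> for
  each coordinate. Polydiscs and the scaled domains \<open>P t\<close> both have it, so one Cauchy
  estimate serves for both.\<close>

definition nbh :: "(('n::finite, 'm::finite) ix => real) => real => ('n, 'm) phase set => ('n, 'm) phase set => bool" where
  "nbh R e S T \<longleftrightarrow> (\<forall>z\<in>S. \<forall>v. (\<forall>i. cmod (co i v) < e * R i) \<longrightarrow> z + v \<in> T)"

text \<open>If all coordinates of v are within \<open>m * R i\<close>, the disc of radius e / m
  along v stays in T. Estimating the derivative along v at once, instead of summing partial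
  derivatives, keeps the constant independent of the dimension.\<close>

lemma Cauchy_nbh:
  assumes n: "nbh R e S T" and e: "0 < e" and R: "\<And>i. 0 < R i" and F: "holo_on F T"
    and M: "\<And>w. w \<in> T ==> cmod (F w) <= M" and z: "z \<in> S"
    and m: "\<And>i. cmod (co i v) <= m * R i"
  shows "cmod (pd v F z) * e <= m * M"
proof -
  have m0: "m \<ge> 0"
  proof -
    have "0 <= m * R CY" using m[of CY] norm_ge_zero order_trans by blast
    then show ?thesis using R[of CY] by (simp add: zero_le_mult_iff not_less)
  qed
  have "\<forall>i. cmod (co i 0) < e * R i" using e R by simp
  then have zT: "z \<in> T" using n z unfolding nbh_def by fastforce
  show ?thesis
  proof (cases "m = 0")
    case True
    then have "v = 0" using m by (intro phase_eqI) auto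
    then show ?thesis using True holo_at(2)[OF F zT, of 0 v] by simp
  next
    case False
    have "cmod (pd v F z) * (e / m) <= M"
    proof (rule Cauchy_pd[OF _ _ F M])
      show "0 < e / m" using e m0 False by simp
      fix c assume c: "cmod c < e / m"
      have "cmod (co i (cscale c v)) < e * R i" for i
      proof -
      have "cmod (co i (cscale c v)) <= cmod c * (m * R i)"
      using m[of i] by (simp add: norm_mult mult_left_mono)
      also have "... < e / m * (m * R i)" using c m0 False R[of i] by (intro mult_strict_right_mono) auto
      finally show ?thesis using False by simp
      qed
      then show "z + cscale c v \<in> T" using n z unfolding nbh_def by blast
    qed
    then show ?thesis using m0 False by (simp add: field_simps)
  qed
qed

subsection \<open>Lie derivatives\<close>

lemma sum_ix:
  "(\<Sum>i\<in>UNIV. f (i :: ('n::finite, 'm::finite) ix)) =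
    (\<Sum>i\<in>UNIV. f (CI i)) + (\<Sum>i\<in>UNIV. f (CT i)) + (\<Sum>i\<in>UNIV. f (CP i)) + (\<Sum>i\<in>UNIV. f (CQ i)) + f CY + f CX"
  for f :: "_ => 'a::comm_monoid_add"
proof -
  have i: "inj CI" "inj CT" "inj CP" "inj CQ" by (auto simp: inj_def)
  have "(\<Sum>i\<in>UNIV. f (i :: ('n, 'm) ix)) = sum f (range CI \<union> range CT \<union> range CP \<union> range CQ \<union> {CY, CX})"
    by (simp only: UNIV_ix[symmetric])
  also have "... = sum f (range CI) + sum f (range CT) + sum f (range CP) + sum f (range CQ) + sum f {CY, CX}"
    by (subst sum.union_disjoint; auto)+
  finally show ?thesis by (simp add: sum.reindex i add.assoc)
qed

fun cj :: "('n, 'm) ix => ('n, 'm) ix" where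
  "cj (CI i) = CT i" | "cj (CT i) = CI i" | "cj (CP i) = CQ i" | "cj (CQ i) = CP i"
| "cj CY = CX" | "cj CX = CY"

fun sg :: "('n, 'm) ix => complex" where
  "sg (CI i) = -1" | "sg (CT i) = 1" | "sg (CP i) = -1" | "sg (CQ i) = 1" | "sg CY = -1" | "sg CX = 1"

lemma norm_sg [simp]: "cmod (sg i) = 1" by (cases i) auto

text \<open>The Hamiltonian vector field for the sign convention of \<open>lie\<close>:
  \<open>cj\<close> is the conjugate coordinate and \<open>sg\<close> the sign with which it enters.
  By \<open>lie_eq\<close> a bracket is one directional derivative, to which
  \<open>Cauchy_nbh\<close> applies.\<close>

definition XH :: "('n::finite, 'm::finite) func => ('n, 'm) phase => ('n, 'm) phase" where
  "XH \<phi> z = mk (\<lambda>i. sg i * pd (eb (cj i)) \<phi> z)"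

lemma eb_simps:
  "eb (CI i) = (axis i 1, 0, 0, 0, 0, 0)" "eb (CT i) = (0, axis i 1, 0, 0, 0, 0)"
  "eb (CP j) = (0, 0, axis j 1, 0, 0, 0)" "eb (CQ j) = (0, 0, 0, axis j 1, 0, 0)"
  "eb CY = (0, 0, 0, 0, 1, 0)" "eb CX = (0, 0, 0, 0, 0, 1)"
  by (auto simp: eb_def mk_def axis_def vec_eq_iff)

lemma lie_eq_sum: "lie \<phi> F z = (\<Sum>i\<in>UNIV. sg i * pd (eb (cj i)) \<phi> z * pd (eb i) F z)"
  by (simp add: sum_ix lie_def dI_def d\<theta>_def dp_def dq_def dy_def dx_def eb_simps
      sum_subtractf sum_negf algebra_simps)

lemma lie_eq: "holo_on F S ==> z \<in> S ==> lie \<phi> F z = pd (XH \<phi> z) F z"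
  by (subst pd_expand[of F S]) (simp_all add: lie_eq_sum XH_def)

lemma holo_lie: "open S ==> holo_on \<phi> S ==> holo_on F S ==> holo_on (lie \<phi> F) S"
  unfolding lie_eq_sum[abs_def] by (intro holo_intros holo_pd)

lemma holo_lies: "open S ==> holo_on \<phi> S ==> holo_on F S ==> holo_on ((lie \<phi> ^^ k) F) S"
  by (induction k) (auto intro: holo_lie)

lemma lie_cong: "open S ==> (\<And>z. z \<in> S ==> F z = G z) ==> z \<in> S ==> lie \<phi> F z = lie \<phi> G z"
  unfolding lie_eq_sum using pd_cong[of S F G z] by simp

lemma lies_cong: "open S ==> (\<And>z. z \<in> S ==> F z = G z) ==> z \<in> S ==> (lie \<phi> ^^ k) F z = (lie \<phi> ^^ k) G z"
  by (induction k arbitrary: z) (auto intro: lie_cong)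

lemma lie_cong1: "open S ==> (\<And>z. z \<in> S ==> \<phi> z = \<psi> z) ==> z \<in> S ==> lie \<phi> F z = lie \<psi> F z"
  unfolding lie_eq_sum using pd_cong[of S \<phi> \<psi> z] by simp

lemma lie_add: "holo_on F S ==> holo_on G S ==> z \<in> S ==> lie \<phi> (\<lambda>z. F z + G z) z = lie \<phi> F z + lie \<phi> G z"
  unfolding lie_eq_sum by (simp add: pd_plus algebra_simps sum.distrib)

lemma lie_mult: "holo_on F S ==> holo_on G S ==> z \<in> S ==>
    lie \<phi> (\<lambda>z. F z * G z) z = lie \<phi> F z * G z + F z * lie \<phi> G z"
  unfolding lie_eq_sum by (simp add: pd_mult algebra_simps sum.distrib sum_distrib_left sum_distrib_right)

lemma lie_sum: "z \<in> S ==> (\<And>a. a \<in> A ==> holo_on (F a) S) ==>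
    lie \<phi> (\<lambda>z. \<Sum>a\<in>A. F a z) z = (\<Sum>a\<in>A. lie \<phi> (F a) z)"
  unfolding lie_eq_sum by (subst pd_sum[of z S], auto simp: sum_distrib_left intro: sum.swap)

lemma lie_sum1: "z \<in> S ==> (\<And>a. a \<in> A ==> holo_on (\<phi> a) S) ==>
    lie (\<lambda>z. \<Sum>a\<in>A. \<phi> a z) F z = (\<Sum>a\<in>A. lie (\<phi> a) F z)"
  unfolding lie_eq_sum by (subst pd_sum[of z S], auto simp: sum_distrib_left sum_distrib_right intro: sum.swap)

lemma lie_const [simp]: "lie \<phi> (\<lambda>_. c) z = 0"
  by (simp add: lie_eq_sum)

lemma lie_cmult: "holo_on F S ==> z \<in> S ==> lie \<phi> (\<lambda>z. c * F z) z = c * lie \<phi> F z"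
  using lie_mult[OF holo_const, of F S z \<phi> c] by simp

lemma lies_add:
  assumes "open S" "holo_on \<phi> S" "holo_on F S" "holo_on G S" "z \<in> S"
  shows "(lie \<phi> ^^ k) (\<lambda>z. F z + G z) z = (lie \<phi> ^^ k) F z + (lie \<phi> ^^ k) G z"
  using assms(5)
proof (induction k arbitrary: z)
  case (Suc k)
  have "lie \<phi> ((lie \<phi> ^^ k) (\<lambda>z. F z + G z)) z = lie \<phi> (\<lambda>z. (lie \<phi> ^^ k) F z + (lie \<phi> ^^ k) G z) z"
    by (rule lie_cong[OF assms(1) Suc]) (use Suc in auto)
  then show ?case using lie_add[OF holo_lies[OF assms(1-3), of k] holo_lies[OF assms(1,2,4), of k] Suc.prems] by simp
qed simp

lemma lies_cmult:
  assumes "open S" "holo_on \<phi> S" "holo_on F S" "z \<in> S"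
  shows "(lie \<phi> ^^ k) (\<lambda>z. c * F z) z = c * (lie \<phi> ^^ k) F z"
  using assms(4)
proof (induction k arbitrary: z)
  case (Suc k)
  have "lie \<phi> ((lie \<phi> ^^ k) (\<lambda>z. c * F z)) z = lie \<phi> (\<lambda>z. c * (lie \<phi> ^^ k) F z) z"
    by (rule lie_cong[OF assms(1) Suc]) (use Suc in auto)
  then show ?case using lie_cmult[OF holo_lies[OF assms(1-3), of k] Suc.prems] by simp
qed simp

lemma lies_const: "(lie \<phi> ^^ k) (\<lambda>_. c) z = (if k = 0 then c else 0)"
proof (induction k arbitrary: z)
  case (Suc k)
  have "(lie \<phi> ^^ k) (\<lambda>_. c) = (\<lambda>_. if k = 0 then c else 0)" using Suc by blast
  then show ?case by simp
qed simp

text \<open>Leibniz' rule, with the factorials distributed so that the right-hand side is a term of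
  a Cauchy product. This makes the Lie series multiplicative (\<open>E_mult\<close>).\<close>

lemma lies_mult:
  assumes "open S" "holo_on \<phi> S" "holo_on F S" "holo_on G S" "z \<in> S"
  shows "(lie \<phi> ^^ k) (\<lambda>z. F z * G z) z / fact k =
     (\<Sum>i\<le>k. ((lie \<phi> ^^ i) F z / fact i) * ((lie \<phi> ^^ (k - i)) G z / fact (k - i)))"
proof -
  note hF = holo_lies[OF assms(1-3)] and hG = holo_lies[OF assms(1,2,4)]
  have "(lie \<phi> ^^ k) (\<lambda>z. F z * G z) z =
     (\<Sum>i\<le>k. of_nat (k choose i) * ((lie \<phi> ^^ i) F z * (lie \<phi> ^^ (k - i)) G z))"
    using assms(5)
  proof (induction k arbitrary: z)
    case (Suc k)
    let ?a = "\<lambda>i z. (lie \<phi> ^^ i) F z" and ?b = "\<lambda>i z. (lie \<phi> ^^ i) G z"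
    have "lie \<phi> ((lie \<phi> ^^ k) (\<lambda>z. F z * G z)) z =
      lie \<phi> (\<lambda>z. \<Sum>i\<le>k. of_nat (k choose i) * (?a i z * ?b (k - i) z)) z"
      by (rule lie_cong[OF assms(1) Suc]) (use Suc in auto)
    also have "... = (\<Sum>i\<le>k. lie \<phi> (\<lambda>z. of_nat (k choose i) * (?a i z * ?b (k - i) z)) z)"
      by (rule lie_sum[OF Suc.prems]) (intro holo_intros hF hG)
    also have "... = (\<Sum>i\<le>k. of_nat (k choose i) * (?a (Suc i) z * ?b (k - i) z) +
      of_nat (k choose i) * (?a i z * ?b (Suc k - i) z))"
    proof (rule sum.cong[OF refl])
      fix i assume i: "i \<in> {..k}"
      have "lie \<phi> (\<lambda>z. of_nat (k choose i) * (?a i z * ?b (k - i) z)) z =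
      of_nat (k choose i) * lie \<phi> (\<lambda>z. ?a i z * ?b (k - i) z) z"
      by (rule lie_cmult[OF _ Suc.prems]) (intro holo_intros hF hG)
      also have "lie \<phi> (\<lambda>z. ?a i z * ?b (k - i) z) z = ?a (Suc i) z * ?b (k - i) z + ?a i z * ?b (Suc k - i) z"
      using lie_mult[OF hF[of i] hG[of "k - i"] Suc.prems, of \<phi>] i by (simp add: Suc_diff_le)
      finally show "lie \<phi> (\<lambda>z. of_nat (k choose i) * (?a i z * ?b (k - i) z)) z =
      of_nat (k choose i) * (?a (Suc i) z * ?b (k - i) z) + of_nat (k choose i) * (?a i z * ?b (Suc k - i) z)"
      by (simp add: distrib_left)
    qed
    also have "... = (\<Sum>i\<le>k. of_nat (k choose i) * (?a (Suc i) z * ?b (k - i) z)) +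
      (\<Sum>i\<le>Suc k. of_nat (k choose i) * (?a i z * ?b (Suc k - i) z))"
      by (simp add: sum.distrib)
    also have "(\<Sum>i\<le>k. of_nat (k choose i) * (?a (Suc i) z * ?b (k - i) z)) =
      (\<Sum>i\<in>{1..Suc k}. of_nat (k choose (i - 1)) * (?a i z * ?b (Suc k - i) z))"
      by (rule sum.reindex_bij_witness[of _ "\<lambda>i. i - 1" Suc]) auto
    also have "... = (\<Sum>i\<le>Suc k. (if i = 0 then 0 else of_nat (k choose (i - 1))) * (?a i z * ?b (Suc k - i) z))"
      by (rule sum.mono_neutral_cong_left) auto
    finally have "(lie \<phi> ^^ Suc k) (\<lambda>z. F z * G z) z = (\<Sum>i\<le>Suc k. ((if i = 0 then 0 else of_nat (k choose (i - 1)))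
      + of_nat (k choose i)) * (?a i z * ?b (Suc k - i) z))"
      by (simp only: sum.distrib[symmetric] distrib_right funpow.simps comp_def)
    moreover have "(if i = 0 then 0 else of_nat (k choose (i - 1))) + of_nat (k choose i) = (of_nat (Suc k choose i) :: complex)" for i
      by (cases i) auto
    ultimately show ?case by simp
  qed simp
  then show ?thesis
    by (auto simp: sum_divide_distrib binomial_fact intro!: sum.cong)
qed

text \<open>The quotient k^k / k! is one term of the series of exp k, and e <= 3. It absorbs the
  power k^k that arises when a gap is divided into k equal Cauchy steps.\<close>

lemma power_le_fact: "real k ^ k <= 3 ^ k * fact k"
proof -
  have "real k ^ k / fact k <= (\<Sum>n. real k ^ n / fact n)"
    using sum_le_suminf[OF summable_exp[of "real k"], of "{k}"]
    by (simp add: field_simps)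
  also have "... = exp (real k)" by (simp add: exp_def field_simps)
  also have "... = exp 1 ^ k" by (metis exp_of_nat_mult mult.right_neutral)
  also have "... <= 3 ^ k" by (rule power_mono[OF exp_le]) simp
  finally show ?thesis by (simp add: field_simps)
qed

text \<open>The gap b - a is divided into k equal parts, one for each bracket. The predicate Q is
  abstract because the induction is run both for sup norms on polydiscs and for
  \<open>dec\<close>.\<close>

lemma lie_iterate:
  assumes step: "\<And>u t F M. a <= u ==> u < t ==> t <= b ==> Q t F M ==> Q u (lie \<phi> F) (\<kappa> / (t - u) * M)"
    and mono: "\<And>F M. Q b F M ==> Q a F M" and ab: "a < b" and Q: "Q b F M"
  shows "Q a ((lie \<phi> ^^ k) F) ((\<kappa> * real k / (b - a)) ^ k * M)"
proof (cases "k = 0")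
  case True
  then show ?thesis using mono[OF Q] by simp
next
  case False
  define h where "h = (b - a) / real k"
  have h: "h > 0" using ab False by (simp add: h_def)
  have "j <= k ==> Q (b - real j * h) ((lie \<phi> ^^ j) F) ((\<kappa> / h) ^ j * M)" for j
  proof (induction j)
    case (Suc j)
    have "real (Suc j) * h <= b - a"
      using Suc.prems ab False mult_right_mono[of "real (Suc j)" "real k" "b - a"] by (simp add: h_def field_simps)
    then have "Q (b - real (Suc j) * h) (lie \<phi> ((lie \<phi> ^^ j) F)) (\<kappa> / ((b - real j * h) - (b - real (Suc j) * h)) * ((\<kappa> / h) ^ j * M))"
      using h Suc by (intro step) (auto simp: algebra_simps)
    then show ?case by (simp add: algebra_simps)
  qed (use Q in simp)
  from this[of k] show ?thesis using False by (simp add: h_def)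
qed

definition polyd :: "(('n::finite, 'm::finite) ix => real) => ('n, 'm) phase => real => ('n, 'm) phase set" where
  "polyd R z a = {w. \<forall>i. cmod (co i w - co i z) < a * R i}"

lemma open_polyd: "open (polyd R z a)"
proof -
  have "polyd R z a = (\<Inter>i\<in>UNIV. {w. cmod (co i w - co i z) < a * R i})"
    unfolding polyd_def by blast
  then show ?thesis
    by (auto intro!: open_INT open_Collect_less continuous_intros bounded_linear.continuous_on[OF bounded_linear_co] simp del: INT_simps)
qed

lemma compact_polyd: "compact {w :: ('n::finite, 'm::finite) phase. \<forall>i. cmod (co i w - co i z) <= a * R i}"
proof -
  let ?S = "{w :: ('n::finite, 'm::finite) phase. \<forall>i. cmod (co i w - co i z) <= a * R i}"
  have "?S = (\<Inter>i\<in>UNIV. {w. cmod (co i w - co i z) <= a * R i})" by blast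
  then have "closed ?S"
    by (auto intro!: closed_INT closed_Collect_le continuous_intros bounded_linear.continuous_on[OF bounded_linear_co] simp del: INT_simps)
  moreover have "bounded ?S"
    unfolding bounded_iff
  proof (intro exI ballI)
    fix w assume w: "w \<in> ?S"
    have "cmod (co i w) <= cmod (co i z) + a * R i" for i
      using w norm_triangle_sub[of "co i w" "co i z"] by (smt (verit, best) mem_Collect_eq)
    then show "norm w <= (\<Sum>i\<in>UNIV. (cmod (co i z) + a * R i) * norm (eb i :: ('n, 'm) phase))"
      by (intro order_trans[OF norm_le_co] sum_mono mult_right_mono) auto
  qed
  ultimately show ?thesis by (simp add: compact_eq_bounded_closed)
qed

lemma nbh_polyd: "nbh R (t - u) (polyd R z u) (polyd R z t)"
  unfolding nbh_def polyd_def
proof (intro ballI allI impI, rule CollectI, rule allI)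
  fix w v i assume "w \<in> {w. \<forall>i. cmod (co i w - co i z) < u * R i}" "\<forall>i. cmod (co i v) < (t - u) * R i"
  then have "cmod (co i w - co i z) < u * R i" "cmod (co i v) < (t - u) * R i" by blast+
  moreover have "cmod (co i (w + v) - co i z) <= cmod (co i w - co i z) + cmod (co i v)"
    using norm_triangle_ineq[of "co i w - co i z" "co i v"] by (simp add: algebra_simps)
  ultimately show "cmod (co i (w + v) - co i z) < t * R i" by (simp add: algebra_simps)
qed

subsection \<open>Hamiltonian flows on polydiscs\<close>

lemma polyd_mono: "a <= b ==> (\<And>i. 0 < R i) ==> polyd R z a \<subseteq> polyd R z b"
proof (rule subsetI)
  fix w assume a: "a <= b" "\<And>i. 0 < R i" "w \<in> polyd R z a"
  have "cmod (co i w - co i z) < b * R i" for i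
  proof -
    have "cmod (co i w - co i z) < a * R i" using a(3) by (simp add: polyd_def)
    also have "... <= b * R i" using a(1) a(2)[of i] by (simp add: mult_right_mono)
    finally show ?thesis .
  qed
  then show "w \<in> polyd R z b" by (simp add: polyd_def)
qed

lemma centre_polyd: "0 < a ==> (\<And>i. 0 < R i) ==> z \<in> polyd R z a"
  by (simp add: polyd_def)

lemma polyd_segment:
  assumes "v \<in> polyd R z a" "w \<in> polyd R z a" "t \<in> {0..1}"
  shows "v + cscale (of_real t) (w - v) \<in> polyd R z a"
proof -
  have "cmod (co i (v + cscale (of_real t) (w - v)) - co i z) < a * R i" for i
  proof -
    have m: "co i v \<in> ball (co i z) (a * R i)" "co i w \<in> ball (co i z) (a * R i)"
      using assms(1,2) by (simp_all add: polyd_def dist_norm norm_minus_commute)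
    have "(1 - t) *\<^sub>R co i v + t *\<^sub>R co i w \<in> ball (co i z) (a * R i)"
      by (rule convexD_alt[OF convex_ball m]) (use assms(3) in auto)
    moreover have "(1 - t) *\<^sub>R co i v + t *\<^sub>R co i w = co i (v + cscale (of_real t) (w - v))"
      by (simp add: scaleR_conv_of_real algebra_simps)
    ultimately show ?thesis by (simp add: dist_norm norm_minus_commute)
  qed
  then show ?thesis by (simp add: polyd_def)
qed

text \<open>Hadamard's lemma: the derivative of F is integrated along the segment from a to w, which
  stays in the convex polydisc. The factors \<open>co i w - co i a\<close> are what a multiplicative
  functional can annihilate, as in \<open>eval\<close>.\<close>

lemma gleason:
  fixes z :: "('n::finite, 'm::finite) phase"
  assumes F: "holo_on F (polyd R z b)" and a: "a \<in> polyd R z b"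
  defines "G \<equiv> \<lambda>i w. integral {0..1} (\<lambda>t. pd (eb i) F (a + cscale (of_real t) (w - a)))"
  shows "holo_on (G i) (polyd R z b)"
    and "w \<in> polyd R z b ==> F w - F a = (\<Sum>i\<in>UNIV. (co i w - co i a) * G i w)"
proof -
  let ?P = "polyd R z b"
  have pdF: "holo_on (pd v F) ?P" for v by (rule holo_pd[OF open_polyd F])
  have cont: "continuous_on ({0..1} \<times> ?P) (\<lambda>(t, w). a + cscale (of_real t) (w - a))"
  proof -
    have "continuous_on ({0..1} \<times> ?P) (\<lambda>x. mk (\<lambda>i. co i a + of_real (fst x) * (co i (snd x) - co i a)))"
      by (intro continuous_on_mk continuous_intros continuous_on_co)
    moreover have "mk (\<lambda>i. co i a + of_real (fst x) * (co i (snd x) - co i a)) = (case x of (t, w) => a + cscale (of_real t) (w - a))" for x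
      by (cases x) (auto intro: phase_eqI simp del: co.simps)
    ultimately show ?thesis by simp
  qed
  have sub: "(\<lambda>(t, w). a + cscale (of_real t) (w - a)) ` ({0..1} \<times> ?P) \<subseteq> ?P"
  proof (rule image_subsetI)
    fix x :: "real \<times> ('n, 'm) phase" assume x: "x \<in> {0..1} \<times> ?P"
    then have "a + cscale (of_real (fst x)) (snd x - a) \<in> ?P"
      by (intro polyd_segment[OF a]) (simp_all add: mem_Times_iff)
    then show "(case x of (t, w) => a + cscale (of_real t) (w - a)) \<in> ?P" by (simp add: case_prod_unfold)
  qed
  have c2: "continuous_on ({0..1} \<times> ?P) (\<lambda>(t, w). pd v F (a + cscale (of_real t) (w - a)))" for v
    using continuous_on_compose2[OF holo_continuous[OF pdF] cont sub, of v] by (simp add: case_prod_unfold)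
  have h: "holo_on (\<lambda>w. pd v F (a + cscale (of_real t) (w - a))) ?P" if "t \<in> {0..1}" for t v
    by (rule holo_comp[OF _ pdF polyd_segment[OF a _ that]]) (simp_all add: holo_intros)
  show "holo_on (G i) ?P" for i
    unfolding G_def by (rule holo_integral(1)[OF open_polyd h c2])
  assume w: "w \<in> ?P"
  have cw: "continuous_on {0..1} (\<lambda>t. pd v F (a + cscale (of_real t) (w - a)))" for v
  proof -
    have "continuous_on {0..1} (\<lambda>t. (t, w))" by (intro continuous_intros)
    moreover have "(\<lambda>t. (t, w)) ` {0..1} \<subseteq> {0..1} \<times> ?P" using w by blast
    ultimately show ?thesis using continuous_on_compose2[OF c2, of "{0..1}" "\<lambda>t. (t, w)"] by simp
  qed
  have "((\<lambda>t. pd (w - a) F (a + cscale (of_real t) (w - a))) has_integral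
      F (a + cscale (of_real 1) (w - a)) - F (a + cscale (of_real 0) (w - a))) {0..1}"
  proof (rule fundamental_theorem_of_calculus)
    fix t :: real assume t: "t \<in> {0..1}"
    show "((\<lambda>t. F (a + cscale (of_real t) (w - a))) has_vector_derivative
      pd (w - a) F (a + cscale (of_real t) (w - a))) (at t within {0..1})"
      by (rule has_vector_derivative_real_field[OF holo_line[OF F polyd_segment[OF a w t]]])
  qed simp
  then have "F w - F a = integral {0..1} (\<lambda>t. pd (w - a) F (a + cscale (of_real t) (w - a)))"
    by (simp add: integral_unique)
  also have "... = integral {0..1} (\<lambda>t. \<Sum>i\<in>UNIV. (co i w - co i a) * pd (eb i) F (a + cscale (of_real t) (w - a)))"
    by (rule integral_cong) (subst pd_expand[OF F polyd_segment[OF a w]], simp_all)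
  also have "... = (\<Sum>i\<in>UNIV. (co i w - co i a) * G i w)"
    unfolding G_def by (subst integral_sum) (auto intro!: integrable_continuous_real continuous_intros cw)
  finally show "F w - F a = (\<Sum>i\<in>UNIV. (co i w - co i a) * G i w)" .
qed

text \<open>The Lie series is studied at the centre z. The condition 12 * m <= g makes 3 * m / (g/2)
  at most 1/2, so for F bounded on radius g the terms decay like (1/2)^k on radius g/2; the radius 2
  * g leaves room for Cauchy estimates on the disc of radius g.\<close>

locale poly_flow =
  fixes \<phi> :: "('n::finite, 'm::finite) func" and R :: "('n, 'm) ix => real" and z :: "('n, 'm) phase"
    and g m :: real
  assumes R: "\<And>i. 0 < R i" and g: "0 < g" and m: "0 <= m" and mg: "12 * m <= g"
    and \<phi>: "holo_on \<phi> (polyd R z (2 * g))"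
    and X: "\<And>w i. w \<in> polyd R z (2 * g) ==> cmod (co i (XH \<phi> w)) <= m * R i"
begin

lemma term_bound:
  assumes ab: "0 < a" "a < b" "b <= 2 * g" and F: "holo_on F (polyd R z b)"
    and M: "\<And>w. w \<in> polyd R z b ==> cmod (F w) <= M" and w: "w \<in> polyd R z a"
  shows "cmod ((lie \<phi> ^^ k) F w / fact k) <= (3 * m / (b - a)) ^ k * M"
proof -
  let ?Q = "\<lambda>t F M. holo_on F (polyd R z t) \<and> (\<forall>w\<in>polyd R z t. cmod (F w) <= M)"
  have "?Q a ((lie \<phi> ^^ k) F) ((m * real k / (b - a)) ^ k * M)"
  proof (rule lie_iterate)
    fix u t F M assume ut: "a <= u" "u < t" "t <= b" and Q: "?Q t F M"
    have sub: "polyd R z u \<subseteq> polyd R z t" "polyd R z u \<subseteq> polyd R z (2 * g)"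
      by (rule polyd_mono; use ut ab R in simp)+
    show "?Q u (lie \<phi> F) (m / (t - u) * M)"
    proof (intro conjI ballI)
      show "holo_on (lie \<phi> F) (polyd R z u)"
      by (rule holo_lie[OF open_polyd holo_subset[OF \<phi>] holo_subset[OF conjunct1[OF Q]]]) (use sub in auto)
      fix w assume w: "w \<in> polyd R z u"
      have "cmod (pd (XH \<phi> w) F w) * (t - u) <= m * M"
      proof (rule Cauchy_nbh[OF nbh_polyd _ R conjunct1[OF Q] _ w])
      show "cmod (F v) <= M" if "v \<in> polyd R z t" for v using Q that by blast
      show "cmod (co i (XH \<phi> w)) <= m * R i" for i using X sub w by blast
      qed (use ut in simp)
      moreover have "lie \<phi> F w = pd (XH \<phi> w) F w"
      using lie_eq[OF conjunct1[OF Q]] w sub by blast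
      ultimately show "cmod (lie \<phi> F w) <= m / (t - u) * M"
      using ut by (simp add: field_simps)
    qed
  next
    fix F M assume "?Q b F M"
    then show "?Q a F M" using polyd_mono[of a b R z] ab R by (meson holo_subset less_imp_le subsetD)
  qed (use ab F M in auto)
  then have "cmod ((lie \<phi> ^^ k) F w) <= (m / (b - a)) ^ k * real k ^ k * M"
    using w by (simp add: power_mult_distrib power_divide field_simps)
  also have "... <= (m / (b - a)) ^ k * (3 ^ k * fact k) * M"
  proof (intro mult_right_mono mult_left_mono power_le_fact)
    have "0 <= cmod (F z)" by simp
    also have "... <= M" by (rule M[OF centre_polyd]) (use ab R in auto)
    finally show "0 <= M" .
  qed (use m ab in auto)
  finally show ?thesis by (simp add: norm_divide field_simps power_mult_distrib power_divide)
qed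

lemma series:
  assumes F: "holo_on F (polyd R z g)" and M: "\<And>w. w \<in> polyd R z g ==> cmod (F w) <= M"
  shows "w \<in> polyd R z (g / 2) ==> cmod ((lie \<phi> ^^ k) F w / fact k) <= (1 / 2) ^ k * M"
    and "w \<in> polyd R z (g / 2) ==> summable (\<lambda>k. norm ((lie \<phi> ^^ k) F w / fact k))"
proof -
  have M0: "0 <= M" using M[OF centre_polyd] g R norm_ge_zero order_trans by blast
  show *: "cmod ((lie \<phi> ^^ k) F w / fact k) <= (1 / 2) ^ k * M" if "w \<in> polyd R z (g / 2)" for w k
  proof -
    have "cmod ((lie \<phi> ^^ k) F w / fact k) <= (3 * m / (g - g / 2)) ^ k * M"
      by (rule term_bound[OF _ _ _ F M that]) (use g in auto)
    also have "... <= (1 / 2) ^ k * M"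
      by (intro mult_right_mono power_mono M0) (use g m mg in \<open>auto simp: field_simps\<close>)
    finally show ?thesis .
  qed
  show "summable (\<lambda>k. norm ((lie \<phi> ^^ k) F w / fact k))" if "w \<in> polyd R z (g / 2)"
    by (rule summable_comparison_test'[OF summable_mult2[OF summable_geometric[of "1/2"]]])
      (use *[OF that] in auto)
qed

abbreviation "E F \<equiv> lie_exp \<phi> F z"

lemma zg: "z \<in> polyd R z (g / 2)" by (rule centre_polyd) (use g R in auto)

lemma E_mult:
  assumes F: "holo_on F (polyd R z g)" "\<And>w. w \<in> polyd R z g ==> cmod (F w) <= M"
    and G: "holo_on G (polyd R z g)" "\<And>w. w \<in> polyd R z g ==> cmod (G w) <= M'"
  shows "E (\<lambda>w. F w * G w) = E F * E G"
proof -
  have "holo_on \<phi> (polyd R z g)" by (rule holo_subset[OF \<phi> polyd_mono]; use g R in simp)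
  note l = lies_mult[OF open_polyd this F(1) G(1) centre_polyd[OF g R]]
  have e: "(lie \<phi> ^^ k) (\<lambda>w. F w * G w) z / fact k =
     (\<Sum>i\<le>k. ((lie \<phi> ^^ i) F z / fact i) * ((lie \<phi> ^^ (k - i)) G z / fact (k - i)))" for k
    by (rule l)
  show ?thesis
    unfolding lie_exp_def e
    by (rule Cauchy_product[OF series(2)[OF F zg] series(2)[OF G zg], symmetric])
qed

lemma E_add:
  assumes F: "holo_on F (polyd R z g)" "\<And>w. w \<in> polyd R z g ==> cmod (F w) <= M"
    and G: "holo_on G (polyd R z g)" "\<And>w. w \<in> polyd R z g ==> cmod (G w) <= M'"
  shows "E (\<lambda>w. F w + G w) = E F + E G"
proof -
  have "holo_on \<phi> (polyd R z g)" by (rule holo_subset[OF \<phi> polyd_mono]; use g R in simp)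
  note l = lies_add[OF open_polyd this F(1) G(1) centre_polyd[OF g R]]
  have e: "(lie \<phi> ^^ k) (\<lambda>w. F w + G w) z = (lie \<phi> ^^ k) F z + (lie \<phi> ^^ k) G z" for k
    by (rule l)
  show ?thesis
    unfolding lie_exp_def e add_divide_distrib
    by (rule suminf_add[symmetric]; rule summable_norm_cancel; rule series(2)[OF F zg] series(2)[OF G zg])
qed

lemma E_const: "E (\<lambda>_. c) = c"
proof -
  have "(\<Sum>k. (lie \<phi> ^^ k) (\<lambda>_. c) z / fact k) = (\<Sum>k\<in>{0}. (lie \<phi> ^^ k) (\<lambda>_. c) z / fact k)"
    by (rule suminf_finite) (auto simp: lies_const)
  then show ?thesis by (simp add: lie_exp_def)
qed

lemma E_sum:
  assumes "\<And>a. a \<in> A ==> holo_on (F a) (polyd R z g)" "\<And>a w. a \<in> A ==> w \<in> polyd R z g ==> cmod (F a w) <= M a"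
  shows "E (\<lambda>w. \<Sum>a\<in>A. F a w) = (\<Sum>a\<in>A. E (F a))"
  using assms
proof (induction A rule: infinite_finite_induct)
  case (insert a A)
  have "E (\<lambda>w. F a w + (\<Sum>a\<in>A. F a w)) = E (F a) + E (\<lambda>w. \<Sum>a\<in>A. F a w)"
  proof (rule E_add)
    show "cmod (\<Sum>a\<in>A. F a w) <= (\<Sum>a\<in>A. M a)" if "w \<in> polyd R z g" for w
      using insert.prems(2) that by (intro order_trans[OF norm_sum] sum_mono) auto
    show "cmod (F a w) <= M a" if "w \<in> polyd R z g" for w using insert.prems(2) that by simp
    show "holo_on (F a) (polyd R z g)" "holo_on (\<lambda>w. \<Sum>a\<in>A. F a w) (polyd R z g)"
      using insert.prems(1) by (simp_all add: holo_sum)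
  qed
  then show ?case using insert by simp
qed (simp_all add: E_const)

text \<open>The first bracket \<open>lie \<phi> (co i)\<close> is a component of \<open>XH\<close>
  and is bounded by B itself, without a Cauchy estimate; the remaining k brackets cost the factor 3
  * m / g each. So the shift of a coordinate is proportional to its own component of the
  field.\<close>

lemma displacement:
  assumes Xb: "\<And>w. w \<in> polyd R z (2 * g) ==> cmod (co i (XH \<phi> w)) <= B"
  shows "cmod (E (co i) - co i z) <= B / (1 - 3 * m / g)"
proof -
  define q where "q = 3 * m / g"
  have q: "0 <= q" "q < 1" using m mg g by (auto simp: q_def field_simps)
  have sub: "polyd R z g \<subseteq> polyd R z (2 * g)" using g R by (intro polyd_mono) auto
  have h: "holo_on (lie \<phi> (co i)) (polyd R z (2 * g))" by (intro holo_lie open_polyd \<phi> holo_co)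
  have b: "cmod (lie \<phi> (co i) w) <= B" if "w \<in> polyd R z (2 * g)" for w
    using Xb[OF that] lie_eq[OF holo_co that] by simp
  have t: "cmod ((lie \<phi> ^^ Suc k) (co i) z / fact (Suc k)) <= q ^ k * (B)" for k
  proof -
    have "cmod ((lie \<phi> ^^ Suc k) (co i) z / fact (Suc k)) <= cmod ((lie \<phi> ^^ k) (lie \<phi> (co i)) z / fact k)"
      by (simp add: funpow_Suc_right norm_divide norm_mult divide_left_mono del: funpow.simps of_nat_Suc)
    also have "... <= (3 * m / (2 * g - g)) ^ k * (B)"
      by (rule term_bound[OF _ _ _ h b centre_polyd[OF g R]]) (use g in auto)
    finally show ?thesis by (simp add: q_def)
  qed
  have s: "summable (\<lambda>k. q ^ k * (B))" using q by (intro summable_mult2 summable_geometric) auto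
  have s1: "summable (\<lambda>k. (lie \<phi> ^^ Suc k) (co i) z / fact (Suc k))"
    by (rule summable_comparison_test'[OF s t])
  have "E (co i) = (\<Sum>k. (lie \<phi> ^^ Suc k) (co i) z / fact (Suc k)) + (lie \<phi> ^^ 0) (co i) z / fact 0"
    unfolding lie_exp_def
    using suminf_split_head[of "\<lambda>k. (lie \<phi> ^^ k) (co i) z / fact k"]
      iffD1[OF summable_Suc_iff[of "\<lambda>k. (lie \<phi> ^^ k) (co i) z / fact k"] s1] by (metis (no_types, lifting) diff_add_cancel)
  then have "E (co i) - co i z = (\<Sum>k. (lie \<phi> ^^ Suc k) (co i) z / fact (Suc k))" by simp
  also have "cmod ... <= (\<Sum>k. q ^ k * (B))" by (rule norm_suminf_le[OF t s])
  also have "... = B / (1 - q)"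
    using q by (simp add: suminf_mult2[symmetric] suminf_geometric summable_geometric)
  finally show ?thesis by (simp add: q_def)
qed

definition "ev = mk (\<lambda>i. E (co i))"

lemma ev_displacement: "cmod (co i ev - co i z) <= m * R i / (1 - 3 * m / g)"
  using displacement[OF X] by (simp add: ev_def)

lemma ev_in: "ev \<in> polyd R z g"
proof -
  have "cmod (co i ev - co i z) < g * R i" for i
  proof -
    have "m * R i / (1 - 3 * m / g) <= m * R i / (1 / 2)"
      using m mg g R[of i] by (intro divide_left_mono) (auto simp: field_simps)
    also have "... < g * R i" using mg m g R[of i] by (cases "m = 0") (auto intro!: mult_strict_right_mono)
    finally show ?thesis using ev_displacement[of i] by simp
  qed
  then show ?thesis by (simp add: polyd_def)
qed

text \<open>On bounded holomorphic functions the Lie series at z is additive, multiplicative and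
  preserves constants, and it maps \<open>co i - co i ev\<close> to 0. In the decomposition of
  \<open>gleason\<close> at the point \<open>ev\<close> every product is therefore mapped to 0, and
  only \<open>F ev\<close> remains. The transformation is thus the composition with a point
  map.\<close>

lemma eval:
  assumes F: "holo_on F (polyd R z (2 * g))" and M: "\<And>w. w \<in> polyd R z (2 * g) ==> cmod (F w) <= M"
  shows "E F = F ev"
proof -
  have sub: "polyd R z g \<subseteq> polyd R z (2 * g)" using g R by (intro polyd_mono) auto
  let ?G = "\<lambda>i w. integral {0..1} (\<lambda>t. pd (eb i) F (ev + cscale (of_real t) (w - ev)))"
  have Fg: "holo_on F (polyd R z g)" by (rule holo_subset[OF F sub])
  have hG: "holo_on (?G i) (polyd R z g)" for i by (rule gleason(1)[OF Fg ev_in])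
  have bG: "cmod (?G i w) <= M / (g * R i)" if w: "w \<in> polyd R z g" for i w
  proof -
    have "cmod (integral (cbox 0 1) (\<lambda>t. pd (eb i) F (ev + cscale (of_real t) (w - ev)))) <= M / (g * R i) * measure lborel (cbox 0 (1::real))"
    proof (rule integrable_bound)
      have M0: "0 <= M" using M[OF centre_polyd] g R norm_ge_zero order_trans by (metis mult_pos_pos zero_less_numeral)
      then show "0 <= M / (g * R i)" using g R[of i] by simp
      have c1: "continuous_on {0..1} (\<lambda>t. mk (\<lambda>i. co i ev + of_real t * (co i w - co i ev)))"
      by (intro continuous_on_mk continuous_intros)
      have e: "mk (\<lambda>i. co i ev + of_real t * (co i w - co i ev)) = ev + cscale (of_real t) (w - ev)" for t
      by (rule phase_eqI) simp
      have "continuous_on {0..1} (\<lambda>t. pd (eb i) F (ev + cscale (of_real t) (w - ev)))"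
      by (rule continuous_on_compose2[OF holo_continuous[OF holo_pd[OF open_polyd Fg]] c1[unfolded e]])
      (use polyd_segment[OF ev_in w] in blast)
      then show "(\<lambda>t. pd (eb i) F (ev + cscale (of_real t) (w - ev))) integrable_on cbox 0 1"
      by (simp add: integrable_continuous_real)
      fix t :: real assume "t \<in> cbox 0 1"
      then have v: "ev + cscale (of_real t) (w - ev) \<in> polyd R z g" using polyd_segment[OF ev_in w] by simp
      have "cmod (pd (eb i) F (ev + cscale (of_real t) (w - ev))) * (2 * g - g) <= 1 / R i * M"
      by (rule Cauchy_nbh[OF nbh_polyd _ R F M v]) (use g R less_imp_neq[OF R] in \<open>auto simp: co_eb less_imp_le\<close>)
      then show "cmod (pd (eb i) F (ev + cscale (of_real t) (w - ev))) <= M / (g * R i)"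
      using g R[of i] by (simp add: field_simps)
    qed
    then show ?thesis by simp
  qed
  have bco: "cmod (co i w - c) <= cmod (co i z) + g * R i + cmod c" if "w \<in> polyd R z g" for i w c
  proof -
    have "cmod (co i w - co i z) < g * R i" using that by (simp add: polyd_def)
    moreover have "cmod (co i w - c) <= cmod (co i w - co i z) + cmod (co i z) + cmod c"
      using norm_triangle_ineq4[of "co i w" c] norm_triangle_ineq[of "co i w - co i z" "co i z"] by simp
    ultimately show ?thesis by simp
  qed
  have hco: "holo_on (\<lambda>w. co i w - c) (polyd R z g)" for i c by (intro holo_intros)
  have Eco: "E (\<lambda>w. co i w - co i ev) = 0" for i
  proof -
    have "E (\<lambda>w. (co i w - 0) + (- co i ev)) = E (\<lambda>w. co i w - 0) + E (\<lambda>_. - co i ev)"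
      by (rule E_add[OF hco bco holo_const]) auto
    then show ?thesis by (simp add: E_const ev_def)
  qed
  have bp: "cmod ((co i w - co i ev) * ?G i w) <= (cmod (co i z) + g * R i + cmod (co i ev)) * (M / (g * R i))"
    if "w \<in> polyd R z g" for i w
    unfolding norm_mult by (rule mult_mono[OF bco bG]) (use that g R[of i] in auto)
  have "E F = E (\<lambda>w. F ev + (\<Sum>i\<in>UNIV. (co i w - co i ev) * ?G i w))"
  proof -
    have "F w = F ev + (\<Sum>i\<in>UNIV. (co i w - co i ev) * ?G i w)" if "w \<in> polyd R z g" for w
      using gleason(2)[OF Fg ev_in that] by (simp add: algebra_simps)
    then have "(lie \<phi> ^^ k) F z = (lie \<phi> ^^ k) (\<lambda>w. F ev + (\<Sum>i\<in>UNIV. (co i w - co i ev) * ?G i w)) z" for k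
      by (rule lies_cong[OF open_polyd _ centre_polyd[OF g R]])
    then show ?thesis by (simp add: lie_exp_def)
  qed
  also have "E (\<lambda>w. F ev + (\<Sum>i\<in>UNIV. (co i w - co i ev) * ?G i w)) = E (\<lambda>_. F ev) + E (\<lambda>w. \<Sum>i\<in>UNIV. (co i w - co i ev) * ?G i w)"
    by (rule E_add[OF holo_const _ holo_sum[OF holo_mult[OF hco hG]] order_trans[OF norm_sum sum_mono[OF bp]]]) auto
  also have "E (\<lambda>w. \<Sum>i\<in>UNIV. (co i w - co i ev) * ?G i w) = (\<Sum>i\<in>UNIV. E (\<lambda>w. (co i w - co i ev) * ?G i w))"
    by (rule E_sum[OF holo_mult[OF hco hG] bp])
  also have "... = 0"
    by (rule sum.neutral) (simp add: E_mult[OF hco bco hG bG] Eco)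
  finally show ?thesis by (simp add: E_const)
qed

end

section \<open>Infinite sums: grouping by a label, holomorphy and termwise derivatives\<close>

lemma has_sum_group:
  fixes f :: "'i => 'c::banach"
  assumes "(f has_sum s) A"
  shows "((\<lambda>mu. infsum f {i \<in> A. g i = mu}) has_sum s) UNIV"
proof -
  have b: "bij_betw snd (Sigma UNIV (\<lambda>mu. {i \<in> A. g i = mu})) A"
    by (rule bij_betwI[of _ _ _ "\<lambda>i. (g i, i)"]) auto
  have "((\<lambda>x. f (snd x)) has_sum s) (Sigma UNIV (\<lambda>mu. {i \<in> A. g i = mu}))"
    using assms by (simp add: has_sum_reindex_bij_betw[OF b])
  then show ?thesis
  proof (rule has_sum_SigmaD)
    fix mu
    have "f summable_on {i \<in> A. g i = mu}"
      by (rule summable_on_subset_banach[of f A]) (use assms in \<open>auto simp: summable_on_def\<close>)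
    then show "((\<lambda>y. f (snd (mu, y))) has_sum infsum f {i \<in> A. g i = mu}) {i \<in> A. g i = mu}"
      by simp
  qed
qed

lemma
  fixes G :: "'i => ('n::finite, 'm::finite) func"
  assumes S: "open S" and h: "\<And>i. i \<in> A ==> holo_on (G i) S"
    and B: "\<And>i z. i \<in> A ==> z \<in> S ==> cmod (G i z) <= B i" "B summable_on A"
    and F: "\<And>z. z \<in> S ==> ((\<lambda>i. G i z) has_sum F z) A"
  shows holo_has_sum: "holo_on F S"
    and has_sum_pd: "z \<in> S ==> ((\<lambda>i. pd v (G i) z) has_sum pd v F z) A"
proof -
  have u: "uniform_limit S (\<lambda>X y. \<Sum>x\<in>X. G x y) F (finite_subsets_at_top A)"
    by (rule Weierstrass_m_test_general'[OF B(1) F B(2)])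
  have ev: "\<forall>\<^sub>F X in finite_subsets_at_top A. holo_on (\<lambda>y. \<Sum>x\<in>X. G x y) S"
    unfolding eventually_finite_subsets_at_top
    by (intro exI[of _ "{}"]) (use h in \<open>auto intro!: holo_sum\<close>)
  have loc: "\<exists>R>0. (\<forall>\<^sub>F X in finite_subsets_at_top A. holo_on (\<lambda>y. \<Sum>x\<in>X. G x y) (ball z R)) \<and>
      uniform_limit (ball z R) (\<lambda>X y. \<Sum>x\<in>X. G x y) F (finite_subsets_at_top A)" if z: "z \<in> S" for z
  proof -
    obtain R where "R > 0" "ball z R \<subseteq> S" using S z open_contains_ball by blast
    then show ?thesis
      by (intro exI[of _ R] conjI uniform_limit_on_subset[OF u] eventually_mono[OF ev])
      (use holo_subset in auto)
  qed
  then show "holo_on F S" by (intro holo_limit_on[OF finite_subsets_at_top_neq_bot]) auto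
  assume z: "z \<in> S"
  then obtain R where R: "R > 0" "\<forall>\<^sub>F X in finite_subsets_at_top A. holo_on (\<lambda>y. \<Sum>x\<in>X. G x y) (ball z R)"
    "uniform_limit (ball z R) (\<lambda>X y. \<Sum>x\<in>X. G x y) F (finite_subsets_at_top A)" using loc by blast
  have "((\<lambda>X. pd v (\<lambda>y. \<Sum>x\<in>X. G x y) z) \<longlongrightarrow> pd v F z) (finite_subsets_at_top A)"
    by (rule holo_limit(3)[OF finite_subsets_at_top_neq_bot R])
  moreover have "\<forall>\<^sub>F X in finite_subsets_at_top A. pd v (\<lambda>y. \<Sum>x\<in>X. G x y) z = (\<Sum>x\<in>X. pd v (G x) z)"
    unfolding eventually_finite_subsets_at_top
  proof (intro exI[of _ "{}"] conjI allI impI)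
    fix Y assume "finite Y \<and> {} \<subseteq> Y \<and> Y \<subseteq> A"
    then show "pd v (\<lambda>y. \<Sum>x\<in>Y. G x y) z = (\<Sum>x\<in>Y. pd v (G x) z)"
      by (intro pd_sum[OF z] h) blast
  qed auto
  ultimately show "((\<lambda>i. pd v (G i) z) has_sum pd v F z) A"
    unfolding has_sum_def by (rule Lim_transform_eventually)
qed

lemma has_sum_sum_commute:
  fixes f :: "'a => 'b => 'c::topological_comm_monoid_add"
  assumes "\<And>a. a \<in> A ==> (f a has_sum g a) B"
  shows "((\<lambda>b. \<Sum>a\<in>A. f a b) has_sum (\<Sum>a\<in>A. g a)) B"
  using assms by (induction A rule: infinite_finite_induct) (auto intro: has_sum_add)

subsection \<open>Torus actions and gradings\<close>

text \<open>The torus action with complex parameters. The entries of \<eta> at I, y and x act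
  trivially; they keep the index set uniform.\<close>

definition rot :: "(('n::finite, 'm::finite) ix => complex) => ('n, 'm) phase => ('n, 'm) phase" where
  "rot \<eta> z = mk (\<lambda>i. case i of CT _ => co i z + \<eta> i | CP _ => co i z * exp (\<i> * \<eta> i)
     | CQ _ => co i z * exp (\<i> * \<eta> i) | _ => co i z)"

lemma co_rot: "co i (rot \<eta> z) = (case i of CT _ => co i z + \<eta> i | CP _ => co i z * exp (\<i> * \<eta> i)
     | CQ _ => co i z * exp (\<i> * \<eta> i) | _ => co i z)"
  by (simp add: rot_def)

lemma rot_rot: "rot \<eta> (rot \<zeta> z) = rot (\<lambda>i. \<eta> i + \<zeta> i) z"
  by (rule phase_eqI) (simp add: co_rot exp_add algebra_simps split: ix.split)

lemma rot_0 [simp]: "rot (\<lambda>_. 0) z = z"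
  by (rule phase_eqI) (simp add: co_rot split: ix.split)

definition rotf :: "(('n::finite, 'm::finite) ix => complex) => ('n, 'm) ix => complex" where
  "rotf \<eta> i = (case i of CP _ => exp (\<i> * \<eta> i) | CQ _ => exp (\<i> * \<eta> i) | _ => 1)"

lemma holo_rot: "holo_on (\<lambda>z. co i (rot \<eta> z)) S"
  by (cases i) (simp_all add: co_rot holo_add holo_mult)

lemma pd_rot: "pd v (\<lambda>z. co i (rot \<eta> z)) z = rotf \<eta> i * co i v"
proof -
  have "pd v (\<lambda>z. co i z + c) z = co i v" "pd v (\<lambda>z. co i z * c) z = c * co i v" for c
    using pd_plus[OF holo_co holo_const, of z UNIV v i c] pd_mult[OF holo_co holo_const, of z UNIV v i c] by simp_all
  then show ?thesis by (cases i) (simp_all add: co_rot rotf_def)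
qed

lemma pd_comp_rot:
  assumes "holo_on F S" "rot \<eta> z \<in> S"
  shows "pd (eb i) (\<lambda>z. F (rot \<eta> z)) z = rotf \<eta> i * pd (eb i) F (rot \<eta> z)"
proof -
  have "pd (eb i) (\<lambda>z. F (rot \<eta> z)) z = pd (mk (\<lambda>j. rotf \<eta> j * co j (eb i))) F (rot \<eta> z)"
    using pd_chain[OF holo_rot assms(1) UNIV_I assms(2), of "eb i"] by (simp add: pd_rot)
  also have "mk (\<lambda>j. rotf \<eta> j * co j (eb i)) = cscale (rotf \<eta> i) (eb i)"
    by (rule phase_eqI) (simp add: co_eb)
  finally show ?thesis using holo_at(2)[OF assms] by simp
qed

text \<open>Degree c under the one-parameter group of direction a. Only real parameters are
  demanded, since these preserve the domains (\<open>rinv_P\<close>); \<open>hom_complex\<close>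
  extends the relation to complex ones.\<close>

definition hom :: "(('n::finite, 'm::finite) ix => int) => int => ('n, 'm) phase set => ('n, 'm) func => bool" where
  "hom a c S G \<longleftrightarrow> (\<forall>z\<in>S. \<forall>x::real. G (rot (\<lambda>i. of_real x * of_int (a i)) z) = exp (\<i> * of_int c * of_real x) * G z)"

text \<open>
  The direction \<open>av (CQ i)\<close> rotates \<open>q\<^sub>i\<close> and \<open>p\<^sub>i\<close> oppositely. This torus action is symplectic, so that the Poisson
  bracket adds the degrees of \<open>gr\<close>; the directions \<open>fv\<close> rotate one coordinate each and single out the
  terms of the Taylor--Fourier expansion.
\<close>

fun av :: "('n, 'm) ix => ('n, 'm) ix => int" where
  "av (CT i) j = (if j = CT i then 1 else 0)"
| "av (CQ i) j = (if j = CQ i then 1 else if j = CP i then -1 else 0)"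
| "av _ j = 0"

definition fv :: "('n, 'm) ix => ('n, 'm) ix => int" where
  "fv v j = (if j = v then 1 else 0)"

text \<open>The invariance of the symplectic form, in the shape needed for brackets: conjugate
  coordinates are scaled inversely, so a product of conjugate derivatives is transformed only by the
  degrees of the two functions.\<close>

lemma av_cj: "rotf (\<lambda>i. x * of_int (av v i)) (cj i) * rotf (\<lambda>i. x * of_int (av v i)) i = 1"
  by (cases v; cases i) (auto simp: rotf_def exp_add[symmetric])

definition gr :: "('n::finite, 'm::finite) phase set => (('n, 'm) ix => int) => ('n, 'm) func => bool" where
  "gr S mu G \<longleftrightarrow> (\<forall>v. hom (av v) (mu v) S G)"

definition rinv :: "('n::finite, 'm::finite) phase set => bool" where
  "rinv S \<longleftrightarrow> (\<forall>z\<in>S. \<forall>\<eta>. (\<forall>i. Im (\<eta> i) = 0) \<longrightarrow> rot \<eta> z \<in> S)"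

lemma rinvD: "rinv S ==> z \<in> S ==> rot (\<lambda>i. of_real x * of_int (a i)) z \<in> S"
  unfolding rinv_def by simp

lemma hom_subset: "hom a c S G ==> T \<subseteq> S ==> hom a c T G"
  unfolding hom_def by blast
lemma gr_subset: "gr S mu G ==> T \<subseteq> S ==> gr T mu G"
  unfolding gr_def using hom_subset by blast

lemma hom_lie:
  assumes S: "open S" "rinv S" and h: "holo_on \<phi> S" "holo_on F S"
    and "hom (av v) c S \<phi>" "hom (av v) e S F"
  shows "hom (av v) (c + e) S (lie \<phi> F)"
  unfolding hom_def
proof (intro ballI allI)
  fix z x assume z: "z \<in> S"
  let ?\<eta> = "\<lambda>i. of_real x * of_int (av v i) :: complex"
  have rz: "rot ?\<eta> z \<in> S" by (rule rinvD[OF S(2) z])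
  have "rotf ?\<eta> i * pd (eb i) G (rot ?\<eta> z) = exp (\<i> * of_int k * of_real x) * pd (eb i) G z"
    if "hom (av v) k S G" "holo_on G S" for G k i
  proof -
    have "rotf ?\<eta> i * pd (eb i) G (rot ?\<eta> z) = pd (eb i) (\<lambda>z. G (rot ?\<eta> z)) z"
      using pd_comp_rot[OF that(2) rz] by simp
    also have "... = pd (eb i) (\<lambda>z. exp (\<i> * of_int k * of_real x) * G z) z"
      by (rule pd_cong[OF S(1) _ z]) (use that(1) in \<open>simp add: hom_def\<close>)
    also have "... = exp (\<i> * of_int k * of_real x) * pd (eb i) G z"
      using pd_mult[OF holo_const that(2) z] by simp
    finally show ?thesis .
  qed
  note * = this[OF assms(5) h(1)] this[OF assms(6) h(2)]
  have "lie \<phi> F (rot ?\<eta> z) = (\<Sum>i\<in>UNIV. sg i * (rotf ?\<eta> (cj i) * pd (eb (cj i)) \<phi> (rot ?\<eta> z)) * (rotf ?\<eta> i * pd (eb i) F (rot ?\<eta> z)))"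
    unfolding lie_eq_sum
  proof (rule sum.cong[OF refl])
    fix i
    have "sg i * pd (eb (cj i)) \<phi> (rot ?\<eta> z) * pd (eb i) F (rot ?\<eta> z) =
      (rotf ?\<eta> (cj i) * rotf ?\<eta> i) * (sg i * pd (eb (cj i)) \<phi> (rot ?\<eta> z) * pd (eb i) F (rot ?\<eta> z))"
      by (simp only: av_cj mult_1)
    also have "... = sg i * (rotf ?\<eta> (cj i) * pd (eb (cj i)) \<phi> (rot ?\<eta> z)) * (rotf ?\<eta> i * pd (eb i) F (rot ?\<eta> z))"
      by (simp only: mult_ac)
    finally show "sg i * pd (eb (cj i)) \<phi> (rot ?\<eta> z) * pd (eb i) F (rot ?\<eta> z) = ..." .
  qed
  also have "... = exp (\<i> * of_int (c + e) * of_real x) * lie \<phi> F z"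
    unfolding * lie_eq_sum sum_distrib_left
    by (rule sum.cong) (simp_all add: algebra_simps exp_add)
  finally show "lie \<phi> F (rot ?\<eta> z) = exp (\<i> * of_int (c + e) * of_real x) * lie \<phi> F z" .
qed

lemma gr_lie:
  assumes "open S" "rinv S" "holo_on \<phi> S" "holo_on F S" "gr S mu \<phi>" "gr S nu F"
  shows "gr S (\<lambda>v. mu v + nu v) (lie \<phi> F)"
  using assms hom_lie[OF assms(1-4)] unfolding gr_def by blast

lemma gr_infsum:
  assumes "\<And>i. i \<in> A ==> gr S mu (G i)"
  shows "gr S mu (\<lambda>z. infsum (\<lambda>i. G i z) A)"
  unfolding gr_def hom_def
proof (intro allI ballI)
  fix v z x assume z: "z \<in> S"
  have "infsum (\<lambda>i. G i (rot (\<lambda>i. of_real x * of_int (av v i)) z)) A =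
     infsum (\<lambda>i. exp (\<i> * of_int (mu v) * of_real x) * G i z) A"
    by (rule infsum_cong) (use assms z in \<open>simp add: gr_def hom_def\<close>)
  then show "infsum (\<lambda>i. G i (rot (\<lambda>i. of_real x * of_int (av v i)) z)) A =
     exp (\<i> * of_int (mu v) * of_real x) * infsum (\<lambda>i. G i z) A"
    by (simp add: infsum_cmult_right')
qed

section \<open>The scaled domains and their Cauchy estimates\<close>

locale dom =
  fixes II :: "(real ^ 'n::finite) set" and BB :: "((real ^ 'm::finite) \<times> (real ^ 'm)) set"
    and YY XX :: "real set" and \<rho> s \<delta> r \<xi> :: real
  assumes pos: "0 < \<rho>" "0 < s" "0 < \<delta>" "0 < r" "0 < \<xi>" and zero: "(0, 0) \<in> BB"
begin

abbreviation "DD \<equiv> (II, BB, YY, XX)"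
definition ww :: "real => radii" where "ww t = (t * \<rho>, t * s, t * \<delta>, t * r, t * \<xi>)"
definition P :: "real => ('n, 'm) phase set" where "P t = PP DD (ww t)"
definition d :: real where "d = min (\<rho> * s) (min (r * \<xi>) (\<delta>\<^sup>2))"

fun rad :: "('n, 'm) ix => real" where
  "rad (CI _) = \<rho>" | "rad (CT _) = s" | "rad (CP _) = \<delta>" | "rad (CQ _) = \<delta>" | "rad CY = r" | "rad CX = \<xi>"

lemma rad: "0 < rad i" by (cases i) (auto simp: pos)
lemma d_pos: "0 < d" using pos by (simp add: d_def)
lemma d_le: "d <= rad i * rad (cj i)"
  by (cases i) (auto simp: d_def power2_eq_square mult.commute)

text \<open>The size of each coordinate as the domains see it. With it \<open>P t\<close> is one
  system of inequalities with a common factor t (\<open>P_iff\<close>); that p and q are measured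
  from 0 rests on (0, 0) \<in> BB.\<close>

fun dd :: "real ^ 'n => real => real => ('n, 'm) phase => ('n, 'm) ix => real" where
  "dd a b c z (CI i) = cmod (co (CI i) z - of_real (a $ i))"
| "dd a b c z (CT i) = \<bar>Im (co (CT i) z)\<bar>"
| "dd a b c z (CP i) = cmod (co (CP i) z)"
| "dd a b c z (CQ i) = cmod (co (CQ i) z)"
| "dd a b c z CY = cmod (co CY z - of_real b)"
| "dd a b c z CX = cmod (co CX z - of_real c)"

lemma vmax_less: "vmax v < e \<longleftrightarrow> (\<forall>i. cmod (v $ i) < e)"
  by (auto simp: vmax_def)

lemma all_ix: "(\<forall>i :: ('n, 'm) ix. Q i) \<longleftrightarrow> (\<forall>i. Q (CI i)) \<and> (\<forall>i. Q (CT i)) \<and> (\<forall>i. Q (CP i)) \<and> (\<forall>i. Q (CQ i)) \<and> Q CY \<and> Q CX"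
  by (metis ix.exhaust)

lemma P_iff: "z \<in> P t \<longleftrightarrow> (\<exists>a\<in>II. \<exists>b\<in>YY. \<exists>c\<in>XX. \<forall>i. dd a b c z i < t * rad i)"
proof -
  obtain I \<theta> p q y x where z: "z = (I, \<theta>, p, q, y, x)" by (metis prod.exhaust)
  have "(p, q) \<in> nbhd_pq BB (t * \<delta>) \<longleftrightarrow> (\<forall>i. cmod (p $ i) < t * \<delta>) \<and> (\<forall>i. cmod (q $ i) < t * \<delta>)"
  proof
    assume a: "(\<forall>i. cmod (p $ i) < t * \<delta>) \<and> (\<forall>i. cmod (q $ i) < t * \<delta>)"
    have "cvec (0 :: real ^ 'm) = 0" by (simp add: cvec_def vec_eq_iff)
    then show "(p, q) \<in> nbhd_pq BB (t * \<delta>)"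
      using a zero unfolding nbhd_pq_def by (auto simp: vmax_less intro!: bexI[of _ "(0, 0)"])
  qed (auto simp: nbhd_pq_def vmax_less)
  then show ?thesis
    unfolding P_def ww_def z PP.simps all_ix
    by (simp add: nbhd_vec_def nbhd_line_def strip_def vmax_less cvec_def)
qed

lemma dd_add: "dd a b c (z + v) i <= dd a b c z i + cmod (co i v)"
proof -
  have *: "cmod (x + v - y) <= cmod (x - y) + cmod v" for x y v :: complex
    using norm_triangle_ineq[of "x - y" v] by (simp add: algebra_simps)
  show ?thesis
  proof (cases i)
    case (CT j)
    then show ?thesis using abs_Im_le_cmod[of "co i v"] by simp
  qed (auto simp: * norm_triangle_ineq)
qed

lemma nbh_P: "nbh rad (t - u) (P u) (P t)"
  unfolding nbh_def
proof (intro ballI allI impI)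
  fix z v assume z: "z \<in> P u" and v: "\<forall>i. cmod (co i v) < (t - u) * rad i"
  obtain a b c where abc: "a \<in> II" "b \<in> YY" "c \<in> XX" "\<forall>i. dd a b c z i < u * rad i"
    using z P_iff by blast
  have "dd a b c (z + v) i < t * rad i" for i
    using dd_add[of a b c z v i] abc(4)[rule_format, of i] v[rule_format, of i] by (simp add: algebra_simps)
  then show "z + v \<in> P t" unfolding P_iff using abc by blast
qed

lemma P_mono: "u <= t ==> P u \<subseteq> P t"
proof
  fix z assume "u <= t" and z: "z \<in> P u"
  obtain a b c where abc: "a \<in> II" "b \<in> YY" "c \<in> XX" "\<forall>i. dd a b c z i < u * rad i"
    using z P_iff by blast
  have "dd a b c z i < t * rad i" for i
    using abc(4)[rule_format, of i] mult_right_mono[OF \<open>u <= t\<close> less_imp_le[OF rad[of i]]] by linarith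
  then show "z \<in> P t" unfolding P_iff using abc by blast
qed

text \<open>For fixed base points a, b, c only finitely many strict inequalities are involved, so
  some room is left.\<close>

lemma P_inner:
  assumes "z \<in> P t" obtains u where "u < t" "z \<in> P u"
proof -
  obtain a b c where abc: "a \<in> II" "b \<in> YY" "c \<in> XX" "\<forall>i. dd a b c z i < t * rad i"
    using assms P_iff by blast
  define m where "m = Max (range (\<lambda>i. dd a b c z i / rad i))"
  have "m < t" unfolding m_def using abc(4) rad by (simp add: divide_less_eq)
  moreover have "dd a b c z i < (m + t) / 2 * rad i" for i
  proof -
    have "dd a b c z i / rad i <= m" unfolding m_def by (rule Max_ge) auto
    then have "dd a b c z i / rad i < (m + t) / 2" using \<open>m < t\<close> by argo
    then show ?thesis using rad[of i] by (simp add: divide_less_eq)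
  qed
  then have "z \<in> P ((m + t) / 2)" unfolding P_iff using abc by blast
  moreover have "(m + t) / 2 < t" using \<open>m < t\<close> by simp
  ultimately show ?thesis using that by blast
qed

lemma P_pos: "z \<in> P t ==> 0 < t"
proof -
  assume "z \<in> P t"
  then obtain a b c where "dd a b c z CY < t * rad CY" unfolding P_iff by blast
  then have "0 < t * r" using norm_ge_zero[of "co CY z - of_real b"] by (simp del: norm_ge_zero)
  then show ?thesis using pos by (simp add: zero_less_mult_iff)
qed

lemma polyd_P: "z \<in> P u ==> polyd rad z a \<subseteq> P (u + a)"
proof
  fix w assume z: "z \<in> P u" and w: "w \<in> polyd rad z a"
  have "\<forall>i. cmod (co i (w - z)) < (u + a - u) * rad i" using w by (simp add: polyd_def)
  then have "z + (w - z) \<in> P (u + a)"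
    using nbh_P[of "u + a" u] z unfolding nbh_def by blast
  then show "w \<in> P (u + a)" by simp
qed

lemma open_P: "open (P t)"
proof (rule openI)
  fix z assume "z \<in> P t"
  then obtain u where u: "u < t" "z \<in> P u" by (rule P_inner)
  have "z \<in> polyd rad z (t - u)" using u(1) rad by (intro centre_polyd) auto
  then obtain e where "e > 0" "ball z e \<subseteq> polyd rad z (t - u)"
    using open_polyd[of rad z "t - u"] unfolding open_contains_ball by blast
  moreover have "polyd rad z (t - u) \<subseteq> P t" using polyd_P[OF u(2), of "t - u"] by simp
  ultimately show "\<exists>e>0. ball z e \<subseteq> P t" by blast
qed

lemma rinv_P: "rinv (P t)"
  unfolding rinv_def
proof (intro ballI allI impI)
  fix z and \<eta> :: "('n, 'm) ix => complex" assume z: "z \<in> P t" and \<eta>: "\<forall>i. Im (\<eta> i) = 0"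
  obtain a b c where abc: "a \<in> II" "b \<in> YY" "c \<in> XX" "\<forall>i. dd a b c z i < t * rad i"
    using z P_iff by blast
  have "dd a b c (rot \<eta> z) i = dd a b c z i" for i
    using \<eta> by (cases i) (simp_all add: co_rot norm_mult)
  then have "\<forall>i. dd a b c (rot \<eta> z) i < t * rad i" using abc(4) by simp
  then show "rot \<eta> z \<in> P t" unfolding P_iff using abc(1-3) by blast
qed

text \<open>The same Cauchy estimate in two forms. The first keeps the radius of the conjugate
  coordinate and yields the displacement bounds; the second compares all products of conjugate radii
  with \<open>d\<close>, the form in which \<open>Cauchy_nbh\<close> takes a vector field.\<close>

lemma
  assumes \<phi>: "holo_on \<phi> (P t)" and M: "\<And>w. w \<in> P t ==> cmod (\<phi> w) <= M" and "u < t" and z: "z \<in> P u"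
  shows XH_bound_cj: "cmod (co i (XH \<phi> z)) <= M / ((t - u) * rad (cj i))"
    and XH_bound: "cmod (co i (XH \<phi> z)) <= M / ((t - u) * d) * rad i"
proof -
  have "z \<in> P t" using z P_mono[of u t] \<open>u < t\<close> by (meson less_imp_le subsetD)
  then have M0: "0 <= M" by (rule order_trans[OF norm_ge_zero M])
  have "cmod (pd (eb (cj i)) \<phi> z) * (t - u) <= 1 / rad (cj i) * M"
    by (rule Cauchy_nbh[OF nbh_P _ rad \<phi> M z]) (use \<open>u < t\<close> less_imp_neq[OF rad] in \<open>auto simp: co_eb less_imp_le[OF rad]\<close>)
  then have *: "cmod (pd (eb (cj i)) \<phi> z) <= M / ((t - u) * rad (cj i))"
    using \<open>u < t\<close> rad[of "cj i"] by (simp add: field_simps)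
  then show "cmod (co i (XH \<phi> z)) <= M / ((t - u) * rad (cj i))" by (simp add: XH_def norm_mult)
  note *
  also have "... = M * rad i / ((t - u) * (rad i * rad (cj i)))"
    using less_imp_neq[OF rad, of i] by simp
  also have "... <= M * rad i / ((t - u) * d)"
    using M0 rad[of i] \<open>u < t\<close> d_pos d_le[of i] rad[of "cj i"]
    by (intro divide_left_mono mult_left_mono mult_pos_pos) auto
  finally show "cmod (co i (XH \<phi> z)) <= M / ((t - u) * d) * rad i" by (simp add: XH_def norm_mult)
qed

text \<open>One Cauchy estimate for the field of \<phi> and one for the derivative of F along it.
  The two gaps are kept apart because the functions may live on different domains; in the iteration
  one gap can stay fixed while the other is of order 1/N.\<close>

lemma lie_bound:
  assumes \<phi>: "holo_on \<phi> (P t)" "\<And>w. w \<in> P t ==> cmod (\<phi> w) <= M" "u < t"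
    and F: "holo_on F (P t')" "\<And>w. w \<in> P t' ==> cmod (F w) <= M'" "u < t'" and z: "z \<in> P u"
  shows "cmod (lie \<phi> F z) <= M * M' / ((t - u) * (t' - u) * d)"
proof -
  have "cmod (pd (XH \<phi> z) F z) * (t' - u) <= M / ((t - u) * d) * M'"
    by (rule Cauchy_nbh[OF nbh_P _ rad F(1,2) z XH_bound[OF \<phi> z]]) (use F(3) in simp)
  moreover have "lie \<phi> F z = pd (XH \<phi> z) F z"
    by (rule lie_eq[OF F(1) subsetD[OF P_mono z]]) (use F(3) in simp)
  moreover define A where "A = cmod (lie \<phi> F z)"
  moreover define T T' where "T = t - u" and "T' = t' - u"
  ultimately have "A * T' <= M / (T * d) * M'" "T > 0" "T' > 0" using F(3) \<open>u < t\<close> by simp_all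
  then have "A <= M * M' / (T * T' * d)" using d_pos by (simp add: field_simps)
  then show ?thesis by (simp add: A_def T_def T'_def)
qed

subsection \<open>Graded decompositions\<close>

text \<open>
  The bound \<open>dec t F M\<close> replaces the norm of the expansion. Brackets obey it without loss of constants
  (\<open>dec_lie\<close>), while \<open>tf_norm\<close> on a smaller domain is dominated by it (\<open>dec_tf\<close>).
\<close>

definition dec :: "real => ('n, 'm) func => real => bool" where
  "dec t F M \<longleftrightarrow> (\<exists>G B. (\<forall>mu. holo_on (G mu) (P t) \<and> gr (P t) mu (G mu) \<and> (\<forall>z\<in>P t. cmod (G mu z) <= B mu) \<and> 0 <= B mu) \<and>
     B summable_on UNIV \<and> infsum B UNIV <= M \<and> (\<forall>z\<in>P t. ((\<lambda>mu. G mu z) has_sum F z) UNIV))"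

text \<open>Terms of an absolutely summable family may share a degree; they are collected into one
  component per degree, which costs nothing by the triangle inequality.\<close>

lemma decI:
  fixes G :: "'i => ('n, 'm) func" and g :: "'i => ('n, 'm) ix => int"
  assumes G: "\<And>i. i \<in> A ==> holo_on (G i) (P t)" "\<And>i. i \<in> A ==> gr (P t) (g i) (G i)"
    "\<And>i z. i \<in> A ==> z \<in> P t ==> cmod (G i z) <= B i" "\<And>i. i \<in> A ==> 0 <= B i"
    and B: "(B has_sum S) A" "S <= M" and F: "\<And>z. z \<in> P t ==> ((\<lambda>i. G i z) has_sum F z) A"
  shows "dec t F M"
  unfolding dec_def
proof (intro exI conjI allI ballI)
  let ?A = "\<lambda>mu. {i \<in> A. g i = mu}"
  have Bs: "B summable_on ?A mu" for mu
    by (rule summable_on_subset_banach[of B A]) (use B in \<open>auto simp: summable_on_def\<close>)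
  fix mu
  have hs: "((\<lambda>i. G i z) has_sum infsum (\<lambda>i. G i z) (?A mu)) (?A mu)" if z: "z \<in> P t" for z
    by (rule has_sum_infsum, rule summable_on_subset_banach[of _ A])
      (use F[OF z] in \<open>auto simp: summable_on_def\<close>)
  show "holo_on (\<lambda>z. infsum (\<lambda>i. G i z) (?A mu)) (P t)"
    by (rule holo_has_sum[OF open_P _ _ Bs hs]) (use G(1,3) in blast)+
  show "gr (P t) mu (\<lambda>z. infsum (\<lambda>i. G i z) (?A mu))"
    by (rule gr_infsum) (use G(2) in auto)
  show "0 <= infsum B (?A mu)" by (rule infsum_nonneg) (use G(4) in auto)
  fix z assume z: "z \<in> P t"
  have "(\<lambda>i. norm (G i z)) summable_on ?A mu"
    by (rule summable_on_comparison_test[OF Bs]) (use G(3) z in auto)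
  then have "cmod (infsum (\<lambda>i. G i z) (?A mu)) <= infsum (\<lambda>i. norm (G i z)) (?A mu)"
    by (rule norm_infsum_bound)
  also have "... <= infsum B (?A mu)"
    by (rule infsum_mono[OF \<open>(\<lambda>i. norm (G i z)) summable_on ?A mu\<close> Bs]) (use G(3) z in auto)
  finally show "cmod (infsum (\<lambda>i. G i z) (?A mu)) <= infsum B (?A mu)" .
next
  show "(\<lambda>mu. infsum B {i \<in> A. g i = mu}) summable_on UNIV"
    using has_sum_group[OF B(1)] by (auto simp: summable_on_def)
  show "(\<Sum>\<^sub>\<infinity>mu. infsum B {i \<in> A. g i = mu}) <= M"
    using infsumI[OF has_sum_group[OF B(1)]] B(2) by metis
  show "((\<lambda>mu. infsum (\<lambda>i. G i z) {i \<in> A. g i = mu}) has_sum F z) UNIV" if "z \<in> P t" for z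
    by (rule has_sum_group[OF F[OF that]])
qed

lemma decE:
  assumes "dec t F M"
  obtains G B where "\<And>mu. holo_on (G mu) (P t)" "\<And>mu. gr (P t) mu (G mu)" "\<And>mu z. z \<in> P t ==> cmod (G mu z) <= B mu"
    "\<And>mu. 0 <= B mu" "B summable_on UNIV" "infsum B UNIV <= M" "\<And>z. z \<in> P t ==> ((\<lambda>mu. G mu z) has_sum F z) UNIV"
  using assms unfolding dec_def by blast

lemma dec_holo: "dec t F M ==> holo_on F (P t)"
  by (erule decE) (rule holo_has_sum[OF open_P])

lemma dec_nonneg: "dec t F M ==> 0 <= M"
  by (erule decE) (meson infsum_nonneg order_trans)

lemma dec_bound: "dec t F M ==> z \<in> P t ==> cmod (F z) <= M"
proof (erule decE)
  fix G B assume z: "z \<in> P t" and G: "\<And>mu z. z \<in> P t ==> cmod (G mu z) <= B mu" and B: "B summable_on UNIV" "infsum B UNIV <= M"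
    and F: "\<And>z. z \<in> P t ==> ((\<lambda>mu. G mu z) has_sum F z) UNIV"
  have "cmod (infsum (\<lambda>mu. G mu z) UNIV) <= infsum B UNIV"
    by (rule norm_infsum_le[OF has_sum_infsum[of _ UNIV] has_sum_infsum[OF B(1)]]) (use F[OF z] G[OF z] in \<open>auto simp: summable_on_def\<close>)
  then show ?thesis using infsumI[OF F[OF z]] B(2) by simp
qed

lemma dec_mono:
  assumes "dec t F M" "u <= t" "M <= M'" shows "dec u F M'"
proof -
  obtain G B where *: "\<And>mu. holo_on (G mu) (P t)" "\<And>mu. gr (P t) mu (G mu)" "\<And>mu z. z \<in> P t ==> cmod (G mu z) <= B mu"
    "\<And>mu. 0 <= B mu" "B summable_on UNIV" "infsum B UNIV <= M" "\<And>z. z \<in> P t ==> ((\<lambda>mu. G mu z) has_sum F z) UNIV"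
    using decE[OF assms(1)] by blast
  show ?thesis
  proof (rule decI[of UNIV G u "\<lambda>mu. mu" B "infsum B UNIV"])
    show "holo_on (G mu) (P u)" "gr (P u) mu (G mu)" for mu
      using holo_subset[OF *(1)] gr_subset[OF *(2)] P_mono[OF assms(2)] by blast+
    show "cmod (G mu z) <= B mu" "((\<lambda>mu. G mu z) has_sum F z) UNIV" if "z \<in> P u" for mu z
      using *(3,7) subsetD[OF P_mono[OF assms(2)] that] by blast+
    show "infsum B UNIV <= M'" using *(6) assms(3) by simp
  qed (use *(4,5) in \<open>simp_all add: has_sum_infsum\<close>)
qed

lemma dec_cong: "dec t F M ==> (\<And>z. z \<in> P t ==> F z = G z) ==> dec t G M"
  unfolding dec_def by (simp cong: ball_cong)

end

section \<open>Brackets and Lie series of graded functions\<close>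

context dom begin

lemma gr_cmult: "gr S mu F ==> gr S mu (\<lambda>z. c * F z)"
  unfolding gr_def hom_def by (simp add: mult_ac)

text \<open>The version of \<open>dec\<close> for generators. With finitely many components the
  bracket is additive in its first argument without any interchange of limits.\<close>

definition fin :: "real => ('n, 'm) func => real => bool" where
  "fin t \<phi> M \<longleftrightarrow> (\<exists>C G B. finite C \<and> (\<forall>mu\<in>C. holo_on (G mu) (P t) \<and> gr (P t) mu (G mu) \<and>
     (\<forall>z\<in>P t. cmod (G mu z) <= B mu) \<and> 0 <= B mu) \<and> sum B C <= M \<and> (\<forall>z\<in>P t. \<phi> z = (\<Sum>mu\<in>C. G mu z)))"

lemma finE:
  assumes "fin t \<phi> M"
  obtains C G B where "finite C" "\<And>mu. mu \<in> C ==> holo_on (G mu) (P t)" "\<And>mu. mu \<in> C ==> gr (P t) mu (G mu)"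
    "\<And>mu z. mu \<in> C ==> z \<in> P t ==> cmod (G mu z) <= B mu" "\<And>mu. mu \<in> C ==> 0 <= B mu" "sum B C <= M"
    "\<And>z. z \<in> P t ==> \<phi> z = (\<Sum>mu\<in>C. G mu z)"
  using assms unfolding fin_def by metis

lemma fin_dec: "fin t \<phi> M ==> dec t \<phi> M"
proof (erule finE)
  fix C G B
  assume *: "finite C" "\<And>mu. mu \<in> C ==> holo_on (G mu) (P t)" "\<And>mu. mu \<in> C ==> gr (P t) mu (G mu)"
    "\<And>mu z. mu \<in> C ==> z \<in> P t ==> cmod (G mu z) <= B mu" "\<And>mu. mu \<in> C ==> 0 <= B mu" "sum B C <= M"
    "\<And>z. z \<in> P t ==> \<phi> z = (\<Sum>mu\<in>C. G mu z)"
  show "dec t \<phi> M"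
    by (rule decI[of C G t "\<lambda>mu. mu" B "sum B C"]) (use * in \<open>simp_all add: has_sum_finite\<close>)
qed

lemma dec_cmult: assumes "dec t F M" shows "dec t (\<lambda>z. c * F z) (cmod c * M)"
proof -
  obtain G B where *: "\<And>mu. holo_on (G mu) (P t)" "\<And>mu. gr (P t) mu (G mu)" "\<And>mu z. z \<in> P t ==> cmod (G mu z) <= B mu"
    "\<And>mu. 0 <= B mu" "B summable_on UNIV" "infsum B UNIV <= M" "\<And>z. z \<in> P t ==> ((\<lambda>mu. G mu z) has_sum F z) UNIV"
    using decE[OF assms(1)] by metis
  show ?thesis
  proof (rule decI[of UNIV "\<lambda>mu z. c * G mu z" t "\<lambda>mu. mu" "\<lambda>mu. cmod c * B mu" "cmod c * infsum B UNIV"])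
    show "cmod c * infsum B UNIV <= cmod c * M" using *(6) by (simp add: mult_left_mono)
  qed (use * in \<open>simp_all add: has_sum_cmult_right gr_cmult holo_mult norm_mult mult_left_mono\<close>)
qed

lemma dec_sum:
  assumes F: "\<And>k. k \<in> A ==> dec t (F k) (M k)" and M: "(M has_sum S) A"
    and f: "\<And>z. z \<in> P t ==> ((\<lambda>k. F k z) has_sum f z) A"
  shows "dec t f S"
proof -
  have "\<forall>k. \<exists>G B. k \<in> A \<longrightarrow> (\<forall>mu. holo_on (G mu) (P t) \<and> gr (P t) mu (G mu) \<and> (\<forall>z\<in>P t. cmod (G mu z) <= B mu) \<and> 0 <= B mu) \<and>
     B summable_on UNIV \<and> infsum B UNIV <= M k \<and> (\<forall>z\<in>P t. ((\<lambda>mu. G mu z) has_sum F k z) UNIV)"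
    using F unfolding dec_def by metis
  then obtain G B where GB: "\<And>k. k \<in> A ==> (\<forall>mu. holo_on (G k mu) (P t) \<and> gr (P t) mu (G k mu) \<and> (\<forall>z\<in>P t. cmod (G k mu z) <= B k mu) \<and> 0 <= B k mu) \<and>
     B k summable_on UNIV \<and> infsum (B k) UNIV <= M k \<and> (\<forall>z\<in>P t. ((\<lambda>mu. G k mu z) has_sum F k z) UNIV)"
    by metis
  have Ms: "(\<lambda>k. infsum (B k) UNIV) summable_on A"
    by (rule summable_on_comparison_test[of M]) (use M GB in \<open>auto simp: summable_on_def intro!: infsum_nonneg\<close>)
  have Bs: "(\<lambda>(k, mu). B k mu) summable_on A \<times> UNIV"
    by (rule summable_on_SigmaI[OF _ Ms]) (use GB has_sum_infsum in auto)
  have "infsum (\<lambda>(k, mu). B k mu) (A \<times> UNIV) = infsum (\<lambda>k. infsum (B k) UNIV) A"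
    using infsum_Sigma'_banach[of B A "\<lambda>_. UNIV"] Bs by simp
  also have "... <= infsum M A" by (rule infsum_mono[OF Ms]) (use M GB in \<open>auto simp: summable_on_def\<close>)
  finally have S: "infsum (\<lambda>(k, mu). B k mu) (A \<times> UNIV) <= S" using infsumI[OF M] by simp
  show ?thesis
  proof (rule decI[of "A \<times> UNIV" "\<lambda>(k, mu). G k mu" t snd "\<lambda>(k, mu). B k mu", OF _ _ _ _ has_sum_infsum[OF Bs] S])
    fix z assume z: "z \<in> P t"
    have "(\<lambda>(k, mu). G k mu z) summable_on A \<times> UNIV"
      by (rule abs_summable_summable, rule summable_on_comparison_test[OF Bs]) (use GB z in auto)
    then show "((\<lambda>i. (case i of (k, mu) => G k mu) z) has_sum f z) (A \<times> UNIV)"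
      by (intro has_sum_SigmaI[OF _ f[OF z]]) (use GB z in \<open>simp_all add: case_prod_unfold\<close>)
  qed (use GB in \<open>simp_all add: case_prod_unfold mem_Times_iff\<close>)
qed

lemma dec_add:
  assumes "dec t F M" "dec t G M'" shows "dec t (\<lambda>z. F z + G z) (M + M')"
proof -
  have "dec t (\<lambda>z. F z + G z) (\<Sum>k\<in>{False, True}. if k then M else M')"
    by (rule dec_sum[of "{False, True}" t "\<lambda>k. if k then F else G" "\<lambda>k. if k then M else M'"])
      (use assms in \<open>auto intro!: has_sum_finiteI\<close>)
  then show ?thesis by (simp add: add.commute)
qed

lemma dec_diff: "dec t F M ==> dec t G M' ==> dec t (\<lambda>z. F z - G z) (M + M')"
  using dec_add[OF _ dec_cmult[of t G M' "-1"]] by simp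

text \<open>Brackets of homogeneous components are homogeneous, and their bounds are products, so
  the double sum of bounds factorises into M * M'. In the second argument the infinite sum is
  differentiated termwise by \<open>has_sum_pd\<close>.\<close>

lemma dec_lie:
  assumes \<phi>: "fin t \<phi> M" and F: "dec t' F M'" and u: "u < t" "u < t'"
  shows "dec u (lie \<phi> F) (M * M' / ((t - u) * (t' - u) * d))"
proof -
  define K where "K = (t - u) * (t' - u) * d"
  have K: "K > 0" using u d_pos by (simp add: K_def)
  have Pt: "P u \<subseteq> P t" "P u \<subseteq> P t'" using u by (simp_all add: P_mono)
  obtain C g b where c: "finite C" "\<And>mu. mu \<in> C ==> holo_on (g mu) (P t)" "\<And>mu. mu \<in> C ==> gr (P t) mu (g mu)"
    "\<And>mu z. mu \<in> C ==> z \<in> P t ==> cmod (g mu z) <= b mu" "\<And>mu. mu \<in> C ==> 0 <= b mu" "sum b C <= M"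
    "\<And>z. z \<in> P t ==> \<phi> z = (\<Sum>mu\<in>C. g mu z)"
    using finE[OF \<phi>] by metis
  obtain G B where *: "\<And>mu. holo_on (G mu) (P t')" "\<And>mu. gr (P t') mu (G mu)" "\<And>mu z. z \<in> P t' ==> cmod (G mu z) <= B mu"
    "\<And>mu. 0 <= B mu" "B summable_on UNIV" "infsum B UNIV <= M'" "\<And>z. z \<in> P t' ==> ((\<lambda>mu. G mu z) has_sum F z) UNIV"
    using decE[OF F] by metis
  have "dec u (lie (g mu) F) (b mu * M' / K)" if mu: "mu \<in> C" for mu
  proof (rule decI[of UNIV "\<lambda>nu. lie (g mu) (G nu)" u "\<lambda>nu v. mu v + nu v" "\<lambda>nu. (b mu / K) * B nu" "(b mu / K) * infsum B UNIV"])
    fix nu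
    show "holo_on (lie (g mu) (G nu)) (P u)"
      using holo_lie[OF open_P holo_subset[OF c(2)[OF mu] Pt(1)] holo_subset[OF *(1) Pt(2)]] .
    show "gr (P u) (\<lambda>v. mu v + nu v) (lie (g mu) (G nu))"
      using gr_lie[OF open_P rinv_P holo_subset[OF c(2)[OF mu] Pt(1)] holo_subset[OF *(1) Pt(2)] gr_subset[OF c(3)[OF mu] Pt(1)] gr_subset[OF *(2) Pt(2)]] .
    show "cmod (lie (g mu) (G nu) z) <= b mu / K * B nu" if "z \<in> P u" for z
      using lie_bound[OF c(2)[OF mu] c(4)[OF mu] u(1) *(1) *(3) u(2) that] by (simp add: K_def)
    show "0 <= b mu / K * B nu" using c(5)[OF mu] K *(4)[of nu] by simp
    show "((\<lambda>nu. b mu / K * B nu) has_sum b mu / K * infsum B UNIV) UNIV"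
      by (intro has_sum_cmult_right has_sum_infsum *)
    show "b mu / K * infsum B UNIV <= b mu * M' / K"
      using mult_left_mono[OF *(6), of "b mu / K"] c(5)[OF mu] K by simp
    fix z assume z: "z \<in> P u"
    have "((\<lambda>nu. pd v (G nu) z) has_sum pd v F z) UNIV" for v
      by (rule has_sum_pd[OF open_P *(1) *(3) *(5) *(7)]) (use z Pt in auto)
    then show "((\<lambda>nu. lie (g mu) (G nu) z) has_sum lie (g mu) F z) UNIV"
      unfolding lie_eq_sum by (intro has_sum_sum_commute has_sum_cmult_right)
  qed
  then have "dec u (lie \<phi> F) (\<Sum>mu\<in>C. b mu * M' / K)"
  proof (rule dec_sum)
    fix z assume z: "z \<in> P u"
    have "lie \<phi> F z = lie (\<lambda>z. \<Sum>mu\<in>C. g mu z) F z"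
      by (rule lie_cong1[OF open_P[of t]]) (use c(7) z Pt in auto)
    also have "... = (\<Sum>mu\<in>C. lie (g mu) F z)"
      by (rule lie_sum1[of z "P t"]) (use z Pt c in auto)
    finally show "((\<lambda>mu. lie (g mu) F z) has_sum lie \<phi> F z) C"
      using c(1) by (simp add: has_sum_finite)
  qed (use c(1) in \<open>simp_all add: has_sum_finite\<close>)
  moreover have "(\<Sum>mu\<in>C. b mu * M' / K) <= M * M' / K"
    using mult_right_mono[OF c(6) dec_nonneg[OF F]] K
    by (simp add: sum_divide_distrib[symmetric] sum_distrib_right[symmetric] divide_right_mono)
  ultimately show ?thesis unfolding K_def using dec_mono by blast
qed

lemma fin_nonneg: "fin t \<phi> M ==> 0 <= M" using fin_dec dec_nonneg by blast
lemma fin_holo: "fin t \<phi> M ==> holo_on \<phi> (P t)" using fin_dec dec_holo by blast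

text \<open>Only the gap of F is subdivided. The generator keeps a distance of at least t - v
  throughout, so each bracket costs one fixed \<kappa> divided by its part of the gap, as
  \<open>lie_iterate\<close> requires.\<close>

lemma dec_term:
  assumes \<phi>: "fin t \<phi> M" and uvt: "u < v" "v < t" and F: "dec v F M'"
  shows "dec u (\<lambda>z. (lie \<phi> ^^ k) F z / fact k) ((3 * M / ((t - v) * (v - u) * d)) ^ k * M')"
proof -
  define \<kappa> where "\<kappa> = M / ((t - v) * d)"
  have M: "0 <= M" using fin_nonneg[OF \<phi>] .
  have "dec u ((lie \<phi> ^^ k) F) ((\<kappa> * real k / (v - u)) ^ k * M')"
  proof (rule lie_iterate[where Q = dec])
    fix u' t' F M' assume a: "u <= u'" "u' < t'" "t' <= v" and F: "dec t' F M'"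
    have "dec u' (lie \<phi> F) (M * M' / ((t - u') * (t' - u') * d))"
      by (rule dec_lie[OF \<phi> F]) (use a uvt in auto)
    moreover have "M * M' / ((t - u') * (t' - u') * d) <= M * M' / ((t - v) * (t' - u') * d)"
      using a uvt d_pos M dec_nonneg[OF F] by (intro divide_left_mono mult_right_mono mult_nonneg_nonneg mult_pos_pos) auto
    ultimately show "dec u' (lie \<phi> F) (\<kappa> / (t' - u') * M')"
      by (auto simp: \<kappa>_def mult_ac elim: dec_mono)
  qed (use dec_mono uvt F in \<open>auto intro: dec_mono\<close>)
  from dec_cmult[OF this, of "1 / fact k"]
  have "dec u (\<lambda>z. (lie \<phi> ^^ k) F z / fact k) (1 / fact k * ((\<kappa> * real k / (v - u)) ^ k * M'))"
    by (simp add: norm_divide)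
  moreover have "1 / fact k * ((\<kappa> * real k / (v - u)) ^ k * M') <= (3 * M / ((t - v) * (v - u) * d)) ^ k * M'"
  proof -
    have "1 / fact k * ((\<kappa> * real k / (v - u)) ^ k * M') = (\<kappa> / (v - u)) ^ k * M' * (real k ^ k / fact k)"
      by (simp add: power_divide power_mult_distrib mult_ac)
    also have "... <= (\<kappa> / (v - u)) ^ k * M' * 3 ^ k"
    proof (rule mult_left_mono)
      show "real k ^ k / fact k <= 3 ^ k" using power_le_fact[of k] by (simp add: field_simps)
      show "0 <= (\<kappa> / (v - u)) ^ k * M'"
      using uvt M d_pos dec_nonneg[OF F] by (intro mult_nonneg_nonneg zero_le_power) (auto simp: \<kappa>_def)
    qed
    also have "... = (3 * M / ((t - v) * (v - u) * d)) ^ k * M'"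
      by (simp add: \<kappa>_def power_divide power_mult_distrib mult_ac)
    finally show ?thesis .
  qed
  ultimately show ?thesis using dec_mono by blast
qed

text \<open>Coefficients of modulus at most 1 cover the exponential series as well as its
  remainders, because 1 / (k+1)! and 1 / (k+2)! are such coefficients times 1 / k!.\<close>

lemma dec_series:
  assumes \<phi>: "fin t \<phi> M" and uvt: "u < v" "v < t" and F: "dec v F M'"
    and small: "6 * M <= (t - v) * (v - u) * d" and c: "\<And>k. cmod (c k) <= 1"
  shows "dec u (\<lambda>z. \<Sum>k. c k * ((lie \<phi> ^^ k) F z / fact k)) (2 * M')"
    and "z \<in> P u ==> summable (\<lambda>k. norm (c k * ((lie \<phi> ^^ k) F z / fact k)))"
proof -
  define q where "q = 3 * M / ((t - v) * (v - u) * d)"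
  have M: "0 <= M" "0 <= M'" using fin_nonneg[OF \<phi>] dec_nonneg[OF F] .
  have K: "0 < (t - v) * (v - u) * d" using uvt d_pos by simp
  have q: "0 <= q" "q <= 1/2" using M K small by (auto simp: q_def field_simps)
  have t: "dec u (\<lambda>z. c k * ((lie \<phi> ^^ k) F z / fact k)) ((1/2) ^ k * M')" for k
  proof (rule dec_mono[OF dec_cmult[OF dec_term[OF \<phi> uvt F, of k], of "c k"] order_refl])
    have "cmod (c k) * (q ^ k * M') <= 1 * ((1/2) ^ k * M')"
      by (intro mult_mono power_mono mult_nonneg_nonneg zero_le_power c q M) auto
    then show "cmod (c k) * ((3 * M / ((t - v) * (v - u) * d)) ^ k * M') <= (1/2) ^ k * M'"
      by (simp add: q_def)
  qed
  have s: "summable (\<lambda>k. (1/2::real) ^ k * M')" by (intro summable_mult2 summable_geometric) auto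
  have b: "norm (c k * ((lie \<phi> ^^ k) F z / fact k)) <= (1/2) ^ k * M'" if "z \<in> P u" for z k
    using dec_bound[OF t that] .
  show sn: "summable (\<lambda>k. norm (c k * ((lie \<phi> ^^ k) F z / fact k)))" if "z \<in> P u" for z
    by (rule summable_comparison_test'[OF s]) (use b[OF that] in auto)
  have "(\<lambda>k. (1/2::real) ^ k * M') sums (1 / (1 - 1/2) * M')"
    by (intro sums_mult2 geometric_sums) auto
  then have hs: "((\<lambda>k. (1/2::real) ^ k * M') has_sum 2 * M') UNIV"
    by (intro norm_summable_imp_has_sum) (use s M in simp_all)
  show "dec u (\<lambda>z. \<Sum>k. c k * ((lie \<phi> ^^ k) F z / fact k)) (2 * M')"
    by (rule dec_sum[OF t hs]) (intro norm_summable_imp_has_sum sn summable_sums[OF summable_norm_cancel])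
qed

subsection \<open>Flows\<close>

text \<open>The Hamiltonian is holomorphic but possibly unbounded on \<open>P t\<close>. On a
  polydisc whose closure stays inside it is bounded by compactness, and this suffices for the
  pointwise results of \<open>poly_flow\<close>.\<close>

lemma bounded_polyd:
  assumes "holo_on F (P t)" "z \<in> P u" "u + a < t"
  obtains M where "\<And>w. w \<in> polyd rad z a ==> cmod (F w) <= M"
proof -
  let ?K = "{w. \<forall>i. cmod (co i w - co i z) <= a * rad i}"
  have "?K \<subseteq> polyd rad z ((t - u + a) / 2)"
  proof
    fix w assume w: "w \<in> ?K"
    have "cmod (co i w - co i z) < (t - u + a) / 2 * rad i" for i
    proof -
      have "cmod (co i w - co i z) <= a * rad i" using w by blast
      also have "... < (t - u + a) / 2 * rad i" using assms(3) rad[of i] by (intro mult_strict_right_mono) auto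
      finally show ?thesis .
    qed
    then show "w \<in> polyd rad z ((t - u + a) / 2)" by (simp add: polyd_def)
  qed
  also have "... \<subseteq> P (u + (t - u + a) / 2)" by (rule polyd_P[OF assms(2)])
  also have "... \<subseteq> P t" using assms(3) by (intro P_mono) argo
  finally have "compact (F ` ?K)"
    by (intro compact_continuous_image compact_polyd holo_continuous holo_subset[OF assms(1)])
  then obtain M where "\<forall>x\<in>F ` ?K. norm x <= M" by (meson bounded_iff compact_imp_bounded)
  moreover have "polyd rad z a \<subseteq> ?K" unfolding polyd_def using less_imp_le by blast
  ultimately have "cmod (F w) <= M" if "w \<in> polyd rad z a" for w
    using that by (meson image_eqI subsetD)
  then show ?thesis using that by blast
qed

definition Flow :: "('n, 'm) func => ('n, 'm) phase => ('n, 'm) phase" where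
  "Flow \<phi> z = mk (\<lambda>i. lie_exp \<phi> (co i) z)"

lemma flow:
  assumes \<phi>: "holo_on \<phi> (P t)" and M: "\<And>w. w \<in> P t ==> cmod (\<phi> w) <= M" and uvt: "u < v" "v < t"
    and small: "24 * M <= (t - v) * (v - u) * d" and z: "z \<in> P u"
  shows "cmod (co i (Flow \<phi> z) - co i z) <= M / ((t - v) * rad (cj i)) / (1 - 6 * M / ((t - v) * (v - u) * d))"
    and "Flow \<phi> z \<in> P v"
    and "holo_on F (P t) ==> summable (\<lambda>k. (lie \<phi> ^^ k) F z / fact k)"
    and "holo_on F (P t) ==> lie_exp \<phi> F z = F (Flow \<phi> z)"
    and "holo_on F (P t) ==> holo_on (lie_exp \<phi> F) {z}"
proof -
  \<comment> \<open>The polydisc of radius 2 * g = v - u about z lies in \<open>P v\<close>, where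
    the field of \<phi> is at most m in units of the radii; the hypothesis \<open>small\<close> is
    exactly 12 * m <= g.\<close>
  define g m where "g = (v - u) / 2" and "m = M / ((t - v) * d)"
  have "z \<in> P t" using z P_mono[of u t] uvt by auto
  then have M0: "0 <= M" by (rule order_trans[OF norm_ge_zero M])
  have "2 * g = v - u" by (simp add: g_def)
  then have sub: "polyd rad z (2 * g) \<subseteq> P v" "P v \<subseteq> P t"
    using polyd_P[OF z, of "v - u"] uvt by (simp_all add: P_mono)
  interpret pf: poly_flow \<phi> rad z g m
  proof
    show "12 * m <= g" using small uvt d_pos by (simp add: g_def m_def field_simps)
    show "cmod (co i (XH \<phi> w)) <= m * rad i" if "w \<in> polyd rad z (2 * g)" for w i
      unfolding m_def by (rule XH_bound[OF \<phi> M uvt(2)]) (use that sub in auto)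
    show "holo_on \<phi> (polyd rad z (2 * g))" using holo_subset[OF \<phi>] sub by blast
  qed (use uvt rad M0 d_pos in \<open>auto simp: g_def m_def\<close>)
  have ev: "Flow \<phi> z = pf.ev" by (simp add: Flow_def pf.ev_def)
  have "cmod (co i (Flow \<phi> z) - co i z) <= M / ((t - v) * rad (cj i)) / (1 - 3 * m / g)"
    unfolding ev pf.ev_def co_mk by (rule pf.displacement[OF XH_bound_cj[OF \<phi> M uvt(2)]]) (use sub in auto)
  then show "cmod (co i (Flow \<phi> z) - co i z) <= M / ((t - v) * rad (cj i)) / (1 - 6 * M / ((t - v) * (v - u) * d))"
    by (simp add: m_def g_def mult_ac)
  have "polyd rad z g \<subseteq> P v" using sub(1) polyd_mono[of g "2 * g" rad z] pf.g rad by auto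
  then show "Flow \<phi> z \<in> P v" using pf.ev_in unfolding ev by blast
  assume F: "holo_on F (P t)"
  have Fp: "holo_on F (polyd rad z (2 * g))" using holo_subset[OF F] sub by blast
  have pg: "polyd rad z g \<subseteq> polyd rad z (2 * g)" "polyd rad z (g / 2) \<subseteq> polyd rad z g"
    using pf.g rad by (simp_all add: polyd_mono)
  obtain K where K: "\<And>w. w \<in> polyd rad z (2 * g) ==> cmod (F w) <= K"
    using bounded_polyd[OF F z, of "2 * g"] \<open>2 * g = v - u\<close> uvt by (metis add_diff_cancel_left' add.commute diff_add_cancel)
  have K': "cmod (F w) <= K" if "w \<in> polyd rad z g" for w
    using K that pg(1) by blast
  have ser: "cmod ((lie \<phi> ^^ k) F w / fact k) <= (1 / 2) ^ k * K"
    "summable (\<lambda>k. norm ((lie \<phi> ^^ k) F w / fact k))" if "w \<in> polyd rad z (g / 2)" for w k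
    using pf.series[OF holo_subset[OF Fp pg(1)] _ that] K' by blast+
  show "lie_exp \<phi> F z = F (Flow \<phi> z)" using pf.eval[OF Fp K] ev by simp
  show "summable (\<lambda>k. (lie \<phi> ^^ k) F z / fact k)"
    by (rule summable_norm_cancel[OF ser(2)[OF pf.zg]])
  \<comment> \<open>Uniform convergence holds near z, with a bound K that depends on z; this is why
    holomorphy is stated at the single point z.\<close>
  have "holo_on (lie_exp \<phi> F) (polyd rad z (g / 2))"
  proof (rule holo_has_sum[OF open_polyd])
    show "holo_on (\<lambda>z. (lie \<phi> ^^ k) F z / fact k) (polyd rad z (g / 2))" for k
    proof -
      have "holo_on ((lie \<phi> ^^ k) F) (polyd rad z (g / 2))"
      by (rule holo_lies[OF open_polyd holo_subset[OF pf.\<phi>] holo_subset[OF Fp]]) (use pg in blast)+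
      then show ?thesis by (rule holo_divide[OF _ holo_const]) simp
    qed
    show "cmod ((lie \<phi> ^^ k) F w / fact k) <= (1/2) ^ k * K" if "w \<in> polyd rad z (g / 2)" for k w
      by (rule ser(1)[OF that])
    have s: "summable (\<lambda>k. (1/2::real) ^ k * K)" by (intro summable_mult2 summable_geometric) auto
    have "summable (\<lambda>k. norm ((1/2::real) ^ k * K))" unfolding norm_mult by (intro summable_mult2 summable_norm) (auto simp: norm_power)
    then show "(\<lambda>k. (1/2::real) ^ k * K) summable_on UNIV"
      by (rule norm_summable_imp_summable_on)
    fix w assume w: "w \<in> polyd rad z (g / 2)"
    show "((\<lambda>k. (lie \<phi> ^^ k) F w / fact k) has_sum lie_exp \<phi> F w) UNIV"
      unfolding lie_exp_def by (intro norm_summable_imp_has_sum ser(2)[OF w] summable_sums summable_norm_cancel[OF ser(2)[OF w]])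
  qed
  then show "holo_on (lie_exp \<phi> F) {z}" by (rule holo_subset) (use pf.zg in simp)
qed

end

subsection \<open>Fourier series of periodic holomorphic functions\<close>

definition fc :: "(complex => complex) => int => complex" where
  "fc g m = integral {-pi..pi} (\<lambda>x. g (of_real x) * exp (- \<i> * of_int m * of_real x)) / (2 * of_real pi)"

text \<open>The bound 2 * pi on the real part gives an open neighbourhood of a full period in which
  exp (i w) = 1 only at w = 0.\<close>

definition box :: "real => complex set" where "box e = {w. \<bar>Re w\<bar> < 2 * pi \<and> \<bar>Im w\<bar> < e}"

lemma box: "open (box e)" "convex (box e)"
proof -
  have b: "box e = {w. Re w < 2 * pi} \<inter> {w. Re w > - 2 * pi} \<inter> {w. Im w < e} \<inter> {w. Im w > - e}"
    by (auto simp: box_def)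
  show "open (box e)" unfolding b
    by (intro open_Int open_halfspace_Re_lt open_halfspace_Re_gt open_halfspace_Im_lt open_halfspace_Im_gt)
  show "convex (box e)" unfolding b
    by (intro convex_Int convex_halfspace_Re_lt convex_halfspace_Re_gt convex_halfspace_Im_lt convex_halfspace_Im_gt)
qed

lemma pi_box: "\<bar>x\<bar> <= pi ==> \<bar>y\<bar> < e ==> Complex x y \<in> box e"
proof -
  assume "\<bar>x\<bar> <= pi" "\<bar>y\<bar> < e"
  moreover from this have "\<bar>x\<bar> < 2 * pi" using pi_gt_zero by linarith
  ultimately show ?thesis by (simp add: box_def)
qed

text \<open>With a primitive F, the integral at height y is F (pi + i y) - F (- pi + i y), and the
  derivative of this difference in y vanishes by periodicity.\<close>

lemma shift_integral:
  assumes f: "f holomorphic_on box e" and per: "\<And>y. \<bar>y\<bar> < e ==> f (Complex pi y) = f (Complex (- pi) y)"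
    and y: "\<bar>y\<bar> < e"
  shows "((\<lambda>x. f (Complex x y)) has_integral integral {-pi..pi} (\<lambda>x. f (of_real x))) {-pi..pi}"
proof -
  obtain F where F: "\<And>w. w \<in> box e ==> (F has_field_derivative f w) (at w within box e)"
    by (rule holomorphic_convex_primitive'[OF box(2) box(1) f]) metis
  have F': "(F has_field_derivative f w) (at w)" if "w \<in> box e" for w
    using F[OF that] unfolding at_within_open[OF that box(1)] .
  have *: "((\<lambda>x. f (Complex x y)) has_integral F (Complex pi y) - F (Complex (- pi) y)) {-pi..pi}" if y: "\<bar>y\<bar> < e" for y
  proof (rule fundamental_theorem_of_calculus)
    fix x assume "x \<in> {-pi..pi}"
    then have "Complex x y \<in> box e" using y by (intro pi_box) auto
    then have "(F has_field_derivative f (Complex x y)) (at (of_real x + \<i> * of_real y))"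
      using F' by (simp add: Complex_eq)
    then have "((\<lambda>w. F (w + \<i> * of_real y)) has_field_derivative f (Complex x y) * 1) (at (of_real x))"
      by (rule DERIV_chain2) (auto intro!: derivative_eq_intros)
    then have "((\<lambda>t. F (of_real t + \<i> * of_real y)) has_vector_derivative f (Complex x y)) (at x within {-pi..pi})"
      by (intro has_vector_derivative_real_field) simp
    then show "((\<lambda>x. F (Complex x y)) has_vector_derivative f (Complex x y)) (at x within {-pi..pi})"
      by (simp add: Complex_eq)
  qed simp
  have "F (Complex pi y) - F (Complex (- pi) y) = F (Complex pi 0) - F (Complex (- pi) 0)"
  proof -
    let ?D = "\<lambda>y. F (of_real pi + \<i> * of_real y) - F (of_real (- pi) + \<i> * of_real y)"
    have D0: "(?D has_vector_derivative 0) (at t within {-e<..<e})" if t: "t \<in> {-e<..<e}" for t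
    proof -
      have D: "((\<lambda>y. F (of_real x + \<i> * of_real y)) has_vector_derivative f (Complex x t) * \<i>) (at t within {-e<..<e})"
      if "\<bar>x\<bar> <= pi" for x
      proof (rule has_vector_derivative_real_field)
      have "Complex x t \<in> box e" using t that by (intro pi_box) auto
      then have "(F has_field_derivative f (Complex x t)) (at (of_real x + \<i> * of_real t))"
      using F' by (simp add: Complex_eq)
      then show "((\<lambda>w. F (of_real x + \<i> * w)) has_field_derivative f (Complex x t) * \<i>) (at (of_real t))"
      by (rule DERIV_chain2) (auto intro!: derivative_eq_intros)
      qed
      have "(?D has_vector_derivative f (Complex pi t) * \<i> - f (Complex (- pi) t) * \<i>) (at t within {-e<..<e})"
      by (rule has_vector_derivative_diff[OF D D]) auto
      moreover have "f (Complex pi t) = f (Complex (- pi) t)" using t by (intro per) auto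
      ultimately show "(?D has_vector_derivative 0) (at t within {-e<..<e})" by simp
    qed
    obtain c where "\<And>y. y \<in> {-e<..<e} ==> ?D y = c"
      by (rule has_vector_derivative_zero_constant[of "{-e<..<e}" ?D]) (use D0 in auto)
    moreover have "y \<in> {-e<..<e}" "0 \<in> {-e<..<e}" using y by auto
    ultimately have "?D y = ?D 0" by metis
    then show ?thesis by (simp add: Complex_eq)
  qed
  moreover have "F (Complex pi 0) - F (Complex (- pi) 0) = integral {-pi..pi} (\<lambda>x. f (of_real x))"
    using integral_unique[OF *[of 0]] y by (simp add: Complex_eq)
  ultimately show ?thesis using *[OF y] by simp
qed

text \<open>The line of integration is moved to height eps with the sign opposite to that of m,
  where the exponential factor has modulus exp (- eps |m|).\<close>

lemma fc_bound:
  assumes g: "g holomorphic_on box e" and per: "\<And>y. \<bar>y\<bar> < e ==> g (Complex pi y) = g (Complex (- pi) y)"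
    and eps: "0 <= eps" "eps < e" and M: "\<And>w. \<bar>Re w\<bar> <= pi ==> \<bar>Im w\<bar> <= eps ==> cmod (g w) <= M"
  shows "cmod (fc g m) <= M * exp (- eps * \<bar>real_of_int m\<bar>)"
proof -
  let ?f = "\<lambda>w. g w * exp (- \<i> * of_int m * w)"
  define y where "y = (if m \<ge> 0 then - eps else eps)"
  have y: "\<bar>y\<bar> < e" "of_int m * y = - eps * \<bar>real_of_int m\<bar>" "\<bar>y\<bar> = eps" using eps by (auto simp: y_def)
  have ex: "exp (- \<i> * of_int m * Complex pi y) = exp (- \<i> * of_int m * Complex (- pi) y)" for y
    unfolding exp_eq by (intro exI[of _ "- m"]) (simp add: Complex_eq algebra_simps)
  have hi: "((\<lambda>x. ?f (Complex x y)) has_integral integral {-pi..pi} (\<lambda>x. ?f (of_real x))) {-pi..pi}"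
    by (rule shift_integral[OF _ _ y(1)]) (auto intro!: holomorphic_intros g simp: per ex[simplified])
  have "cmod (integral {-pi..pi} (\<lambda>x. ?f (of_real x))) <= M * exp (- eps * \<bar>real_of_int m\<bar>) * (pi - (- pi))"
  proof -
    have "norm (integral {-pi..pi} (\<lambda>x. ?f (of_real x))) <= M * exp (- eps * \<bar>real_of_int m\<bar>) * measure lborel (cbox (-pi) pi)"
    proof (rule has_integral_bound)
      have "0 <= M" using M[of 0] eps by (auto intro: order_trans[OF norm_ge_zero])
      then show "0 <= M * exp (- eps * \<bar>real_of_int m\<bar>)" by simp
      show "((\<lambda>x. ?f (Complex x y)) has_integral integral {-pi..pi} (\<lambda>x. ?f (of_real x))) (cbox (-pi) pi)" using hi by simp
      fix x assume "x \<in> cbox (-pi) pi"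
      then have "cmod (g (Complex x y)) <= M" using y by (intro M) auto
      moreover have "cmod (exp (- \<i> * of_int m * Complex x y)) = exp (- eps * \<bar>real_of_int m\<bar>)"
      using y(2) by simp
      ultimately show "norm (?f (Complex x y)) <= M * exp (- eps * \<bar>real_of_int m\<bar>)"
      unfolding norm_mult by (simp add: mult_right_mono)
    qed
    then show ?thesis by simp
  qed
  then show ?thesis by (simp add: fc_def norm_divide field_simps)
qed

lemma summable_exp_int:
  assumes "e > 0" shows "(\<lambda>m. exp (- e * \<bar>real_of_int m\<bar>)) summable_on (UNIV :: int set)"
proof -
  have "summable (\<lambda>n. exp (- e) ^ n)" using assms by (intro summable_geometric) auto
  then have s: "(\<lambda>n. exp (- e) ^ n) summable_on (UNIV :: nat set)"
    by (intro norm_summable_imp_summable_on) (simp add: norm_power)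
  have e: "exp (- e) ^ n = exp (- e * real n)" for n
    using exp_of_nat_mult[of n "- e"] by (simp add: mult.commute)
  have "(\<lambda>m. exp (- e * \<bar>real_of_int m\<bar>)) summable_on (range int)"
    by (subst summable_on_reindex) (use s in \<open>auto simp: o_def e\<close>)
  moreover have "(\<lambda>m. exp (- e * \<bar>real_of_int m\<bar>)) summable_on (range (\<lambda>n. - int n))"
    by (subst summable_on_reindex) (use s in \<open>auto simp: o_def e inj_def\<close>)
  moreover have "range int \<union> range (\<lambda>n. - int n) = UNIV"
  proof -
    have "m \<in> range int \<union> range (\<lambda>n. - int n)" for m by (cases m rule: int_cases2) auto
    then show ?thesis by blast
  qed
  ultimately show ?thesis by (metis summable_on_union)
qed

text \<open>Write g - g 0 = G q with q w = exp (i w) - 1. In the box q vanishes only at 0, to first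
  order, so G is holomorphic and again takes equal values at both ends of the period. The Fourier
  coefficients of g - g 0 are then differences of neighbouring coefficients of G, and the symmetric
  partial sums telescope to g 0 up to two remote coefficients of G, which decay by
  \<open>fc_bound\<close>.\<close>

lemma fourier:
  assumes e: "0 < e" and g: "g holomorphic_on {w. \<bar>Im w\<bar> < e}"
    and per: "\<And>w. \<bar>Im w\<bar> < e ==> g (w + 2 * of_real pi) = g w"
  shows "(fc g has_sum g 0) UNIV"
proof -
  \<comment> \<open>A and B are the difference quotients of g and q at 0 with the removable
    singularity filled in, so that G = A / B.\<close>
  define A where "A = (\<lambda>w. if w = 0 then deriv g 0 else (g w - g 0) / (w - 0))"
  define q where "q = (\<lambda>w. exp (\<i> * w) - 1)"
  define B where "B = (\<lambda>w. if w = 0 then deriv q 0 else (q w - q 0) / (w - 0))"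
  have sub: "box e \<subseteq> {w. \<bar>Im w\<bar> < e}" by (auto simp: box_def)
  have gb: "g holomorphic_on box e" by (rule holomorphic_on_subset[OF g sub])
  have qb: "q holomorphic_on box e" unfolding q_def by (intro holomorphic_intros)
  have 0: "0 \<in> box e" using e by (simp add: box_def)
  have hA: "A holomorphic_on box e" unfolding A_def by (rule pole_lemma[OF gb]) (use 0 box(1) in \<open>simp add: interior_open\<close>)
  have hB: "B holomorphic_on box e" unfolding B_def by (rule pole_lemma[OF qb]) (use 0 box(1) in \<open>simp add: interior_open\<close>)
  have dq: "deriv q 0 = \<i>" unfolding q_def by (rule DERIV_imp_deriv) (auto intro!: derivative_eq_intros)
  have q0: "q w \<noteq> 0" if "w \<in> box e" "w \<noteq> 0" for w
  proof
    assume "q w = 0"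
    then have "exp (\<i> * w) = exp 0" by (simp add: q_def)
    then obtain n :: int where n: "\<i> * w = of_int (2 * n) * of_real pi * \<i>" unfolding exp_eq by auto
    then have "w = of_real (2 * of_int n * pi)" by (simp add: algebra_simps)
    then have "w = of_real (2 * of_int n * pi)" "\<bar>2 * of_int n * pi\<bar> < 2 * pi" using that(1) by (simp_all add: box_def)
    then have "\<bar>of_int n :: real\<bar> < 1" by (simp add: abs_mult)
    then have "n = 0" by linarith
    then show False using \<open>w = of_real (2 * of_int n * pi)\<close> that(2) by simp
  qed
  have B0: "B w \<noteq> 0" if "w \<in> box e" for w
    using q0[OF that] by (auto simp: B_def dq) (auto simp: q_def)
  define G where "G = (\<lambda>w. A w / B w)"
  have hG: "G holomorphic_on box e" unfolding G_def using B0 by (intro holomorphic_intros hA hB) auto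
  have Gq: "g w - g 0 = G w * q w" if "w \<in> box e" for w
  proof (cases "w = 0")
    case False
    then show ?thesis using q0[OF that] by (simp add: G_def A_def B_def) (simp add: q_def)
  qed (simp add: q_def)
  have gper: "g (Complex pi y) = g (Complex (- pi) y)" if "\<bar>y\<bar> < e" for y
    using per[of "Complex (- pi) y"] that by (simp add: Complex_eq algebra_simps)
  have Gper: "G (Complex pi y) = G (Complex (- pi) y)" if y: "\<bar>y\<bar> < e" for y
  proof -
    have b: "Complex pi y \<in> box e" "Complex (- pi) y \<in> box e" using y by (auto intro: pi_box)
    have nz: "Complex pi y \<noteq> 0" "Complex (- pi) y \<noteq> 0" by (auto simp: complex_eq_iff)
    have "exp (\<i> * Complex pi y) = exp (\<i> * Complex (- pi) y + 2 * of_real pi * \<i>)"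
      by (simp add: Complex_eq algebra_simps)
    then have "q (Complex pi y) = q (Complex (- pi) y)" by (simp add: q_def exp_add)
    moreover have "G (Complex pi y) * q (Complex pi y) = G (Complex (- pi) y) * q (Complex (- pi) y)"
      using Gq[OF b(1)] Gq[OF b(2)] gper[OF y] by simp
    ultimately show ?thesis using q0[OF b(2) nz(2)] by simp
  qed
  define eps where "eps = e / 2"
  have eps: "0 < eps" "eps < e" using e by (auto simp: eps_def)
  have bd: "\<exists>M. \<forall>w. \<bar>Re w\<bar> <= pi \<longrightarrow> \<bar>Im w\<bar> <= eps \<longrightarrow> cmod (f w) <= M" if f: "f holomorphic_on box e" for f
  proof -
    have "{w. \<bar>Re w\<bar> <= pi \<and> \<bar>Im w\<bar> <= eps} = cbox (Complex (- pi) (- eps)) (Complex pi eps)"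
      by (auto simp: in_cbox_complex_iff)
    then have c: "compact {w. \<bar>Re w\<bar> <= pi \<and> \<bar>Im w\<bar> <= eps}" by simp
    have "{w. \<bar>Re w\<bar> <= pi \<and> \<bar>Im w\<bar> <= eps} \<subseteq> box e"
      using eps(2) pi_box[of "Re w" "Im w" e for w] by (auto intro: le_less_trans)
    then have "compact (f ` {w. \<bar>Re w\<bar> <= pi \<and> \<bar>Im w\<bar> <= eps})"
      by (intro compact_continuous_image c holomorphic_on_imp_continuous_on holomorphic_on_subset[OF f])
    then obtain M where "\<forall>x\<in>f ` {w. \<bar>Re w\<bar> <= pi \<and> \<bar>Im w\<bar> <= eps}. norm x <= M" by (meson bounded_iff compact_imp_bounded)
    then show ?thesis by auto
  qed
  obtain M where M: "\<And>w. \<bar>Re w\<bar> <= pi ==> \<bar>Im w\<bar> <= eps ==> cmod (g w) <= M" using bd[OF gb] by blast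
  obtain M' where M': "\<And>w. \<bar>Re w\<bar> <= pi ==> \<bar>Im w\<bar> <= eps ==> cmod (G w) <= M'" using bd[OF hG] by blast
  have bg: "cmod (fc g m) <= M * exp (- eps * \<bar>real_of_int m\<bar>)" for m
    by (rule fc_bound[OF gb gper _ eps(2) M]) (use eps in auto)
  have bG: "cmod (fc G m) <= M' * exp (- eps * \<bar>real_of_int m\<bar>)" for m
    by (rule fc_bound[OF hG Gper _ eps(2) M']) (use eps in auto)
  have abs: "(\<lambda>m. norm (fc g m)) summable_on UNIV"
    by (rule summable_on_comparison_test[OF summable_on_cmult_right[OF summable_exp_int[OF eps(1)], of M] bg]) auto
  then have s: "(fc g has_sum infsum (fc g) UNIV) UNIV" by (simp add: abs_summable_summable)
  have c0: "integral {-pi..pi} (\<lambda>x. exp (- \<i> * of_int m * of_real x)) = (if m = 0 then 2 * of_real pi else 0)" for m :: int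
  proof (cases "m = 0")
    case False
    have "((\<lambda>x. exp (- \<i> * of_int m * of_real x)) has_integral
      exp (- \<i> * of_int m * of_real pi) / (- \<i> * of_int m) - exp (- \<i> * of_int m * of_real (- pi)) / (- \<i> * of_int m)) {-pi..pi}"
    proof (rule fundamental_theorem_of_calculus)
      show "((\<lambda>x. exp (- \<i> * of_int m * of_real x) / (- \<i> * of_int m)) has_vector_derivative
      exp (- \<i> * of_int m * of_real x)) (at x within {-pi..pi})" for x
      by (rule has_vector_derivative_real_field) (use False in \<open>auto intro!: derivative_eq_intros\<close>)
    qed simp
    moreover have "exp (- \<i> * of_int m * of_real pi) = exp (- \<i> * of_int m * of_real (- pi))"
      unfolding exp_eq by (intro exI[of _ "- m"]) (simp add: algebra_simps)
    ultimately show ?thesis using False by (simp add: integral_unique)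
  qed (simp add: scaleR_conv_of_real)
  have cont: "continuous_on {-pi..pi} (\<lambda>x. f (of_real x))" if "f holomorphic_on box e" for f
  proof (rule continuous_on_compose2[OF holomorphic_on_imp_continuous_on[OF that]])
    show "complex_of_real ` {-pi..pi} \<subseteq> box e"
      using pi_box[of _ 0 e] e by (auto simp: complex_of_real_def)
  qed (intro continuous_intros)
  have tel: "fc g m = (if m = 0 then g 0 else 0) + (fc G (m - 1) - fc G m)" for m
  proof -
    have "integral {-pi..pi} (\<lambda>x. g (of_real x) * exp (- \<i> * of_int m * of_real x)) =
      integral {-pi..pi} (\<lambda>x. g 0 * exp (- \<i> * of_int m * of_real x) +
      (G (of_real x) * exp (- \<i> * of_int (m - 1) * of_real x) - G (of_real x) * exp (- \<i> * of_int m * of_real x)))"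
    proof (rule integral_cong)
      fix x :: real assume "x \<in> {-pi..pi}"
      then have "of_real x \<in> box e" using pi_box[of x 0 e] e by (auto simp: complex_of_real_def)
      from Gq[OF this] have gx: "g (of_real x) = g 0 + G (of_real x) * q (of_real x)" by (simp add: algebra_simps)
      have "exp (\<i> * of_real x) * exp (- \<i> * of_int m * of_real x) = exp (- \<i> * of_int (m - 1) * of_real x)"
      by (simp add: exp_add[symmetric] algebra_simps)
      then show "g (of_real x) * exp (- \<i> * of_int m * of_real x) = g 0 * exp (- \<i> * of_int m * of_real x) +
      (G (of_real x) * exp (- \<i> * of_int (m - 1) * of_real x) - G (of_real x) * exp (- \<i> * of_int m * of_real x))"
      unfolding gx q_def by (simp add: distrib_right left_diff_distrib right_diff_distrib mult.assoc)
    qed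
    also have "... = g 0 * (if m = 0 then 2 * of_real pi else 0) +
      (integral {-pi..pi} (\<lambda>x. G (of_real x) * exp (- \<i> * of_int (m - 1) * of_real x)) -
      integral {-pi..pi} (\<lambda>x. G (of_real x) * exp (- \<i> * of_int m * of_real x)))"
      unfolding c0[symmetric]
      by (subst integral_add, (intro integrable_continuous_real continuous_intros cont hG)+)
      (subst integral_diff, (intro integrable_continuous_real continuous_intros cont hG)+, simp)
    finally show ?thesis by (simp add: fc_def diff_divide_distrib add_divide_distrib)
  qed
  have part: "(\<Sum>m\<in>{- int n..int n}. fc g m) = g 0 + (fc G (- int n - 1) - fc G (int n))" for n
  proof (induction n)
    case 0
    then show ?case using tel[of 0] by simp
  next
    case (Suc n)
    have "{- int (Suc n)..int (Suc n)} = insert (- int n - 1) (insert (int n + 1) {- int n..int n})" by auto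
    then have "(\<Sum>m\<in>{- int (Suc n)..int (Suc n)}. fc g m) = fc g (- int n - 1) + (fc g (int n + 1) + (\<Sum>m\<in>{- int n..int n}. fc g m))"
      by simp
    then have "(\<Sum>m\<in>{- int (Suc n)..int (Suc n)}. fc g m) = fc g (- int n - 1) + (fc g (int n + 1) + (g 0 + (fc G (- int n - 1) - fc G (int n))))"
      unfolding Suc .
    then show ?case using tel[of "- int n - 1"] tel[of "int n + 1"]
      by (simp only:) (simp add: algebra_simps)
  qed
  have lim0: "(\<lambda>n. fc G (h n)) \<longlonglongrightarrow> 0" if h: "\<And>n. real n <= \<bar>real_of_int (h n)\<bar>" for h :: "nat => int"
  proof (rule Lim_null_comparison)
    have M'0: "0 <= M'" using M'[of 0] eps by (auto intro: order_trans[OF norm_ge_zero])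
    have "cmod (fc G (h n)) <= M' * exp (- eps) ^ n" for n
    proof -
      have "exp (- eps * \<bar>real_of_int (h n)\<bar>) <= exp (- eps * real n)" using h[of n] eps by simp
      also have "... = exp (- eps) ^ n" using exp_of_nat_mult[of n "- eps"] by (simp add: mult.commute)
      finally show ?thesis using bG[of "h n"] M'0 mult_left_mono order_trans by blast
    qed
    then show "\<forall>\<^sub>F n in sequentially. cmod (fc G (h n)) <= M' * exp (- eps) ^ n" by simp
    have "(\<lambda>n. exp (- eps) ^ n) \<longlonglongrightarrow> 0" using eps by (intro LIMSEQ_realpow_zero) auto
    then show "(\<lambda>n. M' * exp (- eps) ^ n) \<longlonglongrightarrow> 0" using tendsto_mult_right_zero by blast
  qed
  have "(\<lambda>n. g 0 + (fc G (- int n - 1) - fc G (int n))) \<longlonglongrightarrow> g 0 + (0 - 0)"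
    by (intro tendsto_intros lim0) auto
  \<comment> \<open>The unordered sum exists by decay, and the symmetric intervals exhaust the
    finite sets, so its value is the limit just computed.\<close>
  moreover have "(\<lambda>n. \<Sum>m\<in>{- int n..int n}. fc g m) \<longlonglongrightarrow> infsum (fc g) UNIV"
  proof -
    have "filterlim (\<lambda>n. {- int n..int n}) (finite_subsets_at_top UNIV) sequentially"
      unfolding filterlim_finite_subsets_at_top
    proof (intro allI impI)
      fix X :: "int set" assume X: "finite X \<and> X \<subseteq> UNIV"
      define N where "N = nat (Max (insert 0 (abs ` X)))"
      have "X \<subseteq> {- int n..int n}" if "n \<ge> N" for n
      proof
      fix x assume "x \<in> X"
      then have "\<bar>x\<bar> <= Max (insert 0 (abs ` X))" using X by (intro Max_ge) auto
      then show "x \<in> {- int n..int n}" using that by (auto simp: N_def)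
      qed
      then show "\<forall>\<^sub>F y in sequentially. finite {- int y..int y} \<and> X \<subseteq> {- int y..int y} \<and> {- int y..int y} \<subseteq> UNIV"
      by (intro eventually_mono[OF eventually_ge_at_top[of N]]) auto
    qed
    then show ?thesis using s unfolding has_sum_def by (rule filterlim_compose[rotated])
  qed
  ultimately have "infsum (fc g) UNIV = g 0" unfolding part using LIMSEQ_unique by fastforce
  then show ?thesis using s by simp
qed

lemma translate_integral:
  assumes e: "0 < e" and f: "f holomorphic_on {w. \<bar>Im w\<bar> < e}"
    and per: "\<And>w. \<bar>Im w\<bar> < e ==> f (w + 2 * of_real pi) = f w"
  shows "integral {-pi..pi} (\<lambda>x. f (of_real (c + x))) = integral {-pi..pi} (\<lambda>x. f (of_real x))"
proof -
  let ?S = "{w. \<bar>Im w\<bar> < e}"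
  have "?S = {w. Im w < e} \<inter> {w. Im w > - e}" by auto
  then have S: "convex ?S" "open ?S"
    by (simp_all add: convex_Int convex_halfspace_Im_lt convex_halfspace_Im_gt open_Int open_halfspace_Im_lt open_halfspace_Im_gt)
  obtain F where F0: "\<And>w. w \<in> ?S ==> (F has_field_derivative f w) (at w within ?S)"
    by (rule holomorphic_convex_primitive'[OF S f]) metis
  have F: "(F has_field_derivative f w) (at w)" if "w \<in> ?S" for w
    using F0[OF that] unfolding at_within_open[OF that S(2)] .
  have D: "((\<lambda>x. F (of_real (a + x))) has_vector_derivative f (of_real (a + x))) (at x within T)" for a x T
  proof -
    have "(F has_field_derivative f (of_real (a + x))) (at (of_real a + of_real x))"
      using F[of "of_real (a + x)"] e by simp
    then have "((\<lambda>w. F (of_real a + w)) has_field_derivative f (of_real (a + x)) * 1) (at (of_real x))"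
      by (rule DERIV_chain2) (auto intro!: derivative_eq_intros)
    from has_vector_derivative_real_field[OF this] show ?thesis by simp
  qed
  have i: "integral {-pi..pi} (\<lambda>x. f (of_real (a + x))) = F (of_real (pi + a)) - F (of_real (- pi + a))" for a
    by (rule integral_unique, subst (1 2) add.commute, rule fundamental_theorem_of_calculus[OF _ D]) simp
  have D2: "((\<lambda>a. F (of_real (pi + a)) - F (of_real (- pi + a))) has_vector_derivative 0) (at a within UNIV)" for a
  proof -
    have "f (of_real (pi + a)) = f (of_real (- pi + a))"
      using per[of "of_real (- pi + a)"] e by (simp add: add.commute)
    then show ?thesis using has_vector_derivative_diff[OF D[of pi a UNIV] D[of "- pi" a UNIV]] by simp
  qed
  obtain k where k: "\<And>a. a \<in> UNIV ==> F (of_real (pi + a)) - F (of_real (- pi + a)) = k"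
    by (rule has_vector_derivative_zero_constant[of UNIV, OF _ D2]) auto
  show ?thesis using k[of c] k[of 0] i[of c] i[of 0] by simp
qed

section \<open>Summability of products over a finite index set\<close>

lemma sum_prod_bound:
  fixes g :: "'b => real"
  assumes g: "\<And>b. 0 <= g b" and s: "g summable_on UNIV" and A: "finite (A :: ('v::finite => 'b) set)"
  shows "(\<Sum>\<kappa>\<in>A. \<Prod>v\<in>UNIV. g (\<kappa> v)) <= infsum g UNIV ^ CARD('v)"
proof -
  define K where "K = (\<Union>v. (\<lambda>\<kappa>. \<kappa> v) ` A)"
  have K: "finite K" using A by (auto simp: K_def)
  have sub: "A \<subseteq> PiE UNIV (\<lambda>_. K)" by (auto simp: K_def)
  have fin: "finite (PiE UNIV (\<lambda>_ :: 'v. K))" by (rule finite_PiE) (auto simp: K)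
  have "(\<Sum>\<kappa>\<in>A. \<Prod>v\<in>UNIV. g (\<kappa> v)) <= (\<Sum>\<kappa>\<in>PiE (UNIV :: 'v set) (\<lambda>_. K). \<Prod>v\<in>UNIV. g (\<kappa> v))"
    by (rule sum_mono2[OF fin sub]) (auto intro: prod_nonneg g)
  also have "... = (\<Prod>v\<in>(UNIV :: 'v set). \<Sum>b\<in>K. g b)"
    by (rule prod_sum_PiE[symmetric]) (auto simp: K)
  also have "... <= (\<Prod>v\<in>(UNIV :: 'v set). infsum g UNIV)"
    by (intro prod_mono) (auto intro!: sum_nonneg finite_sum_le_infsum s K g)
  finally show ?thesis by simp
qed

lemma summable_prod:
  fixes g :: "'b => real"
  assumes g: "\<And>b. 0 <= g b" and s: "g summable_on UNIV"
  shows "(\<lambda>\<kappa>. \<Prod>v\<in>(UNIV :: 'v::finite set). g (\<kappa> v)) summable_on UNIV"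
proof (rule nonneg_bdd_above_summable_on)
  show "bdd_above (sum (\<lambda>\<kappa>. \<Prod>v\<in>(UNIV :: 'v::finite set). g (\<kappa> v)) ` {F. F \<subseteq> UNIV \<and> finite F})"
    by (rule bdd_aboveI[of _ "infsum g UNIV ^ CARD('v)"]) (auto intro: sum_prod_bound[OF g s])
qed (auto intro: prod_nonneg g)

subsection \<open>Projections to Fourier modes\<close>

lemma holo_curve:
  assumes "\<And>i. ((\<lambda>w. co i (\<gamma> w)) has_field_derivative \<gamma>' i) (at w)" "holo_on F S" "\<gamma> w \<in> S"
  shows "((\<lambda>w. F (\<gamma> w)) has_field_derivative pd (mk \<gamma>') F (\<gamma> w)) (at w)"
proof -
  have "((\<lambda>w. mk (\<lambda>i. co i (\<gamma> w))) has_derivative (\<lambda>c. mk (\<lambda>i. \<gamma>' i * c))) (at w)"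
    by (rule has_derivative_mk) (use assms(1) in \<open>simp add: has_field_derivative_def\<close>)
  moreover have "mk (\<lambda>i. \<gamma>' i * c) = cscale c (mk \<gamma>')" for c by (rule phase_eqI) simp
  ultimately have "(\<gamma> has_derivative (\<lambda>c. cscale c (mk \<gamma>'))) (at w)" by simp
  from has_derivative_compose[OF this holo_at(1)[OF assms(2,3)]]
  have "((\<lambda>w. F (\<gamma> w)) has_derivative (\<lambda>c. c * pd (mk \<gamma>') F (\<gamma> w))) (at w)"
    by (simp add: holo_at(2)[OF assms(2,3)])
  moreover have "(\<lambda>c. c * pd (mk \<gamma>') F (\<gamma> w)) = (*) (pd (mk \<gamma>') F (\<gamma> w))" by (auto simp: mult.commute)
  ultimately show ?thesis by (simp add: has_field_derivative_def)
qed

text \<open>The vector field that generates the rotations of direction a, that is, the velocity in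
  \<open>rot_curve\<close>.\<close>

definition VV :: "(('n::finite, 'm::finite) ix => int) => ('n, 'm) phase => ('n, 'm) phase" where
  "VV a z = mk (\<lambda>i. case i of CT _ => of_int (a i) | CP _ => \<i> * of_int (a i) * co i z
     | CQ _ => \<i> * of_int (a i) * co i z | _ => 0)"

abbreviation "rota a w \<equiv> rot (\<lambda>i. w * of_int (a i))"

lemma rot_curve:
  assumes "holo_on F S" "rota a w z \<in> S"
  shows "((\<lambda>w. F (rota a w z)) has_field_derivative pd (VV a (rota a w z)) F (rota a w z)) (at w)"
  unfolding VV_def
proof (rule holo_curve[where \<gamma> = "\<lambda>w. rota a w z", OF _ assms])
  fix i
  show "((\<lambda>w. co i (rota a w z)) has_field_derivative
    (case i of CT _ => of_int (a i) | CP _ => \<i> * of_int (a i) * co i (rota a w z)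
     | CQ _ => \<i> * of_int (a i) * co i (rota a w z) | _ => 0)) (at w)"
    by (cases i) (auto simp: co_rot intro!: derivative_eq_intros)
qed

lemma continuous_rot:
  "continuous_on S (\<lambda>x. rot (\<lambda>i. f i x) (g x))"
  if "\<And>i. continuous_on S (f i)" "continuous_on S g"
proof -
  have c: "continuous_on S (\<lambda>x. co i (g x))" for i by (intro continuous_on_co that)
  show ?thesis
    unfolding rot_def
  proof (rule continuous_on_mk)
    fix i
    show "continuous_on S (\<lambda>x. case i of CT _ => co i (g x) + f i x | CP _ => co i (g x) * exp (\<i> * f i x)
      | CQ _ => co i (g x) * exp (\<i> * f i x) | _ => co i (g x))"
      by (cases i) (auto intro!: continuous_intros c that)
  qed
qed

context dom begin

lemma rot_in:
  assumes z: "z \<in> P u" "u <= t" and T: "\<And>i. \<bar>Im (\<eta> (CT i))\<bar> <= (t - u) * s"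
    and pq: "\<And>i. exp (- Im (\<eta> (CP i))) * u <= t" "\<And>i. exp (- Im (\<eta> (CQ i))) * u <= t"
  shows "rot \<eta> z \<in> P t"
proof -
  obtain a b c where abc: "a \<in> II" "b \<in> YY" "c \<in> XX" "\<forall>i. dd a b c z i < u * rad i"
    using z(1) P_iff by blast
  have u: "0 < u" using P_pos[OF z(1)] .
  have "dd a b c (rot \<eta> z) i < t * rad i" for i
  proof -
    have m: "x * exp (- y) < t * \<delta>" if "x < u * \<delta>" "exp (- y) * u <= t" for x y
    proof -
      have "x * exp (- y) < u * \<delta> * exp (- y)" using that by simp
      also have "... <= t * \<delta>" using mult_right_mono[OF that(2), of \<delta>] pos by (simp add: mult_ac)
      finally show ?thesis .
    qed
    have k: "u * rad i <= t * rad i" using z(2) rad[of i] by simp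
    show ?thesis
    proof (cases i)
      case (CT j)
      have "\<bar>Im (co (CT j) z)\<bar> < u * s" using abc(4)[rule_format, of "CT j"] by simp
      then show ?thesis using T[of j] CT by (simp add: co_rot left_diff_distrib)
    next
      case (CP j)
      have "cmod (co (CP j) z) < u * \<delta>" using abc(4)[rule_format, of "CP j"] by simp
      from m[OF this pq(1)[of j]] show ?thesis using CP by (simp add: co_rot norm_mult)
    next
      case (CQ j)
      have "cmod (co (CQ j) z) < u * \<delta>" using abc(4)[rule_format, of "CQ j"] by simp
      from m[OF this pq(2)[of j]] show ?thesis using CQ by (simp add: co_rot norm_mult)
    qed (use abc(4)[rule_format, of i] k in \<open>simp_all add: co_rot\<close>)
  qed
  then show ?thesis unfolding P_iff using abc(1-3) by blast
qed

lemma rot_nhd: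
  assumes "z \<in> P t" obtains e where "e > 0" "\<And>\<eta>. (\<And>i. \<bar>Im (\<eta> i)\<bar> < e) ==> rot \<eta> z \<in> P t"
proof -
  obtain u where u: "u < t" "z \<in> P u" using P_inner[OF assms] .
  have u0: "0 < u" using P_pos[OF u(2)] .
  define e where "e = min ((t - u) * s) (ln (t / u))"
  have e: "e > 0" using u u0 pos by (simp add: e_def)
  have "rot \<eta> z \<in> P t" if \<eta>: "\<And>i. \<bar>Im (\<eta> i)\<bar> < e" for \<eta>
  proof (rule rot_in[OF u(2)])
    have *: "exp (- Im (\<eta> i)) * u <= t" for i
    proof -
      have "\<bar>Im (\<eta> i)\<bar> < ln (t / u)" using \<eta>[of i] by (simp add: e_def)
      then have "- Im (\<eta> i) <= ln (t / u)" by linarith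
      then have "exp (- Im (\<eta> i)) <= exp (ln (t / u))" by simp
      then show ?thesis using u u0 by (simp add: field_simps)
    qed
    show "exp (- Im (\<eta> (CP i))) * u <= t" "exp (- Im (\<eta> (CQ i))) * u <= t" for i using * by auto
    show "\<bar>Im (\<eta> (CT i))\<bar> <= (t - u) * s" for i using \<eta>[of "CT i"] by (simp add: e_def)
  qed (use u in simp)
  then show ?thesis using that e by blast
qed

text \<open>Along the segment the imaginary parts of the angles are affine and the moduli of p, q
  are monotone in \<tau>, so every bound valid at both ends is valid between. On this segment
  \<open>hom_complex\<close> shows a function to be constant.\<close>

lemma rot_segment:
  assumes z: "z \<in> P t" and w: "rota a w z \<in> P t" and \<tau>: "0 <= \<tau>" "\<tau> <= 1"
  shows "rota a (of_real \<tau> * w) z \<in> P t"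
proof -
  obtain A b c where abc: "A \<in> II" "b \<in> YY" "c \<in> XX" "\<forall>i. dd A b c z i < t * rad i"
    using z P_iff by blast
  obtain A' b' c' where abc': "\<forall>i. dd A' b' c' (rota a w z) i < t * rad i"
    using w P_iff by blast
  have "dd A b c (rota a (of_real \<tau> * w) z) i < t * rad i" for i
  proof -
    have ex: "x * exp (- (\<tau> * y)) < m" if "0 <= x" "x < m" "x * exp (- y) < m" for x y m :: real
    proof (cases "y \<ge> 0")
      case True
      then have "x * exp (- (\<tau> * y)) <= x * 1" using that \<tau> by (intro mult_left_mono) auto
      then show ?thesis using that by simp
    next
      case False
      then have "x * exp (- (\<tau> * y)) <= x * exp (- y)" using that \<tau> mult_right_mono[of \<tau> 1 "- y"] by (intro mult_left_mono) auto
      then show ?thesis using that by simp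
    qed
    note h = abc(4)[rule_format, of i] abc'[rule_format, of i]
    show ?thesis
    proof (cases i)
      case (CT j)
      define x y where "x = Im (co (CT j) z)" and "y = Im w * of_int (a (CT j))"
      have "\<bar>x\<bar> < t * s" "\<bar>x + y\<bar> < t * s" using h CT by (simp_all add: co_rot x_def y_def)
      moreover have "x + \<tau> * y = (1 - \<tau>) * x + \<tau> * (x + y)" by (simp add: algebra_simps)
      ultimately have "\<bar>x + \<tau> * y\<bar> <= (1 - \<tau>) * \<bar>x\<bar> + \<tau> * \<bar>x + y\<bar>"
      using \<tau> by (metis abs_mult abs_of_nonneg abs_triangle_ineq diff_ge_0_iff_ge)
      also have "... < t * s" using convex_bound_lt[OF \<open>\<bar>x\<bar> < t * s\<close> \<open>\<bar>x + y\<bar> < t * s\<close>, of "1 - \<tau>" \<tau>] \<tau> by simp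
      finally show ?thesis using CT by (simp add: co_rot x_def y_def algebra_simps)
    next
      case (CP j)
      show ?thesis using ex[of "cmod (co i z)" "t * \<delta>" "Im w * of_int (a i)"] h CP
      by (simp add: co_rot norm_mult mult_ac)
    next
      case (CQ j)
      show ?thesis using ex[of "cmod (co i z)" "t * \<delta>" "Im w * of_int (a i)"] h CQ
      by (simp add: co_rot norm_mult mult_ac)
    qed (use h in \<open>simp_all add: co_rot\<close>)
  qed
  then show ?thesis unfolding P_iff using abc(1-3) by blast
qed

text \<open>Euler's identity for homogeneous functions. The derivative at 0 is computed along real
  parameters, where \<open>hom\<close> is known; it determines the complex derivative.\<close>

lemma euler:
  assumes h: "hom a c (P t) G" "holo_on G (P t)" and z: "z \<in> P t"
  shows "pd (VV a z) G z = \<i> * of_int c * G z"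
proof -
  have r0: "rota a 0 z = z" by simp
  have "((\<lambda>w. G (rota a w z)) has_field_derivative pd (VV a z) G z) (at 0)"
    using rot_curve[OF h(2), where a = a and w = 0 and z = z] z by simp
  then have "((\<lambda>x. G (rota a (of_real x) z)) has_vector_derivative pd (VV a z) G z) (at 0)"
    using has_vector_derivative_real_field[of "\<lambda>w. G (rota a w z)" _ 0 UNIV] by simp
  moreover have "(\<lambda>x. G (rota a (of_real x) z)) = (\<lambda>x. exp (\<i> * of_int c * of_real x) * G z)"
    using h(1) z by (auto simp: hom_def)
  moreover have "((\<lambda>x. exp (\<i> * of_int c * of_real x) * G z) has_vector_derivative \<i> * of_int c * G z) (at 0)"
    by (rule has_vector_derivative_real_field[of "\<lambda>w. exp (\<i> * of_int c * w) * G z" _ 0 UNIV, simplified])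
      (auto intro!: derivative_eq_intros)
  ultimately show ?thesis using vector_derivative_unique_at by fastforce
qed

text \<open>By \<open>euler\<close>, \<open>exp (- (\<i> * of_int c * v)) * G (rota a v z)\<close>
  has derivative 0 in v. Imaginary parameters thus change G by a real factor determined by its
  degree, which is what \<open>decay\<close> exploits.\<close>

lemma hom_complex:
  assumes h: "hom a c (P t) G" "holo_on G (P t)" and z: "z \<in> P t" and w: "rota a w z \<in> P t"
  shows "G (rota a w z) = exp (\<i> * of_int c * w) * G z"
proof -
  let ?f = "\<lambda>v. exp (- (\<i> * of_int c * v)) * G (rota a v z)"
  have "\<exists>k. \<forall>v\<in>closed_segment 0 w. ?f v = k"
  proof (rule has_field_derivative_zero_constant)
    fix v assume "v \<in> closed_segment 0 w"
    then obtain \<tau> where \<tau>: "0 <= \<tau>" "\<tau> <= 1" "v = of_real \<tau> * w"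
      by (auto simp: closed_segment_def scaleR_conv_of_real)
    have vin: "rota a v z \<in> P t" unfolding \<tau>(3) by (rule rot_segment[OF z w \<tau>(1,2)])
    have "((\<lambda>v. G (rota a v z)) has_field_derivative \<i> * of_int c * G (rota a v z)) (at v)"
      using rot_curve[OF h(2) vin] euler[OF h vin] by simp
    then have "(?f has_field_derivative 0) (at v)" by (auto intro!: derivative_eq_intros)
    then show "(?f has_field_derivative 0) (at v within closed_segment 0 w)"
      by (rule has_field_derivative_at_within)
  qed simp
  then obtain k where "\<forall>v\<in>closed_segment 0 w. ?f v = k" by blast
  then have "?f w = ?f 0" by (metis ends_in_segment)
  then have "exp (- (\<i> * of_int c * w)) * G (rota a w z) = G z" by simp
  then have "exp (\<i> * of_int c * w) * (exp (- (\<i> * of_int c * w)) * G (rota a w z)) = exp (\<i> * of_int c * w) * G z" by simp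
  then show ?thesis by (simp add: mult.assoc[symmetric] exp_add[symmetric])
qed

text \<open>A condition on the angles only: in the other directions a rotation by 2 pi is the
  identity. In this uniform form Fourier modes in the angles and Taylor modes in p, q are extracted
  by the same operator.\<close>

definition per :: "real => ('n, 'm) func => bool" where
  "per t F \<longleftrightarrow> (\<forall>v. \<forall>z\<in>P t. F (rota (fv v) (of_real (2 * pi)) z) = F z)"

text \<open>The Fourier mode m along the orbit of direction v. For an angle this is the usual
  Fourier projection; for p or q it is Cauchy's integral for the Taylor term of order m in that
  coordinate.\<close>

definition pr :: "('n, 'm) ix => int => ('n, 'm) func => ('n, 'm) func" where
  "pr v m F z = fc (\<lambda>w. F (rota (fv v) w z)) m"

lemma rota_add: "rota a w (rota a w' z) = rota a (w + w') z"
  by (simp add: rot_rot algebra_simps)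

lemma rot_commute: "rot \<eta> (rot \<zeta> z) = rot \<zeta> (rot \<eta> z)"
  by (simp add: rot_rot add.commute)

context
  fixes F :: "('n, 'm) func" and t :: real
  assumes F: "holo_on F (P t)" and perF: "per t F"
begin

lemma strip_fun:
  assumes z: "z \<in> P t"
  obtains e where "e > 0" "\<And>\<eta>. (\<And>i. \<bar>Im (\<eta> i)\<bar> < e) ==> rot \<eta> z \<in> P t"
    "\<And>v. (\<lambda>w. F (rota (fv v) w z)) holomorphic_on {w. \<bar>Im w\<bar> < e}"
    "\<And>v w. \<bar>Im w\<bar> < e ==> F (rota (fv v) (w + 2 * of_real pi) z) = F (rota (fv v) w z)"
proof -
  obtain e where e: "e > 0" "\<And>\<eta>. (\<And>i. \<bar>Im (\<eta> i)\<bar> < e) ==> rot \<eta> z \<in> P t" using rot_nhd[OF z] by metis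
  have i: "rota (fv v) w z \<in> P t" if "\<bar>Im w\<bar> < e" for v w
    by (rule e(2)) (use that e(1) in \<open>simp add: fv_def\<close>)
  show ?thesis
  proof (rule that[OF e])
    have "open {w. \<bar>Im w\<bar> < e}"
    proof -
      have "{w. \<bar>Im w\<bar> < e} = {w. Im w < e} \<inter> {w. Im w > - e}" by auto
      then show ?thesis by (simp add: open_Int open_halfspace_Im_lt open_halfspace_Im_gt)
    qed
    then show "(\<lambda>w. F (rota (fv v) w z)) holomorphic_on {w. \<bar>Im w\<bar> < e}" for v
      unfolding holomorphic_on_open[OF \<open>open {w. \<bar>Im w\<bar> < e}\<close>] using rot_curve[OF F i] by blast
    show "F (rota (fv v) (w + 2 * of_real pi) z) = F (rota (fv v) w z)" if "\<bar>Im w\<bar> < e" for v w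
    proof -
      have "F (rota (fv v) (of_real (2 * pi)) (rota (fv v) w z)) = F (rota (fv v) w z)"
      using perF i[OF that] unfolding per_def by blast
      then show ?thesis unfolding rota_add by (simp add: add.commute)
    qed
  qed
qed

lemma pr_holo: "holo_on (pr v m F) (P t)"
proof -
  have "holo_on (\<lambda>z. integral {-pi..pi} (\<lambda>x. F (rota (fv v) (of_real x) z) * exp (- \<i> * of_int m * of_real x))) (P t)"
  proof (rule holo_integral(1)[OF open_P])
    fix x show "holo_on (\<lambda>z. F (rota (fv v) (of_real x) z) * exp (- \<i> * of_int m * of_real x)) (P t)"
      by (rule holo_mult[OF holo_comp[OF holo_rot F rinvD[OF rinv_P]] holo_const])
  next
    have c: "continuous_on ({-pi..pi} \<times> P t) (\<lambda>y. rota (fv v) (of_real (fst y)) (snd y))"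
      by (intro continuous_rot continuous_intros)
    have "continuous_on ({-pi..pi} \<times> P t) (\<lambda>y. F (rota (fv v) (of_real (fst y)) (snd y)))"
      by (rule continuous_on_compose2[OF holo_continuous[OF F] c]) (use rinvD[OF rinv_P] in \<open>auto simp: mem_Times_iff\<close>)
    then show "continuous_on ({-pi..pi} \<times> P t) (\<lambda>(x, z). F (rota (fv v) (of_real x) z) * exp (- \<i> * of_int m * of_real x))"
      unfolding case_prod_unfold by (intro continuous_intros)
  qed
  then show ?thesis unfolding pr_def fc_def by (rule holo_divide) simp_all
qed

lemma pr_bound: assumes M: "\<And>z. z \<in> P t ==> cmod (F z) <= M" and z: "z \<in> P t" shows "cmod (pr v m F z) <= M"
proof -
  obtain e where e: "e > 0" "\<And>\<eta>. (\<And>i. \<bar>Im (\<eta> i)\<bar> < e) ==> rot \<eta> z \<in> P t"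
    "\<And>v. (\<lambda>w. F (rota (fv v) w z)) holomorphic_on {w. \<bar>Im w\<bar> < e}"
    "\<And>v w. \<bar>Im w\<bar> < e ==> F (rota (fv v) (w + 2 * of_real pi) z) = F (rota (fv v) w z)" using strip_fun[OF z] by metis
  have "cmod (fc (\<lambda>w. F (rota (fv v) w z)) m) <= M * exp (- 0 * \<bar>real_of_int m\<bar>)"
  proof (rule fc_bound)
    show "(\<lambda>w. F (rota (fv v) w z)) holomorphic_on box e"
      by (rule holomorphic_on_subset[OF e(3)]) (auto simp: box_def)
    show "F (rota (fv v) (Complex pi y) z) = F (rota (fv v) (Complex (- pi) y) z)" if "\<bar>y\<bar> < e" for y
      using e(4)[of "Complex (- pi) y" v] that by (simp add: Complex_eq algebra_simps)
    show "cmod (F (rota (fv v) w z)) <= M" if "\<bar>Im w\<bar> <= 0" for w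
      using M[OF rinvD[OF rinv_P z, of "Re w" "fv v"]] that by (simp add: complex_is_Real_iff[THEN iffD2, THEN of_real_Re])
  qed (use e in auto)
  then show ?thesis by (simp add: pr_def)
qed

lemma pr_per: "per t (pr v m F)"
  unfolding per_def
proof (intro allI ballI)
  fix w z assume z: "z \<in> P t"
  have "F (rota (fv v) (of_real x) (rota (fv w) (of_real (2 * pi)) z)) = F (rota (fv v) (of_real x) z)" for x
    using perF rinvD[OF rinv_P z, of x "fv v"] unfolding per_def rot_commute[of "\<lambda>i. of_real x * of_int (fv v i)"] by blast
  then show "pr v m F (rota (fv w) (of_real (2 * pi)) z) = pr v m F z"
    by (simp add: pr_def fc_def)
qed

lemma pr_hom_other: "hom a c (P t) F ==> hom a c (P t) (pr v m F)"
  unfolding hom_def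
proof (intro ballI allI)
  fix z x assume h: "\<forall>z\<in>P t. \<forall>x. F (rota a (of_real x) z) = exp (\<i> * of_int c * of_real x) * F z" and z: "z \<in> P t"
  have "F (rota (fv v) (of_real y) (rota a (of_real x) z)) = exp (\<i> * of_int c * of_real x) * F (rota (fv v) (of_real y) z)" for y
    using h rinvD[OF rinv_P z, of y "fv v"] unfolding rot_commute[of "\<lambda>i. of_real y * of_int (fv v i)"] by blast
  then show "pr v m F (rota a (of_real x) z) = exp (\<i> * of_int c * of_real x) * pr v m F z"
    by (simp add: pr_def fc_def mult.assoc)
qed

lemma pr_hom: "hom (fv v) m (P t) (pr v m F)"
  unfolding hom_def
proof (intro ballI allI)
  fix z and x :: real assume z: "z \<in> P t"
  obtain e where e: "e > 0" "\<And>\<eta>. (\<And>i. \<bar>Im (\<eta> i)\<bar> < e) ==> rot \<eta> z \<in> P t"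
    "\<And>v. (\<lambda>w. F (rota (fv v) w z)) holomorphic_on {w. \<bar>Im w\<bar> < e}"
    "\<And>v w. \<bar>Im w\<bar> < e ==> F (rota (fv v) (w + 2 * of_real pi) z) = F (rota (fv v) w z)" using strip_fun[OF z] by metis
  let ?f = "\<lambda>w. F (rota (fv v) w z) * exp (- \<i> * of_int m * w)"
  have ex: "exp (- \<i> * of_int m * (w + 2 * of_real pi)) = exp (- \<i> * of_int m * w)" for w
    unfolding exp_eq by (intro exI[of _ "- m"]) (simp add: algebra_simps)
  have "integral {-pi..pi} (\<lambda>y. ?f (of_real (x + y))) = integral {-pi..pi} (\<lambda>y. ?f (of_real y))"
    by (rule translate_integral[OF e(1)]) (use e(4) ex in \<open>auto intro!: holomorphic_intros e(3)\<close>)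
  moreover have "F (rota (fv v) (of_real y) (rota (fv v) (of_real x) z)) * exp (- \<i> * of_int m * of_real y) =
      exp (\<i> * of_int m * of_real x) * ?f (of_real (x + y))" for y
  proof -
    have "exp (\<i> * of_int m * of_real x) * exp (- \<i> * of_int m * of_real (x + y)) = exp (- \<i> * of_int m * of_real y)"
      unfolding exp_add[symmetric] by (simp add: algebra_simps)
    moreover have "rota (fv v) (of_real y) (rota (fv v) (of_real x) z) = rota (fv v) (of_real (x + y)) z"
      unfolding rota_add by (simp add: add.commute)
    ultimately show ?thesis by (simp only: mult.left_commute[of "exp (\<i> * of_int m * of_real x)"])
  qed
  ultimately have "integral {-pi..pi} (\<lambda>y. F (rota (fv v) (of_real y) (rota (fv v) (of_real x) z)) * exp (- \<i> * of_int m * of_real y)) =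
     exp (\<i> * of_int m * of_real x) * integral {-pi..pi} (\<lambda>y. ?f (of_real y))"
    by simp
  then show "pr v m F (rota (fv v) (of_real x) z) = exp (\<i> * of_int m * of_real x) * pr v m F z"
    unfolding pr_def fc_def by simp
qed

lemma pr_sum: assumes z: "z \<in> P t" shows "((\<lambda>m. pr v m F z) has_sum F z) UNIV"
proof -
  obtain e where e: "e > 0" "\<And>\<eta>. (\<And>i. \<bar>Im (\<eta> i)\<bar> < e) ==> rot \<eta> z \<in> P t"
    "\<And>v. (\<lambda>w. F (rota (fv v) w z)) holomorphic_on {w. \<bar>Im w\<bar> < e}"
    "\<And>v w. \<bar>Im w\<bar> < e ==> F (rota (fv v) (w + 2 * of_real pi) z) = F (rota (fv v) w z)" using strip_fun[OF z] by metis
  show ?thesis using fourier[OF e(1) e(3) e(4), of v] by (simp add: pr_def)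
qed

end

primrec proj :: "('n, 'm) ix list => (('n, 'm) ix => int) => ('n, 'm) func => ('n, 'm) func" where
  "proj [] \<kappa> F = F"
| "proj (v # vs) \<kappa> F = pr v (\<kappa> v) (proj vs \<kappa> F)"

lemma proj_cong: "(\<And>v. v \<in> set vs ==> \<kappa> v = \<kappa>' v) ==> proj vs \<kappa> F = proj vs \<kappa>' F"
  by (induction vs) auto

lemma proj_holo_per: "holo_on F (P t) ==> per t F ==> holo_on (proj vs \<kappa> F) (P t) \<and> per t (proj vs \<kappa> F)"
  by (induction vs) (simp_all add: pr_holo pr_per)

lemma proj_bound: "holo_on F (P t) ==> per t F ==> (\<And>z. z \<in> P t ==> cmod (F z) <= M) ==> z \<in> P t ==> cmod (proj vs \<kappa> F z) <= M"
proof (induction vs arbitrary: z)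
  case (Cons v vs)
  have "holo_on (proj vs \<kappa> F) (P t)" "per t (proj vs \<kappa> F)" using proj_holo_per[OF Cons.prems(1,2)] by auto
  then show ?case using Cons by (auto intro: pr_bound)
qed simp

lemma proj_hom: "holo_on F (P t) ==> per t F ==> v \<in> set vs ==> hom (fv v) (\<kappa> v) (P t) (proj vs \<kappa> F)"
  by (induction vs) (auto simp: pr_hom pr_hom_other proj_holo_per)

text \<open>The rotations in directions not yet projected remain free parameters \<eta>, so that
  \<open>fc_bound\<close> can shift the contour in the next direction. Each projection then
  contributes its own exponential factor.\<close>

lemma proj_decay:
  assumes F: "holo_on F (P t)" "per t F" and e: "0 <= e" "e < e'" "\<And>\<eta>. (\<And>i. \<bar>Im (\<eta> i)\<bar> < e') ==> rot \<eta> z \<in> P t"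
    and M: "\<And>\<eta>. (\<And>i. \<bar>Re (\<eta> i)\<bar> <= pi \<and> \<bar>Im (\<eta> i)\<bar> <= e) ==> cmod (F (rot \<eta> z)) <= M"
    and "distinct vs" "\<And>i. \<bar>Re (\<eta> i)\<bar> <= pi \<and> \<bar>Im (\<eta> i)\<bar> <= e" "\<And>v. v \<in> set vs ==> \<eta> v = 0"
  shows "cmod (proj vs \<kappa> F (rot \<eta> z)) <= M * exp (- e * (\<Sum>v\<in>set vs. \<bar>real_of_int (\<kappa> v)\<bar>))"
  using assms(7-)
proof (induction vs arbitrary: \<eta>)
  case Nil
  then show ?case using M[of \<eta>] by simp
next
  case (Cons v vs)
  define G where "G = proj vs \<kappa> F"
  have G: "holo_on G (P t)" "per t G" using proj_holo_per[OF F] by (auto simp: G_def)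
  have upd: "rota (fv v) w (rot \<eta> z) = rot (\<eta>(v := w)) z" for w
  proof -
    have "(\<lambda>i. w * of_int (fv v i) + \<eta> i) = \<eta>(v := w)" using Cons.prems(3)[of v] by (auto simp: fv_def)
    then show ?thesis by (simp add: rot_rot)
  qed
  have inP: "rot (\<eta>(v := w)) z \<in> P t" if "\<bar>Im w\<bar> < e'" for w
    using Cons.prems(2) e(2) that by (intro e(3)) (auto intro: le_less_trans)
  have "cmod (fc (\<lambda>w. G (rota (fv v) w (rot \<eta> z))) (\<kappa> v)) <=
     (M * exp (- e * (\<Sum>v\<in>set vs. \<bar>real_of_int (\<kappa> v)\<bar>))) * exp (- e * \<bar>real_of_int (\<kappa> v)\<bar>)"
  proof (rule fc_bound[OF _ _ e(1,2)])
    show "(\<lambda>w. G (rota (fv v) w (rot \<eta> z))) holomorphic_on box e'"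
      unfolding holomorphic_on_open[OF box(1)]
    proof
      fix w assume "w \<in> box e'"
      then have "rota (fv v) w (rot \<eta> z) \<in> P t" unfolding upd by (intro inP) (simp add: box_def)
      then show "\<exists>f'. ((\<lambda>w. G (rota (fv v) w (rot \<eta> z))) has_field_derivative f') (at w)"
      using rot_curve[OF G(1)] by blast
    qed
    show "G (rota (fv v) (Complex pi y) (rot \<eta> z)) = G (rota (fv v) (Complex (- pi) y) (rot \<eta> z))" if "\<bar>y\<bar> < e'" for y
    proof -
      have "rota (fv v) (Complex (- pi) y) (rot \<eta> z) \<in> P t" unfolding upd by (intro inP) (use that in simp)
      then have "G (rota (fv v) (of_real (2 * pi)) (rota (fv v) (Complex (- pi) y) (rot \<eta> z))) = G (rota (fv v) (Complex (- pi) y) (rot \<eta> z))"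
      using G(2) unfolding per_def by blast
      moreover have "of_real (2 * pi) + Complex (- pi) y = Complex pi y" by (simp add: complex_eq_iff)
      ultimately show ?thesis unfolding rota_add by simp
    qed
    fix w assume w: "\<bar>Re w\<bar> <= pi" "\<bar>Im w\<bar> <= e"
    show "cmod (G (rota (fv v) w (rot \<eta> z))) <= M * exp (- e * (\<Sum>v\<in>set vs. \<bar>real_of_int (\<kappa> v)\<bar>))"
      unfolding upd G_def using Cons.prems w by (intro Cons.IH) auto
  qed
  moreover have "exp (- e * (\<Sum>v\<in>set (v # vs). \<bar>real_of_int (\<kappa> v)\<bar>)) =
     exp (- e * (\<Sum>v\<in>set vs. \<bar>real_of_int (\<kappa> v)\<bar>)) * exp (- e * \<bar>real_of_int (\<kappa> v)\<bar>)"
    unfolding exp_add[symmetric] using Cons.prems(1) by (simp add: algebra_simps)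
  ultimately show ?case by (simp add: pr_def G_def mult.assoc)
qed

lemma torus_bound:
  assumes F: "holo_on F (P t)" and e: "0 <= e" "e < e'" "\<And>\<eta>. (\<And>i. \<bar>Im (\<eta> i)\<bar> < e') ==> rot \<eta> z \<in> P t"
  obtains M where "\<And>\<eta>. (\<And>i. \<bar>Re (\<eta> i)\<bar> <= pi \<and> \<bar>Im (\<eta> i)\<bar> <= e) ==> cmod (F (rot \<eta> z)) <= M"
proof -
  let ?K = "{\<zeta> :: ('n, 'm) phase. \<forall>i. \<bar>Re (co i \<zeta>)\<bar> <= pi \<and> \<bar>Im (co i \<zeta>)\<bar> <= e}"
  have "?K = (\<Inter>i\<in>UNIV. {\<zeta>. \<bar>Re (co i \<zeta>)\<bar> <= pi} \<inter> {\<zeta>. \<bar>Im (co i \<zeta>)\<bar> <= e})" by blast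
  moreover have "closed (\<Inter>i\<in>UNIV. {\<zeta> :: ('n, 'm) phase. \<bar>Re (co i \<zeta>)\<bar> <= pi} \<inter> {\<zeta>. \<bar>Im (co i \<zeta>)\<bar> <= e})"
    by (intro closed_INT ballI closed_Int closed_Collect_le continuous_intros continuous_on_co)
  ultimately have cl: "closed ?K" by simp
  have "bounded ?K"
    unfolding bounded_iff
  proof (intro exI ballI)
    fix \<zeta> assume \<zeta>: "\<zeta> \<in> ?K"
    have "cmod (co i \<zeta>) <= pi + e" for i
      using \<zeta> cmod_le[of "co i \<zeta>"] by (smt (verit, best) mem_Collect_eq)
    then show "norm \<zeta> <= (\<Sum>i\<in>UNIV. (pi + e) * norm (eb i :: ('n, 'm) phase))"
      by (intro order_trans[OF norm_le_co] sum_mono mult_right_mono) auto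
  qed
  then have cK: "compact ?K" using cl by (simp add: compact_eq_bounded_closed)
  have "continuous_on ?K (\<lambda>\<zeta>. rot (\<lambda>i. co i \<zeta>) z)"
    by (intro continuous_rot continuous_intros continuous_on_co)
  moreover have "(\<lambda>\<zeta>. rot (\<lambda>i. co i \<zeta>) z) ` ?K \<subseteq> P t"
  proof (rule image_subsetI, rule e(3))
    fix \<zeta> i assume "\<zeta> \<in> ?K"
    then have "\<bar>Im (co i \<zeta>)\<bar> <= e" by blast
    then show "\<bar>Im (co i \<zeta>)\<bar> < e'" using e(2) by simp
  qed
  ultimately have "compact ((\<lambda>\<zeta>. F (rot (\<lambda>i. co i \<zeta>) z)) ` ?K)"
    by (intro compact_continuous_image[OF continuous_on_compose2[OF holo_continuous[OF F]] cK])
  then obtain M where M: "\<forall>x\<in>(\<lambda>\<zeta>. F (rot (\<lambda>i. co i \<zeta>) z)) ` ?K. norm x <= M" by (meson bounded_iff compact_imp_bounded)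
  have "cmod (F (rot \<eta> z)) <= M" if "\<And>i. \<bar>Re (\<eta> i)\<bar> <= pi \<and> \<bar>Im (\<eta> i)\<bar> <= e" for \<eta>
  proof -
    have "mk \<eta> \<in> ?K" using that by simp
    then have "norm (F (rot (\<lambda>i. co i (mk \<eta>)) z)) <= M" using M by blast
    then show ?thesis by simp
  qed
  then show ?thesis using that by blast
qed

lemma summable_exp_ix:
  assumes "e > 0"
  shows "(\<lambda>\<kappa>. exp (- e * (\<Sum>v\<in>UNIV. \<bar>real_of_int (\<kappa> (v :: ('n, 'm) ix))\<bar>))) summable_on UNIV"
proof -
  have "(\<lambda>\<kappa> :: ('n, 'm) ix => int. \<Prod>v\<in>UNIV. exp (- e * \<bar>real_of_int (\<kappa> v)\<bar>)) summable_on UNIV"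
    by (rule summable_prod) (use summable_exp_int[OF assms] in auto)
  then show ?thesis by (simp add: exp_sum[symmetric] sum_distrib_left)
qed

text \<open>Summing one direction after another gives an iterated sum. The joint decay of
  \<open>proj_decay\<close> makes the family absolutely summable, which allows the sums to be
  merged.\<close>

lemma proj_sum:
  assumes F: "holo_on F (P t)" "per t F" and z: "z \<in> P t" and "distinct vs"
  shows "((\<lambda>\<kappa>. proj vs \<kappa> F z) has_sum F z) {\<kappa>. \<forall>v. v \<notin> set vs \<longrightarrow> \<kappa> v = 0}"
proof -
  obtain e' where e': "e' > 0" "\<And>\<eta>. (\<And>i. \<bar>Im (\<eta> i)\<bar> < e') ==> rot \<eta> z \<in> P t" using rot_nhd[OF z] by metis
  define e where "e = e' / 2"
  have e: "0 < e" "e < e'" using e' by (auto simp: e_def)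
  obtain M where M: "\<And>\<eta>. (\<And>i. \<bar>Re (\<eta> i)\<bar> <= pi \<and> \<bar>Im (\<eta> i)\<bar> <= e) ==> cmod (F (rot \<eta> z)) <= M"
    using torus_bound[OF F(1) _ e(2) e'(2)] e(1) by (metis less_imp_le)
  let ?S = "\<lambda>vs. {\<kappa> :: ('n, 'm) ix => int. \<forall>v. v \<notin> set vs \<longrightarrow> \<kappa> v = 0}"
  have dec: "cmod (proj vs \<kappa> F z) <= M * exp (- e * (\<Sum>v\<in>UNIV. \<bar>real_of_int (\<kappa> v)\<bar>))" if "distinct vs" "\<kappa> \<in> ?S vs" for vs \<kappa>
  proof -
    have "cmod (proj vs \<kappa> F (rot (\<lambda>_. 0) z)) <= M * exp (- e * (\<Sum>v\<in>set vs. \<bar>real_of_int (\<kappa> v)\<bar>))"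
      by (rule proj_decay[OF F less_imp_le[OF e(1)] e(2) e'(2) M that(1)]) (use e in auto)
    also have "(\<Sum>v\<in>set vs. \<bar>real_of_int (\<kappa> v)\<bar>) = (\<Sum>v\<in>UNIV. \<bar>real_of_int (\<kappa> v)\<bar>)"
      by (rule sum.mono_neutral_left) (use that(2) in auto)
    finally show ?thesis by simp
  qed
  have sum: "(\<lambda>\<kappa>. proj vs \<kappa> F z) summable_on ?S vs" if "distinct vs" for vs
    by (rule abs_summable_summable, rule summable_on_comparison_test[OF summable_on_subset_banach[OF summable_on_cmult_right[OF summable_exp_ix[OF e(1)], of M]]])
      (use dec[OF that] in auto)
  show ?thesis using \<open>distinct vs\<close>
  proof (induction vs)
    case Nil
    have "{\<kappa> :: ('n, 'm) ix => int. \<forall>v. v \<notin> set [] \<longrightarrow> \<kappa> v = 0} = {\<lambda>_. 0}" by auto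
    then show ?case by (simp add: has_sum_finite_iff)
  next
    case (Cons v vs)
    let ?h = "\<lambda>(\<kappa> :: ('n, 'm) ix => int, m). \<kappa>(v := m)"
    have b: "bij_betw ?h (?S vs \<times> UNIV) (?S (v # vs))"
    proof (rule bij_betwI[of _ _ _ "\<lambda>\<kappa>. (\<kappa>(v := 0), \<kappa> v)"])
      show "?h \<in> ?S vs \<times> UNIV \<rightarrow> ?S (v # vs)" by auto
      show "(\<lambda>\<kappa>. (\<kappa>(v := 0), \<kappa> v)) \<in> ?S (v # vs) \<rightarrow> ?S vs \<times> UNIV" by auto
      show "(\<lambda>\<kappa>. (\<kappa>(v := 0), \<kappa> v)) (?h x) = x" if "x \<in> ?S vs \<times> UNIV" for x
      proof -
      obtain \<kappa> m where x: "x = (\<kappa>, m)" by fastforce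
      then have "\<kappa> v = 0" using that Cons.prems by auto
      then show ?thesis by (auto simp: x)
      qed
    qed auto
    have e: "proj (v # vs) (?h x) F z = pr v (snd x) (proj vs (fst x) F) z" for x
    proof -
      have "proj vs ((fst x)(v := snd x)) F = proj vs (fst x) F"
      by (rule proj_cong) (use Cons.prems in auto)
      then show ?thesis by (simp add: case_prod_unfold)
    qed
    have s: "(\<lambda>x. pr v (snd x) (proj vs (fst x) F) z) summable_on ?S vs \<times> UNIV"
      using sum[OF Cons.prems] unfolding summable_on_reindex_bij_betw[OF b, of "\<lambda>\<kappa>. proj (v # vs) \<kappa> F z", symmetric] e .
    have "((\<lambda>x. pr v (snd x) (proj vs (fst x) F) z) has_sum F z) (?S vs \<times> UNIV)"
    proof (rule has_sum_SigmaI[OF _ _ s, of "\<lambda>\<kappa>. proj vs \<kappa> F z"])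
      show "((\<lambda>\<kappa>. proj vs \<kappa> F z) has_sum F z) (?S vs)" using Cons by simp
      fix \<kappa>
      have "((\<lambda>m. pr v m (proj vs \<kappa> F) z) has_sum proj vs \<kappa> F z) UNIV"
      using pr_sum[OF conjunct1[OF proj_holo_per[OF F]] conjunct2[OF proj_holo_per[OF F]] z] .
      then show "((\<lambda>y. pr v (snd (\<kappa>, y)) (proj vs (fst (\<kappa>, y)) F) z) has_sum proj vs \<kappa> F z) UNIV" by simp
    qed
    then show ?case unfolding has_sum_reindex_bij_betw[OF b, of "\<lambda>\<kappa>. proj (v # vs) \<kappa> F z", symmetric] e .
  qed
qed

lemma fine_expansion:
  assumes F: "holo_on F (P t)" "per t F"
  obtains G where "\<And>\<kappa>. holo_on (G \<kappa>) (P t)" "\<And>\<kappa> v. hom (fv v) (\<kappa> v) (P t) (G \<kappa>)"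
    "\<And>M \<kappa> z. (\<And>z. z \<in> P t ==> cmod (F z) <= M) ==> z \<in> P t ==> cmod (G \<kappa> z) <= M"
    "\<And>z. z \<in> P t ==> ((\<lambda>\<kappa>. G \<kappa> z) has_sum F z) UNIV"
proof -
  obtain vs where vs: "set vs = (UNIV :: ('n, 'm) ix set)" "distinct vs"
    using finite_distinct_list[of "UNIV :: ('n, 'm) ix set"] finite by blast
  show ?thesis
  proof (rule that[of "\<lambda>\<kappa>. proj vs \<kappa> F"])
    show "((\<lambda>\<kappa>. proj vs \<kappa> F z) has_sum F z) UNIV" if "z \<in> P t" for z
      using proj_sum[OF F that vs(2)] by (simp add: vs(1))
  qed (use F vs proj_hom proj_bound proj_holo_per in auto)
qed

end

subsection \<open>Taylor--Fourier expansions\<close>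

lemma root_sum:
  fixes m :: int
  assumes n: "n > (0::nat)"
  shows "(\<Sum>l<n. exp (\<i> * of_int m * of_real (2 * pi * real l / real n))) = (if int n dvd m then of_nat n else 0)"
proof -
  define w where "w = exp (\<i> * of_int m * of_real (2 * pi / real n))"
  have e: "exp (\<i> * of_int m * of_real (2 * pi * real l / real n)) = w ^ l" for l
    unfolding w_def exp_of_nat_mult[symmetric] by (simp add: mult_ac)
  have wn: "w ^ n = 1"
  proof -
    have "w ^ n = exp (\<i> * of_int m * of_real (2 * pi))"
      unfolding w_def exp_of_nat_mult[symmetric] using n by (simp add: field_simps)
    also have "... = exp 0" unfolding exp_eq by (intro exI[of _ m]) (simp add: algebra_simps)
    finally show ?thesis by simp
  qed
  have "w = 1 \<longleftrightarrow> int n dvd m"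
  proof
    assume "w = 1"
    then have "exp (\<i> * of_int m * of_real (2 * pi / real n)) = exp 0" by (simp add: w_def)
    then obtain k :: int where "\<i> * of_int m * of_real (2 * pi / real n) = of_int (2 * k) * of_real pi * \<i>"
      unfolding exp_eq by auto
    then have "(of_int m :: complex) = of_real (real_of_int k * real n)" using n by (simp add: field_simps)
    then have "m = k * int n" by (metis of_int_eq_iff of_int_mult of_int_of_nat_eq of_real_of_int_eq)
    then show "int n dvd m" by simp
  next
    assume "int n dvd m"
    then obtain k where k: "m = int n * k" by (auto simp: dvd_def)
    have "exp (\<i> * of_int m * of_real (2 * pi / real n)) = exp 0"
      unfolding exp_eq by (intro exI[of _ k]) (use n in \<open>simp add: k\<close>)
    then show "w = 1" by (simp add: w_def)
  qed
  then show ?thesis using wn n unfolding e by (simp add: sum_gp_strict)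
qed

text \<open>Averaging over rotations by n-th roots of unity keeps exactly the terms whose degrees
  agree with that of i modulo n. Such finite averages commute with \<open>has_sum\<close> at once,
  whereas integrals would need uniformity along the orbit. If F i z were not 0, some finite X would
  carry all but less than |F i z| of the absolute sum; for large n only i survives in X, and the
  averaged sum cannot be 0.\<close>

lemma graded_unique:
  fixes F :: "'i => ('n::finite, 'm::finite) func" and a :: "'v::finite => ('n, 'm) ix => int"
  assumes h: "\<And>i v. hom (a v) (deg i v) S (F i)" and "inj deg" and S: "rinv S"
    and sum: "\<And>z. z \<in> S ==> ((\<lambda>i. F i z) has_sum 0) UNIV" and z: "z \<in> S"
  shows "F i z = 0"
proof (rule ccontr)
  assume nz: "F i z \<noteq> 0"
  have av: "((\<lambda>j. if \<forall>v\<in>W. int n dvd (deg j v - deg i v) then F j z else 0) has_sum 0) UNIV"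
    if n: "n > 0" and z: "z \<in> S" for n W z
  proof -
    have "finite W" by simp
    then show ?thesis using z
    proof (induction W arbitrary: z rule: finite_induct)
      case empty
      then show ?case using sum by simp
    next
      case (insert v W)
      let ?c = "\<lambda>W j. \<forall>v\<in>W. int n dvd (deg j v - deg i v)"
      let ?x = "\<lambda>l. 2 * pi * real l / real n"
      have "((\<lambda>j. \<Sum>l<n. exp (- (\<i> * of_int (deg i v) * of_real (?x l))) * (if ?c W j then F j (rota (a v) (of_real (?x l)) z) else 0))
      has_sum (\<Sum>l<n. exp (- (\<i> * of_int (deg i v) * of_real (?x l))) * 0)) UNIV"
      by (intro has_sum_sum_commute has_sum_cmult_right insert.IH rinvD[OF S insert.prems])
      moreover have "(\<Sum>l<n. exp (- (\<i> * of_int (deg i v) * of_real (?x l))) * (if ?c W j then F j (rota (a v) (of_real (?x l)) z) else 0))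
      = of_nat n * (if ?c (insert v W) j then F j z else 0)" for j
      proof -
      have "exp (- (\<i> * of_int (deg i v) * of_real (?x l))) * (if ?c W j then F j (rota (a v) (of_real (?x l)) z) else 0)
      = exp (\<i> * of_int (deg j v - deg i v) * of_real (?x l)) * (if ?c W j then F j z else 0)" for l
      proof -
      have "F j (rota (a v) (of_real (?x l)) z) = exp (\<i> * of_int (deg j v) * of_real (?x l)) * F j z"
      using h insert.prems unfolding hom_def by blast
      moreover have "exp (- (\<i> * of_int (deg i v) * of_real (?x l))) * exp (\<i> * of_int (deg j v) * of_real (?x l))
      = exp (\<i> * of_int (deg j v - deg i v) * of_real (?x l))"
      unfolding exp_add[symmetric] by (simp add: left_diff_distrib right_diff_distrib diff_divide_distrib)
      ultimately have "exp (- (\<i> * of_int (deg i v) * of_real (?x l))) * F j (rota (a v) (of_real (?x l)) z) =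
      exp (\<i> * of_int (deg j v - deg i v) * of_real (?x l)) * F j z"
      by (simp only: mult.assoc[symmetric])
      then show ?thesis by (cases "?c W j") (simp_all only: if_P if_not_P mult_zero_right simp_thms)
      qed
      then have "(\<Sum>l<n. exp (- (\<i> * of_int (deg i v) * of_real (?x l))) * (if ?c W j then F j (rota (a v) (of_real (?x l)) z) else 0))
      = (\<Sum>l<n. exp (\<i> * of_int (deg j v - deg i v) * of_real (?x l))) * (if ?c W j then F j z else 0)"
      by (simp only: sum_distrib_right)
      then show ?thesis unfolding root_sum[OF n] by auto
      qed
      ultimately have "((\<lambda>j. of_nat n * (if ?c (insert v W) j then F j z else 0)) has_sum 0) UNIV" by simp
      from has_sum_cmult_right[OF this, of "1 / of_nat n"] show ?case using n by simp
    qed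
  qed
  have abs: "(\<lambda>j. cmod (F j z)) summable_on UNIV"
    using sum[OF z] summable_on_iff_abs_summable_on_complex[of "\<lambda>j. F j z" UNIV] has_sum_imp_summable by blast
  then have "((\<lambda>j. cmod (F j z)) has_sum infsum (\<lambda>j. cmod (F j z)) UNIV) UNIV" by simp
  then have "\<forall>\<^sub>F X in finite_subsets_at_top UNIV. dist (\<Sum>j\<in>X. cmod (F j z)) (infsum (\<lambda>j. cmod (F j z)) UNIV) < cmod (F i z)"
    unfolding has_sum_def tendsto_iff using nz by simp
  then obtain X0 where X0: "finite X0" "\<And>X. finite X ==> X0 \<subseteq> X ==> dist (\<Sum>j\<in>X. cmod (F j z)) (infsum (\<lambda>j. cmod (F j z)) UNIV) < cmod (F i z)"
    unfolding eventually_finite_subsets_at_top by auto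
  define X where "X = insert i X0"
  have X: "finite X" "dist (\<Sum>j\<in>X. cmod (F j z)) (infsum (\<lambda>j. cmod (F j z)) UNIV) < cmod (F i z)"
    using X0 by (auto simp: X_def)
  \<comment> \<open>Larger than every difference of degrees between i and a member of X, so that
    congruence modulo n forces equality there.\<close>
  define n where "n = Suc (\<Sum>j\<in>X. \<Sum>v\<in>UNIV. nat \<bar>deg j v - deg i v\<bar>)"
  have small: "j = i" if "j \<in> X" "\<forall>v\<in>UNIV. int n dvd (deg j v - deg i v)" for j
  proof -
    have "deg j v = deg i v" for v
    proof (rule ccontr)
      assume ne: "deg j v \<noteq> deg i v"
      have "nat \<bar>deg j v - deg i v\<bar> <= (\<Sum>v\<in>UNIV. nat \<bar>deg j v - deg i v\<bar>)"
      by (rule member_le_sum) auto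
      also have "... <= (\<Sum>j\<in>X. \<Sum>v\<in>UNIV. nat \<bar>deg j v - deg i v\<bar>)"
      by (rule member_le_sum[OF that(1) _ X(1)]) auto
      finally have "nat \<bar>deg j v - deg i v\<bar> < n" unfolding n_def by (rule le_imp_less_Suc)
      then have "\<bar>deg j v - deg i v\<bar> < int n" by linarith
      moreover have "int n <= \<bar>deg j v - deg i v\<bar>"
      using dvd_imp_le_int[of "deg j v - deg i v" "int n"] that(2) ne by simp
      ultimately show False by simp
    qed
    then show ?thesis using \<open>inj deg\<close> by (meson ext injD)
  qed
  let ?f = "\<lambda>j. if \<forall>v\<in>UNIV. int n dvd (deg j v - deg i v) then F j z else 0"
  have f0: "(?f has_sum 0) UNIV" by (rule av[OF _ z]) (simp add: n_def)
  have fX: "(?f has_sum F i z) X"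
  proof -
    have "(\<Sum>j\<in>X. ?f j) = (\<Sum>j\<in>{i}. ?f j)"
      by (rule sum.mono_neutral_right[OF X(1)]) (use small in \<open>auto simp: X_def\<close>)
    then show ?thesis using X(1) by (simp add: has_sum_finite_iff)
  qed
  have fc: "(?f has_sum (0 - F i z)) (UNIV - X)" by (rule has_sum_Diff[OF f0 fX]) simp
  have absX: "((\<lambda>j. cmod (F j z)) has_sum (infsum (\<lambda>j. cmod (F j z)) UNIV - (\<Sum>j\<in>X. cmod (F j z)))) (UNIV - X)"
    by (rule has_sum_Diff[OF has_sum_infsum[OF abs]]) (use X(1) in \<open>auto simp: has_sum_finite\<close>)
  have "cmod (0 - F i z) <= infsum (\<lambda>j. cmod (F j z)) UNIV - (\<Sum>j\<in>X. cmod (F j z))"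
    by (rule norm_infsum_le[OF fc absX]) auto
  then show False using X(2) by (simp add: dist_real_def)
qed

text \<open>The degree of an expansion term under the rotations \<open>fv\<close> of single
  coordinates. It determines the term (\<open>inj_kap\<close>), in contrast to the degree
  \<open>cdg\<close> of the symplectic action.\<close>

fun kap :: "('n::finite, 'm::finite) mindex => ('n, 'm) ix => int" where
  "kap (k, h, j) (CT i) = k $ i"
| "kap (k, h, j) (CP i) = int (h $ i)"
| "kap (k, h, j) (CQ i) = int (j $ i)"
| "kap (k, h, j) _ = 0"

lemma inj_kap: "inj (kap :: ('n::finite, 'm::finite) mindex => _)"
proof (rule injI)
  fix nu nu' :: "('n, 'm) mindex" assume e: "kap nu = kap nu'"
  obtain k h j k' h' j' where nu: "nu = (k, h, j)" "nu' = (k', h', j')" by (metis prod.exhaust)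
  have "k $ i = k' $ i" for i using fun_cong[OF e, of "CT i"] by (simp add: nu)
  moreover have "h $ i = h' $ i" "j $ i = j' $ i" for i
    using fun_cong[OF e, of "CP i"] fun_cong[OF e, of "CQ i"] by (simp_all add: nu)
  ultimately show "nu = nu'" by (simp add: nu vec_eq_iff)
qed

lemma range_kap:
  assumes "\<And>i. \<kappa> (CI i) = 0" "\<kappa> CY = 0" "\<kappa> CX = 0" "\<And>i. 0 <= \<kappa> (CP i)" "\<And>i. 0 <= \<kappa> (CQ i)"
  shows "\<kappa> \<in> range (kap :: ('n::finite, 'm::finite) mindex => _)"
proof
  show "\<kappa> = kap ((\<chi> i. \<kappa> (CT i)), (\<chi> i. nat (\<kappa> (CP i))), (\<chi> i. nat (\<kappa> (CQ i))))"
  proof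
    fix v show "\<kappa> v = kap ((\<chi> i. \<kappa> (CT i)), (\<chi> i. nat (\<kappa> (CP i))), (\<chi> i. nat (\<kappa> (CQ i)))) v"
      using assms by (cases v) auto
  qed
qed simp

fun uu :: "('n::finite, 'm::finite) phase => (complex ^ 'n) \<times> complex \<times> complex" where
  "uu (I, \<theta>, p, q, y, x) = (I, y, x)"

fun mono :: "('n::finite, 'm::finite) mindex => ('n, 'm) phase => complex" where
  "mono (k, h, j) z = exp (\<i> * (\<Sum>i\<in>UNIV. of_int (k $ i) * co (CT i) z)) *
     (\<Prod>i\<in>UNIV. co (CP i) z ^ (h $ i)) * (\<Prod>i\<in>UNIV. co (CQ i) z ^ (j $ i))"

lemma tf_term_mono: "tf_term a z nu = a nu (uu z) * mono nu z"
  by (cases z; cases nu) (simp add: mult.assoc)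

lemma uu_eqI: "(\<And>i. co (CI i) z = co (CI i) z') ==> co CY z = co CY z' ==> co CX z = co CX z' ==> uu z = uu z'"
  by (cases z; cases z') (simp add: vec_eq_iff)

lemma uu_rot [simp]: "uu (rot \<eta> z) = uu z"
  by (rule uu_eqI) (simp_all add: co_rot)

lemma holo_mono: "holo_on (mono nu) S"
proof -
  obtain k h j where nu: "nu = (k, h, j)" by (metis prod.exhaust)
  show ?thesis unfolding nu mono.simps[abs_def] by (intro holo_intros)
qed

lemma mono_rota: "mono nu (rota (fv v) w z) = exp (\<i> * of_int (kap nu v) * w) * mono nu z"
proof -
  obtain k h j where nu: "nu = (k, h, j)" by (metis prod.exhaust)
  have e: "exp (\<i> * c) ^ n = exp (\<i> * of_int (int n) * c)" for n c
    using exp_of_nat_mult[of n "\<i> * c"] by (simp add: mult_ac)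
  show ?thesis
  proof (cases v)
    case (CT l)
    have "(\<Sum>i\<in>UNIV. of_int (k $ i) * co (CT i) (rota (fv v) w z)) =
      (\<Sum>i\<in>UNIV. of_int (k $ i) * co (CT i) z + (if i = l then of_int (k $ l) * w else 0))"
      by (rule sum.cong) (auto simp: co_rot CT fv_def algebra_simps)
    then show ?thesis by (simp add: nu CT co_rot fv_def sum.distrib exp_add algebra_simps)
  next
    case (CP l)
    have "(\<Prod>i\<in>UNIV. co (CP i) (rota (fv v) w z) ^ (h $ i)) =
      (\<Prod>i\<in>UNIV. co (CP i) z ^ (h $ i) * (if i = l then exp (\<i> * w) ^ (h $ l) else 1))"
      by (rule prod.cong) (auto simp: co_rot CP fv_def power_mult_distrib)
    then show ?thesis by (simp add: nu CP co_rot fv_def prod.distrib e)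
  next
    case (CQ l)
    have "(\<Prod>i\<in>UNIV. co (CQ i) (rota (fv v) w z) ^ (j $ i)) =
      (\<Prod>i\<in>UNIV. co (CQ i) z ^ (j $ i) * (if i = l then exp (\<i> * w) ^ (j $ l) else 1))"
      by (rule prod.cong) (auto simp: co_rot CQ fv_def power_mult_distrib)
    then show ?thesis by (simp add: nu CQ co_rot fv_def prod.distrib e)
  qed (simp_all add: nu co_rot fv_def)
qed

lemma hom_tf_term: "hom (fv v) (kap nu v) S (\<lambda>z. tf_term a z nu)"
  unfolding hom_def by (simp add: tf_term_mono mono_rota)

section \<open>Modes of the single rotations as terms of the Taylor--Fourier expansion\<close>

context dom begin

text \<open>A reference point with the same I, y, x at which no monomial vanishes. It depends only
  on (I, y, x) and t, so the coefficients read off there are functions of (I, y, x).\<close>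

definition bz :: "real => ('n, 'm) phase => ('n, 'm) phase" where
  "bz t z = mk (\<lambda>i. case i of CT _ => 0 | CP _ => of_real (t * \<delta> / 2) | CQ _ => of_real (t * \<delta> / 2) | _ => co i z)"

lemma mix_P:
  assumes z: "z \<in> P t" and w: "\<And>i. co i w = co i z \<or> co i w = co i (bz t z)"
  shows "w \<in> P t"
proof -
  obtain a b c where abc: "a \<in> II" "b \<in> YY" "c \<in> XX" "\<forall>i. dd a b c z i < t * rad i"
    using z P_iff by blast
  have "0 < t" using P_pos[OF z] .
  have \<tau>: "cmod (of_real (t * \<delta> / 2)) < t * \<delta>" using \<open>0 < t\<close> pos by (subst norm_of_real) simp
  have "dd a b c w i < t * rad i" for i
    using w[of i] abc(4)[rule_format, of i] \<tau> \<open>0 < t\<close> pos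
    by (cases i) (auto simp: bz_def simp del: of_real_mult of_real_divide norm_of_real)
  then show ?thesis unfolding P_iff using abc(1-3) by blast
qed

context
  fixes G :: "('n, 'm) func" and \<kappa> :: "('n, 'm) ix => int" and t :: real
  assumes G: "holo_on G (P t)" "\<And>v. hom (fv v) (\<kappa> v) (P t) G"
begin

text \<open>A degree outside the range of \<open>kap\<close> is nonzero in a direction that acts
  trivially, or negative in some p or q. In the first case rotation by pi over the degree changes
  the sign of G z without moving z. In the second, imaginary rotations send the coordinate to 0,
  where G has a finite limit, while homogeneity would make it grow exponentially.\<close>

lemma fine_zero: assumes z: "z \<in> P t" and \<kappa>: "\<kappa> \<notin> range kap" shows "G z = 0"
proof -
  have inert: "G z = 0" if "\<kappa> v \<noteq> 0" "\<And>w. rota (fv v) w z = z" for v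
  proof -
    have "G (rota (fv v) (of_real (pi / \<kappa> v)) z) = exp (\<i> * of_int (\<kappa> v) * of_real (pi / \<kappa> v)) * G z"
      using G(2)[of v] z unfolding hom_def by blast
    moreover have "\<i> * of_int (\<kappa> v) * of_real (pi / \<kappa> v) = \<i> * of_real pi"
      using that(1) by (simp add: field_simps)
    ultimately have "G z = exp (\<i> * of_real pi) * G z" unfolding that(2) by metis
    then show ?thesis by simp
  qed
  have neg: "G z = 0" if "\<kappa> v < 0" and v: "(\<exists>i. v = CP i) \<or> (\<exists>i. v = CQ i)" for v
  proof -
    define z0 where "z0 = z - cscale (co v z) (eb v)"
    have r: "rota (fv v) (\<i> * of_real y) z = z0 + cscale (of_real (exp (- y))) (cscale (co v z) (eb v))" for y
    proof (rule phase_eqI)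
      fix i
      have "exp (\<i> * (\<i> * of_real y)) = of_real (exp (- y))" by (simp add: exp_of_real[symmetric] mult.assoc[symmetric])
      then show "co i (rota (fv v) (\<i> * of_real y) z) = co i (z0 + cscale (of_real (exp (- y))) (cscale (co v z) (eb v)))"
      using v by (cases i) (auto simp: co_rot fv_def z0_def co_eb algebra_simps)
    qed
    have t: "0 < t" using P_pos[OF z] .
    have inP: "rota (fv v) (\<i> * of_real y) z \<in> P t" if "y \<ge> 0" for y
      by (rule rot_in[OF z order_refl]) (use v that t in \<open>auto simp: fv_def\<close>)
    have z0P: "z0 \<in> P t"
    proof -
      obtain a b c where abc: "a \<in> II" "b \<in> YY" "c \<in> XX" "\<forall>i. dd a b c z i < t * rad i"
      using z P_iff by blast
      have "dd a b c z0 i < t * rad i" for i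
      using abc(4)[rule_format, of i] v t pos by (cases i) (auto simp: z0_def co_eb)
      then show ?thesis unfolding P_iff using abc(1-3) by blast
    qed
    have "((\<lambda>y::real. exp (- y)) \<longlongrightarrow> 0) at_top" by (intro filterlim_compose[OF exp_at_bot] filterlim_uminus_at_bot_at_top)
    then have "((\<lambda>y. z0 + cscale (of_real (exp (- y))) (cscale (co v z) (eb v))) \<longlongrightarrow> z0 + cscale (of_real 0) (cscale (co v z) (eb v))) at_top"
      by (intro tendsto_intros bounded_linear.tendsto[OF bounded_linear_cscale_left])
    then have "((\<lambda>y. rota (fv v) (\<i> * of_real y) z) \<longlongrightarrow> z0) at_top" unfolding r by simp
    then have "((\<lambda>y. G (rota (fv v) (\<i> * of_real y) z)) \<longlongrightarrow> G z0) at_top"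
      using holo_at(1)[OF G(1) z0P] has_derivative_continuous isCont_tendsto_compose by blast
    moreover have "((\<lambda>y. exp (of_int (\<kappa> v) * of_real y :: complex)) \<longlongrightarrow> 0) at_top"
    proof (rule tendsto_norm_zero_cancel)
      have "filterlim (\<lambda>y. real_of_int (\<kappa> v) * y) at_bot at_top"
      using that(1) by (intro filterlim_tendsto_neg_mult_at_bot[OF tendsto_const _ filterlim_ident]) auto
      then have "((\<lambda>y. exp (real_of_int (\<kappa> v) * y)) \<longlongrightarrow> 0) at_top" by (rule filterlim_compose[OF exp_at_bot])
      then show "((\<lambda>y. cmod (exp (of_int (\<kappa> v) * of_real y))) \<longlongrightarrow> 0) at_top" by simp
    qed
    ultimately have "((\<lambda>y. exp (of_int (\<kappa> v) * of_real y) * G (rota (fv v) (\<i> * of_real y) z)) \<longlongrightarrow> 0 * G z0) at_top"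
      by (intro tendsto_mult)
    moreover have "\<forall>\<^sub>F y in at_top. exp (of_int (\<kappa> v) * of_real y) * G (rota (fv v) (\<i> * of_real y) z) = G z"
      using eventually_ge_at_top[of 0]
    proof eventually_elim
      case (elim y)
      have "G (rota (fv v) (\<i> * of_real y) z) = exp (\<i> * of_int (\<kappa> v) * (\<i> * of_real y)) * G z"
      by (rule hom_complex[OF G(2) G(1) z inP[OF elim]])
      moreover have "exp (of_int (\<kappa> v) * of_real y) * exp (\<i> * of_int (\<kappa> v) * (\<i> * of_real y)) = 1"
      unfolding exp_add[symmetric] by (simp add: algebra_simps)
      ultimately show ?case by (simp only: mult.assoc[symmetric] mult_1)
    qed
    ultimately have "((\<lambda>y::real. G z) \<longlongrightarrow> 0) at_top" using Lim_transform_eventually by fastforce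
    then show ?thesis using tendsto_unique[OF trivial_limit_at_top_linorder tendsto_const] by metis
  qed
  have in0: "rota (fv (CI i)) w z = z" "rota (fv CY) w z = z" "rota (fv CX) w z = z" for i w
    by (rule phase_eqI, simp add: co_rot fv_def split: ix.split)+
  show ?thesis
  proof (rule ccontr)
    assume nz: "G z \<noteq> 0"
    have "\<kappa> (CI i) = 0" "\<kappa> CY = 0" "\<kappa> CX = 0" for i using inert in0 nz by blast+
    moreover have "0 <= \<kappa> (CP i)" "0 <= \<kappa> (CQ i)" for i using neg[of "CP i"] neg[of "CQ i"] nz by force+
    ultimately show False using range_kap \<kappa> by blast
  qed
qed

text \<open>If no p or q coordinate vanishes, z is reached from \<open>bz t z\<close> by complex
  rotations, one coordinate at a time, and each multiplies G and the monomial by the same factor.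
  For fixed base points the domain restricts every coordinate separately, so the intermediate points
  stay inside (\<open>mix_P\<close>).\<close>

lemma fine_mono_nz:
  assumes z: "z \<in> P t" and \<kappa>: "\<kappa> = kap (k, h, j)" and nz: "\<And>i. co (CP i) z \<noteq> 0" "\<And>i. co (CQ i) z \<noteq> 0"
  shows "G z * mono (k, h, j) (bz t z) = G (bz t z) * mono (k, h, j) z"
proof -
  have t: "0 < t" using P_pos[OF z] .
  \<comment> \<open>For p and q the logarithm solves
    \<open>co i (bz t z) * exp (\<i> * \<eta> i) = co i z\<close>; the angles start from 0 and are
    simply added.\<close>
  define \<eta> where "\<eta> i = (case i of CT _ => co i z | CP _ => - \<i> * Ln (co i z / of_real (t * \<delta> / 2))
    | CQ _ => - \<i> * Ln (co i z / of_real (t * \<delta> / 2)) | _ => 0)" for i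
  let ?W = "\<lambda>W i. if i \<in> W then \<eta> i else 0"
  have r: "co i (rot (?W W) (bz t z)) = (if i \<in> W then co i z else co i (bz t z))" for W i
    using nz t pos by (cases i) (auto simp: co_rot \<eta>_def bz_def mult.assoc[symmetric])
  have inP: "rot (?W W) (bz t z) \<in> P t" for W by (rule mix_P[OF z]) (simp add: r)
  have st: "rot (?W (insert v W)) (bz t z) = rota (fv v) (\<eta> v) (rot (?W W) (bz t z))" if "v \<notin> W" for v W
  proof -
    have "?W (insert v W) = (\<lambda>i. \<eta> v * of_int (fv v i) + ?W W i)" using that by (auto simp: fv_def)
    then show ?thesis by (simp add: rot_rot)
  qed
  have "finite (UNIV :: ('n, 'm) ix set)" by simp
  then have "G (rot (?W UNIV) (bz t z)) * mono (k, h, j) (bz t z) = G (bz t z) * mono (k, h, j) (rot (?W UNIV) (bz t z))"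
  proof (induction rule: finite_induct)
    case (insert v W)
    have "G (rota (fv v) (\<eta> v) (rot (?W W) (bz t z))) = exp (\<i> * of_int (\<kappa> v) * \<eta> v) * G (rot (?W W) (bz t z))"
      by (rule hom_complex[OF G(2) G(1) inP]) (use inP[of "insert v W"] st[OF insert(2)] in simp)
    then show ?case unfolding st[OF insert(2)] mono_rota using insert(3) by (simp add: \<kappa> mult_ac)
  qed simp
  moreover have "rot (?W UNIV) (bz t z) = z" by (rule phase_eqI) (use r[of _ UNIV] in simp)
  ultimately show ?thesis by simp
qed

text \<open>Zero coordinates are moved to eps > 0 and eps tends to 0; the reference point does not
  change, and both sides are continuous at z.\<close>

lemma fine_mono:
  assumes z: "z \<in> P t" and \<kappa>: "\<kappa> = kap (k, h, j)"
  shows "G z * mono (k, h, j) (bz t z) = G (bz t z) * mono (k, h, j) z"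
proof -
  define e where "e = (mk (\<lambda>i. if ((\<exists>j. i = CP j) \<or> (\<exists>j. i = CQ j)) \<and> co i z = 0 then 1 else 0) :: ('n, 'm) phase)"
  let ?z = "\<lambda>eps::real. z + cscale (of_real eps) e"
  have lim: "((\<lambda>eps. ?z eps) \<longlongrightarrow> z + cscale (of_real 0) e) (at_right 0)"
    by (intro tendsto_intros bounded_linear.tendsto[OF bounded_linear_cscale_left])
  have ev: "\<forall>\<^sub>F eps in at_right 0. ?z eps \<in> P t"
    using topological_tendstoD[OF lim open_P] z by simp
  have b: "bz t (?z eps) = bz t z" for eps by (rule phase_eqI) (auto simp: bz_def e_def split: ix.split)
  have l: "((\<lambda>eps. F (?z eps)) \<longlongrightarrow> F z) (at_right 0)" if "holo_on F (P t)" for F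
  proof -
    have "isCont F z" using holo_at(1)[OF that z] has_derivative_continuous by blast
    moreover have "((\<lambda>eps. ?z eps) \<longlongrightarrow> z) (at_right 0)" using lim by simp
    ultimately show ?thesis by (rule isCont_tendsto_compose)
  qed
  have A: "((\<lambda>eps. G (?z eps) * mono (k, h, j) (bz t z)) \<longlongrightarrow> G z * mono (k, h, j) (bz t z)) (at_right 0)"
    by (intro tendsto_intros l G)
  have B: "((\<lambda>eps. G (bz t z) * mono (k, h, j) (?z eps)) \<longlongrightarrow> G (bz t z) * mono (k, h, j) z) (at_right 0)"
    by (intro tendsto_mult tendsto_const l holo_mono)
  have "\<forall>\<^sub>F eps in at_right 0. G (?z eps) * mono (k, h, j) (bz t z) = G (bz t z) * mono (k, h, j) (?z eps)"
    using ev eventually_at_right_less[of 0]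
  proof eventually_elim
    case (elim eps)
    have "co (CP i) (?z eps) \<noteq> 0" "co (CQ i) (?z eps) \<noteq> 0" for i using elim(2) by (auto simp: e_def)
    from fine_mono_nz[OF elim(1) \<kappa> this] show ?case by (simp add: b)
  qed
  from tendsto_unique[OF trivial_limit_at_right_real Lim_transform_eventually[OF A this] B] show ?thesis .
qed

end

lemma expansion:
  assumes F: "holo_on F (P t)" "per t F" and t: "0 < t"
  obtains a where "tf_expansion DD (ww t) F a" "\<And>nu. holo_on (\<lambda>z. tf_term a z nu) (P t)"
    "\<And>M nu z. (\<And>z. z \<in> P t ==> cmod (F z) <= M) ==> z \<in> P t ==> cmod (tf_term a z nu) <= M"
proof -
  obtain G where G: "\<And>\<kappa>. holo_on (G \<kappa>) (P t)" "\<And>\<kappa> v. hom (fv v) (\<kappa> v) (P t) (G \<kappa>)"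
    "\<And>M \<kappa> z. (\<And>z. z \<in> P t ==> cmod (F z) <= M) ==> z \<in> P t ==> cmod (G \<kappa> z) <= M"
    "\<And>z. z \<in> P t ==> ((\<lambda>\<kappa>. G \<kappa> z) has_sum F z) UNIV"
    using fine_expansion[OF F] by blast
  define base :: "(complex ^ 'n) \<times> complex \<times> complex => ('n, 'm) phase" where
    "base = (\<lambda>(I, y, x). (I, 0, (\<chi> i. of_real (t * \<delta> / 2)), (\<chi> i. of_real (t * \<delta> / 2)), y, x))"
  have base: "base (uu z) = bz t z" for z
    by (cases z) (simp add: base_def bz_def mk_def vec_eq_iff)
  \<comment> \<open>The coefficient is the mode at the reference point over (I, y, x), divided by
    the monomial there; \<open>fine_mono\<close> says that this reproduces the mode
    everywhere.\<close>
  define a where "a nu u = G (kap nu) (base u) / mono nu (base u)" for nu u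
  have nz: "mono nu (bz t z) \<noteq> 0" for nu z
    using t pos by (cases nu) (simp add: bz_def)
  have tm: "tf_term a z nu = G (kap nu) z" if "z \<in> P t" for z nu
  proof -
    obtain k h j where nu: "nu = (k, h, j)" by (metis prod.exhaust)
    show ?thesis
      using fine_mono[OF G(1) G(2) that, of "kap nu" k h j] nz[of nu z]
      by (simp add: tf_term_mono a_def base nu field_simps del: mono.simps)
  qed
  show ?thesis
  proof (rule that[of a])
    show "tf_expansion DD (ww t) F a"
      unfolding tf_expansion_def P_def[symmetric]
    proof
      fix z assume z: "z \<in> P t"
      have "((\<lambda>\<kappa>. G \<kappa> z) has_sum F z) (range kap)"
      using G(4)[OF z] by (rule has_sum_cong_neutral[THEN iffD1, rotated -1]) (use fine_zero[OF G(1) G(2) z] in auto)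
      then have "((\<lambda>nu. G (kap nu) z) has_sum F z) UNIV"
      unfolding has_sum_reindex[OF inj_kap] by (simp add: o_def)
      then show "(tf_term a z has_sum F z) UNIV" using tm[OF z] by (simp cong: has_sum_cong)
    qed
    show "holo_on (\<lambda>z. tf_term a z nu) (P t)" for nu
      by (rule holo_cong[OF open_P _ G(1)[of "kap nu"]]) (simp add: tm)
    show "cmod (tf_term a z nu) <= M" if "\<And>z. z \<in> P t ==> cmod (F z) <= M" "z \<in> P t" for M nu z
      using G(3)[OF that] tm[OF that(2)] by simp
  qed
qed

lemma expansion_unique:
  assumes a: "tf_expansion DD (ww t) F a" and b: "tf_expansion DD (ww t) F b" and z: "z \<in> P t"
  shows "tf_term a z nu = tf_term b z nu"
proof -
  have "(\<lambda>z. tf_term a z nu - tf_term b z nu) z = 0"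
  proof (rule graded_unique[where F = "\<lambda>nu z. tf_term a z nu - tf_term b z nu" and a = fv and deg = kap and S = "P t", OF _ inj_kap rinv_P _ z])
    show "hom (fv v) (kap nu v) (P t) (\<lambda>z. tf_term a z nu - tf_term b z nu)" for nu v
      using hom_tf_term[of v nu "P t" a] hom_tf_term[of v nu "P t" b] unfolding hom_def by (simp add: algebra_simps)
    show "((\<lambda>nu. tf_term a z nu - tf_term b z nu) has_sum 0) UNIV" if "z \<in> P t" for z
    proof -
      have ab: "(tf_term a z has_sum F z) UNIV" "(tf_term b z has_sum F z) UNIV"
      using a b that unfolding tf_expansion_def P_def[symmetric] by blast+
      show ?thesis using has_sum_add[OF ab(1) has_sum_uminusI[OF ab(2)]] by simp
    qed
  qed
  then show ?thesis by simp
qed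

lemma tf_coeff_expansion:
  assumes "tf_expansion DD (ww t) F a" shows "tf_expansion DD (ww t) F (tf_coeff DD (ww t) F)"
  unfolding tf_coeff_def by (rule someI[of "tf_expansion DD (ww t) F", OF assms])

end

subsection \<open>Norms of expansions\<close>

lemma infsum_ennreal:
  assumes "\<And>x. x \<in> A ==> 0 <= f x" "f summable_on A"
  shows "infsum (\<lambda>x. ennreal (f x)) A = ennreal (infsum f A)"
proof -
  have "infsum (\<lambda>x. ennreal (f x)) A = (SUP F\<in>{F. finite F \<and> F \<subseteq> A}. sum (\<lambda>x. ennreal (f x)) F)"
    by (rule nonneg_infsum_complete) simp
  also have "... = (SUP F\<in>{F. finite F \<and> F \<subseteq> A}. ennreal (sum f F))"
    by (rule SUP_cong) (use assms(1) in \<open>auto simp: subset_iff intro!: sum_ennreal\<close>)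
  also have "... = ennreal (infsum f A)"
    by (rule infsum_nonneg_is_SUPREMUM_ennreal[symmetric]) (use assms in auto)
  finally show ?thesis .
qed

lemma ennreal_summable:
  fixes g :: "'a => ennreal"
  assumes fin: "infsum g A < \<infinity>"
  shows "x \<in> A ==> g x < \<infinity>" "(\<lambda>x. enn2real (g x)) summable_on A"
    "infsum (\<lambda>x. enn2real (g x)) A = enn2real (infsum g A)"
proof -
  have sup: "infsum g A = (SUP F\<in>{F. finite F \<and> F \<subseteq> A}. sum g F)"
    by (rule nonneg_infsum_complete) simp
  have le: "sum g F <= infsum g A" if "finite F" "F \<subseteq> A" for F
    unfolding sup by (rule SUP_upper) (use that in simp)
  show g: "g x < \<infinity>" if "x \<in> A" for x
    using le[of "{x}"] that fin by (simp add: le_less_trans)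
  show s: "(\<lambda>x. enn2real (g x)) summable_on A"
  proof (rule nonneg_bdd_above_summable_on)
    show "bdd_above (sum (\<lambda>x. enn2real (g x)) ` {F. F \<subseteq> A \<and> finite F})"
    proof (rule bdd_aboveI2)
      fix F assume F: "F \<in> {F. F \<subseteq> A \<and> finite F}"
      have "ennreal (sum (\<lambda>x. enn2real (g x)) F) = sum g F"
      using F g by (subst sum_ennreal[symmetric]) (auto intro!: sum.cong simp: subset_iff)
      also have "... <= infsum g A" using le F by simp
      finally show "sum (\<lambda>x. enn2real (g x)) F <= enn2real (infsum g A)"
      using fin by (metis enn2real_ennreal enn2real_mono enn2real_nonneg infinity_ennreal_def sum_nonneg)
    qed
  qed simp
  have "ennreal (infsum (\<lambda>x. enn2real (g x)) A) = infsum (\<lambda>x. ennreal (enn2real (g x))) A"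
    by (rule infsum_ennreal[OF _ s, symmetric]) simp
  also have "... = infsum g A" by (rule infsum_cong) (use g in simp)
  finally show "infsum (\<lambda>x. enn2real (g x)) A = enn2real (infsum g A)"
    by (metis enn2real_ennreal enn2real_nonneg infsum_nonneg)
qed

text \<open>The degree under the symplectic action \<open>av\<close>. Many terms share it: factors
  p_i q_i do not change it, and it is 0 exactly for the terms of the average
  (\<open>cdg_zero\<close>).\<close>

fun cdg :: "('n::finite, 'm::finite) mindex => ('n, 'm) ix => int" where
  "cdg (k, h, j) (CT i) = k $ i"
| "cdg (k, h, j) (CQ i) = int (j $ i) - int (h $ i)"
| "cdg (k, h, j) _ = 0"

lemma mono_rota_av: "mono nu (rota (av v) w z) = exp (\<i> * of_int (cdg nu v) * w) * mono nu z"
proof -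
  obtain k h j where nu: "nu = (k, h, j)" by (metis prod.exhaust)
  have r0: "rota (av v) w z = z" if "av v = (\<lambda>_. 0)" for v using that by simp
  show ?thesis
  proof (cases v)
    case (CT i)
    have "av v = fv v" by (auto simp: CT fv_def)
    then show ?thesis using mono_rota[where nu = nu and v = v and w = w and z = z] by (simp add: CT nu)
  next
    case (CQ i)
    have "rota (av v) w z = rota (fv (CQ i)) w (rota (fv (CP i)) (- w) z)"
      unfolding rot_rot by (rule arg_cong[where f = "\<lambda>\<eta>. rot \<eta> z"]) (auto simp: CQ fv_def)
    then have "mono nu (rota (av v) w z) = (exp (\<i> * of_int (int (j $ i)) * w) * exp (\<i> * of_int (int (h $ i)) * (- w))) * mono nu z"
      by (simp only: mono_rota nu kap.simps mult.assoc)
    also have "exp (\<i> * of_int (int (j $ i)) * w) * exp (\<i> * of_int (int (h $ i)) * (- w)) = exp (\<i> * of_int (cdg nu v) * w)"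
      unfolding exp_add[symmetric] by (simp add: nu CQ algebra_simps)
    finally show ?thesis .
  qed (simp_all add: nu r0 fun_eq_iff)
qed

lemma gr_tf_term: "gr S (cdg nu) (\<lambda>z. tf_term a z nu)"
  unfolding gr_def hom_def by (simp add: tf_term_mono mono_rota_av)

definition hsum :: "nat ^ 'm::finite => nat" where "hsum h = (\<Sum>i\<in>UNIV. h $ i)"

lemma summable_hsum:
  assumes "0 <= q" "q < (1::real)" shows "(\<lambda>h :: nat ^ 'm::finite. q ^ hsum h) summable_on UNIV"
proof -
  have "summable (\<lambda>l. norm (q ^ l))" using assms by (simp add: summable_geometric norm_power)
  then have "(\<lambda>l. q ^ l) summable_on (UNIV :: nat set)" by (rule norm_summable_imp_summable_on)
  then have s: "(\<lambda>\<kappa>. \<Prod>i\<in>(UNIV :: 'm set). q ^ \<kappa> i) summable_on UNIV"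
    using assms by (intro summable_prod) auto
  have b: "bij_betw (\<lambda>h :: nat ^ 'm. \<lambda>i. h $ i) UNIV UNIV"
    by (rule bij_betwI[of _ _ _ "\<lambda>f. \<chi> i. f i"]) auto
  show ?thesis
    using s unfolding summable_on_reindex_bij_betw[OF b, of "\<lambda>\<kappa>. \<Prod>i\<in>UNIV. q ^ \<kappa> i", symmetric]
    by (simp add: hsum_def power_sum)
qed

text \<open>For 0 <= q < 1 this is (1 - q)^(-m). It counts, with weights, the expansion terms of one
  degree \<open>cdg\<close>: such a term is determined by h.\<close>

definition Cm :: "'m::finite itself => real => real" where
  "Cm _ q = infsum (\<lambda>h :: nat ^ 'm. q ^ hsum h) UNIV"

context dom begin

definition Ut :: "real => ((complex ^ 'n) \<times> complex \<times> complex) set" where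
  "Ut t = nbhd_vec II (t * \<rho>) \<times> nbhd_line YY (t * r) \<times> nbhd_line XX (t * \<xi>)"

definition wt :: "real => ('n, 'm) mindex => real" where
  "wt t = (\<lambda>(k, h, j). exp (t * s * real_of_int (\<Sum>i\<in>UNIV. \<bar>k $ i\<bar>)) * (t * \<delta>) ^ (hsum h + hsum j))"

lemma Ut_uu: "z \<in> P t ==> uu z \<in> Ut t"
  by (cases z) (simp add: P_def ww_def Ut_def)

lemma mono_le: assumes z: "z \<in> P t" shows "cmod (mono nu z) <= wt t nu"
proof -
  obtain k h j where nu: "nu = (k, h, j)" by (metis prod.exhaust)
  obtain a b c where abc: "\<forall>i. dd a b c z i < t * rad i" using z P_iff by blast
  have T: "\<bar>Im (co (CT i) z)\<bar> < t * s" for i using abc[rule_format, of "CT i"] by simp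
  have p: "cmod (co (CP i) z) < t * \<delta>" and q: "cmod (co (CQ i) z) < t * \<delta>" for i
    using abc[rule_format, of "CP i"] abc[rule_format, of "CQ i"] by simp_all
  have "Re (\<i> * (\<Sum>i\<in>UNIV. of_int (k $ i) * co (CT i) z)) = (\<Sum>i\<in>UNIV. - (of_int (k $ i) * Im (co (CT i) z)))"
    by (simp add: Im_sum sum_negf)
  also have "... <= (\<Sum>i\<in>UNIV. t * s * real_of_int \<bar>k $ i\<bar>)"
  proof (rule sum_mono)
    fix i
    have "- (of_int (k $ i) * Im (co (CT i) z)) <= \<bar>of_int (k $ i) * Im (co (CT i) z)\<bar>" by simp
    also have "... <= t * s * \<bar>of_int (k $ i)\<bar>" unfolding abs_mult using T[of i] by (subst mult.commute) (intro mult_right_mono, auto)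
    finally show "- (of_int (k $ i) * Im (co (CT i) z)) <= t * s * real_of_int \<bar>k $ i\<bar>" by simp
  qed
  finally have 1: "cmod (exp (\<i> * (\<Sum>i\<in>UNIV. of_int (k $ i) * co (CT i) z))) <= exp (t * s * real_of_int (\<Sum>i\<in>UNIV. \<bar>k $ i\<bar>))"
    by (simp add: sum_distrib_left)
  have 2: "cmod (\<Prod>i\<in>UNIV. co (CP i) z ^ (h $ i)) <= (t * \<delta>) ^ hsum h"
    unfolding hsum_def power_sum prod_norm[symmetric] norm_power by (intro prod_mono conjI power_mono) (auto intro: less_imp_le p)
  have 3: "cmod (\<Prod>i\<in>UNIV. co (CQ i) z ^ (j $ i)) <= (t * \<delta>) ^ hsum j"
    unfolding hsum_def power_sum prod_norm[symmetric] norm_power by (intro prod_mono conjI power_mono) (auto intro: less_imp_le q)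
  have "0 < t" using P_pos[OF z] .
  show ?thesis
    unfolding nu wt_def mono.simps prod.case norm_mult power_add mult.assoc[symmetric]
    using 1 2 3 \<open>0 < t\<close> pos by (intro mult_mono mult_nonneg_nonneg) auto
qed

text \<open>Points that nearly maximise |mono nu| on the domain: the imaginary height of each angle
  has the sign opposite to k_i, and each p and q is as large as l allows. As l tends to 1 the
  modulus tends to the weight \<open>wt\<close>.\<close>

definition ext :: "real => ('n, 'm) mindex => (complex ^ 'n) \<times> complex \<times> complex => real => ('n, 'm) phase" where
  "ext t nu u l = (case u of (I, y, x) => (I, \<chi> i. - \<i> * of_real (l * (t * s)) * of_int (sgn (fst nu $ i)),
     \<chi> i. of_real (l * (t * \<delta>)), \<chi> i. of_real (l * (t * \<delta>)), y, x))"

lemma ext_P: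
  assumes u: "u \<in> Ut t" and l: "0 < l" "l < 1" and t: "0 < t"
  shows "ext t nu u l \<in> P t" "uu (ext t nu u l) = u"
    "cmod (mono nu (ext t nu u l)) = exp (l * (t * s) * real_of_int (\<Sum>i\<in>UNIV. \<bar>fst nu $ i\<bar>)) * (l * (t * \<delta>)) ^ (hsum (fst (snd nu)) + hsum (snd (snd nu)))"
proof -
  obtain I y x where u': "u = (I, y, x)" by (metis prod.exhaust)
  obtain k h j where nu: "nu = (k, h, j)" by (metis prod.exhaust)
  obtain a where a: "a \<in> II" "\<And>i. cmod (I $ i - of_real (a $ i)) < t * \<rho>"
    using u by (auto simp: u' Ut_def nbhd_vec_def vmax_less cvec_def)
  obtain b where b: "b \<in> YY" "cmod (y - of_real b) < t * r" using u by (auto simp: u' Ut_def nbhd_line_def)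
  obtain c where c: "c \<in> XX" "cmod (x - of_real c) < t * \<xi>" using u by (auto simp: u' Ut_def nbhd_line_def)
  have "\<bar>l * (t * s) * real_of_int (sgn (k $ i))\<bar> < t * s" for i
  proof -
    have "\<bar>l * (t * s) * real_of_int (sgn (k $ i))\<bar> = l * (t * s) * \<bar>real_of_int (sgn (k $ i))\<bar>"
      using l t pos by (simp add: abs_mult)
    also have "... <= l * (t * s) * 1" using l t pos by (intro mult_left_mono) (auto simp: sgn_if)
    also have "... < t * s" using l t pos by simp
    finally show ?thesis .
  qed
  then have "dd a b c (ext t nu u l) i < t * rad i" for i
    using a b c l t pos by (cases i) (simp_all add: ext_def u' nu norm_mult)
  then show "ext t nu u l \<in> P t" unfolding P_iff using a(1) b(1) c(1) by blast
  show "uu (ext t nu u l) = u" by (simp add: ext_def u')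
  have "of_int (k $ i) * co (CT i) (ext t nu u l) = - \<i> * of_real (l * (t * s) * \<bar>of_int (k $ i)\<bar>)" for i
    by (simp add: ext_def u' nu sgn_if)
  then have "\<i> * (\<Sum>i\<in>UNIV. of_int (k $ i) * co (CT i) (ext t nu u l)) = of_real (l * (t * s) * real_of_int (\<Sum>i\<in>UNIV. \<bar>k $ i\<bar>))"
    by (simp add: sum_distrib_left mult.assoc[symmetric])
  moreover have "co (CP i) (ext t nu u l) = of_real (l * (t * \<delta>))" "co (CQ i) (ext t nu u l) = of_real (l * (t * \<delta>))" for i
    by (simp_all add: ext_def u')
  ultimately show "cmod (mono nu (ext t nu u l)) = exp (l * (t * s) * real_of_int (\<Sum>i\<in>UNIV. \<bar>fst nu $ i\<bar>)) * (l * (t * \<delta>)) ^ (hsum (fst (snd nu)) + hsum (snd (snd nu)))"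
    using l t pos unfolding nu mono.simps
    by (simp add: norm_mult norm_power prod_norm[symmetric] hsum_def power_sum[symmetric] power_add del: of_real_mult)
qed

text \<open>The coefficient depends on (I, y, x) only and the monomial on the other variables only,
  so the supremum of the product splits, and the points \<open>ext\<close> show that the weight is
  the supremum of the monomial. The weighted norm thus becomes a sum of plain suprema
  (\<open>tf_norm_eq\<close>).\<close>

lemma sup_eq:
  assumes t: "0 < t"
  shows "(SUP u\<in>Ut t. ennreal (cmod (b u))) * ennreal (wt t nu) = (SUP z\<in>P t. ennreal (cmod (b (uu z) * mono nu z)))"
proof (rule antisym)
  have w0: "0 <= wt t nu" using t pos by (auto simp: wt_def split: prod.split)
  show "(SUP z\<in>P t. ennreal (cmod (b (uu z) * mono nu z))) <= (SUP u\<in>Ut t. ennreal (cmod (b u))) * ennreal (wt t nu)"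
  proof (rule SUP_least)
    fix z assume z: "z \<in> P t"
    have "ennreal (cmod (b (uu z) * mono nu z)) = ennreal (cmod (b (uu z))) * ennreal (cmod (mono nu z))"
      by (simp add: norm_mult ennreal_mult)
    also have "... <= (SUP u\<in>Ut t. ennreal (cmod (b u))) * ennreal (wt t nu)"
      by (intro mult_mono SUP_upper Ut_uu[OF z] ennreal_leI mono_le[OF z]) auto
    finally show "ennreal (cmod (b (uu z) * mono nu z)) <= (SUP u\<in>Ut t. ennreal (cmod (b u))) * ennreal (wt t nu)" .
  qed
  show "(SUP u\<in>Ut t. ennreal (cmod (b u))) * ennreal (wt t nu) <= (SUP z\<in>P t. ennreal (cmod (b (uu z) * mono nu z)))"
    unfolding SUP_mult_right_ennreal
  proof (rule SUP_least)
    fix u assume u: "u \<in> Ut t"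
    let ?f = "\<lambda>l. exp (l * (t * s) * real_of_int (\<Sum>i\<in>UNIV. \<bar>fst nu $ i\<bar>)) * (l * (t * \<delta>)) ^ (hsum (fst (snd nu)) + hsum (snd (snd nu)))"
    have "(?f \<longlongrightarrow> ?f 1) (at_left 1)" by (intro tendsto_intros)
    moreover have "?f 1 = wt t nu" by (cases nu) (simp add: wt_def)
    ultimately have "((\<lambda>l. ennreal (cmod (b u) * ?f l)) \<longlongrightarrow> ennreal (cmod (b u) * wt t nu)) (at_left 1)"
      by (intro tendsto_ennrealI tendsto_mult tendsto_const) simp
    moreover have "\<forall>\<^sub>F l in at_left 1. ennreal (cmod (b u) * ?f l) <= (SUP z\<in>P t. ennreal (cmod (b (uu z) * mono nu z)))"
      using eventually_at_left_real[of 0 1, simplified]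
    proof eventually_elim
      case (elim l)
      have l: "0 < l" "l < 1" using elim by auto
      have "ennreal (cmod (b u) * ?f l) = ennreal (cmod (b (uu (ext t nu u l)) * mono nu (ext t nu u l)))"
      using ext_P[OF u l t, of nu] by (simp add: norm_mult)
      also have "... <= (SUP z\<in>P t. ennreal (cmod (b (uu z) * mono nu z)))"
      by (rule SUP_upper) (rule ext_P(1)[OF u l t])
      finally show ?case .
    qed
    ultimately have "ennreal (cmod (b u) * wt t nu) <= (SUP z\<in>P t. ennreal (cmod (b (uu z) * mono nu z)))"
      by (rule tendsto_upperbound) simp
    then show "ennreal (cmod (b u)) * ennreal (wt t nu) <= (SUP z\<in>P t. ennreal (cmod (b (uu z) * mono nu z)))"
      using w0 by (simp add: ennreal_mult)
  qed
qed

lemma tf_norm_eq: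
  assumes t: "0 < t" and a: "tf_expansion DD (ww t) F a"
  shows "tf_norm DD (ww t) F = (\<Sum>\<^sub>\<infinity>nu\<in>UNIV. SUP z\<in>P t. ennreal (cmod (tf_term a z nu)))"
proof -
  let ?c = "tf_coeff DD (ww t) F"
  have c: "tf_expansion DD (ww t) F ?c" by (rule tf_coeff_expansion[OF a])
  have "tf_norm DD (ww t) F = (\<Sum>\<^sub>\<infinity>nu\<in>UNIV. (SUP u\<in>Ut t. ennreal (cmod (?c nu u))) * ennreal (wt t nu))"
    unfolding ww_def tf_norm.simps by (rule infsum_cong) (auto simp: wt_def Ut_def ww_def hsum_def)
  also have "... = (\<Sum>\<^sub>\<infinity>nu\<in>UNIV. SUP z\<in>P t. ennreal (cmod (tf_term a z nu)))"
  proof (rule infsum_cong)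
    fix nu
    have "(SUP u\<in>Ut t. ennreal (cmod (?c nu u))) * ennreal (wt t nu) = (SUP z\<in>P t. ennreal (cmod (tf_term ?c z nu)))"
      unfolding tf_term_mono by (rule sup_eq[OF t])
    also have "... = (SUP z\<in>P t. ennreal (cmod (tf_term a z nu)))"
      by (rule SUP_cong) (simp_all add: expansion_unique[OF c a])
    finally show "(SUP u\<in>Ut t. ennreal (cmod (?c nu u))) * ennreal (wt t nu) = (SUP z\<in>P t. ennreal (cmod (tf_term a z nu)))" .
  qed
  finally show ?thesis .
qed

lemma tf_norm_le:
  assumes t: "0 < t" and a: "tf_expansion DD (ww t) F a"
    and b: "\<And>nu z. z \<in> P t ==> cmod (tf_term a z nu) <= b nu" "\<And>nu. 0 <= b nu" "b summable_on UNIV"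
  shows "tf_norm DD (ww t) F <= ennreal (infsum b UNIV)"
proof -
  have "tf_norm DD (ww t) F <= (\<Sum>\<^sub>\<infinity>nu\<in>UNIV. ennreal (b nu))"
    unfolding tf_norm_eq[OF t a]
    by (rule infsum_mono) (auto intro!: nonneg_summable_on_complete SUP_least ennreal_leI b(1) simp del: tf_term.simps)
  then show ?thesis using infsum_ennreal[of UNIV b] b by simp
qed

lemma tf_norm_parts:
  assumes t: "0 < t" and F: "holo_on F (P t)" "per t F" and fin: "tf_norm DD (ww t) F < \<infinity>"
  obtains b where "\<And>nu z. z \<in> P t ==> cmod (tf_term (tf_coeff DD (ww t) F) z nu) <= b nu" "\<And>nu. 0 <= b nu" "b summable_on UNIV"
    "ennreal (infsum b UNIV) = tf_norm DD (ww t) F" "\<And>nu. holo_on (\<lambda>z. tf_term (tf_coeff DD (ww t) F) z nu) (P t)"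
    "tf_expansion DD (ww t) F (tf_coeff DD (ww t) F)"
proof -
  let ?c = "tf_coeff DD (ww t) F"
  obtain a where a: "tf_expansion DD (ww t) F a" "\<And>nu. holo_on (\<lambda>z. tf_term a z nu) (P t)"
    using expansion[OF F t] by metis
  have c: "tf_expansion DD (ww t) F ?c" by (rule tf_coeff_expansion[OF a(1)])
  let ?g = "\<lambda>nu. SUP z\<in>P t. ennreal (cmod (tf_term ?c z nu))"
  have fin': "infsum ?g UNIV < \<infinity>" using fin unfolding tf_norm_eq[OF t c] .
  note e = ennreal_summable[OF fin']
  show ?thesis
  proof (rule that[of "\<lambda>nu. enn2real (?g nu)"])
    fix nu z assume z: "z \<in> P t"
    have "ennreal (cmod (tf_term ?c z nu)) <= ?g nu" by (rule SUP_upper[OF z])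
    also have "... = ennreal (enn2real (?g nu))" using e(1)[of nu] by simp
    finally show "cmod (tf_term ?c z nu) <= enn2real (?g nu)" by (simp add: ennreal_le_iff)
  next
    show "ennreal (infsum (\<lambda>nu. enn2real (?g nu)) UNIV) = tf_norm DD (ww t) F"
      unfolding e(3) tf_norm_eq[OF t c] using fin' by simp
    show "holo_on (\<lambda>z. tf_term ?c z nu) (P t)" for nu
      by (rule holo_cong[OF open_P _ a(2)[of nu]]) (rule expansion_unique[OF a(1) c])
  qed (use e(2) c in auto)
qed

lemma gr_per: assumes "gr (P t) mu G" shows "per t G"
  unfolding per_def
proof (intro allI ballI)
  fix v z assume z: "z \<in> P t"
  have e: "rota (fv v) (of_real (2 * pi)) z = rota (av v) (of_real (2 * pi)) z"
  proof (rule phase_eqI)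
    fix i
    have e1: "exp (\<i> * (2 * of_real pi)) = 1" "exp (- (\<i> * (2 * of_real pi))) = 1"
      using exp_two_pi_i by (simp_all add: mult_ac exp_minus)
    show "co i (rota (fv v) (of_real (2 * pi)) z) = co i (rota (av v) (of_real (2 * pi)) z)"
      by (cases v; cases i) (auto simp: co_rot fv_def e1)
  qed
  have "G (rota (av v) (of_real (2 * pi)) z) = exp (\<i> * of_int (mu v) * of_real (2 * pi)) * G z"
    using assms z unfolding gr_def hom_def by blast
  also have "exp (\<i> * of_int (mu v) * of_real (2 * pi)) = exp 0"
    unfolding exp_eq by (intro exI[of _ "mu v"]) (simp add: algebra_simps)
  finally show "G (rota (fv v) (of_real (2 * pi)) z) = G z" unfolding e by simp
qed

lemma dec_per: assumes "dec t F M" shows "per t F"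
  unfolding per_def
proof (intro allI ballI)
  fix v z assume z: "z \<in> P t"
  obtain G B where *: "\<And>mu. gr (P t) mu (G mu)" "\<And>z. z \<in> P t ==> ((\<lambda>mu. G mu z) has_sum F z) UNIV"
    using decE[OF assms] by metis
  have "G mu (rota (fv v) (of_real (2 * pi)) z) = G mu z" for mu
    using gr_per[OF *(1)[of mu]] z unfolding per_def by blast
  then have "((\<lambda>mu. G mu z) has_sum F (rota (fv v) (of_real (2 * pi)) z)) UNIV"
    using *(2)[OF rinvD[OF rinv_P z, of "2 * pi" "fv v"]] by simp
  then show "F (rota (fv v) (of_real (2 * pi)) z) = F z" using *(2)[OF z] has_sum_unique by blast
qed

text \<open>Rotating by x and subtracting the factor expected for degree mu gives an expansion of 0
  with terms \<open>?c nu * tf_term a z nu\<close>; by \<open>graded_unique\<close> each of them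
  vanishes.\<close>

lemma tf_zero:
  assumes a: "tf_expansion DD (ww t) G a" and G: "gr (P t) mu G" and z: "z \<in> P t" and ne: "cdg nu \<noteq> mu"
  shows "tf_term a z nu = 0"
proof -
  obtain v where v: "cdg nu v \<noteq> mu v" using ne by blast
  \<comment> \<open>This x makes the two exponentials opposite for the given nu, as their quotient
    is exp (i pi) = -1.\<close>
  define x where "x = pi / of_int (cdg nu v - mu v)"
  let ?c = "\<lambda>nu. exp (\<i> * of_int (cdg nu v) * of_real x) - exp (\<i> * of_int (mu v) * of_real x)"
  have "(\<lambda>z. ?c nu * tf_term a z nu) z = 0"
  proof (rule graded_unique[where F = "\<lambda>nu z. ?c nu * tf_term a z nu" and a = fv and deg = kap and S = "P t", OF _ inj_kap rinv_P _ z])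
    show "hom (fv w) (kap nu w) (P t) (\<lambda>z. ?c nu * tf_term a z nu)" for nu w
      using hom_tf_term[of w nu "P t" a] unfolding hom_def by (simp add: mult_ac)
    fix z assume z: "z \<in> P t"
    have z': "rota (av v) (of_real x) z \<in> P t" by (rule rinvD[OF rinv_P z])
    have s1: "((\<lambda>nu. tf_term a (rota (av v) (of_real x) z) nu) has_sum G (rota (av v) (of_real x) z)) UNIV"
      and s2: "((\<lambda>nu. tf_term a z nu) has_sum G z) UNIV"
      using a z z' unfolding tf_expansion_def P_def[symmetric] by blast+
    have "G (rota (av v) (of_real x) z) = exp (\<i> * of_int (mu v) * of_real x) * G z"
      using G z unfolding gr_def hom_def by blast
    moreover have "tf_term a (rota (av v) (of_real x) z) nu = exp (\<i> * of_int (cdg nu v) * of_real x) * tf_term a z nu" for nu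
      by (simp add: tf_term_mono mono_rota_av)
    ultimately show "((\<lambda>nu. ?c nu * tf_term a z nu) has_sum 0) UNIV"
      using has_sum_add[OF s1 has_sum_uminusI[OF has_sum_cmult_right[OF s2, of "exp (\<i> * of_int (mu v) * of_real x)"]]]
      by (simp add: left_diff_distrib)
  qed
  moreover have "?c nu \<noteq> 0"
  proof
    assume "?c nu = 0"
    then have "exp (\<i> * of_int (cdg nu v) * of_real x) * exp (- (\<i> * of_int (mu v) * of_real x)) = exp (\<i> * of_int (mu v) * of_real x) * exp (- (\<i> * of_int (mu v) * of_real x))"
      by simp
    then have "exp (\<i> * (of_int (cdg nu v - mu v) * of_real x)) = 1"
      unfolding exp_add[symmetric] by (simp add: algebra_simps)
    moreover have "of_int (cdg nu v - mu v) * of_real x = (of_real pi :: complex)"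
    proof -
      have "real_of_int (cdg nu v - mu v) * x = pi" using v by (simp add: x_def)
      then show ?thesis by (metis of_real_mult of_real_of_int_eq)
    qed
    ultimately show False by simp
  qed
  ultimately show ?thesis by simp
qed

text \<open>Each component \<open>G mu\<close> is expanded on its own, with all terms bounded by
  \<open>B mu\<close> on \<open>P t\<close>. Shrinking p and q by q = u / t gains q^(|h| + |j|). The
  degree mu fixes k and j - h, so only h is summed over, which costs \<open>Cm\<close>; no sum over
  Fourier indices occurs within a component.\<close>

lemma dec_tf:
  assumes F: "dec t F M" and ut: "0 < u" "u < t"
  obtains a where "tf_expansion DD (ww u) F a" "tf_norm DD (ww u) F <= ennreal (M * Cm TYPE('m) (u / t))"
proof -
  have t: "0 < t" using ut by simp
  define q where "q = u / t"
  have q: "0 <= q" "q < 1" using ut by (auto simp: q_def)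
  obtain G B where G: "\<And>mu. holo_on (G mu) (P t)" "\<And>mu. gr (P t) mu (G mu)" "\<And>mu z. z \<in> P t ==> cmod (G mu z) <= B mu"
    "\<And>mu. 0 <= B mu" "B summable_on UNIV" "infsum B UNIV <= M" "\<And>z. z \<in> P t ==> ((\<lambda>mu. G mu z) has_sum F z) UNIV"
    using decE[OF F] by metis
  have "\<exists>a. tf_expansion DD (ww t) (G mu) a \<and> (\<forall>nu. \<forall>z\<in>P t. cmod (tf_term a z nu) <= B mu)" for mu
    using expansion[OF G(1) gr_per[OF G(2)] t, of mu] G(3) by metis
  then obtain a where a: "\<And>mu. tf_expansion DD (ww t) (G mu) (a mu)" "\<And>mu nu z. z \<in> P t ==> cmod (tf_term (a mu) z nu) <= B mu"
    by metis
  define A where "A nu = a (cdg nu) nu" for nu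
  define n where "n nu = hsum (fst (snd nu)) + hsum (snd (snd nu))" for nu :: "('n, 'm) mindex"
  have A: "tf_term A z nu = tf_term (a (cdg nu)) z nu" for z nu by (simp add: tf_term_mono A_def)
  have Pu: "z \<in> P t" if "z \<in> P u" for z using P_mono[of u t] ut that by auto
  have bd: "cmod (tf_term (a mu) z nu) <= B mu * q ^ n nu" if z: "z \<in> P u" for mu nu z
  proof -
    obtain k h j where nu: "nu = (k, h, j)" by (metis prod.exhaust)
    \<comment> \<open>The point z' stretches p and q to the larger domain; comparing the monomial at
      z and z' yields the gain.\<close>
    define z' where "z' = mk (\<lambda>i. case i of CP _ => of_real (t / u) * co i z | CQ _ => of_real (t / u) * co i z | _ => co i z)"
    obtain b1 b2 b3 where abc: "b1 \<in> II" "b2 \<in> YY" "b3 \<in> XX" "\<forall>i. dd b1 b2 b3 z i < u * rad i"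
      using z P_iff by blast
    have m: "t / u * x < t * \<delta>" if "x < u * \<delta>" for x using that ut t by (simp add: field_simps)
    have k: "u * rad i <= t * rad i" for i using ut rad[of i] by simp
    have "dd b1 b2 b3 z' i < t * rad i" for i
    proof (cases i)
      case (CP l)
      then show ?thesis using m[of "cmod (co i z)"] abc(4)[rule_format, of i] ut t by (simp add: z'_def norm_mult norm_divide)
    next
      case (CQ l)
      then show ?thesis using m[of "cmod (co i z)"] abc(4)[rule_format, of i] ut t by (simp add: z'_def norm_mult norm_divide)
    qed (use abc(4)[rule_format, of i] k[of i] in \<open>simp_all add: z'_def\<close>)
    then have z': "z' \<in> P t" unfolding P_iff using abc(1-3) by blast
    have uz: "uu z' = uu z" by (rule uu_eqI) (simp_all add: z'_def)
    have "mono nu z' = c ^ n nu * mono nu z" if "c = of_real (t / u)" for c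
      unfolding nu n_def mono.simps
      by (simp add: z'_def that[symmetric] power_mult_distrib prod.distrib hsum_def power_add power_sum mult_ac
      del: of_real_divide)
    from this[OF refl]
    have "cmod (tf_term (a mu) z' nu) = (t / u) ^ n nu * cmod (tf_term (a mu) z nu)"
      unfolding tf_term_mono uz using ut t by (simp add: norm_mult norm_power norm_divide)
    then have "(t / u) ^ n nu * cmod (tf_term (a mu) z nu) <= B mu" using a(2)[OF z'] by metis
    then have "q ^ n nu * ((t / u) ^ n nu * cmod (tf_term (a mu) z nu)) <= q ^ n nu * B mu" using q by (intro mult_left_mono) auto
    moreover have "q ^ n nu * (t / u) ^ n nu = 1" using ut t by (simp add: q_def power_mult_distrib[symmetric])
    ultimately show ?thesis by (simp add: mult.assoc[symmetric] mult.commute)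
  qed
  let ?A = "\<lambda>mu. {nu :: ('n, 'm) mindex. cdg nu = mu}"
  have sh: "(\<lambda>h :: nat ^ 'm. q ^ hsum h) summable_on UNIV" by (rule summable_hsum[OF q])
  have inj: "inj_on (\<lambda>nu :: ('n, 'm) mindex. fst (snd nu)) (?A mu)" for mu
  proof (rule inj_onI)
    fix nu nu' assume "nu \<in> ?A mu" "nu' \<in> ?A mu" and e: "fst (snd nu) = fst (snd nu')"
    then have c: "cdg nu = cdg nu'" by simp
    obtain k h j k' h' j' where nu: "nu = (k, h, j)" "nu' = (k', h', j')" by (metis prod.exhaust)
    have "k $ i = k' $ i" for i using fun_cong[OF c, of "CT i"] by (simp add: nu)
    moreover have "j $ i = j' $ i" for i using fun_cong[OF c, of "CQ i"] e by (simp add: nu)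
    ultimately show "nu = nu'" using e by (simp add: nu vec_eq_iff)
  qed
  have sA: "(\<lambda>nu. q ^ n nu) summable_on ?A mu" and iA: "infsum (\<lambda>nu. q ^ n nu) (?A mu) <= Cm TYPE('m) q" for mu
  proof -
    have s1: "(\<lambda>nu :: ('n, 'm) mindex. q ^ hsum (fst (snd nu))) summable_on ?A mu"
      using summable_on_subset_banach[OF sh, of "(\<lambda>nu. fst (snd nu)) ` ?A mu"]
      unfolding summable_on_reindex[OF inj] by (simp add: o_def)
    have le: "q ^ n nu <= q ^ hsum (fst (snd nu))" for nu
      using q by (intro power_decreasing) (auto simp: n_def)
    show s2: "(\<lambda>nu. q ^ n nu) summable_on ?A mu"
      by (rule summable_on_comparison_test[OF s1]) (use le q in auto)
    have "infsum (\<lambda>nu. q ^ n nu) (?A mu) <= infsum (\<lambda>nu. q ^ hsum (fst (snd nu))) (?A mu)"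
      by (rule infsum_mono[OF s2 s1 le])
    also have "... = infsum (\<lambda>h. q ^ hsum h) ((\<lambda>nu. fst (snd nu)) ` ?A mu)"
      using infsum_reindex[OF inj, of "\<lambda>h. q ^ hsum h" mu] by (simp add: o_def)
    also have "... <= Cm TYPE('m) q" unfolding Cm_def
      by (rule infsum_mono_neutral[OF summable_on_subset_banach[OF sh] sh]) (use q in auto)
    finally show "infsum (\<lambda>nu. q ^ n nu) (?A mu) <= Cm TYPE('m) q" .
  qed
  have C0: "0 <= Cm TYPE('m) q" unfolding Cm_def by (rule infsum_nonneg) (use q in simp)
  let ?b = "\<lambda>(mu, nu). B mu * q ^ n nu"
  have sI: "(\<lambda>mu. B mu * infsum (\<lambda>nu. q ^ n nu) (?A mu)) summable_on UNIV"
    by (rule summable_on_comparison_test[OF summable_on_cmult_left[OF G(5), of "Cm TYPE('m) q"]])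
      (use iA G(4) q in \<open>auto intro!: mult_left_mono mult_nonneg_nonneg infsum_nonneg\<close>)
  have sb: "?b summable_on Sigma UNIV ?A"
    by (rule summable_on_SigmaI[OF _ sI]) (use sA G(4) q in \<open>auto intro!: has_sum_cmult_right has_sum_infsum\<close>)
  have b: "bij_betw snd (Sigma UNIV ?A) UNIV"
    by (rule bij_betwI[of _ _ _ "\<lambda>nu. (cdg nu, nu)"]) auto
  have conv: "(f (fst x) (snd x)) = (\<lambda>nu. f (cdg nu) nu) (snd x)" if "x \<in> Sigma UNIV ?A" for x and f :: "_ => _ => 'z"
    using that by auto
  define bb where "bb nu = B (cdg nu) * q ^ n nu" for nu
  have sbb: "bb summable_on UNIV"
  proof -
    have "(\<lambda>x. bb (snd x)) summable_on Sigma UNIV ?A"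
      using sb by (rule summable_on_cong[THEN iffD1, rotated]) (auto simp: bb_def)
    then show ?thesis unfolding summable_on_reindex_bij_betw[OF b] .
  qed
  have ibb: "infsum bb UNIV <= M * Cm TYPE('m) q"
  proof -
    have "infsum bb UNIV = infsum (\<lambda>x. bb (snd x)) (Sigma UNIV ?A)"
      using infsum_reindex_bij_betw[OF b, of bb] by simp
    also have "... = infsum ?b (Sigma UNIV ?A)" by (rule infsum_cong) (auto simp: bb_def)
    also have "... = infsum (\<lambda>mu. infsum (\<lambda>nu. B mu * q ^ n nu) (?A mu)) UNIV"
      using infsum_Sigma'_banach[of "\<lambda>mu nu. B mu * q ^ n nu" UNIV ?A] sb by simp
    also have "... = infsum (\<lambda>mu. B mu * infsum (\<lambda>nu. q ^ n nu) (?A mu)) UNIV"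
      by (simp add: infsum_cmult_right')
    also have "... <= infsum (\<lambda>mu. B mu * Cm TYPE('m) q) UNIV"
      by (rule infsum_mono[OF sI summable_on_cmult_left[OF G(5)]]) (use iA G(4) in \<open>auto intro: mult_left_mono\<close>)
    also have "... = infsum B UNIV * Cm TYPE('m) q" by (simp add: infsum_cmult_left')
    also have "... <= M * Cm TYPE('m) q" by (rule mult_right_mono[OF G(6) C0])
    finally show ?thesis .
  qed
  have exp: "tf_expansion DD (ww u) F A"
    unfolding tf_expansion_def P_def[symmetric]
  proof
    fix z assume z: "z \<in> P u"
    have "((\<lambda>(mu, nu). tf_term (a mu) z nu) has_sum F z) (Sigma UNIV ?A)"
    proof (rule has_sum_SigmaI[OF _ G(7)[OF Pu[OF z]]])
      fix mu
      have "(tf_term (a mu) z has_sum G mu z) UNIV" using a(1)[of mu] Pu[OF z] unfolding tf_expansion_def P_def[symmetric] by blast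
      then have "(tf_term (a mu) z has_sum G mu z) (?A mu)"
      by (rule has_sum_cong_neutral[THEN iffD1, rotated -1]) (use tf_zero[OF a(1) G(2) Pu[OF z]] in auto)
      then show "((\<lambda>y. case (mu, y) of (mu, nu) => tf_term (a mu) z nu) has_sum G mu z) (?A mu)" by simp
    next
      show "(\<lambda>(mu, nu). tf_term (a mu) z nu) summable_on Sigma UNIV ?A"
      by (rule abs_summable_summable, rule summable_on_comparison_test[OF sb]) (use bd[OF z] in auto)
    qed
    then have "((\<lambda>x. tf_term A z (snd x)) has_sum F z) (Sigma UNIV ?A)"
      by (rule has_sum_cong[THEN iffD1, rotated]) (auto simp: A)
    then show "(tf_term A z has_sum F z) UNIV" unfolding has_sum_reindex_bij_betw[OF b] .
  qed
  have "tf_norm DD (ww u) F <= ennreal (infsum bb UNIV)"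
    by (rule tf_norm_le[OF ut(1) exp _ _ sbb]) (use bd A G(4) q in \<open>auto simp: bb_def\<close>)
  also have "... <= ennreal (M * Cm TYPE('m) q)" by (rule ennreal_leI[OF ibb])
  finally show ?thesis using that exp by (simp add: q_def)
qed

section \<open>Membership in the function spaces\<close>

lemma periodic_per: "periodic_on F (P t) ==> per t F"
  unfolding per_def
proof (intro allI ballI)
  fix v z assume p: "periodic_on F (P t)" and z: "z \<in> P t"
  obtain I \<theta> p q y x where zz: "z = (I, \<theta>, p, q, y, x)" by (metis prod.exhaust)
  have e1: "exp (\<i> * (2 * of_real pi)) = 1" using exp_two_pi_i by (simp add: mult_ac)
  show "F (rota (fv v) (of_real (2 * pi)) z) = F z"
  proof (cases "\<exists>i. v = CT i")
    case True
    then obtain i where v: "v = CT i" by blast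
    have "rota (fv v) (of_real (2 * pi)) z = (I, \<theta> + axis i (2 * of_real pi), p, q, y, x)"
    proof (rule phase_eqI)
      fix l show "co l (rota (fv v) (of_real (2 * pi)) z) = co l (I, \<theta> + axis i (2 * of_real pi), p, q, y, x)"
      by (cases l) (auto simp: co_rot fv_def v zz axis_def)
    qed
    moreover have "F (I, \<theta> + axis i (2 * of_real pi), p, q, y, x) = F (I, \<theta>, p, q, y, x)"
      using bspec[OF p[unfolded periodic_on_def] z] by (simp add: zz)
    ultimately show ?thesis by (simp add: zz)
  next
    case False
    have "rota (fv v) (of_real (2 * pi)) z = z"
    proof (rule phase_eqI)
      fix l show "co l (rota (fv v) (of_real (2 * pi)) z) = co l z"
      using False by (cases l) (auto simp: co_rot fv_def e1)
    qed
    then show ?thesis by simp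
  qed
qed

lemma per_periodic: "per t F ==> periodic_on F (P t)"
  unfolding periodic_on_def
proof (rule ballI)
  fix z assume p: "per t F" and z: "z \<in> P t"
  obtain I \<theta> p q y x where zz: "z = (I, \<theta>, p, q, y, x)" by (metis prod.exhaust)
  have "F (I, \<theta> + axis i (2 * of_real pi), p, q, y, x) = F (I, \<theta>, p, q, y, x)" for i
  proof -
    have "rota (fv (CT i)) (of_real (2 * pi)) z = (I, \<theta> + axis i (2 * of_real pi), p, q, y, x)"
    proof (rule phase_eqI)
      fix l show "co l (rota (fv (CT i)) (of_real (2 * pi)) z) = co l (I, \<theta> + axis i (2 * of_real pi), p, q, y, x)"
      by (cases l) (auto simp: co_rot fv_def zz axis_def)
    qed
    then show ?thesis using p z unfolding per_def zz by metis
  qed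
  then show "case z of (I, \<theta>, p, q, y, x) => \<forall>i. F (I, \<theta> + axis i (2 * of_real pi), p, q, y, x) = F (I, \<theta>, p, q, y, x)"
    by (simp add: zz)
qed

lemma per_mono: "per t F ==> u <= t ==> per u F"
  unfolding per_def using P_mono by blast

lemma OspE:
  assumes "F \<in> Osp DD (ww t)"
  obtains t' where "t < t'" "holo_on F (P t')" "per t' F" "tf_norm DD (ww t) F < \<infinity>"
proof -
  obtain w' where w': "radii_less (ww t) w'" "holo_on F (PP DD w')" "periodic_on F (PP DD w')"
    and fin: "tf_norm DD (ww t) F < \<infinity>" using assms unfolding Osp_def by blast
  obtain r1 r2 r3 r4 r5 where w: "w' = (r1, r2, r3, r4, r5)" by (metis prod.exhaust)
  have l: "t * \<rho> < r1" "t * s < r2" "t * \<delta> < r3" "t * r < r4" "t * \<xi> < r5" using w'(1) by (simp_all add: w ww_def)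
  \<comment> \<open>The largest common factor for which all five scaled radii stay within those of
    w'.\<close>
  define t' where "t' = min (r1 / \<rho>) (min (r2 / s) (min (r3 / \<delta>) (min (r4 / r) (r5 / \<xi>))))"
  have t': "t < t'" using l pos by (simp add: t'_def pos_less_divide_eq)
  have "t' <= r1 / \<rho>" "t' <= r2 / s" "t' <= r3 / \<delta>" "t' <= r4 / r" "t' <= r5 / \<xi>" by (simp_all add: t'_def)
  then have le: "t' * \<rho> <= r1" "t' * s <= r2" "t' * \<delta> <= r3" "t' * r <= r4" "t' * \<xi> <= r5"
    using pos by (simp_all add: pos_le_divide_eq)
  have n1: "nbhd_vec II (t' * \<rho>) \<subseteq> nbhd_vec II r1"
    unfolding nbhd_vec_def by (rule Collect_mono) (meson le(1) less_le_trans)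
  have n2: "(strip (t' * s) :: (complex ^ 'n) set) \<subseteq> strip r2"
    unfolding strip_def by (rule Collect_mono) (meson le(2) less_le_trans)
  have n3: "pq \<in> nbhd_pq BB r3" if pq: "pq \<in> nbhd_pq BB (t' * \<delta>)" for pq
  proof -
    obtain p q where e: "pq = (p, q)" by fastforce
    obtain a b where ab: "(a, b) \<in> BB" "vmax (p - cvec a) < t' * \<delta>" "vmax (q - cvec b) < t' * \<delta>" "vmax p < t' * \<delta>" "vmax q < t' * \<delta>"
      using pq by (auto simp: nbhd_pq_def e)
    then have "vmax (p - cvec a) < r3" "vmax (q - cvec b) < r3" "vmax p < r3" "vmax q < r3" using le(3) by simp_all
    then show ?thesis using ab(1) by (auto simp: nbhd_pq_def e)
  qed
  have n4: "nbhd_line YY (t' * r) \<subseteq> nbhd_line YY r4" "nbhd_line XX (t' * \<xi>) \<subseteq> nbhd_line XX r5"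
    unfolding nbhd_line_def by (rule Collect_mono; meson le(4,5) less_le_trans)+
  have sub: "P t' \<subseteq> PP DD w'"
  proof
    fix z assume z: "z \<in> P t'"
    obtain I \<theta> p q y x where zz: "z = (I, \<theta>, p, q, y, x)" by (metis prod.exhaust)
    have "I \<in> nbhd_vec II (t' * \<rho>)" "\<theta> \<in> strip (t' * s)" "(p, q) \<in> nbhd_pq BB (t' * \<delta>)"
      "y \<in> nbhd_line YY (t' * r)" "x \<in> nbhd_line XX (t' * \<xi>)"
      using z by (simp_all add: P_def ww_def zz)
    then show "z \<in> PP DD w'" using n1 n2 n3 n4 by (simp add: w zz subsetD)
  qed
  show ?thesis
  proof (rule that[OF t' holo_subset[OF w'(2) sub] _ fin])
    have "periodic_on F (P t')" using w'(3) sub unfolding periodic_on_def by blast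
    then show "per t' F" by (rule periodic_per)
  qed
qed

lemma dec_Osp:
  assumes F: "dec t F M" and ut: "0 < u" "u < t" shows "F \<in> Osp DD (ww u)"
proof -
  have "radii_less (ww u) (ww t)" using ut pos by (simp add: ww_def)
  moreover have "holo_on F (PP DD (ww t))" "periodic_on F (PP DD (ww t))"
    using dec_holo[OF F] per_periodic[OF dec_per[OF F]] by (simp_all add: P_def)
  moreover have "tf_norm DD (ww u) F < \<infinity>"
    using dec_tf[OF F ut] by (metis ennreal_less_top infinity_ennreal_def le_less_trans)
  ultimately show ?thesis unfolding Osp_def by blast
qed

lemma dec_subset:
  assumes t: "0 < t" and h: "\<And>nu. holo_on (\<lambda>z. tf_term a z nu) (P t)"
    and b: "\<And>nu z. z \<in> P t ==> cmod (tf_term a z nu) <= b nu" "\<And>nu. 0 <= b nu" "b summable_on UNIV"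
  shows "dec t (\<lambda>z. infsum (tf_term a z) A) (infsum b A)"
proof (rule decI[of A "\<lambda>nu z. tf_term a z nu" t cdg b "infsum b A"])
  have bA: "b summable_on A" by (rule summable_on_subset_banach[OF b(3)]) simp
  then show "(b has_sum infsum b A) A" by simp
  fix z assume z: "z \<in> P t"
  have "(\<lambda>nu. tf_term a z nu) summable_on A"
    by (rule abs_summable_summable, rule summable_on_comparison_test[OF bA]) (use b(1)[OF z] in auto)
  then show "((\<lambda>nu. tf_term a z nu) has_sum infsum (tf_term a z) A) A" by simp
qed (use h b gr_tf_term in auto)

lemma norm_dec:
  assumes t: "0 < t" and F: "holo_on F (P t)" "per t F" "tf_norm DD (ww t) F < \<infinity>"
  shows "dec t F (enn2real (tf_norm DD (ww t) F))"
proof -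
  obtain b where b: "\<And>nu z. z \<in> P t ==> cmod (tf_term (tf_coeff DD (ww t) F) z nu) <= b nu" "\<And>nu. 0 <= b nu" "b summable_on UNIV"
    "ennreal (infsum b UNIV) = tf_norm DD (ww t) F" "\<And>nu. holo_on (\<lambda>z. tf_term (tf_coeff DD (ww t) F) z nu) (P t)"
    "tf_expansion DD (ww t) F (tf_coeff DD (ww t) F)" using tf_norm_parts[OF t F] by metis
  have "dec t (\<lambda>z. infsum (tf_term (tf_coeff DD (ww t) F) z) UNIV) (infsum b UNIV)"
    by (rule dec_subset[OF t b(5) b(1-3)])
  then have "dec t F (infsum b UNIV)"
    by (rule dec_cong) (use b(6) in \<open>auto simp: tf_expansion_def P_def[symmetric] infsumI\<close>)
  moreover have "enn2real (tf_norm DD (ww t) F) = infsum b UNIV"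
    unfolding b(4)[symmetric] using b(2) by (simp add: infsum_nonneg)
  ultimately show ?thesis by simp
qed

lemma Osp_dec:
  assumes F: "F \<in> Osp DD (ww t)" and t: "0 < t" obtains M where "dec t F M"
proof -
  obtain t' where t': "t < t'" "holo_on F (P t')" "per t' F" "tf_norm DD (ww t) F < \<infinity>" using OspE[OF F] .
  have "holo_on F (P t)" "per t F" using holo_subset[OF t'(2) P_mono] per_mono[OF t'(3)] t'(1) by auto
  from norm_dec[OF t this t'(4)] show ?thesis by (rule that)
qed

end

subsection \<open>The unperturbed Hamiltonian\<close>

lemma nbhd_line_convex:
  assumes "convex XX" shows "convex (nbhd_line XX e)"
proof -
  have e: "nbhd_line XX e = (\<Union>x\<in>complex_of_real ` XX. \<Union>y\<in>ball 0 e. {x + y})"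
  proof (intro set_eqI iffI)
    fix z assume "z \<in> nbhd_line XX e"
    then obtain a where a: "a \<in> XX" "cmod (z - of_real a) < e" by (auto simp: nbhd_line_def)
    then have "z - of_real a \<in> ball 0 e" "z = of_real a + (z - of_real a)" by (auto simp: dist_norm norm_minus_commute)
    then show "z \<in> (\<Union>x\<in>complex_of_real ` XX. \<Union>y\<in>ball 0 e. {x + y})" using a(1) by blast
  next
    fix z assume "z \<in> (\<Union>x\<in>complex_of_real ` XX. \<Union>y\<in>ball 0 e. {x + y})"
    then obtain a y where "a \<in> XX" "cmod y < e" "z = of_real a + y" by auto
    then show "z \<in> nbhd_line XX e" by (auto simp: nbhd_line_def intro!: bexI[of _ a])
  qed
  have "convex (complex_of_real ` XX)"
    by (intro convex_linear_image[OF _ assms]) (simp add: linear_iff scaleR_conv_of_real)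
  then show ?thesis unfolding e by (intro convex_sums convex_ball)
qed

text \<open>The points of XX lie between \<xi> - K and K - \<xi>, so the midpoint x0 of the interval
  XX is within K - \<xi> of each of them. As a base point it makes the horizontal distances at most
  K instead of 2 K.\<close>

lemma centre_exists:
  assumes XX: "open XX" "connected XX" "XX \<noteq> {}" and \<xi>: "0 < \<xi>" and b: "\<And>x. x \<in> nbhd_line XX \<xi> ==> cmod x <= K"
  obtains x0 where "x0 \<in> XX" "\<And>c. c \<in> XX ==> \<bar>c - x0\<bar> + \<xi> <= K"
proof -
  have le: "c + \<xi> <= K" "- c + \<xi> <= K" if c: "c \<in> XX" for c
  proof -
    have *: "\<bar>c + e\<bar> <= K" if "\<bar>e\<bar> < \<xi>" for e
    proof -
      have "complex_of_real (c + e) \<in> nbhd_line XX \<xi>"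
      using c that by (auto simp: nbhd_line_def intro!: bexI[of _ c])
      from b[OF this] show ?thesis by (simp add: norm_of_real del: of_real_add)
    qed
    show "c + \<xi> <= K"
    proof (rule dense_le)
      fix y assume y: "y < c + \<xi>"
      define e where "e = max 0 (y - c)"
      have "\<bar>e\<bar> < \<xi>" "y <= c + e" using y \<xi> by (auto simp: e_def)
      then show "y <= K" using *[of e] by linarith
    qed
    show "- c + \<xi> <= K"
    proof (rule dense_le)
      fix y assume y: "y < - c + \<xi>"
      define e where "e = min 0 (- c - y)"
      have "\<bar>e\<bar> < \<xi>" "y <= - (c + e)" using y \<xi> by (auto simp: e_def)
      then show "y <= K" using *[of e] by linarith
    qed
  qed
  have bd: "bdd_above XX" "bdd_below XX"
    by (rule bdd_aboveI[of _ "K - \<xi>"], use le in fastforce) (rule bdd_belowI[of _ "\<xi> - K"], use le in fastforce)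
  define x0 where "x0 = (Inf XX + Sup XX) / 2"
  have Sup: "Sup XX + \<xi> <= K" using cSup_least[OF XX(3), of "K - \<xi>"] le by fastforce
  have Inf: "- Inf XX + \<xi> <= K" using cInf_greatest[OF XX(3), of "\<xi> - K"] le by fastforce
  have "\<bar>c - x0\<bar> + \<xi> <= K" if "c \<in> XX" for c
    using cSup_upper[OF that bd(1)] cInf_lower[OF that bd(2)] Sup Inf by (simp add: x0_def abs_if field_simps)
  moreover have "x0 \<in> XX"
  proof -
    obtain c where c: "c \<in> XX" using XX(3) by blast
    then obtain e where e: "e > 0" "ball c e \<subseteq> XX" using XX(1) open_contains_ball by blast
    then have "c + e / 2 \<in> XX" "c - e / 2 \<in> XX" by (auto simp: dist_norm intro!: subsetD[OF e(2)])
    then have "Inf XX < Sup XX"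
      using e(1) cSup_upper[OF _ bd(1), of "c + e / 2"] cInf_lower[OF _ bd(2), of "c - e / 2"] by linarith
    then have "Inf XX < x0" "x0 < Sup XX" by (auto simp: x0_def)
    then obtain c1 c2 where "c1 \<in> XX" "c1 < x0" "c2 \<in> XX" "x0 < c2"
      using cInf_less_iff[OF XX(3) bd(2)] less_cSup_iff[OF XX(3) bd(1)] by blast
    then show ?thesis using XX(2) connectedD_interval less_imp_le by metis
  qed
  ultimately show ?thesis using that by blast
qed

definition xs :: "('n::finite, 'm::finite) phase => complex => ('n, 'm) phase" where
  "xs z w = mk (\<lambda>i. if i = CX then w else co i z)"

lemma co_xs [simp]: "co i (xs z w) = (if i = CX then w else co i z)"
  by (simp add: xs_def)

locale ham_dom = dom +
  fixes h :: "complex ^ 'a => complex ^ 'b => complex => complex"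
  assumes H0: "holo_on (ham0 h) (P 1)" and wy: "\<And>z. z \<in> P 1 ==> omega_y h z \<noteq> 0"
begin

lemma omega_y_pd: "omega_y h z = pd (eb CY) (ham0 h) z"
proof (cases z)
  case (fields I \<theta> p q y x)
  have "deriv (h I (JJ p q)) y = deriv (\<lambda>t. h I (JJ p q) (y + t)) 0"
    using deriv_shift_0[of "h I (JJ p q)" y] by (simp add: o_def)
  then show ?thesis by (simp add: fields pd_def eb_simps cscale_def)
qed

lemma omega_I_pd: "omega_I h z i = pd (eb (CI i)) (ham0 h) z"
proof (cases z)
  case (fields I \<theta> p q y x)
  have "t *s axis i 1 = (axis i t :: complex ^ 'a)" for t by (simp add: axis_def vec_eq_iff)
  then show ?thesis by (simp add: fields pd_def eb_simps cscale_def)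
qed

lemma pd_zero: "pd (eb (CT i)) (ham0 h) z = 0" "pd (eb CX) (ham0 h) z = 0"
  by (cases z, simp add: pd_def eb_simps cscale_def)+

lemma mono1: "t <= 1 ==> z \<in> P t ==> z \<in> P 1" using P_mono by blast

text \<open>The derivative of h in J_i has to be recovered from \<open>ham0\<close>, whose
  derivatives in p_i and q_i vanish at p_i = q_i = 0. The section moves z to a point with the same J
  but p_i = c, not 0; there a shift of q_i changes J_i at the rate c.\<close>

definition sec :: "real => 'b => ('a, 'b) phase => ('a, 'b) phase" where
  "sec c i z = mk (\<lambda>l. if l = CP i then of_real c else if l = CQ i then co (CP i) z * co (CQ i) z / of_real c else co l z)"

lemma sec_P:
  assumes z: "z \<in> P t" and t: "t < 1" shows "sec (t * \<delta>) i z \<in> P 1"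
proof -
  have t0: "0 < t" using P_pos[OF z] .
  obtain a b c where abc: "a \<in> II" "b \<in> YY" "c \<in> XX" "\<forall>i. dd a b c z i < t * rad i"
    using z P_iff by blast
  have le: "t * rad l < 1 * rad l" for l using t rad[of l] by simp
  have pq: "cmod (co (CP i) z) < t * \<delta>" "cmod (co (CQ i) z) < t * \<delta>"
    using abc(4)[rule_format, of "CP i"] abc(4)[rule_format, of "CQ i"] by simp_all
  have td: "0 < t * \<delta>" "t * \<delta> < \<delta>" using t t0 pos by simp_all
  have "cmod (co (CP i) z * co (CQ i) z / of_real (t * \<delta>)) < \<delta>"
  proof -
    have "cmod (co (CP i) z) * cmod (co (CQ i) z) <= (t * \<delta>) * (t * \<delta>)"
      using pq td by (intro mult_mono) auto
    also have "... < \<delta> * (t * \<delta>)" using td by (intro mult_strict_right_mono)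
    finally have "cmod (co (CP i) z) * cmod (co (CQ i) z) / (t * \<delta>) < \<delta>" using td(1) by (simp add: pos_divide_less_eq)
    then show ?thesis using td(1) by (simp add: norm_mult norm_divide abs_of_pos del: of_real_mult)
  qed
  then have "dd a b c (sec (t * \<delta>) i z) l < 1 * rad l" for l
    using less_trans[OF abc(4)[rule_format, of l] le[of l]] td t t0
    by (cases l) (auto simp: sec_def abs_mult simp del: of_real_mult)
  then show ?thesis unfolding P_iff using abc(1-3) by blast
qed

lemma ham0_J:
  assumes z: "z \<in> P t" and t: "t < 1"
  shows "((\<lambda>w. h (fst z) (JJ (fst (snd (snd z))) (fst (snd (snd (snd z)))) + axis i w) (fst (snd (snd (snd (snd z))))))
    has_field_derivative omega_J h z i) (at 0)"
    and "omega_J h z i = pd (eb (CQ i)) (ham0 h) (sec (t * \<delta>) i z) / of_real (t * \<delta>)"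
proof -
  obtain I \<theta> p q y x where zz: "z = (I, \<theta>, p, q, y, x)" by (metis prod.exhaust)
  define c where "c = complex_of_real (t * \<delta>)"
  have c: "c \<noteq> 0" using P_pos[OF z] pos by (simp add: c_def)
  let ?g = "\<lambda>w. h I (JJ p q + axis i w) y"
  let ?z = "sec (t * \<delta>) i z"
  have g: "ham0 h (?z + cscale w (eb (CQ i))) = ?g (c * w)" for w
  proof -
    obtain I' \<theta>' p' q' y' x' where e: "?z + cscale w (eb (CQ i)) = (I', \<theta>', p', q', y', x')" by (metis prod.exhaust)
    have co: "co l (I', \<theta>', p', q', y', x') = (if l = CP i then c else if l = CQ i then p $ i * q $ i / c + w else co l z)" for l
      unfolding e[symmetric] by (auto simp: sec_def co_eb c_def zz)
    have "I' = I" "y' = y" using co[of "CI _"] co[of CY] by (auto simp: zz vec_eq_iff)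
    moreover have "JJ p' q' = JJ p q + axis i (c * w)"
    proof -
      have "p' $ l * q' $ l = p $ l * q $ l + (if l = i then c * w else 0)" for l
      using co[of "CP l"] co[of "CQ l"] c by (simp add: zz field_simps)
      then show ?thesis by (simp add: JJ_def vec_eq_iff axis_def)
    qed
    ultimately show ?thesis by (simp add: e)
  qed
  have "((\<lambda>w. ham0 h (?z + cscale w (eb (CQ i)))) has_field_derivative pd (eb (CQ i)) (ham0 h) (?z + cscale 0 (eb (CQ i)))) (at 0)"
    by (rule holo_line[OF H0]) (use sec_P[OF z t] in simp)
  then have "((\<lambda>w. ?g (c * w)) has_field_derivative pd (eb (CQ i)) (ham0 h) ?z) (at (0 / c))"
    unfolding g by simp
  then have "((\<lambda>w. ?g (c * (w / c))) has_field_derivative pd (eb (CQ i)) (ham0 h) ?z * (1 / c)) (at 0)"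
    by (rule DERIV_chain2) (use c in \<open>auto intro!: derivative_eq_intros\<close>)
  then have d: "(?g has_field_derivative pd (eb (CQ i)) (ham0 h) ?z / c) (at 0)" using c by simp
  then show "omega_J h z i = pd (eb (CQ i)) (ham0 h) ?z / of_real (t * \<delta>)"
    using DERIV_imp_deriv[OF d] by (simp add: zz c_def)
  then show "((\<lambda>w. h (fst z) (JJ (fst (snd (snd z))) (fst (snd (snd (snd z)))) + axis i w) (fst (snd (snd (snd (snd z))))))
    has_field_derivative omega_J h z i) (at 0)"
    using d by (simp add: zz c_def)
qed

lemma pd_pq:
  assumes z: "z \<in> P t" and t: "t < 1"
  shows "pd (eb (CQ i)) (ham0 h) z = omega_J h z i * co (CP i) z"
    and "pd (eb (CP i)) (ham0 h) z = omega_J h z i * co (CQ i) z"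
proof -
  obtain I \<theta> p q y x where zz: "z = (I, \<theta>, p, q, y, x)" by (metis prod.exhaust)
  let ?g = "\<lambda>w. h I (JJ p q + axis i w) y"
  have d: "(?g has_field_derivative omega_J h z i) (at 0)" using ham0_J(1)[OF z t, of i] by (simp add: zz)
  have dc: "((\<lambda>w. ?g (c * w)) has_field_derivative omega_J h z i * c) (at 0)" for c
    by (rule DERIV_chain2[where g = "\<lambda>w. c * w" and f = ?g]) (use d in \<open>auto intro!: derivative_eq_intros\<close>)
  have "JJ p (q + w *s axis i 1) = JJ p q + axis i (p $ i * w)" "JJ (p + w *s axis i 1) q = JJ p q + axis i (q $ i * w)" for w
    by (auto simp: JJ_def vec_eq_iff axis_def algebra_simps)
  then have "pd (eb (CQ i)) (ham0 h) z = deriv (\<lambda>w. ?g (p $ i * w)) 0" "pd (eb (CP i)) (ham0 h) z = deriv (\<lambda>w. ?g (q $ i * w)) 0"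
    by (simp_all add: pd_def zz eb_simps cscale_def)
  then show "pd (eb (CQ i)) (ham0 h) z = omega_J h z i * co (CP i) z"
     "pd (eb (CP i)) (ham0 h) z = omega_J h z i * co (CQ i) z"
    using DERIV_imp_deriv[OF dc] by (simp_all add: zz)
qed

text \<open>The coefficient of the linear equation in x, as \<open>lie_ham0\<close> shows. It does
  not depend on x itself (\<open>Lam_xs\<close>), which makes the equation explicitly
  solvable.\<close>

definition Lam :: "(('a, 'b) ix => int) => ('a, 'b) func" where
  "Lam mu z = \<i> * (\<Sum>i\<in>UNIV. of_int (mu (CT i)) * (omega_I h z i / omega_y h z)) +
     (\<Sum>i\<in>UNIV. of_int (mu (CQ i)) * (omega_J h z i / omega_y h z))"

definition nmu :: "(('a, 'b) ix => int) => real" where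
  "nmu mu = s * (\<Sum>i\<in>UNIV. \<bar>of_int (mu (CT i))\<bar>) + (\<Sum>i\<in>UNIV. \<bar>of_int (mu (CQ i))\<bar>)"

lemma holo_omega: "holo_on (omega_y h) (P 1)" "holo_on (\<lambda>z. omega_I h z i) (P 1)"
  unfolding omega_y_pd[abs_def] omega_I_pd[abs_def] by (rule holo_pd[OF open_P H0])+

lemma holo_omega_J: assumes t: "t < 1" shows "holo_on (\<lambda>z. omega_J h z i) (P t)"
proof (rule holo_cong[OF open_P])
  show "pd (eb (CQ i)) (ham0 h) (sec (t * \<delta>) i z) / of_real (t * \<delta>) = omega_J h z i" if "z \<in> P t" for z
    using ham0_J(2)[OF that t] by simp
  show "holo_on (\<lambda>z. pd (eb (CQ i)) (ham0 h) (sec (t * \<delta>) i z) / of_real (t * \<delta>)) (P t)"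
  proof (cases "t = 0")
    case False
    have "holo_on (\<lambda>z. pd (eb (CQ i)) (ham0 h) (sec (t * \<delta>) i z)) (P t)"
    proof (rule holo_comp[OF _ holo_pd[OF open_P H0] sec_P[OF _ t]])
      fix l
      show "holo_on (\<lambda>z. co l (sec (t * \<delta>) i z)) (P t)"
      unfolding sec_def co_mk using False pos
      by (cases "l = CP i"; cases "l = CQ i") (simp_all add: holo_intros)
    qed
    then show ?thesis by (rule holo_divide) (use False pos in simp_all)
  qed simp
qed

lemma holo_Lam: assumes t: "t < 1" shows "holo_on (Lam mu) (P t)"
proof -
  have sub: "P t \<subseteq> P 1" using t by (simp add: P_mono)
  show ?thesis
    unfolding Lam_def[abs_def]
    by (intro holo_add holo_mult holo_sum holo_const holo_divide holo_omega_J[OF t] holo_subset[OF holo_omega(1) sub]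
      holo_subset[OF holo_omega(2) sub] wy subsetD[OF sub])
qed

lemma omega_cong:
  assumes "\<And>i. co (CI i) z = co (CI i) z'" "co CY z = co CY z'" "\<And>i. co (CP i) z * co (CQ i) z = co (CP i) z' * co (CQ i) z'"
  shows "omega_y h z = omega_y h z'" "omega_I h z i = omega_I h z' i" "omega_J h z l = omega_J h z' l" "Lam mu z = Lam mu z'"
proof -
  obtain I \<theta> p q y x where zz: "z = (I, \<theta>, p, q, y, x)" by (metis prod.exhaust)
  obtain I' \<theta>' p' q' y' x' where zz': "z' = (I', \<theta>', p', q', y', x')" by (metis prod.exhaust)
  have "I = I'" "y = y'" using assms(1,2) by (auto simp: zz zz' vec_eq_iff)
  moreover have "JJ p q = JJ p' q'" using assms(3) by (simp add: JJ_def vec_eq_iff zz zz')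
  ultimately show y: "omega_y h z = omega_y h z'" and I: "omega_I h z i = omega_I h z' i" for i by (simp_all add: zz zz')
  show J: "omega_J h z l = omega_J h z' l" for l using \<open>I = I'\<close> \<open>y = y'\<close> \<open>JJ p q = JJ p' q'\<close> by (simp add: zz zz')
  show "Lam mu z = Lam mu z'" by (simp add: Lam_def y I J)
qed

lemma Lam_rot: "Lam mu (rota (av v) w z) = Lam mu z" "omega_y h (rota (av v) w z) = omega_y h z"
proof -
  have "co (CP i) (rota (av v) w z) * co (CQ i) (rota (av v) w z) = co (CP i) z * co (CQ i) z" for i
  proof -
    have "exp (\<i> * (w * of_int (av v (CP i)))) * exp (\<i> * (w * of_int (av v (CQ i)))) = 1"
      by (cases v) (auto simp: exp_add[symmetric])
    then show ?thesis by (simp add: co_rot mult_ac)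
  qed
  then show "Lam mu (rota (av v) w z) = Lam mu z" "omega_y h (rota (av v) w z) = omega_y h z"
    by (intro omega_cong; simp add: co_rot)+
qed

lemma Lam_xs: "Lam mu (xs z w) = Lam mu z" "Lam mu (z + cscale w (eb CX)) = Lam mu z"
  by (intro omega_cong; simp add: co_eb)+

text \<open>Euler's identity gives the \<theta> derivatives of \<phi>, and for each pair (p_i, q_i)
  the operator q_i d/dq_i - p_i d/dp_i, the only combination that meets the J derivative of h. Only
  the x derivative of \<phi> remains as a derivative.\<close>

lemma lie_ham0:
  assumes \<phi>: "holo_on \<phi> (P t)" "gr (P t) mu \<phi>" and t: "t < 1" and z: "z \<in> P t"
  shows "lie \<phi> (ham0 h) z = - omega_y h z * (Lam mu z * \<phi> z + pd (eb CX) \<phi> z)"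
proof -
  have z1: "z \<in> P 1" using mono1[of t z] t z by simp
  have T: "pd (eb (CT i)) \<phi> z = \<i> * of_int (mu (CT i)) * \<phi> z" for i
  proof -
    have "VV (av (CT i)) z = eb (CT i)" by (rule phase_eqI) (auto simp: VV_def co_eb split: ix.split)
    then show ?thesis using euler[of "av (CT i)" "mu (CT i)" t \<phi> z] \<phi> z unfolding gr_def by simp
  qed
  have Q: "co (CQ i) z * pd (eb (CQ i)) \<phi> z - co (CP i) z * pd (eb (CP i)) \<phi> z = of_int (mu (CQ i)) * \<phi> z" for i
  proof -
    have "VV (av (CQ i)) z = cscale (\<i> * co (CQ i) z) (eb (CQ i)) + cscale (- (\<i> * co (CP i) z)) (eb (CP i))"
      by (rule phase_eqI) (auto simp: VV_def co_eb split: ix.split)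
    then have "\<i> * co (CQ i) z * pd (eb (CQ i)) \<phi> z - \<i> * co (CP i) z * pd (eb (CP i)) \<phi> z = \<i> * of_int (mu (CQ i)) * \<phi> z"
      using euler[of "av (CQ i)" "mu (CQ i)" t \<phi> z] \<phi> z unfolding gr_def
      by (simp add: pd_add[OF \<phi>(1) z] holo_at(2)[OF \<phi>(1) z])
    then have "\<i> * (co (CQ i) z * pd (eb (CQ i)) \<phi> z - co (CP i) z * pd (eb (CP i)) \<phi> z) = \<i> * (of_int (mu (CQ i)) * \<phi> z)"
      by (simp add: algebra_simps)
    then show ?thesis by simp
  qed
  have "lie \<phi> (ham0 h) z = - (\<Sum>i\<in>UNIV. pd (eb (CT i)) \<phi> z * omega_I h z i)
     - (\<Sum>i\<in>UNIV. pd (eb (CQ i)) \<phi> z * (omega_J h z i * co (CQ i) z)) + (\<Sum>i\<in>UNIV. pd (eb (CP i)) \<phi> z * (omega_J h z i * co (CP i) z))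
     - pd (eb CX) \<phi> z * omega_y h z"
    unfolding lie_eq_sum sum_ix
    by (simp add: pd_zero omega_I_pd[symmetric] omega_y_pd[symmetric] pd_pq[OF z t] sum_negf)
  also have "... = - (\<Sum>i\<in>UNIV. \<i> * of_int (mu (CT i)) * \<phi> z * omega_I h z i)
     - (\<Sum>i\<in>UNIV. omega_J h z i * (co (CQ i) z * pd (eb (CQ i)) \<phi> z - co (CP i) z * pd (eb (CP i)) \<phi> z)) - pd (eb CX) \<phi> z * omega_y h z"
    by (simp add: T right_diff_distrib sum_subtractf mult_ac)
  also have "... = - omega_y h z * (Lam mu z * \<phi> z + pd (eb CX) \<phi> z)"
    unfolding Q Lam_def using wy[OF z1]
    by (simp add: distrib_left distrib_right sum_distrib_left sum_distrib_right sum_negf mult_ac)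
  finally show ?thesis .
qed

end

locale ham = ham_dom +
  fixes K N :: real and x0 :: real
  assumes N: "0 < N" and ImI: "\<And>z i. z \<in> P 1 ==> 4 * N * K * \<bar>Im (omega_I h z i / omega_y h z)\<bar> <= s"
    and J1: "\<And>z i. z \<in> P 1 ==> 4 * N * K * cmod (omega_J h z i / omega_y h z) <= 1"
    and XX: "open XX" "connected XX" and x0: "x0 \<in> XX" "\<And>c. c \<in> XX ==> \<bar>c - x0\<bar> + \<xi> <= K"
begin

lemma K: "0 < K" "\<xi> <= K" using x0(2)[OF x0(1)] pos by auto

text \<open>The factor i turns the imaginary part of omega_I / omega_y into a real part of
  \<open>Lam\<close>, which alone governs growth in the real x direction. This is why the hypothesis
  on omega_I concerns the imaginary part only.\<close>

lemma Re_Lam: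
  assumes z: "z \<in> P 1" shows "4 * N * K * \<bar>Re (Lam mu z)\<bar> <= nmu mu"
proof -
  let ?a = "\<lambda>i. of_int (mu (CT i)) * (omega_I h z i / omega_y h z)" and ?b = "\<lambda>i. of_int (mu (CQ i)) * (omega_J h z i / omega_y h z)"
  have nk: "0 <= 4 * N * K" using N K by simp
  have "Re (Lam mu z) = - (\<Sum>i\<in>UNIV. Im (?a i)) + (\<Sum>i\<in>UNIV. Re (?b i))" by (simp add: Lam_def)
  then have "\<bar>Re (Lam mu z)\<bar> <= \<bar>\<Sum>i\<in>UNIV. Im (?a i)\<bar> + \<bar>\<Sum>i\<in>UNIV. Re (?b i)\<bar>" by linarith
  also have "... <= (\<Sum>i\<in>UNIV. \<bar>Im (?a i)\<bar>) + (\<Sum>i\<in>UNIV. cmod (?b i))"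
    by (intro add_mono sum_abs order_trans[OF sum_abs] sum_mono abs_Re_le_cmod)
  finally have "4 * N * K * \<bar>Re (Lam mu z)\<bar> <= 4 * N * K * ((\<Sum>i\<in>UNIV. \<bar>Im (?a i)\<bar>) + (\<Sum>i\<in>UNIV. cmod (?b i)))"
    using nk by (rule mult_left_mono)
  also have "... = (\<Sum>i\<in>UNIV. \<bar>of_int (mu (CT i))\<bar> * (4 * N * K * \<bar>Im (omega_I h z i / omega_y h z)\<bar>)) +
      (\<Sum>i\<in>UNIV. \<bar>of_int (mu (CQ i))\<bar> * (4 * N * K * cmod (omega_J h z i / omega_y h z)))"
  proof -
    have "\<bar>Im (?a i)\<bar> = \<bar>of_int (mu (CT i))\<bar> * \<bar>Im (omega_I h z i / omega_y h z)\<bar>" for i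
    proof -
      have "\<bar>Im (of_int a * w)\<bar> = \<bar>of_int a\<bar> * \<bar>Im w\<bar>" for a w by (simp add: abs_mult)
      then show ?thesis .
    qed
    moreover have "cmod (?b i) = \<bar>of_int (mu (CQ i))\<bar> * cmod (omega_J h z i / omega_y h z)" for i
      by (simp only: norm_mult norm_of_int)
    ultimately show ?thesis by (simp only: distrib_left sum_distrib_left mult_ac)
  qed
  also have "... <= (\<Sum>i\<in>UNIV. \<bar>of_int (mu (CT i))\<bar> * s) + (\<Sum>i\<in>UNIV. \<bar>of_int (mu (CQ i))\<bar> * 1)"
    by (intro add_mono sum_mono mult_left_mono ImI J1 z) auto
  also have "... = nmu mu" by (simp add: nmu_def sum_distrib_left mult.commute)
  finally show ?thesis .
qed

end

subsection \<open>The homological equation\<close>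

text \<open>For |Im w| < pi / 2 the cosine is positive, so |1 + exp w| is at least 1 and at least
  exp (Re w). The weight and its complement are thus bounded by 1, and each decays on one
  side.\<close>

lemma logistic:
  fixes w :: complex
  assumes "\<bar>Im w\<bar> < pi / 2"
  shows "1 + exp w \<noteq> 0" "cmod (1 / (1 + exp w)) <= 1" "cmod (1 / (1 + exp w)) <= exp (- Re w)"
    "cmod (1 - 1 / (1 + exp w)) <= 1" "cmod (1 - 1 / (1 + exp w)) <= exp (Re w)"
proof -
  have c: "cos (Im w) > 0" using assms by (intro cos_gt_zero_pi) auto
  have n: "(cmod (1 + exp w))\<^sup>2 = 1 + 2 * exp (Re w) * cos (Im w) + (exp (Re w))\<^sup>2"
  proof -
    have "(cmod (1 + exp w))\<^sup>2 = (1 + exp (Re w) * cos (Im w))\<^sup>2 + (exp (Re w) * sin (Im w))\<^sup>2"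
      by (simp add: cmod_power2 Re_exp Im_exp)
    also have "... = 1 + 2 * exp (Re w) * cos (Im w) + (exp (Re w))\<^sup>2 * ((cos (Im w))\<^sup>2 + (sin (Im w))\<^sup>2)"
    proof -
      have "(1 + a * c)\<^sup>2 + (a * b)\<^sup>2 = 1 + 2 * a * c + a\<^sup>2 * (c\<^sup>2 + b\<^sup>2)" for a b c :: real
      by (simp add: power2_eq_square algebra_simps)
      then show ?thesis .
    qed
    finally show ?thesis by simp
  qed
  have ge: "1\<^sup>2 <= (cmod (1 + exp w))\<^sup>2" "(exp (Re w))\<^sup>2 <= (cmod (1 + exp w))\<^sup>2"
    unfolding n using c by (auto intro: add_nonneg_nonneg mult_nonneg_nonneg)
  have ge1: "1 <= cmod (1 + exp w)" and ge2: "exp (Re w) <= cmod (1 + exp w)"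
    using power2_le_imp_le[OF ge(1)] power2_le_imp_le[OF ge(2)] by auto
  show nz: "1 + exp w \<noteq> 0" using ge1 by auto
  have e: "1 - 1 / (1 + exp w) = exp w / (1 + exp w)" using nz by (simp add: field_simps)
  have pos: "0 < cmod (1 + exp w)" using ge1 by linarith
  show "cmod (1 / (1 + exp w)) <= 1" "cmod (1 - 1 / (1 + exp w)) <= 1"
    unfolding e using ge1 ge2 pos by (simp_all add: norm_divide divide_le_eq)
  have "exp (- Re w) * exp (Re w) <= exp (- Re w) * cmod (1 + exp w)" using ge2 by (intro mult_left_mono) auto
  then show "cmod (1 / (1 + exp w)) <= exp (- Re w)"
    using pos by (simp add: norm_divide divide_le_eq exp_minus)
  have "exp (Re w) * 1 <= exp (Re w) * cmod (1 + exp w)" using ge1 by (intro mult_left_mono) auto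
  then show "cmod (1 - 1 / (1 + exp w)) <= exp (Re w)"
    unfolding e using pos by (simp add: norm_divide divide_le_eq)
qed

context ham begin

lemma XX_convex: "convex XX" using XX(2) by (simp add: connected_convex_1)

lemma xs_P:
  assumes z: "z \<in> P t" and t: "t <= T" and w: "w \<in> nbhd_line XX (T * \<xi>)" shows "xs z w \<in> P T"
proof -
  obtain a b c where abc: "a \<in> II" "b \<in> YY" "\<forall>i. dd a b c z i < t * rad i" using z P_iff by blast
  obtain c' where c': "c' \<in> XX" "cmod (w - of_real c') < T * \<xi>" using w by (auto simp: nbhd_line_def)
  have le: "t * rad i <= T * rad i" for i using t rad[of i] by simp
  have "dd a b c' (xs z w) i < T * rad i" for i
    using less_le_trans[OF abc(3)[rule_format, of i] le[of i]] c'(2) by (cases i) simp_all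
  then show ?thesis unfolding P_iff using abc(1,2) c'(1) by blast
qed

lemma coX: assumes z: "z \<in> P t" obtains c where "c \<in> XX" "cmod (co CX z - of_real c) < t * \<xi>"
proof -
  obtain c where "c \<in> XX" "dd undefined undefined c z CX < t * rad CX"
  proof -
    obtain a b c where abc: "c \<in> XX" "\<forall>i. dd a b c z i < t * rad i" using z P_iff by blast
    show ?thesis by (rule that[OF abc(1)]) (use abc(2)[rule_format, of CX] in simp)
  qed
  then show ?thesis using that by simp
qed

context
  fixes t T :: real and mu :: "('a, 'b) ix => int" and b :: "('a, 'b) func" and B :: real
  assumes tT: "0 < t" "t < T" "T <= 1"
    and b: "holo_on b (P T)" "gr (P T) mu b" "\<And>z. z \<in> P T ==> cmod (b z) <= B" and mu: "nmu mu <= 3 * N"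
begin

text \<open>
  \<open>TT \<beta>\<close> solves \<open>\<partial>\<^sub>x \<phi> + \<Lambda> \<phi> = b\<close> with initial value \<open>0\<close> at \<open>x = \<beta>\<close>. Since the imaginary part of \<open>\<Lambda>\<close> is not bounded,
  no single base point gives a bounded solution for complex \<open>x\<close>. The two base points \<open>x0 \<plusminus> \<i> t \<xi>\<close> lie above
  and below every \<open>x\<close>, and the logistic weight \<open>th\<close>, which does not depend on \<open>x\<close>, compensates the
  exponential growth of each of the two solutions.
\<close>

definition TT :: "complex => ('a, 'b) func" where
  "TT \<beta> z = integral {0..1} (\<lambda>\<tau>. (co CX z - \<beta>) * exp (- ((1 - of_real \<tau>) * (co CX z - \<beta>) * Lam mu z))
     * b (xs z (\<beta> + of_real \<tau> * (co CX z - \<beta>))))"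

definition bs :: "real => complex" where "bs \<sigma> = Complex x0 (\<sigma> * t * \<xi>)"

definition th :: "('a, 'b) func" where "th z = 1 / (1 + exp (2 * of_real (t * \<xi>) * \<i> * Lam mu z))"

definition ph :: "('a, 'b) func" where "ph z = th z * TT (bs 1) z + (1 - th z) * TT (bs (- 1)) z"

lemma t1: "t < 1" using tT by simp
lemma Pt1: "z \<in> P t ==> z \<in> P 1" using mono1[of t z] t1 by simp

text \<open>The constant 3 / 4 is the cut-off 3 * N over the factor 4 * N of the frequency
  hypotheses.\<close>

lemma ReL: assumes z: "z \<in> P t" shows "K * \<bar>Re (Lam mu z)\<bar> <= 3 / 4"
proof -
  have "4 * N * (K * \<bar>Re (Lam mu z)\<bar>) <= 4 * N * (3 / 4)"
    using Re_Lam[OF Pt1[OF z], of mu] mu by (simp add: mult.assoc)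
  then show ?thesis using N by (simp add: mult_le_cancel_left_pos)
qed

lemma B0: "z \<in> P t ==> 0 <= B"
proof -
  assume "z \<in> P t"
  then have "z \<in> P T" using P_mono[of t T] tT by auto
  then show ?thesis using b(3) norm_ge_zero order_trans by blast
qed

lemma bs_in: assumes "\<bar>\<sigma>\<bar> <= 1" shows "bs \<sigma> \<in> nbhd_line XX (T * \<xi>)"
proof -
  have "bs \<sigma> - of_real x0 = of_real (\<sigma> * t * \<xi>) * \<i>" by (simp add: bs_def complex_eq_iff)
  then have "cmod (bs \<sigma> - of_real x0) = \<bar>\<sigma> * t * \<xi>\<bar>" by (simp only: norm_mult norm_of_real norm_ii mult_1_right)
  also have "... <= 1 * (t * \<xi>)" using assms tT pos by (simp add: abs_mult mult.assoc mult_right_mono)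
  also have "... < T * \<xi>" using tT pos by simp
  finally show ?thesis using x0(1) by (auto simp: nbhd_line_def)
qed

lemma x_in: assumes z: "z \<in> P t" shows "co CX z \<in> nbhd_line XX (T * \<xi>)"
proof -
  obtain c where c: "c \<in> XX" "cmod (co CX z - of_real c) < t * \<xi>" using coX[OF z] .
  moreover have "t * \<xi> < T * \<xi>" using tT pos by simp
  ultimately have "cmod (co CX z - of_real c) < T * \<xi>" by linarith
  then show ?thesis using c(1) by (auto simp: nbhd_line_def)
qed

lemma seg_in:
  assumes z: "z \<in> P t" and \<sigma>: "\<bar>\<sigma>\<bar> <= 1" and \<tau>: "\<tau> \<in> {0..1}"
  shows "xs z (bs \<sigma> + of_real \<tau> * (co CX z - bs \<sigma>)) \<in> P T"
proof (rule xs_P[OF z])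
  have "(1 - \<tau>) *\<^sub>R bs \<sigma> + \<tau> *\<^sub>R co CX z \<in> nbhd_line XX (T * \<xi>)"
    by (rule convexD_alt[OF nbhd_line_convex[OF XX_convex] bs_in[OF \<sigma>] x_in[OF z]]) (use \<tau> in auto)
  moreover have "(1 - \<tau>) *\<^sub>R bs \<sigma> + \<tau> *\<^sub>R co CX z = bs \<sigma> + of_real \<tau> * (co CX z - bs \<sigma>)"
    by (simp add: scaleR_conv_of_real algebra_simps)
  ultimately show "bs \<sigma> + of_real \<tau> * (co CX z - bs \<sigma>) \<in> nbhd_line XX (T * \<xi>)" by simp
qed (use tT in simp)

lemma dist_bs:
  assumes z: "z \<in> P t" and \<sigma>: "\<sigma> = 1 \<or> \<sigma> = - 1"
  shows "cmod (co CX z - bs \<sigma>) <= 2 * K" "\<bar>Re (co CX z - bs \<sigma>)\<bar> <= K"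
    "0 <= - \<sigma> * Im (co CX z - bs \<sigma>)" "- \<sigma> * Im (co CX z - bs \<sigma>) <= 2 * (t * \<xi>)"
proof -
  obtain c where c: "c \<in> XX" "cmod (co CX z - of_real c) < t * \<xi>" using coX[OF z] .
  have l: "\<bar>c - x0\<bar> + \<xi> <= K" by (rule x0(2)[OF c(1)])
  have tx: "0 < t * \<xi>" "t * \<xi> <= \<xi>" using tT pos by simp_all
  have im: "\<bar>Im (co CX z)\<bar> < t * \<xi>" using abs_Im_le_cmod[of "co CX z - of_real c"] c(2) by simp
  have re: "\<bar>Re (co CX z) - c\<bar> < t * \<xi>" using abs_Re_le_cmod[of "co CX z - of_real c"] c(2) by simp
  have cb: "cmod (of_real c - bs \<sigma>) <= \<bar>c - x0\<bar> + t * \<xi>"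
    using cmod_le[of "of_real c - bs \<sigma>"] \<sigma> tx by (auto simp: bs_def)
  have "cmod (co CX z - bs \<sigma>) <= cmod (co CX z - of_real c) + cmod (of_real c - bs \<sigma>)"
    using norm_triangle_ineq[of "co CX z - of_real c" "of_real c - bs \<sigma>"] by simp
  then show "cmod (co CX z - bs \<sigma>) <= 2 * K" using c(2) cb l tx by linarith
  show "\<bar>Re (co CX z - bs \<sigma>)\<bar> <= K" using re l tx by (simp add: bs_def)
  show "0 <= - \<sigma> * Im (co CX z - bs \<sigma>)" "- \<sigma> * Im (co CX z - bs \<sigma>) <= 2 * (t * \<xi>)"
  proof -
    define E where "E = t * \<xi>"
    have e: "Im (co CX z - bs \<sigma>) = Im (co CX z) - \<sigma> * E" by (simp add: bs_def E_def)
    have im: "\<bar>Im (co CX z)\<bar> < E" using im by (simp add: E_def)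
    show "0 <= - \<sigma> * Im (co CX z - bs \<sigma>)" "- \<sigma> * Im (co CX z - bs \<sigma>) <= 2 * (t * \<xi>)"
      unfolding e E_def[symmetric] using \<sigma> im by auto
  qed
qed

text \<open>Since t \<xi> <= K, the imaginary part is at most 2 * 3/4 = 3/2 < pi / 2: the cut-off 3
  * N just fits the range of \<open>logistic\<close>.\<close>

lemma th_arg: assumes z: "z \<in> P t" shows "\<bar>Im (2 * of_real (t * \<xi>) * \<i> * Lam mu z)\<bar> < pi / 2"
proof -
  have "\<bar>Im (2 * of_real (t * \<xi>) * \<i> * Lam mu z)\<bar> = 2 * (t * \<xi>) * \<bar>Re (Lam mu z)\<bar>"
    using tT pos by (simp add: abs_mult)
  also have "... <= 2 * K * \<bar>Re (Lam mu z)\<bar>"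
  proof (intro mult_right_mono mult_left_mono)
    have "t * \<xi> <= 1 * \<xi>" using tT pos by (intro mult_right_mono) auto
    then show "t * \<xi> <= K" using K by simp
  qed auto
  also have "... <= 3 / 2" using ReL[OF z] by simp
  also have "... < pi / 2" using pi_gt3 by simp
  finally show ?thesis .
qed

lemma Re_arg: "Re (2 * of_real (t * \<xi>) * \<i> * Lam mu z) = - (2 * (t * \<xi>) * Im (Lam mu z))" by simp

lemma integrand_cont:
  assumes \<sigma>: "\<bar>\<sigma>\<bar> <= 1"
  shows "continuous_on ({0..1} \<times> P t) (\<lambda>(\<tau>, z). (co CX z - bs \<sigma>) * exp (- ((1 - of_real \<tau>) * (co CX z - bs \<sigma>) * Lam mu z))
     * b (xs z (bs \<sigma> + of_real \<tau> * (co CX z - bs \<sigma>))))"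
proof -
  have c0: "continuous_on ({0..1} \<times> P t) (\<lambda>y :: real \<times> ('a, 'b) phase. co i (snd y))" for i
    by (intro continuous_on_co continuous_intros)
  have cL: "continuous_on ({0..1} \<times> P t) (\<lambda>y :: real \<times> ('a, 'b) phase. Lam mu (snd y))"
    by (rule continuous_on_compose2[OF holo_continuous[OF holo_Lam[OF t1]] continuous_on_snd[OF continuous_on_id]]) auto
  have cx: "continuous_on ({0..1} \<times> P t) (\<lambda>y :: real \<times> ('a, 'b) phase. xs (snd y) (bs \<sigma> + of_real (fst y) * (co CX (snd y) - bs \<sigma>)))"
    unfolding xs_def
  proof (rule continuous_on_mk)
    fix i
    show "continuous_on ({0..1} \<times> P t) (\<lambda>y :: real \<times> ('a, 'b) phase. if i = CX then bs \<sigma> + of_real (fst y) * (co CX (snd y) - bs \<sigma>) else co i (snd y))"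
      by (cases "i = CX") (auto intro!: continuous_intros c0)
  qed
  have "continuous_on ({0..1} \<times> P t) (\<lambda>y. b (xs (snd y) (bs \<sigma> + of_real (fst y) * (co CX (snd y) - bs \<sigma>))))"
    by (rule continuous_on_compose2[OF holo_continuous[OF b(1)] cx]) (use seg_in[OF _ \<sigma>] in \<open>auto simp: mem_Times_iff\<close>)
  then show ?thesis unfolding case_prod_unfold by (intro continuous_intros c0 cL)
qed

lemma TT_holo: assumes \<sigma>: "\<bar>\<sigma>\<bar> <= 1" shows "holo_on (TT (bs \<sigma>)) (P t)"
  unfolding TT_def[abs_def]
proof (rule holo_integral(1)[OF open_P _ integrand_cont[OF \<sigma>]])
  fix \<tau> :: real assume \<tau>: "\<tau> \<in> {0..1}"
  have "holo_on (\<lambda>z. co i (xs z (bs \<sigma> + of_real \<tau> * (co CX z - bs \<sigma>)))) (P t)" for i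
    by (cases "i = CX") (simp_all add: holo_intros)
  then have "holo_on (\<lambda>z. b (xs z (bs \<sigma> + of_real \<tau> * (co CX z - bs \<sigma>)))) (P t)"
    by (rule holo_comp[OF _ b(1) seg_in[OF _ \<sigma> \<tau>]])
  then show "holo_on (\<lambda>z. (co CX z - bs \<sigma>) * exp (- ((1 - of_real \<tau>) * (co CX z - bs \<sigma>) * Lam mu z))
     * b (xs z (bs \<sigma> + of_real \<tau> * (co CX z - bs \<sigma>)))) (P t)"
    by (intro holo_mult holo_exp holo_uminus holo_diff holo_const holo_co holo_Lam[OF t1])
qed

lemma th_holo: "holo_on th (P t)"
  unfolding th_def[abs_def]
  by (intro holo_divide holo_add holo_exp holo_mult holo_const holo_Lam[OF t1] logistic(1) th_arg)

lemma ph_holo: "holo_on ph (P t)"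
  unfolding ph_def[abs_def] by (intro holo_add holo_mult holo_diff holo_const th_holo TT_holo) auto

text \<open>The real part of the exponent has two parts. The product of real parts is at most 3 / 4.
  In the product of imaginary parts the sign of Im (x - \<beta>) is fixed by \<sigma>, because
  \<beta> lies above or below every x; so it can grow for one sign of Im \<Lambda> only, and by at
  most 2 t \<xi> |Im \<Lambda>|.\<close>

lemma TT_bound:
  assumes z: "z \<in> P t" and \<sigma>: "\<sigma> = 1 \<or> \<sigma> = - 1"
  shows "cmod (TT (bs \<sigma>) z) <= 2 * K * (exp (3 / 4) * max 1 (exp (- (\<sigma> * (2 * (t * \<xi>) * Im (Lam mu z)))))) * B"
proof -
  let ?E = "exp (3 / 4) * max 1 (exp (- (\<sigma> * (2 * (t * \<xi>) * Im (Lam mu z)))))"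
  let ?x = "co CX z - bs \<sigma>"
  have \<sigma>1: "\<bar>\<sigma>\<bar> <= 1" using \<sigma> by auto
  have c: "continuous_on {0..1} (\<lambda>\<tau>. ?x * exp (- ((1 - of_real \<tau>) * ?x * Lam mu z)) * b (xs z (bs \<sigma> + of_real \<tau> * ?x)))"
  proof -
    have "continuous_on {0..1} (\<lambda>\<tau>. (\<tau> :: real, z))" by (intro continuous_intros)
    moreover have "(\<lambda>\<tau>. (\<tau>, z)) ` {0..1} \<subseteq> {0..1} \<times> P t" using z by blast
    ultimately show ?thesis using continuous_on_compose2[OF integrand_cont[OF \<sigma>1]] by fastforce
  qed
  have "norm (integral (cbox 0 1) (\<lambda>\<tau>. ?x * exp (- ((1 - of_real \<tau>) * ?x * Lam mu z)) * b (xs z (bs \<sigma> + of_real \<tau> * ?x))))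
     <= (2 * K * ?E * B) * measure lborel (cbox 0 (1::real))"
  proof (rule integrable_bound)
    show "0 <= 2 * K * ?E * B" using K B0[OF z] by (intro mult_nonneg_nonneg) auto
    show "(\<lambda>\<tau>. ?x * exp (- ((1 - of_real \<tau>) * ?x * Lam mu z)) * b (xs z (bs \<sigma> + of_real \<tau> * ?x))) integrable_on cbox 0 1"
      using integrable_continuous_real[OF c] by simp
    fix \<tau> :: real assume "\<tau> \<in> cbox 0 1"
    then have \<tau>: "\<tau> \<in> {0..1}" by simp
    define m where "m = 1 - \<tau>"
    have m: "0 <= m" "m <= 1" using \<tau> by (auto simp: m_def)
    define X Y A C where "X = Re ?x" and "Y = Im ?x" and "A = Re (Lam mu z)" and "C = Im (Lam mu z)"
    have Re: "Re (- ((1 - of_real \<tau>) * ?x * Lam mu z)) = - (m * (X * A)) + m * (Y * C)"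
    proof -
      have "(1 - of_real \<tau> :: complex) = of_real m" by (simp add: m_def)
      then have "- ((1 - of_real \<tau>) * ?x * Lam mu z) = - (of_real m * (?x * Lam mu z))" by (simp add: mult.assoc)
      moreover have "Re (- (of_real m * (a * b))) = - (m * (Re a * Re b)) + m * (Im a * Im b)" for a b :: complex
      by (simp add: algebra_simps)
      ultimately show ?thesis by (simp only: X_def Y_def A_def C_def)
    qed
    have 1: "- (m * (X * A)) <= 3 / 4"
    proof -
      have "\<bar>m * (X * A)\<bar> = m * (\<bar>X\<bar> * \<bar>A\<bar>)" using m by (simp add: abs_mult)
      also have "... <= 1 * (K * \<bar>A\<bar>)" using dist_bs(2)[OF z \<sigma>] m by (intro mult_mono mult_right_mono) (auto simp: X_def)
      also have "... <= 3 / 4" using ReL[OF z] by (simp add: A_def)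
      finally show ?thesis by simp
    qed
    have y: "0 <= - \<sigma> * Y" "- \<sigma> * Y <= 2 * (t * \<xi>)" using dist_bs(3,4)[OF z \<sigma>] by (auto simp: Y_def)
    have YC: "Y * C = (- \<sigma> * Y) * (- \<sigma> * C)" using \<sigma> by auto
    have 2: "m * (Y * C) <= max 0 (- (\<sigma> * (2 * (t * \<xi>) * C)))"
    proof (cases "- \<sigma> * C <= 0")
      case True
      then have "Y * C <= 0" using mult_nonneg_nonpos[OF y(1), of "- \<sigma> * C"] YC by (simp only:)
      then show ?thesis using m mult_nonneg_nonpos[of m "Y * C"] by simp
    next
      case False
      then have "Y * C <= 2 * (t * \<xi>) * (- \<sigma> * C)" unfolding YC using y(2) by (intro mult_right_mono) auto
      moreover have "0 <= Y * C" using mult_nonneg_nonneg[OF y(1), of "- \<sigma> * C"] False YC by linarith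
      ultimately have "m * (Y * C) <= 2 * (t * \<xi>) * (- \<sigma> * C)" using m mult_left_le_one_le[of "Y * C" m] by linarith
      moreover have "2 * (t * \<xi>) * (- \<sigma> * C) = - (\<sigma> * (2 * (t * \<xi>) * C))" by (simp add: mult_ac)
      ultimately show ?thesis by (simp only: le_max_iff_disj simp_thms)
    qed
    have "cmod (exp (- ((1 - of_real \<tau>) * ?x * Lam mu z))) <= exp (3 / 4 + max 0 (- (\<sigma> * (2 * (t * \<xi>) * C))))"
      unfolding norm_exp_eq_Re Re using 1 2 by simp
    also have "... = ?E" unfolding exp_add by (simp add: max_def C_def)
    finally have 3: "cmod (exp (- ((1 - of_real \<tau>) * ?x * Lam mu z))) <= ?E" .
    show "cmod (?x * exp (- ((1 - of_real \<tau>) * ?x * Lam mu z)) * b (xs z (bs \<sigma> + of_real \<tau> * ?x))) <= 2 * K * ?E * B"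
      unfolding norm_mult[of "_ * _"] norm_mult[of ?x]
      using dist_bs(1)[OF z \<sigma>] 3 b(3)[OF seg_in[OF z \<sigma>1 \<tau>]] K by (intro mult_mono mult_nonneg_nonneg) auto
  qed
  then show ?thesis by (simp add: TT_def)
qed

text \<open>Each weight cancels the growth of its solution: \<open>th\<close> decays where the
  solution from above grows, and 1 - \<open>th\<close> where the one from below does. What remains
  is 2 K exp (3/4) B from either.\<close>

lemma ph_bound: assumes z: "z \<in> P t" shows "cmod (ph z) <= 4 * exp (3 / 4) * K * B"
proof -
  let ?I = "2 * (t * \<xi>) * Im (Lam mu z)"
  note L = logistic[OF th_arg[OF z], folded th_def, unfolded Re_arg minus_minus]
  have kb: "0 <= 2 * K * exp (3 / 4) * B" using K B0[OF z] by simp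
  have "cmod (th z) * max 1 (exp (- ?I)) <= 1"
  proof -
    have "cmod (th z) * exp (- ?I) <= exp ?I * exp (- ?I)" using L(3) by (intro mult_right_mono) auto
    then show ?thesis using L(2) by (simp add: max_def exp_add[symmetric])
  qed
  then have 1: "2 * K * exp (3 / 4) * B * (cmod (th z) * max 1 (exp (- ?I))) <= 2 * K * exp (3 / 4) * B * 1"
    using kb by (rule mult_left_mono)
  have "cmod (1 - th z) * max 1 (exp ?I) <= 1"
  proof -
    have "cmod (1 - th z) * exp ?I <= exp (- ?I) * exp ?I" using L(5) by (intro mult_right_mono) auto
    then show ?thesis using L(4) by (simp add: max_def exp_add[symmetric])
  qed
  then have 2: "2 * K * exp (3 / 4) * B * (cmod (1 - th z) * max 1 (exp ?I)) <= 2 * K * exp (3 / 4) * B * 1"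
    using kb by (rule mult_left_mono)
  have "cmod (ph z) <= cmod (th z) * cmod (TT (bs 1) z) + cmod (1 - th z) * cmod (TT (bs (- 1)) z)"
    unfolding ph_def by (rule order_trans[OF norm_triangle_ineq]) (simp add: norm_mult)
  also have "... <= cmod (th z) * (2 * K * (exp (3 / 4) * max 1 (exp (- ?I))) * B) + cmod (1 - th z) * (2 * K * (exp (3 / 4) * max 1 (exp ?I)) * B)"
    using TT_bound[OF z, of 1] TT_bound[OF z, of "- 1"] by (intro add_mono mult_left_mono) auto
  also have "... = 2 * K * exp (3 / 4) * B * (cmod (th z) * max 1 (exp (- ?I))) + 2 * K * exp (3 / 4) * B * (cmod (1 - th z) * max 1 (exp ?I))"
    by (simp only: mult_ac)
  also have "... <= 2 * K * exp (3 / 4) * B * 1 + 2 * K * exp (3 / 4) * B * 1" by (rule add_mono[OF 1 2])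
  also have "... = 4 * exp (3 / 4) * K * B" by simp
  finally show ?thesis .
qed

lemma rot_xs: "rota (av v) w (xs z y) = xs (rota (av v) w z) y"
  by (rule phase_eqI) (auto simp: co_rot split: ix.split)

lemma ph_gr: "gr (P t) mu ph"
  unfolding gr_def hom_def
proof (intro allI ballI)
  fix v z and x :: real assume z: "z \<in> P t"
  let ?e = "exp (\<i> * of_int (mu v) * of_real x)"
  have X: "co CX (rota (av v) (of_real x) z) = co CX z" by (simp add: co_rot)
  have T: "TT (bs \<sigma>) (rota (av v) (of_real x) z) = ?e * TT (bs \<sigma>) z" if \<sigma>: "\<bar>\<sigma>\<bar> <= 1" for \<sigma>
  proof -
    have "TT (bs \<sigma>) (rota (av v) (of_real x) z) = integral {0..1} (\<lambda>\<tau>. ?e * ((co CX z - bs \<sigma>) * exp (- ((1 - of_real \<tau>) * (co CX z - bs \<sigma>) * Lam mu z))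
     * b (xs z (bs \<sigma> + of_real \<tau> * (co CX z - bs \<sigma>)))))"
      unfolding TT_def X Lam_rot
    proof (rule integral_cong)
      fix \<tau> :: real assume "\<tau> \<in> {0..1}"
      then have "b (rota (av v) (of_real x) (xs z (bs \<sigma> + of_real \<tau> * (co CX z - bs \<sigma>)))) = ?e * b (xs z (bs \<sigma> + of_real \<tau> * (co CX z - bs \<sigma>)))"
      using b(2) seg_in[OF z \<sigma>] unfolding gr_def hom_def by blast
      then show "(co CX z - bs \<sigma>) * exp (- ((1 - of_real \<tau>) * (co CX z - bs \<sigma>) * Lam mu z)) *
      b (xs (rota (av v) (of_real x) z) (bs \<sigma> + of_real \<tau> * (co CX z - bs \<sigma>))) =
      ?e * ((co CX z - bs \<sigma>) * exp (- ((1 - of_real \<tau>) * (co CX z - bs \<sigma>) * Lam mu z)) * b (xs z (bs \<sigma> + of_real \<tau> * (co CX z - bs \<sigma>))))"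
      unfolding rot_xs by simp
    qed
    then show ?thesis by (simp add: TT_def)
  qed
  show "ph (rota (av v) (of_real x) z) = ?e * ph z"
    unfolding ph_def T[of 1, simplified] T[of "- 1", simplified] th_def Lam_rot by (simp add: algebra_simps)
qed

text \<open>Variation of constants: with a primitive F of
  \<open>exp (w * Lam mu z) * b (xs z w)\<close> on the convex set of admissible w, the integral at
  w is \<open>exp (- (w * Lam mu z)) * (F w - F \<beta>)\<close>, and the equation is read off by
  differentiating in w.\<close>

lemma TT_eq:
  assumes z: "z \<in> P t" and \<sigma>: "\<bar>\<sigma>\<bar> <= 1"
  shows "pd (eb CX) (TT (bs \<sigma>)) z + Lam mu z * TT (bs \<sigma>) z = b z"
proof -
  let ?S = "nbhd_line XX (T * \<xi>)" and ?L = "Lam mu z" and ?\<beta> = "bs \<sigma>"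
  have oS: "open ?S"
  proof -
    have "?S = (\<Union>a\<in>XX. ball (of_real a) (T * \<xi>))" by (auto simp: nbhd_line_def dist_norm norm_minus_commute)
    then show ?thesis by auto
  qed
  have cS: "convex ?S" by (rule nbhd_line_convex[OF XX_convex])
  let ?g = "\<lambda>w. exp (w * ?L) * b (xs z w)"
  have "(\<lambda>w. b (xs z w)) holomorphic_on ?S"
    unfolding holomorphic_on_open[OF oS]
  proof
    fix w assume w: "w \<in> ?S"
    have "((\<lambda>w. co i (xs z w)) has_field_derivative (if i = CX then 1 else 0)) (at w)" for i
      by (cases "i = CX") (auto intro!: derivative_eq_intros)
    from holo_curve[where \<gamma> = "xs z", OF this b(1) xs_P[OF z _ w]] tT
    show "\<exists>f'. ((\<lambda>w. b (xs z w)) has_field_derivative f') (at w)" by auto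
  qed
  then have hg: "?g holomorphic_on ?S" by (intro holomorphic_intros)
  obtain F where F: "\<And>w. w \<in> ?S ==> (F has_field_derivative ?g w) (at w within ?S)"
    by (rule holomorphic_convex_primitive'[OF cS oS hg]) metis
  have E: "TT ?\<beta> (xs z w) = exp (- (w * ?L)) * (F w - F ?\<beta>)" if w: "w \<in> ?S" for w
  proof -
    have "(?g has_contour_integral F (pathfinish (linepath ?\<beta> w)) - F (pathstart (linepath ?\<beta> w))) (linepath ?\<beta> w)"
    proof (rule contour_integral_primitive[OF F])
      show "path_image (linepath ?\<beta> w) \<subseteq> ?S"
      using closed_segment_subset[OF bs_in[OF \<sigma>] w cS] by simp
    qed auto
    then have "((\<lambda>\<tau>. ?g (linepath ?\<beta> w \<tau>) * (w - ?\<beta>)) has_integral (F w - F ?\<beta>)) {0..1}"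
      by (simp add: has_contour_integral_linepath)
    then have "((\<lambda>\<tau>. exp (- (w * ?L)) * (?g (linepath ?\<beta> w \<tau>) * (w - ?\<beta>))) has_integral exp (- (w * ?L)) * (F w - F ?\<beta>)) {0..1}"
      by (rule has_integral_mult_right)
    moreover have "exp (- (w * ?L)) * (?g (linepath ?\<beta> w \<tau>) * (w - ?\<beta>)) = (w - ?\<beta>) * exp (- ((1 - of_real \<tau>) * (w - ?\<beta>) * ?L)) * b (xs z (?\<beta> + of_real \<tau> * (w - ?\<beta>)))" for \<tau>
    proof -
      have l: "linepath ?\<beta> w \<tau> = ?\<beta> + of_real \<tau> * (w - ?\<beta>)" by (simp add: linepath_def scaleR_conv_of_real algebra_simps)
      have "exp (- (w * ?L)) * exp ((?\<beta> + of_real \<tau> * (w - ?\<beta>)) * ?L) = exp (- ((1 - of_real \<tau>) * (w - ?\<beta>) * ?L))"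
      unfolding exp_add[symmetric] by (simp add: algebra_simps)
      then show ?thesis unfolding l by (simp add: mult_ac)
    qed
    moreover have "xs (xs z w) y = xs z y" for y by (rule phase_eqI) simp
    ultimately show ?thesis by (simp add: TT_def Lam_xs integral_unique)
  qed
  have x: "co CX z \<in> ?S" by (rule x_in[OF z])
  have xz: "xs z (co CX z) = z" by (rule phase_eqI) simp
  have F': "(F has_field_derivative ?g (co CX z)) (at (co CX z))"
    using F[OF x] unfolding at_within_open[OF x oS] .
  have "((\<lambda>w. exp (- (w * ?L)) * (F w - F ?\<beta>)) has_field_derivative
      (- ?L * exp (- (co CX z * ?L)) * (F (co CX z) - F ?\<beta>) + exp (- (co CX z * ?L)) * ?g (co CX z))) (at (co CX z))"
    using F' by (auto intro!: derivative_eq_intros)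
  moreover have "- ?L * exp (- (co CX z * ?L)) * (F (co CX z) - F ?\<beta>) + exp (- (co CX z * ?L)) * ?g (co CX z) = - ?L * TT ?\<beta> z + b z"
  proof -
    have "exp (- (co CX z * ?L)) * ?g (co CX z) = b z"
      by (simp add: mult.assoc[symmetric] exp_add[symmetric] xz)
    moreover have "TT ?\<beta> z = exp (- (co CX z * ?L)) * (F (co CX z) - F ?\<beta>)" using E[OF x] by (simp only: xz)
    ultimately show ?thesis by (simp only: mult.assoc)
  qed
  ultimately have D: "((\<lambda>w. exp (- (w * ?L)) * (F w - F ?\<beta>)) has_field_derivative (- ?L * TT ?\<beta> z + b z)) (at (co CX z))"
    by (simp only:)
  have "((\<lambda>w. TT ?\<beta> (xs z w)) has_field_derivative (- ?L * TT ?\<beta> z + b z)) (at (co CX z))"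
    by (rule has_field_derivative_transform_within_open[OF D oS x]) (simp add: E)
  moreover have "(\<lambda>w. TT ?\<beta> (xs z w)) = (\<lambda>w. TT ?\<beta> (z + cscale (w - co CX z) (eb CX)))"
  proof
    fix w have "xs z w = z + cscale (w - co CX z) (eb CX)" by (rule phase_eqI) (simp add: co_eb)
    then show "TT ?\<beta> (xs z w) = TT ?\<beta> (z + cscale (w - co CX z) (eb CX))" by simp
  qed
  ultimately have "((\<lambda>w. TT ?\<beta> (z + cscale (w - co CX z) (eb CX))) has_field_derivative (- ?L * TT ?\<beta> z + b z)) (at (co CX z + 0))" by simp
  then have "((\<lambda>w. TT ?\<beta> (z + cscale (co CX z + w - co CX z) (eb CX))) has_field_derivative (- ?L * TT ?\<beta> z + b z)) (at 0)"
    using DERIV_shift[of "\<lambda>w. TT ?\<beta> (z + cscale (w - co CX z) (eb CX))" _ 0 "co CX z"] by (simp add: add.commute)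
  then have "pd (eb CX) (TT ?\<beta>) z = - ?L * TT ?\<beta> z + b z"
    unfolding pd_def by (intro DERIV_imp_deriv) simp
  then show ?thesis by simp
qed

text \<open>Both solutions satisfy the same equation and \<open>th\<close> is constant in x, so
  their combination with the weights \<open>th\<close> and 1 - \<open>th\<close> is again a
  solution.\<close>

lemma ph_eq: assumes z: "z \<in> P t" shows "Lam mu z * ph z + pd (eb CX) ph z = b z"
proof -
  have "th (z + cscale w (eb CX)) = th z" for w by (simp add: th_def Lam_xs)
  then have th0: "pd (eb CX) th z = 0" by (simp add: pd_def)
  have h1: "holo_on (\<lambda>z. th z * TT (bs 1) z) (P t)" "holo_on (\<lambda>z. (1 - th z) * TT (bs (- 1)) z) (P t)" "holo_on (\<lambda>z. 1 - th z) (P t)"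
    by (intro holo_mult holo_diff holo_const th_holo TT_holo; simp)+
  have T: "holo_on (TT (bs 1)) (P t)" "holo_on (TT (bs (- 1))) (P t)" by (rule TT_holo; simp)+
  have "pd (eb CX) ph z = th z * pd (eb CX) (TT (bs 1)) z + (1 - th z) * pd (eb CX) (TT (bs (- 1))) z"
    unfolding ph_def[abs_def] pd_plus[OF h1(1,2) z] pd_mult[OF th_holo T(1) z] pd_mult[OF h1(3) T(2) z] pd_minus[OF holo_const th_holo z] th0
    by simp
  also have "... = th z * (b z - Lam mu z * TT (bs 1) z) + (1 - th z) * (b z - Lam mu z * TT (bs (- 1)) z)"
  proof -
    have "pd (eb CX) (TT (bs 1)) z = b z - Lam mu z * TT (bs 1) z" "pd (eb CX) (TT (bs (- 1))) z = b z - Lam mu z * TT (bs (- 1)) z"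
      using TT_eq[OF z, of 1] TT_eq[OF z, of "- 1"] by (simp_all add: eq_diff_eq)
    then show ?thesis by simp
  qed
  also have "... = b z - Lam mu z * ph z" by (simp add: ph_def algebra_simps)
  finally show ?thesis by simp
qed

end

lemma homological:
  assumes tT: "0 < t" "t < T" "T <= 1" and C: "finite C" "\<And>mu. mu \<in> C ==> nmu mu <= 3 * N"
    and f: "\<And>mu. mu \<in> C ==> holo_on (f mu) (P T)" "\<And>mu. mu \<in> C ==> gr (P T) mu (f mu)"
    and B: "\<And>mu z. mu \<in> C ==> z \<in> P T ==> cmod (f mu z / omega_y h z) <= B mu" "\<And>mu. mu \<in> C ==> 0 <= B mu" "sum B C <= S"
  obtains \<phi> where "fin t \<phi> (4 * exp (3 / 4) * K * S)" "\<And>z. z \<in> P t ==> lie \<phi> (ham0 h) z = - (\<Sum>mu\<in>C. f mu z)"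
proof -
  have PT1: "P T \<subseteq> P 1" using tT by (simp add: P_mono)
  let ?b = "\<lambda>mu z. f mu z / omega_y h z"
  have hb: "holo_on (?b mu) (P T)" if "mu \<in> C" for mu
    by (rule holo_divide[OF f(1)[OF that] holo_subset[OF holo_omega(1) PT1]]) (use wy PT1 in blast)
  have gb: "gr (P T) mu (?b mu)" if "mu \<in> C" for mu
    using f(2)[OF that] unfolding gr_def hom_def by (simp add: Lam_rot)
  let ?\<phi> = "\<lambda>mu. ph t mu (?b mu)"
  have h: "holo_on (?\<phi> mu) (P t)" "gr (P t) mu (?\<phi> mu)" "\<And>z. z \<in> P t ==> cmod (?\<phi> mu z) <= 4 * exp (3 / 4) * K * B mu"
    "\<And>z. z \<in> P t ==> Lam mu z * ?\<phi> mu z + pd (eb CX) (?\<phi> mu) z = ?b mu z" if "mu \<in> C" for mu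
    using ph_holo[OF tT hb[OF that] gb[OF that] B(1)[OF that] C(2)[OF that]]
      ph_gr[OF tT hb[OF that] gb[OF that] B(1)[OF that] C(2)[OF that]]
      ph_bound[OF tT hb[OF that] gb[OF that] B(1)[OF that] C(2)[OF that]]
      ph_eq[OF tT hb[OF that] gb[OF that] B(1)[OF that] C(2)[OF that]] by simp_all
  show ?thesis
  proof (rule that[of "\<lambda>z. \<Sum>mu\<in>C. ?\<phi> mu z"])
    show "fin t (\<lambda>z. \<Sum>mu\<in>C. ?\<phi> mu z) (4 * exp (3 / 4) * K * S)"
      unfolding fin_def
    proof (intro exI conjI ballI)
      show "(\<Sum>mu\<in>C. 4 * exp (3 / 4) * K * B mu) <= 4 * exp (3 / 4) * K * S"
      using B(3) K by (simp add: sum_distrib_left[symmetric])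
    qed (use C(1) h B(2) K in auto)
    fix z assume z: "z \<in> P t"
    have z1: "z \<in> P 1" using mono1[of t z] tT z by simp
    have "lie (\<lambda>z. \<Sum>mu\<in>C. ?\<phi> mu z) (ham0 h) z = (\<Sum>mu\<in>C. lie (?\<phi> mu) (ham0 h) z)"
      by (rule lie_sum1[OF z h(1)])
    also have "... = (\<Sum>mu\<in>C. - f mu z)"
    proof (rule sum.cong[OF refl])
      fix mu assume mu: "mu \<in> C"
      have "lie (?\<phi> mu) (ham0 h) z = - omega_y h z * ?b mu z"
      using lie_ham0[OF h(1,2)[OF mu] _ z] h(4)[OF mu z] tT by simp
      then show "lie (?\<phi> mu) (ham0 h) z = - f mu z" using wy[OF z1] by simp
    qed
    finally show "lie (\<lambda>z. \<Sum>mu\<in>C. ?\<phi> mu z) (ham0 h) z = - (\<Sum>mu\<in>C. f mu z)" by (simp add: sum_negf)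
  qed
qed

end

subsection \<open>The cut-off\<close>

context dom begin

text \<open>Integer combinations of the directions \<open>av\<close> serve to rotate all angles, or
  all pairs (p_i, q_i), at once with the signs of mu.\<close>

lemma hom_lin:
  assumes G: "gr (P t) mu G"
  shows "hom (\<lambda>j. \<Sum>v\<in>A. n v * av v j) (\<Sum>v\<in>A. n v * mu v) (P t) G"
proof (induction A rule: infinite_finite_induct)
  case (insert v A)
  show ?case
    unfolding hom_def
  proof (intro ballI allI)
    fix z and x :: real assume z: "z \<in> P t"
    let ?z = "rota (\<lambda>j. \<Sum>v\<in>A. n v * av v j) (of_real x) z"
    have z': "?z \<in> P t" by (rule rinvD[OF rinv_P z])
    have "rota (\<lambda>j. \<Sum>v\<in>insert v A. n v * av v j) (of_real x) z = rota (av v) (of_real (x * of_int (n v))) ?z"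
      unfolding rot_rot using insert(1,2) by (simp add: algebra_simps)
    also have "G ... = exp (\<i> * of_int (mu v) * of_real (x * of_int (n v))) * G ?z"
      using G z' unfolding gr_def hom_def by blast
    also have "G ?z = exp (\<i> * of_int (\<Sum>v\<in>A. n v * mu v) * of_real x) * G z"
      using insert(3) z unfolding hom_def by blast
    finally have *: "G (rota (\<lambda>j. \<Sum>v\<in>insert v A. n v * av v j) (of_real x) z) =
      exp (\<i> * of_int (mu v) * of_real (x * of_int (n v))) * (exp (\<i> * of_int (\<Sum>v\<in>A. n v * mu v) * of_real x) * G z)" .
    show "G (rota (\<lambda>j. \<Sum>v\<in>insert v A. n v * av v j) (of_real x) z) = exp (\<i> * of_int (\<Sum>v\<in>insert v A. n v * mu v) * of_real x) * G z"
      unfolding * mult.assoc[symmetric] exp_add[symmetric] using insert(1,2)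
      by (simp add: algebra_simps)
  qed
qed (simp_all add: hom_def)

text \<open>Degrees are functions on all indices, but at the indices of I, p, y and x the direction
  \<open>av\<close> acts trivially. A component with a nonzero degree there is 0
  (\<open>gr_unsupp\<close>); excluding these degrees makes \<open>Cut\<close> finite.\<close>

definition supp :: "(('n, 'm) ix => int) => bool" where
  "supp mu \<longleftrightarrow> (\<forall>v. (\<forall>j. av v j = 0) \<longrightarrow> mu v = 0)"

lemma gr_unsupp:
  assumes G: "gr S mu G" and mu: "\<not> supp mu" and z: "z \<in> S" shows "G z = 0"
proof -
  obtain v where v: "\<And>j. av v j = 0" "mu v \<noteq> 0" using mu unfolding supp_def by blast
  have "G (rot (\<lambda>i. of_real (pi / of_int (mu v)) * of_int (av v i)) z) = exp (\<i> * of_int (mu v) * of_real (pi / of_int (mu v))) * G z"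
    using G z unfolding gr_def hom_def by blast
  moreover have "\<i> * of_int (mu v) * of_real (pi / of_int (mu v)) = \<i> * of_real pi"
    using v(2) by simp
  ultimately have "G z = - G z" by (simp add: v(1) exp_pi_i' del: of_real_divide)
  then show ?thesis by (simp add: eq_neg_iff_add_eq_0)
qed

lemma dec_zero: "dec t (\<lambda>_. 0) 0"
  by (rule decI[of "{}" _ _ "\<lambda>mu. mu" _ 0]) auto

lemma gr_zero: "gr S mu (\<lambda>_. 0)"
  by (simp add: gr_def hom_def)

text \<open>The zero generator acts as the identity but passes to a smaller domain. It closes the
  composition at t = 1/3 and is the whole transformation when f = 0.\<close>

lemma trivial_flow:
  assumes "0 < u" "u < t"
  shows "time_one_flow DD (ww t) (ww u) (\<lambda>_. 0)" "lie_exp (\<lambda>_. 0) (F :: ('n, 'm) func) = F"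
proof -
  have l: "lie (\<lambda>_. 0) F = (\<lambda>_. 0)" for F :: "('n, 'm) func"
  proof
    fix z show "lie (\<lambda>_. 0) F z = 0" by (simp add: lie_eq_sum pd_def)
  qed
  have k: "(lie (\<lambda>_. 0) ^^ k) F = (if k = 0 then F else (\<lambda>_. 0))" for F :: "('n, 'm) func" and k
    by (cases k) (simp_all add: l)
  have s: "(\<lambda>k. (lie (\<lambda>_. 0) ^^ k) F z / fact k) sums F z" for F :: "('n, 'm) func" and z
  proof -
    have "(\<lambda>k. (lie (\<lambda>_. 0) ^^ k) F z / fact k) = (\<lambda>k. if k = 0 then F z else 0)" by (auto simp: k)
    then show ?thesis using sums_single[of 0 "\<lambda>_. F z"] by simp
  qed
  have e: "lie_exp (\<lambda>_. 0) F = F" for F :: "('n, 'm) func"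
    by (rule ext) (simp add: lie_exp_def sums_unique[OF s, symmetric])
  show "lie_exp (\<lambda>_. 0) F = F" by (rule e)
  have O: "F \<in> Osp DD (ww u)" if F: "F \<in> Osp DD (ww t)" for F
  proof -
    obtain M where "dec t F M" by (rule Osp_dec[OF F]) (use assms in simp)
    then show ?thesis using dec_Osp assms by blast
  qed
  have "(\<lambda>_. 0) \<in> Osp DD (ww u)" by (rule dec_Osp[OF dec_zero assms])
  moreover have "PP DD (ww u) \<subseteq> PP DD (ww t)" using P_mono[of u t] assms unfolding P_def by simp
  ultimately show "time_one_flow DD (ww t) (ww u) (\<lambda>_. 0)"
    unfolding time_one_flow_def e using sums_summable[OF s] O holo_subset by blast
qed

lemma radii_less_ww: "0 < u ==> u < t ==> radii_less (ww u) (ww t)" "0 < u ==> radii_less (0, 0, 0, 0, 0) (ww u)"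
  using pos by (simp_all add: ww_def)

end

context ham begin

definition Cut :: "(('a, 'b) ix => int) set" where "Cut = {mu. supp mu \<and> nmu mu <= 3 * N}"

lemma finite_Cut: "finite Cut"
proof -
  define b where "b = \<lceil>3 * N / s + 3 * N\<rceil>"
  have b: "3 * N / s + 3 * N <= of_int b" by (simp add: b_def)
  have p: "0 <= 3 * N / s" "0 <= 3 * N" using N pos by simp_all
  have "mu v \<in> {- b..b}" if mu: "mu \<in> Cut" for mu v
  proof -
    have n: "s * (\<Sum>i\<in>UNIV. \<bar>of_int (mu (CT i))\<bar>) + (\<Sum>i\<in>UNIV. \<bar>of_int (mu (CQ i))\<bar>) <= 3 * N" and su: "supp mu"
      using mu by (auto simp: Cut_def nmu_def)
    have nn: "0 <= s * (\<Sum>i\<in>UNIV. \<bar>of_int (mu (CT i))\<bar> :: real)" "0 <= (\<Sum>i\<in>UNIV. \<bar>of_int (mu (CQ i))\<bar> :: real)"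
      using pos by (auto intro!: mult_nonneg_nonneg sum_nonneg)
    have "\<bar>of_int (mu v)\<bar> <= 3 * N / s + 3 * N"
    proof (cases v)
      case (CT i)
      have "\<bar>of_int (mu (CT i))\<bar> <= (\<Sum>i\<in>UNIV. \<bar>of_int (mu (CT i))\<bar> :: real)" by (rule member_le_sum) auto
      also have "... <= 3 * N / s"
      proof -
      have "(\<Sum>i\<in>UNIV. \<bar>of_int (mu (CT i))\<bar>) * s <= 3 * N" using n nn(2) by (subst mult.commute) linarith
      then show ?thesis using pos by (simp only: pos_le_divide_eq)
      qed
      finally show ?thesis using p CT by simp
    next
      case (CQ i)
      have "\<bar>of_int (mu (CQ i))\<bar> <= (\<Sum>i\<in>UNIV. \<bar>of_int (mu (CQ i))\<bar> :: real)" by (rule member_le_sum) auto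
      also have "... <= 3 * N" using n nn(1) by simp
      finally show ?thesis using p CQ by simp
    qed (use su p in \<open>simp_all add: supp_def\<close>)
    then have "\<bar>of_int (mu v)\<bar> <= (of_int b :: real)" using b by linarith
    then have "\<bar>mu v\<bar> <= b" by linarith
    then show ?thesis by auto
  qed
  then have "Cut \<subseteq> PiE UNIV (\<lambda>_. {- b..b})" by (auto simp: PiE_UNIV_domain)
  moreover have "finite (PiE (UNIV :: ('a, 'b) ix set) (\<lambda>_. {- b..b}))" by (rule finite_PiE) auto
  ultimately show ?thesis by (rule finite_subset)
qed

text \<open>Two imaginary rotations, with the signs of mu, use up the gap e = T - u: the angles are
  shifted by at most e s, and p and q grow by at most the factor exp e. The value of G is multiplied
  by exp (e * nmu mu) and is still at most B.\<close>

lemma decay: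
  assumes G: "holo_on G (P T)" "gr (P T) mu G" "\<And>z. z \<in> P T ==> cmod (G z) <= B"
    and T: "u <= T" "T <= 1" and z: "z \<in> P u"
  shows "cmod (G z) <= exp (- ((T - u) * nmu mu)) * B"
proof -
  define e where "e = T - u"
  have e: "0 <= e" and u0: "0 < u" using T P_pos[OF z] by (simp_all add: e_def)
  define n1 n2 where "n1 = (\<lambda>v. case v of CT i => sgn (mu v) | _ => 0)" and "n2 = (\<lambda>v. case v of CQ i => sgn (mu v) | _ => 0)"
  define a1 a2 where "a1 = (\<lambda>j. \<Sum>v\<in>UNIV. n1 v * av v j)" and "a2 = (\<lambda>j. \<Sum>v\<in>UNIV. n2 v * av v j)"
  define c1 c2 where "c1 = (\<Sum>v\<in>UNIV. n1 v * mu v)" and "c2 = (\<Sum>v\<in>UNIV. n2 v * mu v)"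
  have h: "hom a1 c1 (P T) G" "hom a2 c2 (P T) G"
    unfolding a1_def a2_def c1_def c2_def by (rule hom_lin[OF G(2)])+
  have sm: "(\<Sum>i\<in>UNIV. g i * (if i0 = i then c else 0)) = (g i0 * c :: int)" for g :: "'k::finite => int" and i0 c
    using sum.delta[of UNIV i0 "\<lambda>i. g i * c"] by (simp add: if_distrib[of "\<lambda>x. _ * x"] cong: if_cong)
  have a1: "a1 (CT i) = sgn (mu (CT i))" "a1 (CP j) = 0" "a1 (CQ j) = 0" for i j
    by (simp_all add: a1_def sum_ix n1_def sm)
  have a2: "a2 (CT i) = 0" "a2 (CP j) = - sgn (mu (CQ j))" "a2 (CQ j) = sgn (mu (CQ j))" for i j
    by (simp_all add: a2_def sum_ix n2_def sm cong: if_cong)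
  have c: "real_of_int c1 = (\<Sum>i\<in>UNIV. \<bar>of_int (mu (CT i))\<bar>)" "real_of_int c2 = (\<Sum>i\<in>UNIV. \<bar>of_int (mu (CQ i))\<bar>)"
    by (simp_all add: c1_def c2_def sum_ix n1_def n2_def mult.commute abs_sgn[symmetric] of_int_abs[symmetric] del: of_int_abs)
  define w1 w2 where "w1 = - \<i> * of_real (e * s)" and "w2 = - \<i> * of_real e"
  have zT: "z \<in> P T" using z P_mono T by blast
  have sg: "\<bar>real_of_int (sgn k)\<bar> <= 1" for k :: int by (cases k "0 :: int" rule: linorder_cases) simp_all
  have im: "Im (- \<i> * of_real y * of_int k) = - (y * of_int k)" for y k by simp
  have T1: "\<bar>Im (w1 * of_int (a1 (CT i)))\<bar> <= (T - u) * s" for i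
  proof -
    have "\<bar>Im (w1 * of_int (a1 (CT i)))\<bar> = e * s * \<bar>of_int (sgn (mu (CT i)))\<bar>"
      unfolding w1_def im a1 using e pos by (simp add: abs_mult)
    also have "... <= e * s * 1" using e pos sg by (intro mult_left_mono) auto
    finally show ?thesis by (simp add: e_def)
  qed
  \<comment> \<open>The factor exp e fits into the gap because 1 - e <= exp (- e) and, as T <= 1, u
    = T - e <= T (1 - e).\<close>
  have ee: "exp x * u <= T" if x: "x <= e" for x
  proof -
    have "T * (1 - e) <= T * exp (- e)" using exp_ge_add_one_self[of "- e"] u0 T by (intro mult_left_mono) auto
    moreover have "u <= T * (1 - e)"
    proof -
      have "0 <= (T - u) * (1 - T)" using T by simp
      then show ?thesis by (simp add: e_def algebra_simps)
    qed
    ultimately have "u <= T / exp e" by (simp add: exp_minus divide_inverse)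
    then have "exp e * u <= T" by (simp add: pos_le_divide_eq mult.commute)
    moreover have "exp x * u <= exp e * u" using x u0 by (intro mult_right_mono) auto
    ultimately show ?thesis by simp
  qed
  have z1: "rota a1 w1 z \<in> P T"
  proof (rule rot_in[OF z T(1)])
    show "\<bar>Im (w1 * of_int (a1 (CT i)))\<bar> <= (T - u) * s" for i by (rule T1)
    show "exp (- Im (w1 * of_int (a1 (CP i)))) * u <= T" "exp (- Im (w1 * of_int (a1 (CQ i)))) * u <= T" for i
      using T by (simp_all add: a1)
  qed
  have x2: "- Im (w2 * of_int (a2 l)) <= e" if "l = CP i \<or> l = CQ i" for l i
  proof -
    have "\<bar>real_of_int (a2 l)\<bar> <= 1" using that sg a2 by auto
    then have "e * \<bar>real_of_int (a2 l)\<bar> <= e * 1" using e by (intro mult_left_mono) auto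
    moreover have "- Im (w2 * of_int (a2 l)) = e * of_int (a2 l)" unfolding w2_def im by simp
    moreover have "e * of_int (a2 l) <= e * \<bar>real_of_int (a2 l)\<bar>" using e by (intro mult_left_mono) auto
    ultimately show ?thesis by linarith
  qed
  have z2: "rota a2 w2 (rota a1 w1 z) \<in> P T"
    unfolding rot_rot
  proof (rule rot_in[OF z T(1)])
    show "\<bar>Im (w2 * of_int (a2 (CT i)) + w1 * of_int (a1 (CT i)))\<bar> <= (T - u) * s" for i
      using T1[of i] by (simp add: a2)
    show "exp (- Im (w2 * of_int (a2 (CP i)) + w1 * of_int (a1 (CP i)))) * u <= T"
      "exp (- Im (w2 * of_int (a2 (CQ i)) + w1 * of_int (a1 (CQ i)))) * u <= T" for i
      using ee[OF x2[of "CP i" i]] ee[OF x2[of "CQ i" i]] by (simp_all add: a1)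
  qed
  have "G (rota a2 w2 (rota a1 w1 z)) = exp (\<i> * of_int c2 * w2) * (exp (\<i> * of_int c1 * w1) * G z)"
    using hom_complex[OF h(2) G(1) z1 z2] hom_complex[OF h(1) G(1) zT z1] by simp
  also have "... = exp (of_real (e * nmu mu)) * G z"
    unfolding mult.assoc[symmetric] exp_add[symmetric]
    by (rule arg_cong[where f = "\<lambda>x. exp x * G z"]) (simp add: w1_def w2_def nmu_def c[symmetric] algebra_simps)
  finally have "exp (e * nmu mu) * cmod (G z) <= B"
    using G(3)[OF z2] by (simp add: norm_mult)
  then have "exp (- (e * nmu mu)) * (exp (e * nmu mu) * cmod (G z)) <= exp (- (e * nmu mu)) * B"
    by (intro mult_left_mono) auto
  then show ?thesis by (simp add: e_def mult.assoc[symmetric] exp_add[symmetric])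
qed

lemma cut_tail:
  assumes G: "\<And>mu. holo_on (G mu) (P T)" "\<And>mu. gr (P T) mu (G mu)" "\<And>mu z. z \<in> P T ==> cmod (G mu z) <= B mu"
    "\<And>mu. 0 <= B mu" "B summable_on UNIV" "infsum B UNIV <= M" "\<And>z. z \<in> P T ==> ((\<lambda>mu. G mu z) has_sum F z) UNIV"
    and T: "u <= T" "T <= 1"
  shows "dec u (\<lambda>z. F z - (\<Sum>mu\<in>Cut. G mu z)) (exp (- ((T - u) * (3 * N))) * M)"
proof -
  have sub: "P u \<subseteq> P T" by (rule P_mono[OF T(1)])
  let ?q = "exp (- ((T - u) * (3 * N)))"
  have Bs: "B summable_on - Cut" by (rule summable_on_subset_banach[OF G(5)]) simp
  show ?thesis
  proof (rule decI[of "- Cut" G u "\<lambda>mu. mu" "\<lambda>mu. ?q * B mu" "?q * infsum B (- Cut)"])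
    show "cmod (G mu z) <= ?q * B mu" if mu: "mu \<in> - Cut" and z: "z \<in> P u" for mu z
    proof (cases "supp mu")
      case True
      then have n: "3 * N <= nmu mu" using mu by (simp add: Cut_def)
      have "cmod (G mu z) <= exp (- ((T - u) * nmu mu)) * B mu" by (rule decay[OF G(1,2,3) T z])
      also have "... <= ?q * B mu"
      using n T G(4) by (intro mult_right_mono) (simp_all add: mult_left_mono)
      finally show ?thesis .
    next
      case False
      then show ?thesis using gr_unsupp[OF G(2) _ subsetD[OF sub z]] G(4)[of mu] by simp
    qed
    show "?q * infsum B (- Cut) <= ?q * M"
    proof (intro mult_left_mono)
      have "infsum B (- Cut) <= infsum B UNIV" by (rule infsum_mono_neutral[OF Bs G(5)]) (use G(4) in auto)
      then show "infsum B (- Cut) <= M" using G(6) by simp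
    qed simp
    show "((\<lambda>mu. ?q * B mu) has_sum ?q * infsum B (- Cut)) (- Cut)"
      by (intro has_sum_cmult_right has_sum_infsum Bs)
    show "((\<lambda>mu. G mu z) has_sum F z - (\<Sum>mu\<in>Cut. G mu z)) (- Cut)" if z: "z \<in> P u" for z
      using has_sum_Diff[OF G(7)[OF subsetD[OF sub z]] has_sum_finite[OF finite_Cut]] by (simp add: Compl_eq_Diff_UNIV)
  qed (use holo_subset[OF G(1) sub] gr_subset[OF G(2) sub] G(4) in auto)
qed

end

subsection \<open>The averaging step\<close>

context ham begin

text \<open>
  Since \<open>lie \<phi> (ham0 h) = - cut\<close>, the transformed Hamiltonian is the old one without \<open>cut\<close>, up to
  \<open>R = (\<Sum>k. L\<^sup>k E / (k + 1)!) - (\<Sum>k. L\<^sup>k (L cut) / (k + 2)!)\<close>, where \<open>L = lie \<phi>\<close> and \<open>E = L (A + f)\<close>.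
\<close>

lemma step:
  assumes u: "0 < u" "0 < e" "u + e <= 1"
    and A: "dec t' A MA" "u + e / 2 + a <= t'" "0 < a" and f: "dec (u + e) f M"
    and C: "finite C" "\<And>mu. mu \<in> C ==> nmu mu <= 3 * N"
    and G: "\<And>mu. mu \<in> C ==> holo_on (G mu) (P (u + e))" "\<And>mu. mu \<in> C ==> gr (P (u + e)) mu (G mu)"
    and B: "\<And>mu z. mu \<in> C ==> z \<in> P (u + e) ==> cmod (G mu z / omega_y h z) <= B mu" "\<And>mu. mu \<in> C ==> 0 <= B mu" "sum B C <= S"
    and cut: "dec (u + e) (\<lambda>z. \<Sum>mu\<in>C. G mu z) M"
    and \<kappa>: "\<kappa> = 4 * exp (3 / 4) * K * S" and small: "384 * \<kappa> <= e\<^sup>2 * d"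
  obtains \<phi> R where "fin (u + 3 * e / 4) \<phi> \<kappa>" "time_one_flow DD (ww (u + e)) (ww u) \<phi>"
    "\<And>F z. holo_on F (P (u + e)) ==> z \<in> P u ==> lie_exp \<phi> F z = F (Flow \<phi> z)"
    "\<And>z. z \<in> P u ==> Flow \<phi> z \<in> P (u + e)"
    "\<And>z i. z \<in> P u ==> rad (cj i) * cmod (co i (Flow \<phi> z) - co i z) <= 8 * \<kappa> / e"
    "dec u R (\<kappa> / (e * d) * (8 * MA / a + 32 * M / e))"
    "\<And>H z. (\<And>z. z \<in> P (u + e) ==> H z = ham0 h z + (A z + f z)) ==> z \<in> P u ==>
      lie_exp \<phi> H z = ham0 h z + (A z + f z - (\<Sum>mu\<in>C. G mu z)) + R z"
proof -
  \<comment> \<open>The generator lives on \<open>?t1\<close>, its brackets with A, f and the cut on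
    \<open>?v\<close>, and the Lie series on \<open>?w\<close>, which exceeds u because membership
    in \<open>Osp\<close> at u requires a larger domain.\<close>
  let ?t1 = "u + 3 * e / 4" and ?v = "u + e / 2" and ?w = "u + e / 4"
  let ?cut = "\<lambda>z. \<Sum>mu\<in>C. G mu z"
  have df: "?t1 - ?v = e / 4" "?v - u = e / 2" "?v - ?w = e / 4" "u + e - ?v = e / 2" "?w - u = e / 4" by (simp_all add: field_simps)
  have lt: "0 < ?t1" "?t1 < u + e" "u < ?v" "?v < ?t1" "?w < ?v" "u < ?w" "?v < u + e" "0 < ?w" "?v < t'" using u A by simp_all
  have sub: "P u \<subseteq> P ?w" "P ?w \<subseteq> P ?v" "P ?v \<subseteq> P ?t1" "P ?t1 \<subseteq> P (u + e)" "P (u + e) \<subseteq> P 1" "P ?v \<subseteq> P t'"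
    by (rule P_mono; use lt u in simp)+
  obtain \<phi> where \<phi>: "fin ?t1 \<phi> \<kappa>" and hom: "\<And>z. z \<in> P ?t1 ==> lie \<phi> (ham0 h) z = - ?cut z"
    using homological[OF lt(1,2) u(3) C G B] unfolding \<kappa> by metis
  have h\<phi>: "holo_on \<phi> (P ?t1)" by (rule fin_holo[OF \<phi>])
  have b\<phi>: "cmod (\<phi> z) <= \<kappa>" if "z \<in> P ?t1" for z by (rule dec_bound[OF fin_dec[OF \<phi>] that])
  have \<kappa>0: "0 <= \<kappa>" by (rule fin_nonneg[OF \<phi>])
  have ed: "0 < e\<^sup>2 * d" "0 < e * d" using u d_pos by simp_all
  \<comment> \<open>In terms of e the conditions are 192 * \<kappa> <= e^2 d for the point map and
    96 * \<kappa> <= e^2 d for the series of the next line.\<close>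
  have s1: "24 * \<kappa> <= (?t1 - ?v) * (?v - u) * d" unfolding df using small \<kappa>0 by (simp add: power2_eq_square)
  have s2: "6 * \<kappa> <= (?t1 - ?v) * (?v - ?w) * d" unfolding df using small \<kappa>0 by (simp add: power2_eq_square)
  note fl = flow[OF h\<phi> b\<phi> lt(3,4) s1]
  have M0: "0 <= M" "0 <= MA" using dec_nonneg f A by blast+
  have Fl: "lie_exp \<phi> F z = F (Flow \<phi> z)" "summable (\<lambda>k. (lie \<phi> ^^ k) F z / fact k)" "holo_on (lie_exp \<phi> F) {z}"
    if F: "holo_on F (P (u + e))" and z: "z \<in> P u" for F z
    by (rule fl(4)[OF _ z holo_subset[OF F sub(4)]] fl(3)[OF _ z holo_subset[OF F sub(4)]] fl(5)[OF _ z holo_subset[OF F sub(4)]]; assumption)+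
  have Fin: "Flow \<phi> z \<in> P (u + e)" if "z \<in> P u" for z
  proof -
    have "Flow \<phi> z \<in> P ?v" by (rule fl(2)[OF _ that])
    then show ?thesis using sub by blast
  qed
  have disp: "rad (cj i) * cmod (co i (Flow \<phi> z) - co i z) <= 8 * \<kappa> / e" if z: "z \<in> P u" for z i
  proof -
    have q: "6 * \<kappa> / ((?t1 - ?v) * (?v - u) * d) <= 1 / 2"
      using s1 \<kappa>0 lt d_pos by (simp add: divide_le_eq mult_pos_pos)
    have "cmod (co i (Flow \<phi> z) - co i z) <= \<kappa> / ((?t1 - ?v) * rad (cj i)) / (1 - 6 * \<kappa> / ((?t1 - ?v) * (?v - u) * d))"
      by (rule fl(1)[OF _ z])
    also have "... <= \<kappa> / ((?t1 - ?v) * rad (cj i)) / (1 / 2)"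
      using q \<kappa>0 lt rad[of "cj i"] by (intro divide_left_mono) (auto intro!: divide_nonneg_nonneg mult_nonneg_nonneg)
    also have "... = 8 * \<kappa> / e / rad (cj i)" unfolding df by simp
    finally have "cmod (co i (Flow \<phi> z) - co i z) * rad (cj i) <= 8 * \<kappa> / e" using rad[of "cj i"] by (simp only: pos_le_divide_eq)
    then show ?thesis by (simp only: mult.commute)
  qed
  have tof: "time_one_flow DD (ww (u + e)) (ww u) \<phi>"
    unfolding time_one_flow_def
  proof (intro conjI allI impI ballI)
    show "\<phi> \<in> Osp DD (ww u)" by (rule dec_Osp[OF fin_dec[OF \<phi>] u(1)]) (use lt in simp)
    fix F assume F: "holo_on F (PP DD (ww (u + e)))"
    show "summable (\<lambda>k. (lie \<phi> ^^ k) F z / fact k)" if "z \<in> PP DD (ww u)" for z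
      using Fl(2) F that unfolding P_def by blast
    show "holo_on (lie_exp \<phi> F) (PP DD (ww u))"
      using Fl(3) F unfolding P_def holo_on_def by blast
  next
    fix F assume F: "F \<in> Osp DD (ww (u + e))"
    obtain M' where M': "dec (u + e) F M'" by (rule Osp_dec[OF F]) (use u in simp)
    have "dec ?v F M'" by (rule dec_mono[OF M']) (use lt in simp_all)
    from dec_series(1)[OF \<phi> lt(5,4) this s2, of "\<lambda>_. 1"]
    have "dec ?w (lie_exp \<phi> F) (2 * M')" unfolding lie_exp_def[abs_def] by simp
    then show "lie_exp \<phi> F \<in> Osp DD (ww u)" by (rule dec_Osp) (use u lt in simp_all)
  qed
  define E where "E = (\<lambda>z. lie \<phi> A z + lie \<phi> f z)"
  define ME MC where "ME = \<kappa> * MA * 4 / (e * a * d) + \<kappa> * M * 8 / (e\<^sup>2 * d)" and "MC = \<kappa> * M * 8 / (e\<^sup>2 * d)"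
  have dE: "dec ?v E ME"
    unfolding E_def ME_def
  proof (rule dec_add)
    have "dec ?v (lie \<phi> A) (\<kappa> * MA / ((?t1 - ?v) * (t' - ?v) * d))"
      by (rule dec_lie[OF \<phi> A(1)]) (use lt in simp_all)
    moreover have "\<kappa> * MA / ((?t1 - ?v) * (t' - ?v) * d) <= \<kappa> * MA / ((e / 4) * a * d)"
      unfolding df(1) using A(2,3) u d_pos \<kappa>0 M0 by (intro divide_left_mono mult_right_mono mult_left_mono mult_pos_pos) auto
    ultimately show "dec ?v (lie \<phi> A) (\<kappa> * MA * 4 / (e * a * d))" by (elim dec_mono) simp_all
    have "dec ?v (lie \<phi> f) (\<kappa> * M / ((?t1 - ?v) * (u + e - ?v) * d))"
      by (rule dec_lie[OF \<phi> f]) (use lt in simp_all)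
    then show "dec ?v (lie \<phi> f) (\<kappa> * M * 8 / (e\<^sup>2 * d))" unfolding df by (simp add: power2_eq_square mult_ac)
  qed
  have dC: "dec ?v (lie \<phi> ?cut) MC"
  proof -
    have "dec ?v (lie \<phi> ?cut) (\<kappa> * M / ((?t1 - ?v) * (u + e - ?v) * d))"
      by (rule dec_lie[OF \<phi> cut]) (use lt in simp_all)
    then show ?thesis unfolding df MC_def by (simp add: power2_eq_square mult_ac)
  qed
  define cE cC :: "nat => complex" where "cE k = 1 / of_nat (Suc k)" and "cC k = 1 / (of_nat (Suc k) * of_nat (Suc (Suc k)))" for k
  have n1: "1 <= cmod (of_nat (Suc k))" for k unfolding norm_of_nat by simp
  have cb: "cmod (cE k) <= 1" "cmod (cC k) <= 1" for k
    using n1[of k] mult_mono[OF n1[of k] n1[of "Suc k"]] unfolding cE_def cC_def norm_divide norm_mult norm_one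
    by (simp_all only: divide_le_eq_1 zero_le_one mult_1_left norm_ge_zero) auto
  define R where "R = (\<lambda>z. (\<Sum>k. cE k * ((lie \<phi> ^^ k) E z / fact k)) - (\<Sum>k. cC k * ((lie \<phi> ^^ k) (lie \<phi> ?cut) z / fact k)))"
  note serE = dec_series[where c = cE, OF \<phi> lt(5,4) dE s2 cb(1)] and serC = dec_series[where c = cC, OF \<phi> lt(5,4) dC s2 cb(2)]
  have dR: "dec u R (\<kappa> / (e * d) * (8 * MA / a + 32 * M / e))"
  proof (rule dec_mono)
    show "dec ?w R (2 * ME + 2 * MC)" unfolding R_def by (rule dec_diff[OF serE(1) serC(1)])
    have "2 * ME + 2 * MC = \<kappa> / (e * d) * (8 * MA / a + 32 * M / e)"
      using u A d_pos by (simp add: ME_def MC_def field_simps power2_eq_square)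
    then show "2 * ME + 2 * MC <= \<kappa> / (e * d) * (8 * MA / a + 32 * M / e)" by simp
  qed (use lt in simp)
  have main: "lie_exp \<phi> H z = ham0 h z + (A z + f z - ?cut z) + R z"
    if H: "\<And>z. z \<in> P (u + e) ==> H z = ham0 h z + (A z + f z)" and z: "z \<in> P u" for H z
  proof -
    have zv: "z \<in> P ?v" "z \<in> P ?w" "z \<in> P (u + e)" using z sub by blast+
    have hv: "holo_on \<phi> (P ?v)" "holo_on (ham0 h) (P ?v)" "holo_on A (P ?v)" "holo_on f (P ?v)" "holo_on ?cut (P ?v)" "holo_on E (P ?v)"
    proof -
      have *: "P ?v \<subseteq> P (u + e)" "P ?v \<subseteq> P 1" using sub by blast+
      show "holo_on \<phi> (P ?v)" by (rule holo_subset[OF h\<phi> sub(3)])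
      show "holo_on (ham0 h) (P ?v)" by (rule holo_subset[OF H0 *(2)])
      show "holo_on A (P ?v)" by (rule holo_subset[OF dec_holo[OF A(1)] sub(6)])
      show "holo_on f (P ?v)" by (rule holo_subset[OF dec_holo[OF f] *(1)])
      show "holo_on ?cut (P ?v)" by (rule holo_subset[OF dec_holo[OF cut] *(1)])
      show "holo_on E (P ?v)" by (rule dec_holo[OF dE])
    qed
    have LH: "lie \<phi> H y = E y + (- 1) * ?cut y" if y: "y \<in> P ?v" for y
    proof -
      have "lie \<phi> H y = lie \<phi> (\<lambda>z. ham0 h z + (A z + f z)) y"
      by (rule lie_cong[OF open_P _ y]) (use H sub in blast)
      also have "... = lie \<phi> (ham0 h) y + (lie \<phi> A y + lie \<phi> f y)"
      using lie_add[OF hv(2) holo_add[OF hv(3,4)] y] lie_add[OF hv(3,4) y] by simp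
      finally show ?thesis unfolding hom[OF subsetD[OF sub(3) y]] by (simp add: E_def)
    qed
    have LS: "(lie \<phi> ^^ Suc k) H z = (lie \<phi> ^^ k) E z - (lie \<phi> ^^ k) ?cut z" for k
    proof -
      have "(lie \<phi> ^^ Suc k) H z = (lie \<phi> ^^ k) (lie \<phi> H) z" by (simp add: funpow_Suc_right del: funpow.simps)
      also have "... = (lie \<phi> ^^ k) (\<lambda>y. E y + (- 1) * ?cut y) z"
      by (rule lies_cong[OF open_P LH zv(1)])
      also have "... = (lie \<phi> ^^ k) E z + (lie \<phi> ^^ k) (\<lambda>y. (- 1) * ?cut y) z"
      by (rule lies_add[OF open_P hv(1,6) holo_mult[OF holo_const hv(5)] zv(1)])
      also have "(lie \<phi> ^^ k) (\<lambda>y. (- 1) * ?cut y) z = (- 1) * (lie \<phi> ^^ k) ?cut z"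
      by (rule lies_cmult[OF open_P hv(1,5) zv(1)])
      finally show ?thesis by simp
    qed
    have sE: "(\<lambda>k. (lie \<phi> ^^ k) E z / fact (Suc k)) sums (\<Sum>k. cE k * ((lie \<phi> ^^ k) E z / fact k))"
    proof -
      have e: "cE k * ((lie \<phi> ^^ k) E z / fact k) = (lie \<phi> ^^ k) E z / fact (Suc k)" for k by (simp add: cE_def)
      show ?thesis using summable_sums[OF summable_norm_cancel[OF serE(2)[OF zv(2)]]] by (simp only: e)
    qed
    have sC: "(\<lambda>k. (lie \<phi> ^^ Suc k) ?cut z / fact (Suc (Suc k))) sums (\<Sum>k. cC k * ((lie \<phi> ^^ k) (lie \<phi> ?cut) z / fact k))"
    proof -
      have e: "cC k * ((lie \<phi> ^^ k) (lie \<phi> ?cut) z / fact k) = (lie \<phi> ^^ Suc k) ?cut z / fact (Suc (Suc k))" for k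
      by (simp add: cC_def funpow_Suc_right mult_ac del: funpow.simps)
      show ?thesis using summable_sums[OF summable_norm_cancel[OF serC(2)[OF zv(2)]]] by (simp only: e)
    qed
    \<comment> \<open>The term k = 0 is the cut itself, the part that disappears from f; all later
      terms contain its bracket and go into R.\<close>
    have "(\<lambda>k. (lie \<phi> ^^ k) ?cut z / fact (Suc k)) sums
      ((\<Sum>k. cC k * ((lie \<phi> ^^ k) (lie \<phi> ?cut) z / fact k)) + (lie \<phi> ^^ 0) ?cut z / fact (Suc 0))"
      by (rule sums_Suc[OF sC])
    from sums_diff[OF sE this]
    have "(\<lambda>k. (lie \<phi> ^^ Suc k) H z / fact (Suc k)) sums (R z - ?cut z)"
      by (simp only: LS diff_divide_distrib R_def) (simp add: algebra_simps)
    from sums_Suc[OF this]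
    have "(\<lambda>k. (lie \<phi> ^^ k) H z / fact k) sums (R z - ?cut z + H z)" by simp
    then have "lie_exp \<phi> H z = R z - ?cut z + H z" unfolding lie_exp_def by (rule sums_unique[symmetric])
    then show ?thesis using H[OF zv(3)] by simp
  qed
  show ?thesis by (rule that[OF \<phi> tof Fl(1) Fin disp dR main])
qed

end

subsection \<open>The iteration\<close>

lemma flow_composition_Osp: "flow_composition D w w' \<Psi> ==> F \<in> Osp D w ==> \<Psi> F \<in> Osp D w'"
  by (induction rule: flow_composition.induct) (simp_all add: time_one_flow_def)

lemma flow_composition_holo: "flow_composition D w w' \<Psi> ==> holo_on F (PP D w) ==> holo_on (\<Psi> F) (PP D w')"
  by (induction rule: flow_composition.induct) (simp_all add: time_one_flow_def)

text \<open>In \<open>iterate\<close> the tail factor 33/100 and the bracket factor 17/100 add up to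
  one half. The second bound turns 4 exp (3/4) into 46/5.\<close>

lemma exp_bounds: "exp (- (6 / 5) :: real) <= 33 / 100" "exp (3 / 4 :: real) <= 23 / 10"
proof -
  have "(33 / 100) * (28 / 25) ^ 10 \<ge> (1 :: real)" by (simp add: power_divide)
  also have "(33 / 100) * (28 / 25) ^ 10 <= (33 / 100) * exp (3 / 25 :: real) ^ 10"
    using exp_ge_add_one_self[of "3 / 25 :: real"] by (intro mult_left_mono power_mono) auto
  also have "exp (3 / 25 :: real) ^ 10 = exp (6 / 5)" by (simp add: exp_of_nat_mult[symmetric])
  finally show "exp (- (6 / 5) :: real) <= 33 / 100" by (simp add: exp_minus inverse_eq_divide divide_le_eq)
  have "exp (3 / 4 :: real) ^ 4 = exp 1 ^ 3" by (simp add: exp_of_nat_mult[symmetric])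
  also have "... <= 3 ^ 3" by (intro power_mono exp_le) auto
  also have "... <= (23 / 10 :: real) ^ 4" by (simp add: power_divide)
  finally show "exp (3 / 4 :: real) <= 23 / 10" by (rule power_le_imp_le_base[where n = 3, simplified]) simp
qed

context ham begin

text \<open>
  One step loses the width \<open>e\<close>; the tail gains the factor \<open>exp (- 3 N e) = exp (- 6/5)\<close>, and the
  remainder of \<open>step\<close> takes up the rest of the factor \<open>1/2\<close>.
\<close>

lemma iterate:
  assumes e: "e = 2 / (5 * N)" and A0: "dec 1 A0 F0" and f1: "dec (4 / 5) f1 M1"
    and W: "0 <= W" "\<And>z. z \<in> P 1 ==> cmod (1 / omega_y h z) <= W" and \<kappa>0: "\<kappa>0 = 4 * exp (3 / 4) * K * W"
    and small: "384 * (\<kappa>0 * M1) <= e\<^sup>2 * d" "\<kappa>0 / (e * d) * (40 * F0 + 96 * M1 / e) <= 17 / 100"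
    and \<Psi>0: "flow_composition DD (ww 1) (ww (4 / 5)) \<Psi>0" "\<And>z. z \<in> P (4 / 5) ==> \<Psi>0 H z = ham0 h z + (A0 z + f1 z)"
    and j: "real j <= N" and t: "t = 4 / 5 - real j * e"
  shows "\<exists>\<Psi> \<Phi> g fr. flow_composition DD (ww 1) (ww t) \<Psi> \<and>
    (\<forall>z\<in>P t. \<Phi> z \<in> P (4 / 5) \<and> (\<forall>F. holo_on F (P 1) \<longrightarrow> \<Psi> F z = \<Psi>0 F (\<Phi> z)) \<and>
      (\<forall>i. rad (cj i) * cmod (co i (\<Phi> z) - co i z) <= 16 * (\<kappa>0 * M1) / e * (1 - 1 / 2 ^ j)) \<and>
      \<Psi> H z = ham0 h z + (A0 z + (g z + fr z))) \<and>
    dec t g (2 * M1 * (1 - 1 / 2 ^ j)) \<and> gr (P t) (\<lambda>_. 0) g \<and> dec t fr (M1 / 2 ^ j)"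
  using j t
proof (induction j arbitrary: t)
  case 0
  have t: "t = 4 / 5" using 0(2) by simp
  then show ?case
    unfolding t using \<Psi>0 f1 dec_zero gr_zero
    by - (rule exI[of _ \<Psi>0], rule exI[of _ "\<lambda>z. z"], rule exI[of _ "\<lambda>_. 0"], rule exI[of _ f1], simp)
next
  case (Suc j)
  define T where "T = 4 / 5 - real j * e"
  define M where "M = M1 / 2 ^ j"
  have e0: "0 < e" "N * e = 2 / 5" using N by (simp_all add: e)
  have te: "t + e = T" using Suc.prems by (simp add: T_def algebra_simps)
  have t0: "0 < t" "T <= 4 / 5"
  proof -
    have "real (Suc j) * e <= N * e" using Suc.prems e0 by (intro mult_right_mono) auto
    then show "0 < t" using Suc.prems e0 by simp
    show "T <= 4 / 5" using e0 by (simp add: T_def)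
  qed
  have jN: "real j <= N" using Suc.prems by simp
  obtain \<Psi> \<Phi> g fr where IH0: "flow_composition DD (ww 1) (ww T) \<Psi> \<and>
    (\<forall>z\<in>P T. \<Phi> z \<in> P (4 / 5) \<and> (\<forall>F. holo_on F (P 1) \<longrightarrow> \<Psi> F z = \<Psi>0 F (\<Phi> z)) \<and>
      (\<forall>i. rad (cj i) * cmod (co i (\<Phi> z) - co i z) <= 16 * (\<kappa>0 * M1) / e * (1 - 1 / 2 ^ j)) \<and>
      \<Psi> H z = ham0 h z + (A0 z + (g z + fr z))) \<and>
    dec T g (2 * M1 * (1 - 1 / 2 ^ j)) \<and> gr (P T) (\<lambda>_. 0) g \<and> dec T fr (M1 / 2 ^ j)"
    using Suc.IH[OF jN T_def] by (elim exE) (rule that)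
  note mid = bspec[OF conjunct1[OF conjunct2[OF IH0]]] and last = conjunct2[OF conjunct2[OF IH0]]
  have IH: "flow_composition DD (ww 1) (ww T) \<Psi>"
    "\<And>z. z \<in> P T ==> \<Phi> z \<in> P (4 / 5)" "\<And>z F. z \<in> P T ==> holo_on F (P 1) ==> \<Psi> F z = \<Psi>0 F (\<Phi> z)"
    "\<And>z i. z \<in> P T ==> rad (cj i) * cmod (co i (\<Phi> z) - co i z) <= 16 * (\<kappa>0 * M1) / e * (1 - 1 / 2 ^ j)"
    "\<And>z. z \<in> P T ==> \<Psi> H z = ham0 h z + (A0 z + (g z + fr z))"
    "dec T g (2 * M1 * (1 - 1 / 2 ^ j))" "gr (P T) (\<lambda>_. 0) g" "dec T fr M"
    using conjunct1[OF IH0] conjunct1[OF mid] conjunct1[OF conjunct2[OF mid]] conjunct1[OF conjunct2[OF conjunct2[OF mid]]]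
      conjunct2[OF conjunct2[OF conjunct2[OF mid]]] last
    unfolding M_def by simp_all
  have M: "0 <= M" "M <= M1" "0 <= M1" using dec_nonneg[OF IH(8)] dec_nonneg[OF f1] by (simp_all add: M_def divide_le_eq mult_le_cancel_left1)
  obtain G B where G: "\<And>mu. holo_on (G mu) (P T)" "\<And>mu. gr (P T) mu (G mu)" "\<And>mu z. z \<in> P T ==> cmod (G mu z) <= B mu"
    "\<And>mu. 0 <= B mu" "B summable_on UNIV" "infsum B UNIV <= M" "\<And>z. z \<in> P T ==> ((\<lambda>mu. G mu z) has_sum fr z) UNIV"
    using decE[OF IH(8)] by metis
  define C where "C = Cut - {\<lambda>_. 0}"
  have C: "finite C" "\<And>mu. mu \<in> C ==> nmu mu <= 3 * N" using finite_Cut by (auto simp: C_def Cut_def)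
  have C0: "(\<lambda>_. 0) \<in> Cut" using N by (simp add: Cut_def supp_def nmu_def)
  have Bs: "sum B A <= M" if "finite A" for A
    using finite_sum_le_infsum[OF G(5) that] G(4,6) by fastforce
  have P1: "P T \<subseteq> P 1" "P t \<subseteq> P T" using t0 te e0 by (simp_all add: P_mono)
  \<comment> \<open>At most 2 * M1 for the averages accumulated so far, a geometric sum, and M1 for
    the current remainder.\<close>
  have gf: "dec T (\<lambda>z. g z + fr z) (3 * M1)"
  proof (rule dec_mono[OF dec_add[OF IH(6,8)] order_refl])
    have "2 * M1 * (1 - 1 / 2 ^ j) <= 2 * M1 * 1" using M by (intro mult_left_mono) auto
    then show "2 * M1 * (1 - 1 / 2 ^ j) + M <= 3 * M1" using M by simp
  qed
  have cut: "dec T (\<lambda>z. \<Sum>mu\<in>C. G mu z) (3 * M1)"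
  proof (rule decI[of C G T "\<lambda>mu. mu" B "sum B C"])
    show "sum B C <= 3 * M1" using Bs[OF C(1)] M by simp
  qed (use G C(1) in \<open>simp_all add: has_sum_finite\<close>)
  have BW: "cmod (G mu z / omega_y h z) <= W * B mu" if "z \<in> P T" for mu z
  proof -
    have "cmod (G mu z / omega_y h z) = cmod (1 / omega_y h z) * cmod (G mu z)" by (simp add: norm_divide)
    also have "... <= W * B mu" by (rule mult_mono[OF W(2)[OF subsetD[OF P1(1) that]] G(3)[OF that] W(1) norm_ge_zero])
    finally show ?thesis .
  qed
  have SW: "(\<Sum>mu\<in>C. W * B mu) <= W * M" using Bs[OF C(1)] W by (simp add: sum_distrib_left[symmetric] mult_left_mono)
  have \<kappa>pos: "0 <= \<kappa>0" using K W by (simp add: \<kappa>0)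
  have \<kappa>: "\<kappa>0 * M = 4 * exp (3 / 4) * K * (W * M)" by (simp add: \<kappa>0)
  have sm: "384 * (\<kappa>0 * M) <= e\<^sup>2 * d"
    using small(1) mult_left_mono[OF M(2) \<kappa>pos] by simp
  obtain \<phi> R where st: "time_one_flow DD (ww T) (ww t) \<phi>"
    "\<And>F z. holo_on F (P T) ==> z \<in> P t ==> lie_exp \<phi> F z = F (Flow \<phi> z)"
    "\<And>z. z \<in> P t ==> Flow \<phi> z \<in> P T"
    "\<And>z i. z \<in> P t ==> rad (cj i) * cmod (co i (Flow \<phi> z) - co i z) <= 8 * (\<kappa>0 * M) / e"
    "dec t R (\<kappa>0 * M / (e * d) * (8 * F0 / (1 / 5) + 32 * (3 * M1) / e))"
    "\<And>H z. (\<And>z. z \<in> P T ==> H z = ham0 h z + (A0 z + (g z + fr z))) ==> z \<in> P t ==>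
      lie_exp \<phi> H z = ham0 h z + (A0 z + (g z + fr z) - (\<Sum>mu\<in>C. G mu z)) + R z"
  proof -
    \<comment> \<open>\<open>A0\<close> is bounded on t = 1 and T <= 4/5, so its gap is at least 1/5
      in every step, whatever N is.\<close>
    have p: "T <= 1" "t + e / 2 + 1 / 5 <= 1" "(0 :: real) < 1 / 5" using te t0 e0 by simp_all
    have W0: "0 <= W * B mu" for mu using W(1) G(4) by simp
    show ?thesis
    proof (rule step[of t e 1 A0 F0 "1 / 5" "\<lambda>z. g z + fr z" "3 * M1" C G "\<lambda>mu. W * B mu" "W * M" "\<kappa>0 * M", unfolded te,
      OF t0(1) e0(1) p(1) A0 p(2,3) gf C G(1,2) BW W0 SW cut \<kappa> sm], assumption, assumption)
      fix \<phi> R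
      assume *: "time_one_flow DD (ww T) (ww t) \<phi>" "\<And>F z. holo_on F (P T) ==> z \<in> P t ==> lie_exp \<phi> F z = F (Flow \<phi> z)"
      "\<And>z. z \<in> P t ==> Flow \<phi> z \<in> P T"
      "\<And>z i. z \<in> P t ==> rad (cj i) * cmod (co i (Flow \<phi> z) - co i z) <= 8 * (\<kappa>0 * M) / e"
      "dec t R (\<kappa>0 * M / (e * d) * (8 * F0 / (1 / 5) + 32 * (3 * M1) / e))"
      "\<And>H z. (\<And>z. z \<in> P T ==> H z = ham0 h z + (A0 z + (g z + fr z))) ==> z \<in> P t ==>
      lie_exp \<phi> H z = ham0 h z + (A0 z + (g z + fr z) - (\<Sum>mu\<in>C. G mu z)) + R z"
      show thesis by (rule that[OF *])
    qed
  qed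
  have h\<Psi>: "holo_on (\<Psi> F) (P T)" if "holo_on F (P 1)" for F
    using flow_composition_holo[OF IH(1)] that unfolding P_def by blast
  \<comment> \<open>The degree-zero component of the remainder is kept: it belongs to the normal
    form and is added to g.\<close>
  have G0: "dec t (G (\<lambda>_. 0)) M"
  proof (rule decI[of "{\<lambda>_. 0}" G t "\<lambda>mu. mu" B "B (\<lambda>_. 0)"])
    show "B (\<lambda>_. 0) <= M" using Bs[of "{\<lambda>_. 0}"] by simp
  qed (use P1 G(3,4) holo_subset[OF G(1) P1(2)] gr_subset[OF G(2) P1(2)] in \<open>auto intro!: has_sum_finiteI\<close>)
  have split: "(\<Sum>mu\<in>Cut. G mu z) = G (\<lambda>_. 0) z + (\<Sum>mu\<in>C. G mu z)" for z
    unfolding C_def by (rule sum.remove[OF finite_Cut C0])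
  let ?g = "\<lambda>z. g z + G (\<lambda>_. 0) z" and ?f = "\<lambda>z. (fr z - (\<Sum>mu\<in>Cut. G mu z)) + R z"
  have "flow_composition DD (ww 1) (ww t) (lie_exp \<phi> \<circ> \<Psi>)"
    by (rule flow_composition.intros(2)[OF IH(1) _ _ st(1)]) (use radii_less_ww t0 te e0 in auto)
  moreover have "\<Phi> (Flow \<phi> z) \<in> P (4 / 5)" if "z \<in> P t" for z by (rule IH(2)[OF st(3)[OF that]])
  moreover have "(lie_exp \<phi> \<circ> \<Psi>) F z = \<Psi>0 F (\<Phi> (Flow \<phi> z))" if F: "holo_on F (P 1)" and z: "z \<in> P t" for F z
    using st(2)[OF h\<Psi>[OF F] z] IH(3)[OF st(3)[OF z] F] by simp
  moreover have "rad (cj i) * cmod (co i (\<Phi> (Flow \<phi> z)) - co i z) <= 16 * (\<kappa>0 * M1) / e * (1 - 1 / 2 ^ Suc j)" if z: "z \<in> P t" for z i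
  proof -
    have "cmod (co i (\<Phi> (Flow \<phi> z)) - co i z) <= cmod (co i (\<Phi> (Flow \<phi> z)) - co i (Flow \<phi> z)) + cmod (co i (Flow \<phi> z) - co i z)"
      using norm_triangle_ineq[of "co i (\<Phi> (Flow \<phi> z)) - co i (Flow \<phi> z)" "co i (Flow \<phi> z) - co i z"] by simp
    then have "rad (cj i) * cmod (co i (\<Phi> (Flow \<phi> z)) - co i z) <= rad (cj i) * (cmod (co i (\<Phi> (Flow \<phi> z)) - co i (Flow \<phi> z)) + cmod (co i (Flow \<phi> z) - co i z))"
      by (rule mult_left_mono) (use rad[of "cj i"] in simp)
    also have "... <= 16 * (\<kappa>0 * M1) / e * (1 - 1 / 2 ^ j) + 8 * (\<kappa>0 * M) / e"
      unfolding distrib_left by (rule add_mono[OF IH(4)[OF st(3)[OF z]] st(4)[OF z]])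
    also have "... = 16 * (\<kappa>0 * M1) / e * (1 - 1 / 2 ^ Suc j)"
    proof -
      \<comment> \<open>The generators halve from step to step, so the displacements add up like a
        geometric series.\<close>
      have "8 * (\<kappa>0 * M) / e = 16 * (\<kappa>0 * M1) / e * (1 / 2 ^ j - 1 / 2 ^ Suc j)" by (simp add: M_def mult_ac)
      then show ?thesis by (simp only: distrib_left[symmetric]) simp
    qed
    finally show ?thesis .
  qed
  moreover have "(lie_exp \<phi> \<circ> \<Psi>) H z = ham0 h z + (A0 z + (?g z + ?f z))" if z: "z \<in> P t" for z
    using st(6)[OF IH(5) z] by (simp add: split)
  moreover have "dec t ?g (2 * M1 * (1 - 1 / 2 ^ Suc j))"
  proof (rule dec_mono[OF dec_add[OF dec_mono[OF IH(6) _ order_refl] G0] order_refl])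
    show "2 * M1 * (1 - 1 / 2 ^ j) + M <= 2 * M1 * (1 - 1 / 2 ^ Suc j)" by (simp add: M_def field_simps)
  qed (use te e0 in simp)
  moreover have "gr (P t) (\<lambda>_. 0) ?g"
    using gr_subset[OF IH(7) P1(2)] gr_subset[OF G(2)[of "\<lambda>_. 0"] P1(2)] unfolding gr_def hom_def by (simp add: distrib_left)
  moreover have "dec t ?f (M1 / 2 ^ Suc j)"
  proof (rule dec_mono[OF dec_add[OF cut_tail[OF G] st(5)] order_refl])
    have "T - t = e" using te by simp
    then have "(T - t) * (3 * N) = 3 * (N * e)" by simp
    then have 65: "(T - t) * (3 * N) = 6 / 5" using e0(2) by simp
    have "exp (- ((T - t) * (3 * N))) * M <= 33 / 100 * M" unfolding 65 by (rule mult_right_mono[OF exp_bounds(1) M(1)])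
    moreover have "\<kappa>0 * M / (e * d) * (8 * F0 / (1 / 5) + 32 * (3 * M1) / e) <= 17 / 100 * M"
    proof -
      have "\<kappa>0 * M / (e * d) * (8 * F0 / (1 / 5) + 32 * (3 * M1) / e) = \<kappa>0 / (e * d) * (40 * F0 + 96 * M1 / e) * M" by simp
      also have "... <= 17 / 100 * M" by (rule mult_right_mono[OF small(2) M(1)])
      finally show ?thesis .
    qed
    ultimately show "exp (- ((T - t) * (3 * N))) * M + \<kappa>0 * M / (e * d) * (8 * F0 / (1 / 5) + 32 * (3 * M1) / e) <= M1 / 2 ^ Suc j"
      by (simp add: M_def)
  qed (use te e0 t0 in simp_all)
  ultimately show ?case
    by - (rule exI[of _ "lie_exp \<phi> \<circ> \<Psi>"], rule exI[of _ "\<lambda>z. \<Phi> (Flow \<phi> z)"], rule exI[of _ ?g], rule exI[of _ ?f], blast)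
qed

end

subsection \<open>Comparison of norms\<close>

lemma cdg_zero: "cdg nu = (\<lambda>_. 0) \<longleftrightarrow> nu \<notin> {(k, h, j). \<not> (k = 0 \<and> h = j)}"
proof -
  obtain k h j where nu: "nu = (k, h, j)" by (metis prod.exhaust)
  have "cdg nu = (\<lambda>_. 0) \<longleftrightarrow> k = 0 \<and> h = j"
  proof
    assume e: "cdg nu = (\<lambda>_. 0)"
    have "k $ i = 0" for i using fun_cong[OF e, of "CT i"] by (simp add: nu)
    moreover have "h $ i = j $ i" for i using fun_cong[OF e, of "CQ i"] by (simp add: nu)
    ultimately show "k = 0 \<and> h = j" by (simp add: vec_eq_iff)
  next
    assume e: "k = 0 \<and> h = j"
    show "cdg nu = (\<lambda>_. 0)"
    proof
      fix v show "cdg nu v = 0" using e by (cases v) (simp_all add: nu)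
    qed
  qed
  then show ?thesis by (simp add: nu)
qed

context dom begin

lemma graded_eq:
  assumes G: "\<And>mu. gr (P t) mu (G mu)" "\<And>z. z \<in> P t ==> ((\<lambda>mu. G mu z) has_sum F z) UNIV"
    and G': "\<And>mu. gr (P t) mu (G' mu)" "\<And>z. z \<in> P t ==> ((\<lambda>mu. G' mu z) has_sum F z) UNIV" and z: "z \<in> P t"
  shows "G mu z = G' mu z"
proof -
  have "(\<lambda>mu z. G mu z - G' mu z) mu z = 0"
  proof (rule graded_unique[where a = av and deg = "\<lambda>mu. mu", OF _ _ rinv_P _ z])
    show "hom (av v) (mu v) (P t) (\<lambda>z. G mu z - G' mu z)" for mu v
      using G(1)[of mu] G'(1)[of mu] unfolding gr_def hom_def by (simp add: right_diff_distrib)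
    show "((\<lambda>mu. G mu z - G' mu z) has_sum 0) UNIV" if "z \<in> P t" for z
      using has_sum_add[OF G(2)[OF that] has_sum_uminusI[OF G'(2)[OF that]]] by simp
  qed simp
  then show ?thesis by simp
qed

lemma comp_eq:
  assumes a: "tf_expansion DD (ww t) F a"
    and G: "\<And>mu. gr (P t) mu (G mu)" "\<And>z. z \<in> P t ==> ((\<lambda>mu. G mu z) has_sum F z) UNIV" and z: "z \<in> P t"
  shows "infsum (tf_term a z) {nu. cdg nu = mu} = G mu z"
proof -
  have "(\<lambda>mu z. infsum (tf_term a z) {nu \<in> UNIV. cdg nu = mu}) mu z = G mu z"
  proof (rule graded_eq[OF _ _ G z])
    show "gr (P t) mu (\<lambda>z. infsum (tf_term a z) {nu \<in> UNIV. cdg nu = mu})" for mu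
      by (rule gr_infsum) (use gr_tf_term in auto)
    show "((\<lambda>mu. infsum (tf_term a z) {nu \<in> UNIV. cdg nu = mu}) has_sum F z) UNIV" if "z \<in> P t" for z
      by (rule has_sum_group) (use a that in \<open>simp add: tf_expansion_def P_def\<close>)
  qed
  then show ?thesis by simp
qed

lemma sum_comp_eq:
  assumes a: "tf_expansion DD (ww t) F a"
    and G: "\<And>mu. gr (P t) mu (G mu)" "\<And>z. z \<in> P t ==> ((\<lambda>mu. G mu z) has_sum F z) UNIV" and z: "z \<in> P t" and C: "finite C"
  shows "(tf_term a z has_sum (\<Sum>mu\<in>C. G mu z)) {nu. cdg nu \<in> C}"
    and "(tf_term a z has_sum (F z - (\<Sum>mu\<in>C. G mu z))) {nu. cdg nu \<notin> C}"
proof -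
  let ?A = "{nu. cdg nu \<in> C}"
  have s: "(tf_term a z has_sum F z) UNIV" using a z by (simp add: tf_expansion_def P_def)
  then have "tf_term a z summable_on ?A" by (rule summable_on_subset_banach[OF has_sum_imp_summable]) simp
  then have h: "(tf_term a z has_sum infsum (tf_term a z) ?A) ?A" by (rule has_sum_infsum)
  have "((\<lambda>mu. infsum (tf_term a z) {nu \<in> ?A. cdg nu = mu}) has_sum infsum (tf_term a z) ?A) UNIV"
    by (rule has_sum_group[OF h])
  moreover have "((\<lambda>mu. infsum (tf_term a z) {nu \<in> ?A. cdg nu = mu}) has_sum (\<Sum>mu\<in>C. G mu z)) UNIV"
  proof (rule has_sum_finite_neutralI[OF C])
    fix mu assume "mu \<in> UNIV - C"
    then have "{nu \<in> ?A. cdg nu = mu} = {}" by blast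
    then show "infsum (tf_term a z) {nu \<in> ?A. cdg nu = mu} = 0" by (simp only: infsum_empty)
  next
    show "(\<Sum>mu\<in>C. G mu z) = (\<Sum>mu\<in>C. infsum (tf_term a z) {nu \<in> ?A. cdg nu = mu})"
    proof (rule sum.cong[OF refl])
      fix mu assume "mu \<in> C"
      then have "{nu \<in> ?A. cdg nu = mu} = {nu. cdg nu = mu}" by blast
      then show "G mu z = infsum (tf_term a z) {nu \<in> ?A. cdg nu = mu}" using comp_eq[OF a G z] by simp
    qed
  qed simp
  ultimately have e: "infsum (tf_term a z) ?A = (\<Sum>mu\<in>C. G mu z)" by (rule has_sum_unique)
  show A: "(tf_term a z has_sum (\<Sum>mu\<in>C. G mu z)) ?A" using h unfolding e .
  have "UNIV - ?A = {nu. cdg nu \<notin> C}" by blast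
  then show "(tf_term a z has_sum (F z - (\<Sum>mu\<in>C. G mu z))) {nu. cdg nu \<notin> C}"
    using has_sum_Diff[OF s A] by simp
qed

lemma average_eq:
  assumes a: "tf_expansion DD (ww t) F a"
    and G: "\<And>mu. gr (P t) mu (G mu)" "\<And>z. z \<in> P t ==> ((\<lambda>mu. G mu z) has_sum F z) UNIV" and z: "z \<in> P t"
  shows "average DD (ww t) F z = G (\<lambda>_. 0) z" "off_average DD (ww t) F z = F z - G (\<lambda>_. 0) z"
proof -
  have e: "{(k, h, j). \<not> (k = 0 \<and> h = j)} = {nu :: ('n, 'm) mindex. cdg nu \<notin> {\<lambda>_. 0}}"
    using cdg_zero by blast
  have s: "(\<Sum>mu\<in>{\<lambda>_. 0}. G mu z) = G (\<lambda>_. 0) z" by simp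
  have "finite {\<lambda>_ :: ('n, 'm) ix. 0 :: int}" by simp
  from infsumI[OF sum_comp_eq(2)[OF tf_coeff_expansion[OF a] G z this]]
  show *: "off_average DD (ww t) F z = F z - G (\<lambda>_. 0) z"
    unfolding off_average_def e s .
  then show "average DD (ww t) F z = G (\<lambda>_. 0) z" unfolding average_def by simp
qed

lemma gr_average:
  assumes G: "holo_on G (P t)" "gr (P t) (\<lambda>_. 0) G" and z: "z \<in> P t"
  shows "off_average DD (ww t) G z = 0"
proof -
  obtain a where a: "tf_expansion DD (ww t) G a" using expansion[OF G(1) gr_per[OF G(2)] P_pos[OF z]] by metis
  let ?G = "\<lambda>(mu :: ('n, 'm) ix => int) z. if mu = (\<lambda>_. 0) then G z else 0"
  have "off_average DD (ww t) G z = G z - ?G (\<lambda>_. 0) z"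
  proof (rule average_eq(2)[where G = ?G, OF a _ _ z])
    show "gr (P t) mu (?G mu)" for mu using G(2) gr_zero by (cases "mu = (\<lambda>_. 0)") simp_all
    show "((\<lambda>mu. ?G mu z) has_sum G z) UNIV" for z
      by (rule has_sum_finite_neutralI[of "{\<lambda>_. 0}"]) auto
  qed
  then show ?thesis by simp
qed

lemma tf_norm_cong:
  assumes "\<And>z. z \<in> P t ==> F z = G z" shows "tf_norm DD (ww t) F = tf_norm DD (ww t) G"
proof -
  have "tf_expansion DD (ww t) F = tf_expansion DD (ww t) G"
    using assms by (auto simp: fun_eq_iff tf_expansion_def P_def)
  then have "tf_coeff DD (ww t) F = tf_coeff DD (ww t) G" by (simp add: tf_coeff_def)
  then show ?thesis unfolding ww_def by simp
qed

text \<open>A component of one degree is a sum of expansion terms, so taking suprema over degrees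
  instead of over single terms can only decrease the total. Through this inequality the expansion
  norms of the theorem control the components.\<close>

lemma coarse_norm:
  assumes t: "0 < t" and F: "holo_on F (P t)"
    and G: "\<And>mu. gr (P t) mu (G mu)" "\<And>z. z \<in> P t ==> ((\<lambda>mu. G mu z) has_sum F z) UNIV" and C: "finite C"
  shows "(\<Sum>mu\<in>C. SUP z\<in>P t. ennreal (cmod (G mu z))) <= tf_norm DD (ww t) F"
proof (cases "tf_norm DD (ww t) F < \<infinity>")
  case True
  have "per t F"
    unfolding per_def
  proof (intro allI ballI)
    fix v z assume z: "z \<in> P t"
    have r: "rota (fv v) (of_real (2 * pi)) z \<in> P t" by (rule rinvD[OF rinv_P z])
    have "G mu (rota (fv v) (of_real (2 * pi)) z) = G mu z" for mu
      using gr_per[OF G(1)] z unfolding per_def by blast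
    then show "F (rota (fv v) (of_real (2 * pi)) z) = F z"
      using has_sum_unique[OF G(2)[OF r]] G(2)[OF z] by simp
  qed
  then obtain G1 B where *: "\<And>mu. gr (P t) mu (G1 mu)" "\<And>mu z. z \<in> P t ==> cmod (G1 mu z) <= B mu"
    "\<And>mu. 0 <= B mu" "B summable_on UNIV" "infsum B UNIV <= enn2real (tf_norm DD (ww t) F)" "\<And>z. z \<in> P t ==> ((\<lambda>mu. G1 mu z) has_sum F z) UNIV"
    using decE[OF norm_dec[OF t F _ True]] by metis
  have "(\<Sum>mu\<in>C. SUP z\<in>P t. ennreal (cmod (G mu z))) <= (\<Sum>mu\<in>C. ennreal (B mu))"
  proof (intro sum_mono SUP_least)
    fix mu z assume z: "z \<in> P t"
    show "ennreal (cmod (G mu z)) <= ennreal (B mu)"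
      using *(2)[OF z, of mu] graded_eq[OF G *(1,6) z] by (simp add: ennreal_leI)
  qed
  also have "... = ennreal (sum B C)" using *(3) by simp
  also have "... <= ennreal (enn2real (tf_norm DD (ww t) F))"
    using finite_sum_le_infsum[OF *(4) C] *(3,5) by (intro ennreal_leI) (metis order_trans subset_UNIV)
  also have "... = tf_norm DD (ww t) F" using True by simp
  finally show ?thesis .
qed (simp add: less_top[symmetric])

lemma tf_norm_add:
  assumes t: "0 < t" and F: "holo_on F (P t)" "per t F" and G: "holo_on G (P t)" "per t G"
  shows "tf_norm DD (ww t) (\<lambda>z. F z + G z) <= tf_norm DD (ww t) F + tf_norm DD (ww t) G"
proof (cases "tf_norm DD (ww t) F < \<infinity> \<and> tf_norm DD (ww t) G < \<infinity>")
  case True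
  let ?a = "tf_coeff DD (ww t) F" and ?b = "tf_coeff DD (ww t) G"
  obtain a where a: "\<And>nu z. z \<in> P t ==> cmod (tf_term ?a z nu) <= a nu" "\<And>nu. 0 <= a nu" "a summable_on UNIV"
    "ennreal (infsum a UNIV) = tf_norm DD (ww t) F" "tf_expansion DD (ww t) F ?a" using tf_norm_parts[OF t F] True by metis
  obtain b where b: "\<And>nu z. z \<in> P t ==> cmod (tf_term ?b z nu) <= b nu" "\<And>nu. 0 <= b nu" "b summable_on UNIV"
    "ennreal (infsum b UNIV) = tf_norm DD (ww t) G" "tf_expansion DD (ww t) G ?b" using tf_norm_parts[OF t G] True by metis
  let ?c = "\<lambda>nu u. ?a nu u + ?b nu u"
  have tm: "tf_term ?c z nu = tf_term ?a z nu + tf_term ?b z nu" for z nu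
    by (simp add: tf_term_mono distrib_right)
  have "tf_norm DD (ww t) (\<lambda>z. F z + G z) <= ennreal (infsum (\<lambda>nu. a nu + b nu) UNIV)"
  proof (rule tf_norm_le[OF t, where a = ?c])
    show "tf_expansion DD (ww t) (\<lambda>z. F z + G z) ?c"
      using a(5) b(5) unfolding tf_expansion_def tm by (intro ballI has_sum_add) blast+
    show "cmod (tf_term ?c z nu) <= a nu + b nu" if "z \<in> P t" for z nu
      unfolding tm by (rule norm_triangle_mono[OF a(1)[OF that] b(1)[OF that]])
    show "0 <= a nu + b nu" for nu using a(2) b(2) by simp
    show "(\<lambda>nu. a nu + b nu) summable_on UNIV" by (rule summable_on_add[OF a(3) b(3)])
  qed
  also have "... = ennreal (infsum a UNIV) + ennreal (infsum b UNIV)"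
    unfolding infsum_add[OF a(3) b(3)] using a(2) b(2) by (intro ennreal_plus infsum_nonneg) auto
  finally show ?thesis using a(4) b(4) by simp
qed (auto simp: less_top[symmetric])

end

context ham begin

text \<open>
  Here the loss of the factor \<open>Cm\<close> in passing from \<open>dec\<close> to \<open>tf_norm\<close> is avoided, since the decay
  of the tail is needed without a constant in front.
\<close>

lemma tail_norm:
  assumes F: "holo_on F (P 1)" "per 1 F" "tf_norm DD (ww 1) F = ennreal F0" "0 <= F0"
    and G: "\<And>mu. gr (P 1) mu (G mu)" "\<And>z. z \<in> P 1 ==> ((\<lambda>mu. G mu z) has_sum F z) UNIV" and u: "0 < u" "u <= 1"
  shows "tf_norm DD (ww u) (\<lambda>z. F z - (\<Sum>mu\<in>Cut. G mu z)) <= ennreal (exp (- ((1 - u) * (3 * N))) * F0)"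
proof -
  let ?a = "tf_coeff DD (ww 1) F" and ?q = "exp (- ((1 - u) * (3 * N)))"
  have fin: "tf_norm DD (ww 1) F < \<infinity>" using F(3) by simp
  obtain b where b: "\<And>nu z. z \<in> P 1 ==> cmod (tf_term ?a z nu) <= b nu" "\<And>nu. 0 <= b nu" "b summable_on UNIV"
    "ennreal (infsum b UNIV) = tf_norm DD (ww 1) F" "\<And>nu. holo_on (\<lambda>z. tf_term ?a z nu) (P 1)"
    "tf_expansion DD (ww 1) F ?a" using tf_norm_parts[OF zero_less_one F(1,2) fin] by metis
  let ?c = "\<lambda>nu x. if cdg nu \<in> Cut then 0 else ?a nu x"
  have c: "tf_term ?c z nu = (if cdg nu \<in> Cut then 0 else tf_term ?a z nu)" for z nu
    by (simp add: tf_term_mono)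
  have sub: "P u \<subseteq> P 1" by (rule P_mono[OF u(2)])
  have "tf_norm DD (ww u) (\<lambda>z. F z - (\<Sum>mu\<in>Cut. G mu z)) <= ennreal (infsum (\<lambda>nu. ?q * b nu) UNIV)"
  proof (rule tf_norm_le[OF u(1), where a = ?c])
    show "tf_expansion DD (ww u) (\<lambda>z. F z - (\<Sum>mu\<in>Cut. G mu z)) ?c"
      unfolding tf_expansion_def
    proof (intro ballI)
      fix z assume "z \<in> PP DD (ww u)"
      then have z: "z \<in> P 1" using sub unfolding P_def by blast
      show "(tf_term ?c z has_sum F z - (\<Sum>mu\<in>Cut. G mu z)) UNIV"
      by (rule iffD1[OF has_sum_cong_neutral sum_comp_eq(2)[OF b(6) G z finite_Cut]]) (auto simp: c)
    qed
    show "cmod (tf_term ?c z nu) <= ?q * b nu" if z: "z \<in> P u" for z nu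
    proof (cases "cdg nu \<in> Cut")
      case False
      have "\<not> supp (cdg nu) ==> tf_term ?a z nu = 0"
      using gr_unsupp[OF gr_tf_term _ z] by blast
      moreover have "cmod (tf_term ?a z nu) <= ?q * b nu" if "supp (cdg nu)"
      proof -
      have n: "3 * N <= nmu (cdg nu)" using False that by (simp add: Cut_def)
      have "cmod (tf_term ?a z nu) <= exp (- ((1 - u) * nmu (cdg nu))) * b nu"
      by (rule decay[OF b(5) gr_tf_term b(1) u(2) order_refl z])
      also have "... <= ?q * b nu"
      using n u b(2) by (intro mult_right_mono) (simp_all add: mult_left_mono)
      finally show ?thesis .
      qed
      ultimately show ?thesis using False b(2)[of nu] unfolding c by (cases "supp (cdg nu)") simp_all
    qed (use b(2) in \<open>simp add: c\<close>)
    show "0 <= ?q * b nu" for nu using b(2) by simp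
    show "(\<lambda>nu. ?q * b nu) summable_on UNIV" by (rule summable_on_cmult_right[OF b(3)])
  qed
  also have "infsum (\<lambda>nu. ?q * b nu) UNIV = ?q * infsum b UNIV" by (rule infsum_cmult_right) (use b(3) in simp)
  also have "infsum b UNIV = F0" using b(2,4) F(3,4) by (simp add: infsum_nonneg)
  finally show ?thesis .
qed

end

subsection \<open>The normal form\<close>

lemma exp_neg_two: "exp (- 2 :: real) <= 1 / 6"
proof -
  have "(6 :: real) <= (6 / 5) ^ 10" by (simp add: power_divide)
  also have "... <= exp (1 / 5 :: real) ^ 10" using exp_ge_add_one_self[of "1 / 5 :: real"] by (intro power_mono) auto
  also have "... = exp 2" by (simp add: exp_of_nat_mult[symmetric])
  finally show ?thesis by (simp add: exp_minus inverse_eq_divide)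
qed

lemma Cm_nonneg: "0 <= q ==> 0 <= Cm TYPE('m::finite) q"
  unfolding Cm_def by (rule infsum_nonneg) simp

context ham begin

text \<open>Division by omega_y keeps degrees, since omega_y is invariant. The sum over C avoids
  degree 0, so it does not see the average and is bounded both by the norm of f / omega_y and by
  that of the off-average part over omega_y. One number thus serves the displacement bound and the
  bound for g.\<close>

lemma coarse_sup:
  assumes f: "holo_on f (P 1)" and a: "tf_expansion DD (ww 1) f a"
    and G: "\<And>mu. gr (P 1) mu (G mu)" "\<And>z. z \<in> P 1 ==> ((\<lambda>mu. G mu z) has_sum f z) UNIV" and hG: "\<And>mu. holo_on (G mu) (P 1)"
    and C: "finite C" "(\<lambda>_. 0) \<notin> C"
  shows "(\<Sum>mu\<in>C. SUP z\<in>P 1. ennreal (cmod (G mu z / omega_y h z))) <= tf_norm DD (ww 1) (\<lambda>z. f z / omega_y h z)" (is "?S <= _")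
    and "(\<Sum>mu\<in>C. SUP z\<in>P 1. ennreal (cmod (G mu z / omega_y h z))) <= tf_norm DD (ww 1) (\<lambda>z. off_average DD (ww 1) f z / omega_y h z)"
proof -
  have g: "gr (P 1) mu (\<lambda>z. G mu z / omega_y h z)" for mu
    using G(1)[of mu] unfolding gr_def hom_def by (simp add: Lam_rot)
  have s: "((\<lambda>mu. G mu z / omega_y h z) has_sum f z / omega_y h z) UNIV" if "z \<in> P 1" for z
    using has_sum_cmult_left[OF G(2)[OF that], of "1 / omega_y h z"] by simp
  show "?S <= tf_norm DD (ww 1) (\<lambda>z. f z / omega_y h z)"
    by (rule coarse_norm[OF zero_less_one holo_divide[OF f holo_omega(1) wy] g s C(1)])
  let ?O = "\<lambda>z. (f z - G (\<lambda>_. 0) z) / omega_y h z" and ?g = "\<lambda>mu z. if mu = (\<lambda>_. 0) then 0 else G mu z / omega_y h z"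
  have "?S = (\<Sum>mu\<in>C. SUP z\<in>P 1. ennreal (cmod (?g mu z)))"
    by (rule sum.cong[OF refl], rule SUP_cong[OF refl]) (use C(2) in auto)
  also have "... <= tf_norm DD (ww 1) ?O"
  proof (rule coarse_norm[OF zero_less_one _ _ _ C(1)])
    show "holo_on ?O (P 1)" by (rule holo_divide[OF holo_diff[OF f hG] holo_omega(1) wy])
    show "gr (P 1) mu (?g mu)" for mu
    proof (cases "mu = (\<lambda>_. 0)")
      case True
      then show ?thesis by (simp add: gr_def hom_def)
    qed (use g[of mu] in simp)
    fix z assume z: "z \<in> P 1"
    have "((\<lambda>mu. if mu = (\<lambda>_. 0) then - (G mu z / omega_y h z) else 0) has_sum - (G (\<lambda>_. 0) z / omega_y h z)) UNIV"
      by (rule has_sum_finite_neutralI[of "{\<lambda>_. 0}"]) auto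
    from has_sum_add[OF s[OF z] this]
    have "((\<lambda>mu. G mu z / omega_y h z + (if mu = (\<lambda>_. 0) then - (G mu z / omega_y h z) else 0)) has_sum ?O z) UNIV"
      by (simp add: diff_divide_distrib)
    moreover have "(\<lambda>mu. G mu z / omega_y h z + (if mu = (\<lambda>_. 0) then - (G mu z / omega_y h z) else 0)) = (\<lambda>mu. ?g mu z)"
      by (rule ext) simp
    ultimately show "((\<lambda>mu. ?g mu z) has_sum ?O z) UNIV" by (simp only:)
  qed
  also have "tf_norm DD (ww 1) ?O = tf_norm DD (ww 1) (\<lambda>z. off_average DD (ww 1) f z / omega_y h z)"
    by (rule tf_norm_cong) (simp add: average_eq(2)[OF a G])
  finally show "?S <= tf_norm DD (ww 1) (\<lambda>z. off_average DD (ww 1) f z / omega_y h z)" .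
qed

text \<open>The number \<beta> is the size over omega_y of the part of f that the first step
  removes; it controls the first generator and hence the remainder M1. Later generators are bounded
  by W times the current remainder. The argument 5/6 of \<open>Cm\<close> is the ratio of 1/3 to
  2/5, and the power of ten in c is a generous margin.\<close>

lemma main:
  assumes n: "N = real n" "1 <= n" and f: "f \<in> Osp DD (ww 1)"
    and F0: "tf_norm DD (ww 1) f = ennreal F0" "0 <= F0" and W: "0 <= W" "\<And>z. z \<in> P 1 ==> cmod (1 / omega_y h z) <= W"
    and c: "10 ^ 8 * (1 + Cm TYPE('b) (5 / 6)) <= c" and small: "c * N * (K / d) * F0 * W <= 1"
  obtains \<Psi> \<Phi> g' f' \<beta> where "0 <= \<beta>" "ennreal \<beta> <= tf_norm DD (ww 1) (\<lambda>z. f z / omega_y h z)"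
    "ennreal \<beta> <= tf_norm DD (ww 1) (\<lambda>z. off_average DD (ww 1) f z / omega_y h z)"
    "flow_composition DD (ww 1) (ww (1 / 3)) \<Psi>"
    "\<And>z. z \<in> P (1 / 3) ==> \<Psi> (\<lambda>z. ham0 h z + f z) z = ham0 h z + g' z + f' z"
    "g' \<in> Nsp DD (ww (1 / 3))" "f' \<in> Osp DD (ww (1 / 3))"
    "tf_norm DD (ww (1 / 3)) (\<lambda>z. g' z - average DD (ww 1) f z) <= ennreal (162 * c * (K / d) * \<beta> * F0)"
    "tf_norm DD (ww (1 / 3)) f' <= ennreal (F0 / 2 ^ (n + 1))"
    "\<And>z. z \<in> P (1 / 3) ==> \<Phi> z \<in> P 1"
    "\<And>z F. z \<in> P (1 / 3) ==> holo_on F (P 1) ==> \<Psi> F z = F (\<Phi> z)"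
    "\<And>z i. z \<in> P (1 / 3) ==> rad (cj i) * cmod (co i (\<Phi> z) - co i z) <= 19 * K * \<beta>"
proof -
  obtain t' where t': "1 < t'" "holo_on f (P t')" "per t' f" using OspE[OF f] by metis
  have hf: "holo_on f (P 1)" "per 1 f"
    using holo_subset[OF t'(2) P_mono] per_mono[OF t'(3)] t'(1) by auto
  obtain a where a: "tf_expansion DD (ww 1) f a" using expansion[OF hf zero_less_one] by metis
  have fin: "tf_norm DD (ww 1) f < \<infinity>" using F0(1) by simp
  have df: "dec 1 f F0" using norm_dec[OF zero_less_one hf fin] F0 by simp
  obtain G B where G: "\<And>mu. holo_on (G mu) (P 1)" "\<And>mu. gr (P 1) mu (G mu)" "\<And>mu z. z \<in> P 1 ==> cmod (G mu z) <= B mu"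
    "\<And>mu. 0 <= B mu" "B summable_on UNIV" "infsum B UNIV <= F0" "\<And>z. z \<in> P 1 ==> ((\<lambda>mu. G mu z) has_sum f z) UNIV"
    using decE[OF df] by metis
  define C where "C = Cut - {\<lambda>_. 0}"
  have C: "finite C" "\<And>mu. mu \<in> C ==> nmu mu <= 3 * N" "(\<lambda>_. 0) \<notin> C" using finite_Cut by (auto simp: C_def Cut_def)
  have C0: "(\<lambda>_. 0) \<in> Cut" using N by (simp add: Cut_def supp_def nmu_def)
  have split: "(\<Sum>mu\<in>Cut. G mu z) = G (\<lambda>_. 0) z + (\<Sum>mu\<in>C. G mu z)" for z
    unfolding C_def by (rule sum.remove[OF finite_Cut C0])
  have Bs: "sum B A <= F0" if "finite A" for A
    using finite_sum_le_infsum[OF G(5) that] G(4,6) by fastforce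
  define sn where "sn mu = enn2real (SUP z\<in>P 1. ennreal (cmod (G mu z / omega_y h z)))" for mu
  have le: "(SUP z\<in>P 1. ennreal (cmod (G mu z / omega_y h z))) <= ennreal (W * B mu)" for mu
  proof (rule SUP_least, rule ennreal_leI)
    fix z assume z: "z \<in> P 1"
    have "cmod (G mu z / omega_y h z) = cmod (1 / omega_y h z) * cmod (G mu z)" by (simp add: norm_divide)
    also have "... <= W * B mu" by (rule mult_mono[OF W(2)[OF z] G(3)[OF z] W(1) norm_ge_zero])
    finally show "cmod (G mu z / omega_y h z) <= W * B mu" .
  qed
  have snE: "ennreal (sn mu) = (SUP z\<in>P 1. ennreal (cmod (G mu z / omega_y h z)))" for mu
    unfolding sn_def using le_less_trans[OF le[of mu] ennreal_less_top] by simp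
  have WB: "0 <= W * B mu" for mu using W(1) G(4) by simp
  have sn: "0 <= sn mu" "sn mu <= W * B mu" for mu
  proof -
    show "0 <= sn mu" by (simp add: sn_def)
    show "sn mu <= W * B mu" using le[of mu] unfolding snE[symmetric] by (simp add: ennreal_le_iff[OF WB])
  qed
  have snz: "cmod (G mu z / omega_y h z) <= sn mu" if z: "z \<in> P 1" for mu z
  proof -
    have "ennreal (cmod (G mu z / omega_y h z)) <= ennreal (sn mu)" unfolding snE by (rule SUP_upper[OF z])
    then show ?thesis by (simp only: ennreal_le_iff[OF sn(1)])
  qed
  define \<beta> where "\<beta> = sum sn C"
  have \<beta>0: "0 <= \<beta>" unfolding \<beta>_def using sn(1) by (intro sum_nonneg)
  have \<beta>W: "\<beta> <= W * F0"
  proof -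
    have "\<beta> <= (\<Sum>mu\<in>C. W * B mu)" unfolding \<beta>_def by (rule sum_mono[OF sn(2)])
    also have "... <= W * F0" using Bs[OF C(1)] W by (simp add: sum_distrib_left[symmetric] mult_left_mono)
    finally show ?thesis .
  qed
  have "ennreal \<beta> = (\<Sum>mu\<in>C. ennreal (sn mu))" unfolding \<beta>_def by (rule sum_ennreal[symmetric]) (rule sn(1))
  also have "... = (\<Sum>mu\<in>C. SUP z\<in>P 1. ennreal (cmod (G mu z / omega_y h z)))" unfolding snE ..
  finally have \<beta>S: "ennreal \<beta> = (\<Sum>mu\<in>C. SUP z\<in>P 1. ennreal (cmod (G mu z / omega_y h z)))" .
  note \<beta>1 = coarse_sup[OF hf(1) a G(2,7,1) C(1,3), folded \<beta>S]

  define \<Gamma> where "\<Gamma> = Cm TYPE('b) (5 / 6)"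
  have \<Gamma>: "0 <= \<Gamma>" unfolding \<Gamma>_def by (rule Cm_nonneg) simp
  \<comment> \<open>\<kappa>1 bounds the first generator, and \<kappa>0 times a remainder bound the
    later ones. M1 is the remainder of \<open>step\<close> for e = 1/5 and A = 0, with 5 * 32 * 5 =
    800.\<close>
  define \<kappa>0 \<kappa>1 M1 where "\<kappa>0 = 4 * exp (3 / 4) * K * W" and "\<kappa>1 = 4 * exp (3 / 4) * K * \<beta>" and "M1 = 800 * \<kappa>1 * F0 / d"
  have N1: "1 <= N" using n by simp
  have pos0: "0 <= \<kappa>0" "0 <= \<kappa>1" "0 <= M1" using K W \<beta>0 F0 d_pos by (simp_all add: \<kappa>0_def \<kappa>1_def M1_def)
  have \<kappa>10: "\<kappa>1 <= \<kappa>0 * F0"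
    using mult_left_mono[OF \<beta>W, of "4 * exp (3 / 4) * K"] K by (simp add: \<kappa>0_def \<kappa>1_def mult_ac)
  have \<kappa>1\<beta>: "\<kappa>1 <= 46 / 5 * (K * \<beta>)"
  proof -
    have "4 * exp (3 / 4) * (K * \<beta>) <= 46 / 5 * (K * \<beta>)"
      using exp_bounds(2) K \<beta>0 by (intro mult_right_mono) auto
    then show ?thesis by (simp add: \<kappa>1_def mult.assoc)
  qed
  \<comment> \<open>N times the size of a generator built from all of f. The hypothesis makes just
    this quantity small against d.\<close>
  define X where "X = N * \<kappa>0 * F0"
  have X: "0 <= X" "(1 + \<Gamma>) * X <= d / 10 ^ 7"
  proof -
    show "0 <= X" using N1 pos0 F0 by (simp add: X_def)
    define Y where "Y = N * (K * (F0 * W))"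
    have Y: "0 <= Y" using N1 K F0 W by (simp add: Y_def)
    have XY: "X <= 46 / 5 * Y"
    proof -
      have "4 * exp (3 / 4) * Y <= 46 / 5 * Y" using exp_bounds(2) Y by (intro mult_right_mono) auto
      then show ?thesis by (simp add: X_def Y_def \<kappa>0_def mult_ac)
    qed
    have "c * Y <= d" using small d_pos by (simp add: Y_def divide_le_eq mult_ac)
    moreover have "10 ^ 8 * (1 + \<Gamma>) * Y <= c * Y" using c Y unfolding \<Gamma>_def by (rule mult_right_mono)
    ultimately have Z1: "10 ^ 8 * (1 + \<Gamma>) * Y <= d" by linarith
    define Z where "Z = (1 + \<Gamma>) * Y"
    have "10 ^ 8 * Z <= d" using Z1 unfolding Z_def by (simp only: mult.assoc)
    moreover have "(1 + \<Gamma>) * X <= (1 + \<Gamma>) * (46 / 5 * Y)" using mult_left_mono[OF XY, of "1 + \<Gamma>"] \<Gamma> by simp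
    then have "(1 + \<Gamma>) * X <= 46 / 5 * Z" unfolding Z_def by (simp only: mult.left_commute)
    moreover have "0 <= Z" unfolding Z_def using \<Gamma> Y by simp
    ultimately show "(1 + \<Gamma>) * X <= d / 10 ^ 7" by simp
  qed
  have X1: "X <= d / 10 ^ 7" using X mult_nonneg_nonneg[OF \<Gamma> X(1)] by (simp add: distrib_right)
  have NK: "N * \<kappa>1 <= X" using mult_left_mono[OF \<kappa>10, of N] N1 by (simp add: X_def mult.assoc)
  have K1X: "\<kappa>1 <= X" using NK mult_right_mono[OF N1 pos0(2)] by simp
  have k1d: "\<kappa>1 <= d / 10 ^ 7" using K1X X1 by simp

  have te: "4 / 5 + 1 / 5 = (1 :: real)" by simp
  have dcut: "dec 1 (\<lambda>z. \<Sum>mu\<in>C. G mu z) F0"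
    by (rule decI[of C G 1 "\<lambda>mu. mu" B "sum B C"]) (use G C(1) Bs in \<open>simp_all add: has_sum_finite\<close>)
  have sm0: "384 * \<kappa>1 <= (1 / 5)\<^sup>2 * d" using k1d d_pos by (simp add: power2_eq_square)
  have snz': "\<And>mu z. mu \<in> C ==> z \<in> P 1 ==> cmod (G mu z / omega_y h z) <= sn mu" by (rule snz)
  obtain \<phi>0 R0 where s0: "fin (4 / 5 + 3 * (1 / 5) / 4) \<phi>0 \<kappa>1" "time_one_flow DD (ww 1) (ww (4 / 5)) \<phi>0"
    "\<And>F z. holo_on F (P 1) ==> z \<in> P (4 / 5) ==> lie_exp \<phi>0 F z = F (Flow \<phi>0 z)"
    "\<And>z. z \<in> P (4 / 5) ==> Flow \<phi>0 z \<in> P 1"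
    "dec (4 / 5) R0 (\<kappa>1 / (1 / 5 * d) * (8 * 0 / (1 / 10) + 32 * F0 / (1 / 5)))"
    "\<And>H z. (\<And>z. z \<in> P 1 ==> H z = ham0 h z + (0 + f z)) ==> z \<in> P (4 / 5) ==>
      lie_exp \<phi>0 H z = ham0 h z + (0 + f z - (\<Sum>mu\<in>C. G mu z)) + R0 z"
  proof (rule step[of "4 / 5" "1 / 5" 1 "\<lambda>_. 0" 0 "1 / 10" f F0 C G sn \<beta> \<kappa>1, unfolded te,
      OF _ _ order_refl dec_zero _ _ df C(1,2) G(1,2) snz' sn(1) _ dcut \<kappa>1_def sm0])
    fix \<phi> R
    assume *: "fin (4 / 5 + 3 * (1 / 5) / 4) \<phi> \<kappa>1" "time_one_flow DD (ww 1) (ww (4 / 5)) \<phi>"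
      "\<And>F z. holo_on F (P 1) ==> z \<in> P (4 / 5) ==> lie_exp \<phi> F z = F (Flow \<phi> z)"
      "\<And>z. z \<in> P (4 / 5) ==> Flow \<phi> z \<in> P 1"
      "dec (4 / 5) R (\<kappa>1 / (1 / 5 * d) * (8 * 0 / (1 / 10) + 32 * F0 / (1 / 5)))"
      "\<And>H z. (\<And>z. z \<in> P 1 ==> H z = ham0 h z + (0 + f z)) ==> z \<in> P (4 / 5) ==>
      lie_exp \<phi> H z = ham0 h z + (0 + f z - (\<Sum>mu\<in>C. G mu z)) + R z"
    show thesis by (rule that[OF *])
  qed (simp_all add: \<beta>_def)
  have dR0: "dec (4 / 5) R0 M1" using s0(5) by (simp add: M1_def mult_ac)

  \<comment> \<open>The average and the tail of f in one function: it keeps its place in the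
    Hamiltonian through all steps and enters the remainders only through brackets.\<close>
  define A0 where "A0 z = f z - (\<Sum>mu\<in>C. G mu z)" for z
  have dA0: "dec 1 A0 F0"
  proof (rule decI[of "- C" G 1 "\<lambda>mu. mu" B "infsum B (- C)"])
    have sC: "B summable_on - C" by (rule summable_on_subset_banach[OF G(5)]) simp
    then show "(B has_sum infsum B (- C)) (- C)" by (rule has_sum_infsum)
    have "infsum B (- C) <= infsum B UNIV" by (rule infsum_mono_neutral[OF sC G(5)]) (use G(4) in auto)
    then show "infsum B (- C) <= F0" using G(6) by simp
    show "((\<lambda>mu. G mu z) has_sum A0 z) (- C)" if z: "z \<in> P 1" for z
      using has_sum_Diff[OF G(7)[OF z] has_sum_finite[OF C(1)]] by (simp add: Compl_eq_Diff_UNIV A0_def)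
  qed (use G in auto)
  define e where "e = 2 / (5 * N)"
  have e: "0 < e" "N * e = 2 / 5" using N1 by (simp_all add: e_def)
  have NM: "N * M1 <= 800 * F0 * (X / d)"
  proof -
    have "N * M1 = 800 * F0 * (N * \<kappa>1 / d)" by (simp add: M1_def)
    also have "... <= 800 * F0 * (X / d)" using NK F0 d_pos by (intro mult_left_mono divide_right_mono) auto
    finally show ?thesis .
  qed
  have Xd: "X / d <= 1 / 10 ^ 7" using X1 d_pos by (simp add: divide_le_eq)
  have Xd0: "0 <= X / d" using X(1) d_pos by simp
  \<comment> \<open>M1 is a multiple of F0 * \<kappa>1 / d, so each of the two factors N is
    compensated by one smallness of X. This is the gain of the first step.\<close>
  have sm1: "384 * (\<kappa>0 * M1) <= e\<^sup>2 * d"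
  proof -
    have "N * \<kappa>0 * (N * M1) <= N * \<kappa>0 * (800 * F0 * (X / d))" using NM N1 pos0 by (intro mult_left_mono) auto
    also have "... = 800 * (X * (X / d))" by (simp add: X_def)
    also have "... <= 800 * (d / 10 ^ 7 * (1 / 10 ^ 7))" using X1 Xd X(1) Xd0 d_pos by (intro mult_left_mono mult_mono) auto
    finally have *: "N\<^sup>2 * (\<kappa>0 * M1) <= 800 * d / 10 ^ 14" by (simp add: power2_eq_square mult_ac)
    have "384 * (\<kappa>0 * M1) * N\<^sup>2 <= 4 / 25 * d" using * d_pos by (simp add: mult_ac)
    then have "384 * (\<kappa>0 * M1) <= 4 / 25 * d / N\<^sup>2" using N1 by (simp add: pos_le_divide_eq)
    also have "... = e\<^sup>2 * d" by (simp add: e_def power2_eq_square)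
    finally show ?thesis .
  qed
  have sm2: "\<kappa>0 / (e * d) * (40 * F0 + 96 * M1 / e) <= 17 / 100"
  proof -
    have ie: "x / e = 5 / 2 * N * x" for x using N1 by (simp add: e_def)
    have "\<kappa>0 / (e * d) * (40 * F0 + 96 * M1 / e) = 5 / 2 * (N * \<kappa>0 / d) * (40 * F0 + 240 * (N * M1))"
      using ie[of "\<kappa>0 / d"] ie[of "96 * M1"] by (simp add: mult_ac)
    also have "... <= 5 / 2 * (N * \<kappa>0 / d) * (40 * F0 + F0)"
    proof (rule mult_left_mono)
      have "800 * F0 * (X / d) <= 800 * F0 * (1 / 10 ^ 7)" using Xd F0 by (intro mult_left_mono) auto
      then show "40 * F0 + 240 * (N * M1) <= 40 * F0 + F0" using NM F0(2) by simp
      show "0 <= 5 / 2 * (N * \<kappa>0 / d)" using N1 pos0 d_pos by simp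
    qed
    also have "... = 205 / 2 * (X / d)" by (simp add: X_def)
    also have "... <= 17 / 100" using Xd by simp
    finally show ?thesis .
  qed
  define H where "H z = ham0 h z + f z" for z
  define \<Psi>0 where "\<Psi>0 = lie_exp \<phi>0 \<circ> id"
  have \<Psi>0: "flow_composition DD (ww 1) (ww (4 / 5)) \<Psi>0"
    unfolding \<Psi>0_def by (rule flow_composition.intros(2)[OF flow_composition.intros(1) _ _ s0(2)]) (rule radii_less_ww; simp)+
  have \<Psi>0H: "\<Psi>0 H z = ham0 h z + (A0 z + R0 z)" if "z \<in> P (4 / 5)" for z
    using s0(6)[of H, OF _ that] by (simp add: \<Psi>0_def H_def A0_def)
  have tn: "2 / 5 = 4 / 5 - real n * e" using e(2) n(1) by simp
  have nN: "real n <= N" using n by simp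
  obtain \<Psi> \<Phi> g fr where it: "flow_composition DD (ww 1) (ww (2 / 5)) \<Psi> \<and>
    (\<forall>z\<in>P (2 / 5). \<Phi> z \<in> P (4 / 5) \<and> (\<forall>F. holo_on F (P 1) \<longrightarrow> \<Psi> F z = \<Psi>0 F (\<Phi> z)) \<and>
      (\<forall>i. rad (cj i) * cmod (co i (\<Phi> z) - co i z) <= 16 * (\<kappa>0 * M1) / e * (1 - 1 / 2 ^ n)) \<and>
      \<Psi> H z = ham0 h z + (A0 z + (g z + fr z))) \<and>
    dec (2 / 5) g (2 * M1 * (1 - 1 / 2 ^ n)) \<and> gr (P (2 / 5)) (\<lambda>_. 0) g \<and> dec (2 / 5) fr (M1 / 2 ^ n)"
    by (atomize_elim, rule iterate[OF e_def dA0 dR0 W \<kappa>0_def sm1 sm2 \<Psi>0 \<Psi>0H nN tn])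
  note mid = bspec[OF conjunct1[OF conjunct2[OF it]]]
  have dg: "dec (2 / 5) g (2 * M1 * (1 - 1 / 2 ^ n))" and gg: "gr (P (2 / 5)) (\<lambda>_. 0) g" and dfr: "dec (2 / 5) fr (M1 / 2 ^ n)"
    using conjunct2[OF conjunct2[OF it]] by blast+
  have sub: "P (1 / 3) \<subseteq> P (2 / 5)" "P (2 / 5) \<subseteq> P 1" "P (1 / 3) \<subseteq> P 1" by (simp_all add: P_mono)
  have i1: "\<Phi> z \<in> P (4 / 5)" "holo_on F (P 1) ==> \<Psi> F z = \<Psi>0 F (\<Phi> z)"
    "rad (cj i) * cmod (co i (\<Phi> z) - co i z) <= 16 * (\<kappa>0 * M1) / e * (1 - 1 / 2 ^ n)"
    "\<Psi> H z = ham0 h z + (A0 z + (g z + fr z))" if z: "z \<in> P (1 / 3)" for z F i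
    using mid[OF subsetD[OF sub(1) z]] by simp_all
  \<comment> \<open>\<open>A0\<close> is split again: its degree-zero component joins g, and the
    tail of f joins the remainder.\<close>
  let ?g' = "\<lambda>z. G (\<lambda>_. 0) z + g z" and ?tail = "\<lambda>z. f z - (\<Sum>mu\<in>Cut. G mu z)"
  let ?f' = "\<lambda>z. ?tail z + fr z"
  have third: "(0 :: real) < 1 / 3" "1 / 3 < (2 / 5 :: real)" "1 / 3 <= (1 :: real)" "1 / 3 / (2 / 5) = (5 / 6 :: real)" by simp_all

  have G0: "dec 1 (G (\<lambda>_. 0)) F0"
  proof (rule decI[of "{\<lambda>_. 0}" G 1 "\<lambda>mu. mu" B "B (\<lambda>_. 0)"])
    show "B (\<lambda>_. 0) <= F0" using Bs[of "{\<lambda>_. 0}"] by simp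
  qed (use G in \<open>auto intro!: has_sum_finiteI\<close>)
  have dg': "dec (2 / 5) ?g' (F0 + 2 * M1 * (1 - 1 / 2 ^ n))"
    by (rule dec_add[OF dec_mono[OF G0 _ order_refl] dg]) simp_all
  have gg': "gr (P (2 / 5)) (\<lambda>_. 0) ?g'"
    using gg gr_subset[OF G(2)[of "\<lambda>_. 0"] sub(2)] unfolding gr_def hom_def by (simp add: distrib_left)
  have g'N: "?g' \<in> Nsp DD (ww (1 / 3))"
    unfolding Nsp_def average_def P_def[symmetric]
  proof (intro CollectI conjI ballI)
    show "?g' \<in> Osp DD (ww (1 / 3))" by (rule dec_Osp[OF dg' third(1,2)])
    show "?g' z = ?g' z - off_average DD (ww (1 / 3)) ?g' z" if z: "z \<in> P (1 / 3)" for z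
      using gr_average[OF holo_subset[OF dec_holo[OF dg'] sub(1)] gr_subset[OF gg' sub(1)] z] by simp
  qed
  have dtail: "dec 1 ?tail F0" using cut_tail[OF G order_refl order_refl] by simp
  have f'O: "?f' \<in> Osp DD (ww (1 / 3))"
    by (rule dec_Osp[OF dec_add[OF dec_mono[OF dtail _ order_refl] dfr] third(1,2)]) simp_all
  have gn: "tf_norm DD (ww (1 / 3)) (\<lambda>z. ?g' z - average DD (ww 1) f z) <= ennreal (162 * c * (K / d) * \<beta> * F0)"
  proof -
    have "tf_norm DD (ww (1 / 3)) (\<lambda>z. ?g' z - average DD (ww 1) f z) = tf_norm DD (ww (1 / 3)) g"
      by (rule tf_norm_cong) (simp add: average_eq(1)[OF a G(2,7) subsetD[OF sub(3)]])
    also have "... <= ennreal (2 * M1 * (1 - 1 / 2 ^ n) * \<Gamma>)"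
      using dec_tf[OF dg third(1,2)] unfolding third(4) \<Gamma>_def by metis
    also have "... <= ennreal (162 * c * (K / d) * \<beta> * F0)"
    proof (rule ennreal_leI)
      have "2 * M1 * (1 - 1 / 2 ^ n) * \<Gamma> <= 2 * M1 * 1 * \<Gamma>" using pos0 \<Gamma> by (intro mult_right_mono mult_left_mono) auto
      also have "... = 1600 * \<Gamma> * (F0 / d) * \<kappa>1" by (simp add: M1_def)
      also have "... <= 1600 * \<Gamma> * (F0 / d) * (46 / 5 * (K * \<beta>))"
      using \<kappa>1\<beta> \<Gamma> F0 d_pos by (intro mult_left_mono) auto
      also have "... = 14720 * \<Gamma> * (F0 / d * (K * \<beta>))" by simp
      also have "... <= 162 * c * (F0 / d * (K * \<beta>))"
      proof (rule mult_right_mono)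
      show "14720 * \<Gamma> <= 162 * c" using c \<Gamma> unfolding \<Gamma>_def[symmetric] by simp
      show "0 <= F0 / d * (K * \<beta>)" using F0 d_pos K \<beta>0 by simp
      qed
      finally show "2 * M1 * (1 - 1 / 2 ^ n) * \<Gamma> <= 162 * c * (K / d) * \<beta> * F0" by (simp add: mult_ac)
    qed
    finally show ?thesis .
  qed
  have fn: "tf_norm DD (ww (1 / 3)) ?f' <= ennreal (F0 / 2 ^ (n + 1))"
  proof -
    have dt3: "dec (1 / 3) ?tail F0" by (rule dec_mono[OF dtail]) simp_all
    have df3: "dec (1 / 3) fr (M1 / 2 ^ n)" by (rule dec_mono[OF dfr]) simp_all
    have "tf_norm DD (ww (1 / 3)) ?f' <= tf_norm DD (ww (1 / 3)) ?tail + tf_norm DD (ww (1 / 3)) fr"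
      by (rule tf_norm_add[OF third(1) dec_holo[OF dt3] dec_per[OF dt3] dec_holo[OF df3] dec_per[OF df3]])
    also have "... <= ennreal (exp (- ((1 - 1 / 3) * (3 * N))) * F0) + ennreal (M1 / 2 ^ n * \<Gamma>)"
    proof (rule add_mono)
      show "tf_norm DD (ww (1 / 3)) ?tail <= ennreal (exp (- ((1 - 1 / 3) * (3 * N))) * F0)"
      by (rule tail_norm[OF hf F0 G(2,7) third(1,3)])
      show "tf_norm DD (ww (1 / 3)) fr <= ennreal (M1 / 2 ^ n * \<Gamma>)"
      using dec_tf[OF dfr third(1,2)] unfolding third(4) \<Gamma>_def by metis
    qed
    also have "... = ennreal (exp (- ((1 - 1 / 3) * (3 * N))) * F0 + M1 / 2 ^ n * \<Gamma>)"
      using F0 pos0 \<Gamma> by (intro ennreal_plus[symmetric]) auto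
    \<comment> \<open>The tail contributes 1/3 and the remainder 1/6 of F0 / 2^n, together one half.
      The 1/3 comes from exp (- 2) <= 1/6 and n >= 1.\<close>
    also have "... <= ennreal (F0 / 2 ^ (n + 1))"
    proof (rule ennreal_leI)
      have "exp (- ((1 - 1 / 3) * (3 * N))) = exp (real n * (- 2))" by (simp add: n(1))
      also have "... = exp (- 2) ^ n" by (rule exp_of_nat_mult)
      also have "... <= (1 / 6) ^ n" using exp_neg_two by (intro power_mono) auto
      also have "... = (1 / 3) ^ n * (1 / 2 ^ n)" by (simp add: power_mult_distrib[symmetric] power_one_over)
      also have "... <= (1 / 3) ^ 1 * (1 / 2 ^ n)" using n(2) by (intro mult_right_mono power_decreasing) auto
      finally have 1: "exp (- ((1 - 1 / 3) * (3 * N))) * F0 <= 1 / 3 * (1 / 2 ^ n) * F0"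
      using F0(2) by (intro mult_right_mono) auto
      have "M1 * \<Gamma> <= F0 / 6"
      proof -
      have "M1 * \<Gamma> = 800 * F0 / d * (\<Gamma> * \<kappa>1)" by (simp add: M1_def)
      also have "... <= 800 * F0 / d * (d / 10 ^ 7)"
      proof (rule mult_left_mono)
      have "\<Gamma> * \<kappa>1 <= \<Gamma> * X" by (rule mult_left_mono[OF K1X \<Gamma>])
      also have "... <= d / 10 ^ 7" using X by (simp add: distrib_right)
      finally show "\<Gamma> * \<kappa>1 <= d / 10 ^ 7" .
      qed (use F0 d_pos in simp)
      also have "... <= F0 / 6" using F0 d_pos by simp
      finally show ?thesis .
      qed
      then have "M1 * \<Gamma> * (1 / 2 ^ n) <= F0 / 6 * (1 / 2 ^ n)" by (rule mult_right_mono) simp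
      then have "exp (- ((1 - 1 / 3) * (3 * N))) * F0 + M1 / 2 ^ n * \<Gamma> <= 1 / 3 * (1 / 2 ^ n) * F0 + F0 / 6 * (1 / 2 ^ n)"
      using 1 by (simp add: mult_ac)
      also have "... = F0 / 2 ^ (n + 1)" by simp
      finally show "exp (- ((1 - 1 / 3) * (3 * N))) * F0 + M1 / 2 ^ n * \<Gamma> <= F0 / 2 ^ (n + 1)" .
    qed
    finally show ?thesis .
  qed
  \<comment> \<open>The width from 2/5 to 1/3 is spent on the comparison of norms, so the last link
    of the composition has generator 0.\<close>
  have fc: "flow_composition DD (ww 1) (ww (1 / 3)) (lie_exp (\<lambda>_. 0) \<circ> \<Psi>)"
    by (rule flow_composition.intros(2)[OF conjunct1[OF it] _ _ trivial_flow(1)[OF third(1,2)]]) (rule radii_less_ww; simp)+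
  have Hz: "(lie_exp (\<lambda>_. 0) \<circ> \<Psi>) (\<lambda>z. ham0 h z + f z) z = ham0 h z + ?g' z + ?f' z" if "z \<in> P (1 / 3)" for z
  proof -
    have "(lie_exp (\<lambda>_. 0) \<circ> \<Psi>) (\<lambda>z. ham0 h z + f z) z = \<Psi> H z"
      by (simp add: trivial_flow(2)[OF third(1,2)] H_def[abs_def])
    also have "... = ham0 h z + (A0 z + (g z + fr z))" by (rule i1(4)[OF that])
    also have "... = ham0 h z + ?g' z + ?f' z" by (simp add: A0_def split)
    finally show ?thesis .
  qed
  have in1: "Flow \<phi>0 (\<Phi> z) \<in> P 1" if "z \<in> P (1 / 3)" for z by (rule s0(4)[OF i1(1)[OF that]])
  have ev: "(lie_exp (\<lambda>_. 0) \<circ> \<Psi>) F z = F (Flow \<phi>0 (\<Phi> z))" if z: "z \<in> P (1 / 3)" and F: "holo_on F (P 1)" for z F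
    using i1(2)[OF z F] s0(3)[OF F i1(1)[OF z]] by (simp add: trivial_flow(2)[OF third(1,2)] \<Psi>0_def)
  \<comment> \<open>The bound of \<open>step\<close> with e = 1/5 would give 40 * \<kappa>1, too
    much. The later steps move z at most into \<open>P (7 / 20)\<close>, far inside the domain 19/20
    of the first generator, and \<open>flow\<close> with intermediate domain 9/25 gives a much
    smaller shift. Both displacements together are at most 2 * \<kappa>1, and 2 * 46/5 < 19.\<close>
  have disp: "rad (cj i) * cmod (co i (Flow \<phi>0 (\<Phi> z)) - co i z) <= 19 * K * \<beta>" if z: "z \<in> P (1 / 3)" for z i
  proof -
    have D1: "rad (cj i) * cmod (co i (\<Phi> z) - co i z) <= 32 / 10 ^ 4 * \<kappa>1" for i
    proof -
      have "16 * (\<kappa>0 * M1) / e * (1 - 1 / 2 ^ n) <= 16 * (\<kappa>0 * M1) / e * 1"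
      using pos0 e by (intro mult_left_mono) auto
      also have "... = 32000 * (X / d) * \<kappa>1" using N1 by (simp add: e_def M1_def X_def)
      also have "... <= 32000 * (1 / 10 ^ 7) * \<kappa>1" using Xd pos0 by (intro mult_right_mono mult_left_mono) auto
      finally show ?thesis using i1(3)[OF z, of i] by simp
    qed
    have "\<Phi> z \<in> polyd rad z (1 / 60)"
      unfolding polyd_def
    proof (intro CollectI allI)
      fix i
      have "rad (cj i) * cmod (co i (\<Phi> z) - co i z) <= 32 / 10 ^ 4 * (d / 10 ^ 7)" using D1[of i] k1d by simp
      also have "... < 1 / 60 * d" using d_pos by simp
      also have "... <= 1 / 60 * (rad i * rad (cj i))" using d_le[of i] by simp
      finally have "rad (cj i) * cmod (co i (\<Phi> z) - co i z) < rad (cj i) * (1 / 60 * rad i)" by (simp add: mult_ac)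
      then show "cmod (co i (\<Phi> z) - co i z) < 1 / 60 * rad i" using rad[of "cj i"] by (simp only: mult_less_cancel_left_pos)
    qed
    then have y: "\<Phi> z \<in> P (7 / 20)" using polyd_P[OF z, of "1 / 60"] by auto
    have f0: "fin (19 / 20) \<phi>0 \<kappa>1" using s0(1) by simp
    have b0: "\<And>w. w \<in> P (19 / 20) ==> cmod (\<phi>0 w) <= \<kappa>1" by (rule dec_bound[OF fin_dec[OF f0]])
    have "cmod (co i (Flow \<phi>0 (\<Phi> z)) - co i (\<Phi> z)) <=
      \<kappa>1 / ((19 / 20 - 9 / 25) * rad (cj i)) / (1 - 6 * \<kappa>1 / ((19 / 20 - 9 / 25) * (9 / 25 - 7 / 20) * d))"
      by (rule flow(1)[OF fin_holo[OF f0] b0 _ _ _ y]) (use k1d d_pos in simp_all)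
    also have "... <= \<kappa>1 / ((19 / 20 - 9 / 25) * rad (cj i)) / (99 / 100)"
    proof (rule divide_left_mono)
      have "6 * \<kappa>1 / ((19 / 20 - 9 / 25) * (9 / 25 - 7 / 20) * d) <= 1 / 100" using k1d d_pos by (simp add: divide_le_eq)
      then show *: "99 / 100 <= 1 - 6 * \<kappa>1 / ((19 / 20 - 9 / 25) * (9 / 25 - 7 / 20) * d)" by simp
      show "0 < (1 - 6 * \<kappa>1 / ((19 / 20 - 9 / 25) * (9 / 25 - 7 / 20) * d)) * (99 / 100)"
      by (rule mult_pos_pos[OF less_le_trans[OF _ *]]) simp_all
      show "0 <= \<kappa>1 / ((19 / 20 - 9 / 25) * rad (cj i))" using pos0 rad[of "cj i"] by simp
    qed
    also have "... = 10000 / 5841 * \<kappa>1 / rad (cj i)" by simp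
    finally have "cmod (co i (Flow \<phi>0 (\<Phi> z)) - co i (\<Phi> z)) * rad (cj i) <= 10000 / 5841 * \<kappa>1"
      using rad[of "cj i"] by (simp only: pos_le_divide_eq)
    moreover have "cmod (co i (Flow \<phi>0 (\<Phi> z)) - co i z) <= cmod (co i (Flow \<phi>0 (\<Phi> z)) - co i (\<Phi> z)) + cmod (co i (\<Phi> z) - co i z)"
      using norm_triangle_ineq[of "co i (Flow \<phi>0 (\<Phi> z)) - co i (\<Phi> z)" "co i (\<Phi> z) - co i z"] by simp
    then have "rad (cj i) * cmod (co i (Flow \<phi>0 (\<Phi> z)) - co i z) <=
      cmod (co i (Flow \<phi>0 (\<Phi> z)) - co i (\<Phi> z)) * rad (cj i) + rad (cj i) * cmod (co i (\<Phi> z) - co i z)"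
      using mult_left_mono[of _ _ "rad (cj i)"] rad[of "cj i"] by (simp add: distrib_left[symmetric] mult.commute)
    ultimately have "rad (cj i) * cmod (co i (Flow \<phi>0 (\<Phi> z)) - co i z) <= 10000 / 5841 * \<kappa>1 + 32 / 10 ^ 4 * \<kappa>1"
      using D1[of i] by linarith
    also have "... <= 2 * \<kappa>1" using pos0 by simp
    also have "... <= 19 * K * \<beta>"
    proof -
      have "0 <= K * \<beta>" using K \<beta>0 by simp
      then have "2 * \<kappa>1 <= 19 * (K * \<beta>)" using \<kappa>1\<beta> by linarith
      then show ?thesis by (simp only: mult.assoc)
    qed
    finally show ?thesis .
  qed
  show thesis by (rule that[OF \<beta>0 \<beta>1 fc Hz g'N f'O gn fn in1 ev disp])
qed

end

section \<open>Displacements in the maximum norm, and the degenerate cases\<close>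

lemma vmax_attained: obtains i where "vmax (v :: complex ^ 'n::finite) = cmod (v $ i)"
proof -
  have "vmax v \<in> range (\<lambda>i. cmod (v $ i))" unfolding vmax_def by (rule Max_in) auto
  then show ?thesis using that by blast
qed

lemma vmax_nonneg: "0 <= vmax v"
  by (rule vmax_attained[of v]) simp

lemma vmax_scaled_le: "(\<And>i. a * cmod (v $ i) <= b) ==> a * vmax v <= b"
  by (rule vmax_attained[of v]) simp

lemma Max_scaled_le:
  fixes d :: real
  assumes d: "d <= \<rho> * s" "d <= r * \<xi>" "d <= \<delta>\<^sup>2" and pos: "0 < \<rho>" "0 < s" "0 < \<delta>" "0 < r" "0 < \<xi>"
    and a: "0 <= a1" "0 <= a2" "0 <= a3" "0 <= a4" "0 <= a5" "0 <= a6"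
  shows "d * Max {a1 / \<rho>, a2 / s, a3 / \<delta>, a4 / \<delta>, a5 / r, a6 / \<xi>} <=
    Max {s * a1, \<rho> * a2, \<delta> * a3, \<delta> * a4, \<xi> * a5, r * a6}"
proof -
  let ?A = "{a1 / \<rho>, a2 / s, a3 / \<delta>, a4 / \<delta>, a5 / r, a6 / \<xi>}" and ?B = "{s * a1, \<rho> * a2, \<delta> * a3, \<delta> * a4, \<xi> * a5, r * a6}"
  have *: "d * (x / y) <= z * x" if "d <= z * y" "0 < y" "0 <= x" for x y z :: real
    using mult_right_mono[OF that(1,3)] that(2) by (simp add: pos_divide_le_eq mult_ac)
  have b: "d * (a1 / \<rho>) <= s * a1" "d * (a2 / s) <= \<rho> * a2" "d * (a3 / \<delta>) <= \<delta> * a3" "d * (a4 / \<delta>) <= \<delta> * a4"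
    "d * (a5 / r) <= \<xi> * a5" "d * (a6 / \<xi>) <= r * a6"
    by (rule *; use d pos a in \<open>simp add: mult.commute power2_eq_square\<close>)+
  have u: "s * a1 <= Max ?B" "\<rho> * a2 <= Max ?B" "\<delta> * a3 <= Max ?B" "\<delta> * a4 <= Max ?B" "\<xi> * a5 <= Max ?B" "r * a6 <= Max ?B"
    by (rule Max_ge; simp)+
  have "\<forall>x\<in>?A. d * x <= Max ?B"
    by (simp only: ball_simps simp_thms order_trans[OF b(1) u(1)] order_trans[OF b(2) u(2)] order_trans[OF b(3) u(3)]
      order_trans[OF b(4) u(4)] order_trans[OF b(5) u(5)] order_trans[OF b(6) u(6)])
  moreover have "Max ?A \<in> ?A" by (rule Max_in) auto
  ultimately show ?thesis by (rule bspec)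
qed

context dom begin

lemma tf_norm_zero: "0 < t ==> tf_norm DD (ww t) (\<lambda>_. 0) = 0"
  using dec_tf[OF dec_zero[of "t + 1"], of t] by (metis ennreal_0 le_zero_eq less_add_one mult_zero_left)

lemma norm_zero:
  assumes "0 < t" "holo_on F (P t)" "per t F" "tf_norm DD (ww t) F = 0" "z \<in> P t" shows "F z = 0"
  using dec_bound[OF norm_dec[OF assms(1-3)] assms(5)] assms(4) by simp

lemma vmax_displacement:
  assumes "\<And>i. rad (cj i) * cmod (co i (I, \<theta>, p, q, y, x) - co i (I', \<theta>', p', q', y', x')) <= M"
  shows "Max {s * vmax (I - I'), \<rho> * vmax (\<theta> - \<theta>'), \<delta> * vmax (p - p'), \<delta> * vmax (q - q'), \<xi> * cmod (y - y'), r * cmod (x - x')} <= M"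
proof -
  have "s * vmax (I - I') <= M" by (rule vmax_scaled_le) (use assms[of "CI _"] in simp)
  moreover have "\<rho> * vmax (\<theta> - \<theta>') <= M" by (rule vmax_scaled_le) (use assms[of "CT _"] in simp)
  moreover have "\<delta> * vmax (p - p') <= M" by (rule vmax_scaled_le) (use assms[of "CP _"] in simp)
  moreover have "\<delta> * vmax (q - q') <= M" by (rule vmax_scaled_le) (use assms[of "CQ _"] in simp)
  moreover have "\<xi> * cmod (y - y') <= M" "r * cmod (x - x') <= M" using assms[of CY] assms[of CX] by simp_all
  ultimately show ?thesis by (intro Max.boundedI) auto
qed

end

lemma (in ham_dom) inverse_omega:
  "holo_on (\<lambda>z. 1 / omega_y h z) (P 1)" "gr (P 1) (\<lambda>_. 0) (\<lambda>z. 1 / omega_y h z)" "per 1 (\<lambda>z. 1 / omega_y h z)"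
proof -
  show "holo_on (\<lambda>z. 1 / omega_y h z) (P 1)" by (rule holo_divide[OF holo_const holo_omega(1) wy])
  show g: "gr (P 1) (\<lambda>_. 0) (\<lambda>z. 1 / omega_y h z)" unfolding gr_def hom_def by (simp add: Lam_rot)
  show "per 1 (\<lambda>z. 1 / omega_y h z)" by (rule gr_per[OF g])
qed

theorem theorem4p1:
  "\<exists>c::real. c \<ge> 1 \<and>
    (\<forall>(II :: (real ^ 'n::finite) set) (BB :: ((real ^ 'm::finite) \<times> (real ^ 'm)) set)
       (YY :: real set) (XX :: real set) (\<rho>::real) (s::real) (\<delta>::real) (r::real) (\<xi>::real)
       (h :: complex ^ 'n \<Rightarrow> complex ^ 'm \<Rightarrow> complex \<Rightarrow> complex) (f :: ('n, 'm) func) (N::nat)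
       D w w3 d \<X>.
       open II \<longrightarrow> connected II \<longrightarrow> open BB \<longrightarrow> connected BB \<longrightarrow> (0, 0) \<in> BB \<longrightarrow>
       open YY \<longrightarrow> connected YY \<longrightarrow> open XX \<longrightarrow> connected XX \<longrightarrow>
       \<rho> > 0 \<longrightarrow> s > 0 \<longrightarrow> \<delta> > 0 \<longrightarrow> r > 0 \<longrightarrow> \<xi> > 0 \<longrightarrow> N \<ge> 1 \<longrightarrow>
       D = (II, BB, YY, XX) \<longrightarrow>
       w = (\<rho>, s, \<delta>, r, \<xi>) \<longrightarrow>
       w3 = (\<rho> / 3, s / 3, \<delta> / 3, r / 3, \<xi> / 3) \<longrightarrow>
       d = min (\<rho> * s) (min (r * \<xi>) (\<delta>\<^sup>2)) \<longrightarrow>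
       \<X> = (SUP x\<in>nbhd_line XX \<xi>. ennreal (cmod x)) \<longrightarrow>
       holo_on (\<lambda>z. ham0 h z + f z) (PP D w) \<longrightarrow>
       f \<in> Osp D w \<longrightarrow>
       (\<forall>z\<in>PP D w. omega_y h z \<noteq> 0) \<longrightarrow>
       4 * of_nat N * \<X> * sup_norm (PP D w) (\<lambda>z i. Im (omega_I h z i / omega_y h z)) < ennreal s \<longrightarrow>
       4 * of_nat N * \<X> * sup_norm (PP D w) (\<lambda>z i. omega_J h z i / omega_y h z) < 1 \<longrightarrow>
       ennreal c * of_nat N * (\<X> / ennreal d) * tf_norm D w f *
         tf_norm D w (\<lambda>z. 1 / omega_y h z) < 1 \<longrightarrow>
       (\<exists>\<Psi> \<Phi> g' f'.
          (\<forall>F\<in>Osp D w. \<Psi> F \<in> Osp D w3) \<and>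
          (\<forall>z\<in>PP D w3. \<Psi> (\<lambda>z. ham0 h z + f z) z = ham0 h z + g' z + f' z) \<and>
          g' \<in> Nsp D w3 \<and> f' \<in> Osp D w3 \<and>
          tf_norm D w3 (\<lambda>z. g' z - average D w f z)
            \<le> 162 * ennreal c * (\<X> / ennreal d) *
               tf_norm D w (\<lambda>z. off_average D w f z / omega_y h z) * tf_norm D w f \<and>
          tf_norm D w3 f' \<le> ennreal (1 / 2 ^ (N + 1)) * tf_norm D w f \<and>
          flow_composition D w w3 \<Psi> \<and>
          (\<forall>z\<in>PP D w3. \<Phi> z \<in> PP D w \<and> (\<forall>F. holo_on F (PP D w) \<longrightarrow> \<Psi> F z = F (\<Phi> z))) \<and>
          (\<forall>I' \<theta>' p' q' y' x' I \<theta> p q y x.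
             (I', \<theta>', p', q', y', x') \<in> PP D w3 \<longrightarrow>
             (I, \<theta>, p, q, y, x) = \<Phi> (I', \<theta>', p', q', y', x') \<longrightarrow>
             d * Max {vmax (I - I') / \<rho>, vmax (\<theta> - \<theta>') / s, vmax (p - p') / \<delta>,
                      vmax (q - q') / \<delta>, cmod (y - y') / r, cmod (x - x') / \<xi>}
               \<le> Max {s * vmax (I - I'), \<rho> * vmax (\<theta> - \<theta>'), \<delta> * vmax (p - p'),
                      \<delta> * vmax (q - q'), \<xi> * cmod (y - y'), r * cmod (x - x')} \<and>
             ennreal (Max {s * vmax (I - I'), \<rho> * vmax (\<theta> - \<theta>'), \<delta> * vmax (p - p'),
                      \<delta> * vmax (q - q'), \<xi> * cmod (y - y'), r * cmod (x - x')})
               \<le> 19 * \<X> * tf_norm D w (\<lambda>z. f z / omega_y h z))))"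
proof -
  \<comment> \<open>The constant depends on m through the sum \<open>Cm\<close> over multi-indices
    of p; the angles contribute nothing, because a degree determines its Fourier index.\<close>
  define c where "c = 10 ^ 8 * (1 + Cm TYPE('m) (5 / 6))"
  have c1: "1 <= c" using Cm_nonneg[of "5 / 6", where ?'m = 'm] by (simp add: c_def)
  show ?thesis
  proof (rule exI[of _ c], intro conjI allI impI, goal_cases)
    case 1
    show ?case by (rule c1)
  next
    case (2 II BB YY XX \<rho> s \<delta> r \<xi> h f N D w w3 d \<X>)
    note BB = 2(5) and XX = 2(8,9) and pos = 2(10-14) and N = 2(15) and Dw = 2(16-18) and d = 2(19) and \<X> = 2(20) and H = 2(21)
      and f = 2(22) and wy = 2(23) and sI = 2(24) and sJ = 2(25) and sf = 2(26)
    interpret dm: dom II BB YY XX \<rho> s \<delta> r \<xi> by unfold_locales (use pos BB in simp_all)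
    have ww: "dm.ww 1 = w" "dm.ww (1 / 3) = w3" by (simp_all add: dm.ww_def Dw)
    have PP: "dm.P 1 = PP D w" "dm.P (1 / 3) = PP D w3" unfolding dm.P_def ww Dw(1) by simp_all
    note wD = ww Dw(1)[symmetric]
    have dd: "dm.d = d" by (simp add: dm.d_def d)
    have d0: "0 < d" using dm.d_pos dd by simp
    have max1: "d * Max {vmax (I - I') / \<rho>, vmax (\<theta> - \<theta>') / s, vmax (p - p') / \<delta>,
      vmax (q - q') / \<delta>, cmod (y - y') / r, cmod (x - x') / \<xi>}
      <= Max {s * vmax (I - I'), \<rho> * vmax (\<theta> - \<theta>'), \<delta> * vmax (p - p'),
      \<delta> * vmax (q - q'), \<xi> * cmod (y - y'), r * cmod (x - x')}"
      for I I' \<theta> \<theta>' :: "complex ^ 'n" and p p' q q' :: "complex ^ 'm" and y y' x x'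
      by (rule Max_scaled_le) (use pos vmax_nonneg in \<open>simp_all add: d\<close>)
    have f1: "f \<in> Osp dm.DD (dm.ww 1)" using f by (simp add: wD)
    obtain t' where t': "1 < t'" "holo_on f (dm.P t')" "dm.per t' f" "tf_norm dm.DD (dm.ww 1) f < \<infinity>" using dm.OspE[OF f1] by metis
    have hf: "holo_on f (dm.P 1)" "dm.per 1 f"
      using holo_subset[OF t'(2) dm.P_mono] dm.per_mono[OF t'(3)] t'(1) by auto
    have sub: "dm.P (1 / 3) \<subseteq> dm.P 1" by (rule dm.P_mono) simp
    show ?case
    \<comment> \<open>Norms take values in [0, \<infinity>] with 0 * \<infinity> = 0, so for f = 0
      the smallness hypothesis does not make \<X> and the norm of 1 / omega_y finite. In that case
      the identity does; empty base sets are covered as well.\<close>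
    proof (cases "\<forall>z\<in>dm.P 1. f z = 0")
      case True
      let ?\<Psi> = "lie_exp (\<lambda>_. 0) \<circ> id :: ('n, 'm) func => ('n, 'm) func"
      have lt: "(0 :: real) < 1 / 3" "1 / 3 < (1 :: real)" by simp_all
      have \<Psi>: "?\<Psi> F = F" for F :: "('n, 'm) func" using dm.trivial_flow(2)[OF lt, of F] by simp
      have fc: "flow_composition D w w3 ?\<Psi>"
      using flow_composition.intros(2)[OF flow_composition.intros(1)[of dm.DD "dm.ww 1"] dm.radii_less_ww(2)[OF lt(1)]
      dm.radii_less_ww(1)[OF lt] dm.trivial_flow(1)[OF lt]] by (simp only: wD)
      have zO: "(\<lambda>_. 0) \<in> Osp D w3" using dm.dec_Osp[OF dm.dec_zero lt] by (simp only: wD)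
      have zN: "(\<lambda>_. 0) \<in> Nsp D w3"
      unfolding Nsp_def average_def
      proof (intro CollectI conjI ballI zO)
      fix z assume "z \<in> PP D w3"
      then have "off_average D w3 (\<lambda>_. 0) z = 0"
      using dm.gr_average[where t = "1 / 3" and z = z and G = "\<lambda>_. 0", OF holo_const dm.gr_zero] by (simp only: wD PP)
      then show "0 = 0 - off_average D w3 (\<lambda>_. 0) z" by simp
      qed
      obtain a where a: "tf_expansion dm.DD (dm.ww 1) f a" using dm.expansion[OF hf zero_less_one] by metis
      have "average D w f z = 0" if "z \<in> dm.P 1" for z
      using dm.average_eq(1)[OF a, where G = "\<lambda>_ _. 0", OF dm.gr_zero _ that] True unfolding wD by (simp add: has_sum_0)
      then have "tf_norm D w3 (\<lambda>z. 0 - average D w f z) = tf_norm D w3 (\<lambda>_. 0)"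
      using dm.tf_norm_cong[of "1 / 3" "\<lambda>z. 0 - average D w f z" "\<lambda>_. 0"] sub unfolding wD by fastforce
      moreover have z3: "tf_norm D w3 (\<lambda>_. 0) = 0" using dm.tf_norm_zero[OF lt(1)] unfolding wD .
      ultimately have an: "tf_norm D w3 (\<lambda>z. 0 - average D w f z) = 0" by simp
      show ?thesis
      proof (rule exI[of _ ?\<Psi>], rule exI[of _ "\<lambda>z. z"], rule exI[of _ "\<lambda>_. 0"], rule exI[of _ "\<lambda>_. 0"], intro conjI ballI allI impI)
      show "?\<Psi> F \<in> Osp D w3" if "F \<in> Osp D w" for F by (rule flow_composition_Osp[OF fc that])
      show "?\<Psi> (\<lambda>z. ham0 h z + f z) z = ham0 h z + 0 + 0" if z: "z \<in> PP D w3" for z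
      proof -
      have "f z = 0" using True z sub unfolding PP by blast
      then show ?thesis unfolding \<Psi> by simp
      qed
      show "z \<in> PP D w" if "z \<in> PP D w3" for z using that sub unfolding PP by blast
      show "?\<Psi> F z = F z" for F z unfolding \<Psi> ..
      fix I' \<theta>' I \<theta> :: "complex ^ 'n" and p' q' p q :: "complex ^ 'm" and y' x' y x :: complex
      assume "(I, \<theta>, p, q, y, x) = (I', \<theta>', p', q', y', x')"
      then have "Max {s * vmax (I - I'), \<rho> * vmax (\<theta> - \<theta>'), \<delta> * vmax (p - p'), \<delta> * vmax (q - q'), \<xi> * cmod (y - y'), r * cmod (x - x')} <= 0"
      by (intro dm.vmax_displacement) simp
      then show "ennreal (Max {s * vmax (I - I'), \<rho> * vmax (\<theta> - \<theta>'), \<delta> * vmax (p - p'), \<delta> * vmax (q - q'), \<xi> * cmod (y - y'), r * cmod (x - x')})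
      <= 19 * \<X> * tf_norm D w (\<lambda>z. f z / omega_y h z)" by (simp add: ennreal_neg)
      qed (simp_all only: zN zO fc an z3 max1 zero_le)
    next
      case False
      then obtain z0 where z0: "z0 \<in> dm.P 1" "f z0 \<noteq> 0" by blast
      interpret hd: ham_dom II BB YY XX \<rho> s \<delta> r \<xi> h
      proof unfold_locales
      have "holo_on (\<lambda>z. (ham0 h z + f z) - f z) (dm.P 1)" by (rule holo_diff) (use H hf in \<open>simp_all add: PP\<close>)
      then show "holo_on (ham0 h) (dm.P 1)" by simp
      show "omega_y h z \<noteq> 0" if "z \<in> dm.P 1" for z using wy that PP by simp
      qed
      have XXne: "XX \<noteq> {}" using z0(1) unfolding dm.P_iff by blast
      let ?F = "tf_norm D w f" and ?W = "tf_norm D w (\<lambda>z. 1 / omega_y h z)"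
      have Fn: "?F \<noteq> 0" "?F \<noteq> top"
      using dm.norm_zero[OF zero_less_one hf _ z0(1)] z0(2) t'(4) unfolding wD by auto
      have Wn: "?W \<noteq> 0"
      using dm.norm_zero[OF zero_less_one hd.inverse_omega(1,3) _ z0(1)] hd.wy[OF z0(1)] unfolding wD by auto
      have X0: "\<X> \<noteq> 0"
      proof
      assume "\<X> = 0"
      then have z: "x = 0" if "x \<in> nbhd_line XX \<xi>" for x
      using SUP_upper[OF that, of "\<lambda>x. ennreal (cmod x)"] unfolding \<X>[symmetric] by (simp add: ennreal_eq_0_iff)
      obtain x where x: "x \<in> XX" using XXne by blast
      have "complex_of_real x \<in> nbhd_line XX \<xi>" "complex_of_real x + of_real (\<xi> / 2) \<in> nbhd_line XX \<xi>"
      using x pos by (auto simp: nbhd_line_def intro!: bexI[of _ x])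
      then have "complex_of_real x = 0" "complex_of_real x + of_real (\<xi> / 2) = 0" using z by blast+
      then show False using pos by simp
      qed
      \<comment> \<open>All factors of the smallness product are nonzero, so the finite product
        forces each of them to be finite.\<close>
      have Xt: "\<X> \<noteq> top" and Wt: "?W \<noteq> top"
      proof -
      have "ennreal c * of_nat N * (\<X> / ennreal d) * ?F * ?W < top" using sf by (rule less_trans) simp
      then have t: "ennreal c * of_nat N * (\<X> / ennreal d) * ?F * ?W \<noteq> top" by (simp only: less_top)
      have "ennreal c \<noteq> 0" "(of_nat N :: ennreal) \<noteq> 0" "ennreal d \<noteq> top" "ennreal d \<noteq> 0" using c1 N d0 by auto
      moreover have "\<X> / ennreal d \<noteq> 0" using X0 by (simp add: ennreal_divide_eq_0_iff)
      ultimately show "\<X> \<noteq> top" "?W \<noteq> top"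
      using t Fn(1) Wn by (auto simp: ennreal_mult_eq_top_iff ennreal_divide_eq_top_iff)
      qed
      define K F0 W where "K = enn2real \<X>" and "F0 = enn2real ?F" and "W = enn2real ?W"
      have e: "\<X> = ennreal K" "?F = ennreal F0" "?W = ennreal W" and nn: "0 <= K" "0 <= F0" "0 <= W"
      using Xt Wt Fn by (simp_all add: K_def F0_def W_def less_top)
      have Kb: "cmod x <= K" if "x \<in> nbhd_line XX \<xi>" for x
      using SUP_upper[OF that, of "\<lambda>x. ennreal (cmod x)"] unfolding \<X>[symmetric] e by (simp add: nn)
      obtain x0 where x0: "x0 \<in> XX" "\<And>c. c \<in> XX ==> \<bar>c - x0\<bar> + \<xi> <= K"
      using centre_exists[OF XX XXne pos(5) Kb] by metis
      have nat: "of_nat N = ennreal (real N)" by (simp add: ennreal_of_nat_eq_real_of_nat)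
      have Kd: "ennreal K / ennreal d = ennreal (K / d)" "0 <= K / d" using nn(1) d0 by (simp_all add: divide_ennreal)
      have c0: "0 <= c" using c1 by simp
      have sup: "4 * real N * K * norm (u z i) <= b"
      if u: "4 * of_nat N * \<X> * sup_norm (PP D w) u < ennreal b" "0 <= b" and z: "z \<in> dm.P 1"
      for u :: "('n, 'm) phase => 'l => 'k::real_normed_vector" and z i b
      proof -
      have "ennreal (norm (u z i)) <= sup_norm (PP D w) u"
      unfolding sup_norm_def by (rule SUP_upper2[OF z[unfolded PP]], rule SUP_upper) simp
      then have "4 * of_nat N * \<X> * ennreal (norm (u z i)) <= ennreal b"
      using u(1) by (meson mult_left_mono less_imp_le order_trans zero_le)
      moreover have "4 * of_nat N * \<X> * ennreal (norm (u z i)) = ennreal (4 * real N * K * norm (u z i))"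
      unfolding nat e using nn by (simp add: ennreal_mult' ennreal_mult'')
      ultimately show ?thesis using u(2) by simp
      qed
      interpret hm: ham II BB YY XX \<rho> s \<delta> r \<xi> h K "real N" x0
      proof unfold_locales
      show "0 < real N" using N by simp
      show "4 * real N * K * \<bar>Im (omega_I h z i / omega_y h z)\<bar> <= s" if "z \<in> dm.P 1" for z i
      using sup[OF sI _ that, of i] pos by simp
      show "4 * real N * K * cmod (omega_J h z i / omega_y h z) <= 1" if "z \<in> dm.P 1" for z i
      using sup[of "\<lambda>z i. omega_J h z i / omega_y h z" 1, OF _ _ that, of i] sJ by simp
      qed (use XX x0 in simp_all)
      have Wb: "cmod (1 / omega_y h z) <= W" if "z \<in> dm.P 1" for z
      using dm.dec_bound[OF dm.norm_dec[OF zero_less_one hd.inverse_omega(1,3)] that] Wt unfolding wD by (simp add: W_def less_top)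
      have small: "c * real N * (K / dm.d) * F0 * W <= 1"
      proof -
      have "ennreal c * of_nat N * (\<X> / ennreal d) * ?F * ?W = ennreal (c * real N * (K / d) * F0 * W)"
      unfolding nat e Kd(1) by (simp only: ennreal_mult mult_nonneg_nonneg c0 Kd(2) nn of_nat_0_le_iff)
      then show ?thesis using sf by (simp add: dd)
      qed
      have F0': "tf_norm dm.DD (dm.ww 1) f = ennreal F0" using e(2) unfolding wD .
      obtain \<Psi> \<Phi> g' f' \<beta> where m: "0 <= \<beta>" "ennreal \<beta> <= tf_norm D w (\<lambda>z. f z / omega_y h z)"
      "ennreal \<beta> <= tf_norm D w (\<lambda>z. off_average D w f z / omega_y h z)" "flow_composition D w w3 \<Psi>"
      "\<And>z. z \<in> PP D w3 ==> \<Psi> (\<lambda>z. ham0 h z + f z) z = ham0 h z + g' z + f' z"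
      "g' \<in> Nsp D w3" "f' \<in> Osp D w3"
      "tf_norm D w3 (\<lambda>z. g' z - average D w f z) <= ennreal (162 * c * (K / d) * \<beta> * F0)"
      "tf_norm D w3 f' <= ennreal (F0 / 2 ^ (N + 1))"
      "\<And>z. z \<in> PP D w3 ==> \<Phi> z \<in> PP D w"
      "\<And>z F. z \<in> PP D w3 ==> holo_on F (PP D w) ==> \<Psi> F z = F (\<Phi> z)"
      "\<And>z i. z \<in> PP D w3 ==> dm.rad (cj i) * cmod (co i (\<Phi> z) - co i z) <= 19 * K * \<beta>"
      by (rule hm.main[OF refl N f1 F0' nn(2,3) Wb eq_refl[OF c_def[symmetric]] small, unfolded wD PP dd]) (assumption, rule that)
      show ?thesis
      proof (rule exI[of _ \<Psi>], rule exI[of _ \<Phi>], rule exI[of _ g'], rule exI[of _ f'], intro conjI ballI allI impI m max1)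
      show "\<Psi> F \<in> Osp D w3" if "F \<in> Osp D w" for F by (rule flow_composition_Osp[OF m(4) that])
      have "ennreal (162 * c * (K / d) * \<beta> * F0) = 162 * ennreal c * (\<X> / ennreal d) * ennreal \<beta> * ?F"
      unfolding e Kd(1) by (simp only: ennreal_mult mult_nonneg_nonneg c0 Kd(2) nn m(1) ennreal_numeral zero_le_numeral)
      also have "... <= 162 * ennreal c * (\<X> / ennreal d) * tf_norm D w (\<lambda>z. off_average D w f z / omega_y h z) * ?F"
      by (intro mult_right_mono mult_left_mono m(3)) simp_all
      finally show "tf_norm D w3 (\<lambda>z. g' z - average D w f z) <= 162 * ennreal c * (\<X> / ennreal d) *
      tf_norm D w (\<lambda>z. off_average D w f z / omega_y h z) * ?F" using m(8) by (rule order_trans[rotated])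
      have "ennreal (F0 / 2 ^ (N + 1)) = ennreal (1 / 2 ^ (N + 1)) * ?F"
      unfolding e using nn by (simp add: ennreal_mult''[symmetric])
      then show "tf_norm D w3 f' <= ennreal (1 / 2 ^ (N + 1)) * ?F" using m(9) by simp
      fix I' \<theta>' I \<theta> :: "complex ^ 'n" and p' q' p q :: "complex ^ 'm" and y' x' y x :: complex
      assume z: "(I', \<theta>', p', q', y', x') \<in> PP D w3" and \<Phi>: "(I, \<theta>, p, q, y, x) = \<Phi> (I', \<theta>', p', q', y', x')"
      have "Max {s * vmax (I - I'), \<rho> * vmax (\<theta> - \<theta>'), \<delta> * vmax (p - p'), \<delta> * vmax (q - q'), \<xi> * cmod (y - y'), r * cmod (x - x')} <= 19 * K * \<beta>"
      by (rule dm.vmax_displacement) (unfold \<Phi>, rule m(12)[OF z])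
      then have "ennreal (Max {s * vmax (I - I'), \<rho> * vmax (\<theta> - \<theta>'), \<delta> * vmax (p - p'), \<delta> * vmax (q - q'), \<xi> * cmod (y - y'), r * cmod (x - x')}) <= ennreal (19 * K * \<beta>)"
      by (rule ennreal_leI)
      also have "... = 19 * \<X> * ennreal \<beta>" unfolding e using nn m(1) by (simp add: ennreal_mult' ennreal_mult'')
      also have "... <= 19 * \<X> * tf_norm D w (\<lambda>z. f z / omega_y h z)" by (intro mult_left_mono m(2)) simp
      finally show "ennreal (Max {s * vmax (I - I'), \<rho> * vmax (\<theta> - \<theta>'), \<delta> * vmax (p - p'), \<delta> * vmax (q - q'), \<xi> * cmod (y - y'), r * cmod (x - x')})
      <= 19 * \<X> * tf_norm D w (\<lambda>z. f z / omega_y h z)" .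
      qed
    qed
  qed
qed

end
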